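(* Let $\varepsilon \in (0,1)$, let $x_1, \ldots, x_n \in \mathbb{R}^d$, and let $A$ be the $n \times n$ matrix with $A_{i,j} = \|x_i - x_j\|_2$. There is a randomized algorithm which, using $O(nd^2 + nd\log n)$ preprocessing time, produces (implicitly) an $n \times n$ matrix $B$ such that $By$ can be computed for any query $y \in \mathbb{R}^n$ in $O(n \log(n)/\varepsilon^2)$ time, and with probability $1 - 1/\mathrm{poly}(n)$, $\|A - B\|_F \le \varepsilon \|A\|_F$.
   Context: $\|\cdot\|_F$ denotes the Frobenius norm. *)

theory Defs
  imports "HOL-Probability.Probability" "Jordan_Normal_Form.Matrix"
begin

text \<open>
  The model of computation is the real RAM without a floor function: exact real arithmetic,
  comparisons and square roots at unit cost, and separately natural numbers for counting and
  addressing.  A real can never be turned into a natural number, and the naturals have only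
  addition and (truncated) subtraction at unit cost; unit-cost floor or unit-cost
  multiplication of unbounded integers would make the machine unreasonably powerful.
  Arrays take two indices, so that matrices can be addressed without multiplication.
  Programs are finite syntactic objects; they cannot contain anything that depends on the
  input, and their only constants are naturals, rationals and pi (which is provided because
  the mean of the absolute value of a standard normal variable is the square root of 2/pi).
\<close>

type_synonym name = nat

datatype nexp =
    NConst nat
  | NVar name
  | NRead name nexp nexp
  | NAdd nexp nexp
  | NSub nexp nexp

datatype rexp =
    RConst rat
  | RPi
  | RVar name
  | RRead name nexp nexp
  | ROfNat nexp
  | RAdd rexp rexp
  | RSub rexp rexp
  | RMul rexp rexp
  | RDiv rexp rexp
  | RSqrt rexp

datatype bexp =
    NLess nexp nexp
  | RLess rexp rexp
  | BNot bexp
  | BAnd bexp bexp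

datatype com =
    Skip
  | NAssign name nexp
  | RAssign name rexp
  | NStore name nexp nexp nexp
  | RStore name nexp nexp rexp
  | Uniform name
  | Gauss name
  | Seq com com
  | If bexp com com
  | While bexp com

text \<open>The field \<open>pos\<close> counts the random numbers consumed so far.\<close>

record state =
  nvar :: "name \<Rightarrow> nat"
  rvar :: "name \<Rightarrow> real"
  narr :: "name \<Rightarrow> nat \<Rightarrow> nat \<Rightarrow> nat"
  rarr :: "name \<Rightarrow> nat \<Rightarrow> nat \<Rightarrow> real"
  pos :: nat

text \<open>Division by zero and roots of negative numbers follow the HOL conventions and never get stuck.\<close>

primrec nval :: "nexp \<Rightarrow> state \<Rightarrow> nat" where
  "nval (NConst k) s = k"
| "nval (NVar v) s = nvar s v"
| "nval (NRead a i j) s = narr s a (nval i s) (nval j s)"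
| "nval (NAdd e f) s = nval e s + nval f s"
| "nval (NSub e f) s = nval e s - nval f s"

primrec rval :: "rexp \<Rightarrow> state \<Rightarrow> real" where
  "rval (RConst q) s = of_rat q"
| "rval RPi s = pi"
| "rval (RVar v) s = rvar s v"
| "rval (RRead a i j) s = rarr s a (nval i s) (nval j s)"
| "rval (ROfNat e) s = real (nval e s)"
| "rval (RAdd e f) s = rval e s + rval f s"
| "rval (RSub e f) s = rval e s - rval f s"
| "rval (RMul e f) s = rval e s * rval f s"
| "rval (RDiv e f) s = rval e s / rval f s"
| "rval (RSqrt e) s = sqrt (rval e s)"

primrec bval :: "bexp \<Rightarrow> state \<Rightarrow> bool" where
  "bval (NLess e f) s = (nval e s < nval f s)"
| "bval (RLess e f) s = (rval e s < rval f s)"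
| "bval (BNot b) s = (\<not> bval b s)"
| "bval (BAnd b b') s = (bval b s \<and> bval b' s)"

text \<open>The cost of an expression is the number of its nodes.\<close>

primrec ncost :: "nexp \<Rightarrow> nat" where
  "ncost (NConst k) = 1"
| "ncost (NVar v) = 1"
| "ncost (NRead a i j) = 1 + ncost i + ncost j"
| "ncost (NAdd e f) = 1 + ncost e + ncost f"
| "ncost (NSub e f) = 1 + ncost e + ncost f"

primrec rcost :: "rexp \<Rightarrow> nat" where
  "rcost (RConst q) = 1"
| "rcost RPi = 1"
| "rcost (RVar v) = 1"
| "rcost (RRead a i j) = 1 + ncost i + ncost j"
| "rcost (ROfNat e) = 1 + ncost e"
| "rcost (RAdd e f) = 1 + rcost e + rcost f"
| "rcost (RSub e f) = 1 + rcost e + rcost f"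
| "rcost (RMul e f) = 1 + rcost e + rcost f"
| "rcost (RDiv e f) = 1 + rcost e + rcost f"
| "rcost (RSqrt e) = 1 + rcost e"

primrec bcost :: "bexp \<Rightarrow> nat" where
  "bcost (NLess e f) = 1 + ncost e + ncost f"
| "bcost (RLess e f) = 1 + rcost e + rcost f"
| "bcost (BNot b) = 1 + bcost b"
| "bcost (BAnd b b') = 1 + bcost b + bcost b'"

definition upd2 :: "(name \<Rightarrow> nat \<Rightarrow> nat \<Rightarrow> 'a) \<Rightarrow> name \<Rightarrow> nat \<Rightarrow> nat \<Rightarrow> 'a \<Rightarrow> (name \<Rightarrow> nat \<Rightarrow> nat \<Rightarrow> 'a)" where
  "upd2 m a i j z = m(a := (m a)(i := (m a i)(j := z)))"

text \<open>
  The randomness is a tape of independent pairs of a uniform number from the unit interval and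
  an independent standard normal number.  Every sampling command uses one component of a fresh
  pair, so all samples drawn in a run are independent.
\<close>

type_synonym tape = "nat \<Rightarrow> real \<times> real"

definition tapes :: "tape measure" where
  "tapes = (\<Pi>\<^sub>M k\<in>UNIV. restrict_space lborel {0..1} \<Otimes>\<^sub>M density lborel std_normal_density)"

text \<open>\<open>exec \<omega> p s t s'\<close>: on tape \<open>\<omega>\<close>, program \<open>p\<close> started in \<open>s\<close> halts in \<open>s'\<close> after \<open>t\<close> steps.\<close>

inductive exec :: "tape \<Rightarrow> com \<Rightarrow> state \<Rightarrow> nat \<Rightarrow> state \<Rightarrow> bool" for \<omega> :: tape where
  Skip: "exec \<omega> Skip s 1 s"
| NAssign: "exec \<omega> (NAssign v e) s (1 + ncost e) (s\<lparr>nvar := (nvar s)(v := nval e s)\<rparr>)"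
| RAssign: "exec \<omega> (RAssign v e) s (1 + rcost e) (s\<lparr>rvar := (rvar s)(v := rval e s)\<rparr>)"
| NStore: "exec \<omega> (NStore a i j e) s (1 + ncost i + ncost j + ncost e)
    (s\<lparr>narr := upd2 (narr s) a (nval i s) (nval j s) (nval e s)\<rparr>)"
| RStore: "exec \<omega> (RStore a i j e) s (1 + ncost i + ncost j + rcost e)
    (s\<lparr>rarr := upd2 (rarr s) a (nval i s) (nval j s) (rval e s)\<rparr>)"
| Uniform: "exec \<omega> (Uniform v) s 1
    (s\<lparr>rvar := (rvar s)(v := fst (\<omega> (pos s))), pos := pos s + 1\<rparr>)"
| Gauss: "exec \<omega> (Gauss v) s 1
    (s\<lparr>rvar := (rvar s)(v := snd (\<omega> (pos s))), pos := pos s + 1\<rparr>)"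
| Seq: "\<lbrakk>exec \<omega> p s t s'; exec \<omega> q s' t' s''\<rbrakk> \<Longrightarrow> exec \<omega> (Seq p q) s (t + t') s''"
| IfTrue: "\<lbrakk>bval b s; exec \<omega> p s t s'\<rbrakk> \<Longrightarrow> exec \<omega> (If b p q) s (1 + bcost b + t) s'"
| IfFalse: "\<lbrakk>\<not> bval b s; exec \<omega> q s t s'\<rbrakk> \<Longrightarrow> exec \<omega> (If b p q) s (1 + bcost b + t) s'"
| WhileFalse: "\<not> bval b s \<Longrightarrow> exec \<omega> (While b p) s (1 + bcost b) s"
| WhileTrue: "\<lbrakk>bval b s; exec \<omega> p s t s'; exec \<omega> (While b p) s' t' s''\<rbrakk>
    \<Longrightarrow> exec \<omega> (While b p) s (1 + bcost b + t + t') s''"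

text \<open>On a fixed tape the running time and the final state are unique.\<close>

lemma exec_deterministic:
  "exec \<omega> p s t s' \<Longrightarrow> exec \<omega> p s u s'' \<Longrightarrow> t = u \<and> s' = s''"
proof (induction arbitrary: u s'' rule: exec.induct)
  case (Skip s)
  from Skip.prems show ?case by cases simp
next
  case (NAssign v e s)
  from NAssign.prems show ?case by cases simp
next
  case (RAssign v e s)
  from RAssign.prems show ?case by cases simp
next
  case (NStore a i j e s)
  from NStore.prems show ?case by cases simp
next
  case (RStore a i j e s)
  from RStore.prems show ?case by cases simp
next
  case (Uniform v s)
  from Uniform.prems show ?case by cases simp
next
  case (Gauss v s)
  from Gauss.prems show ?case by cases simp
next
  case (Seq p s t s' q t' s2)
  from Seq.prems show ?case
  proof cases
    case (Seq v r v')
    have "t = v \<and> s' = r" by (rule Seq.IH(1)) (rule Seq(2))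
    moreover from this have "t' = v' \<and> s2 = s''" by (intro Seq.IH(2)) (simp add: Seq(3))
    ultimately show ?thesis using Seq(1) by simp
  qed
next
  case (IfTrue b s p t s' q)
  from IfTrue.prems show ?case
  proof cases
    case (IfTrue v)
    have "t = v \<and> s' = s''" by (rule IfTrue.IH) (rule IfTrue(3))
    then show ?thesis using IfTrue(1) by simp
  next
    case (IfFalse v)
    then show ?thesis using IfTrue.hyps by simp
  qed
next
  case (IfFalse b s q t s' p)
  from IfFalse.prems show ?case
  proof cases
    case (IfTrue v)
    then show ?thesis using IfFalse.hyps by simp
  next
    case (IfFalse v)
    have "t = v \<and> s' = s''" by (rule IfFalse.IH) (rule IfFalse(3))
    then show ?thesis using IfFalse(1) by simp
  qed
next
  case (WhileFalse b s p)
  from WhileFalse.prems show ?case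
  proof cases
    case WhileFalse
    then show ?thesis by simp
  next
    case (WhileTrue v r v')
    then show ?thesis using WhileFalse.hyps by simp
  qed
next
  case (WhileTrue b s p t s' t' s2)
  from WhileTrue.prems show ?case
  proof cases
    case WhileFalse
    then show ?thesis using WhileTrue.hyps by simp
  next
    case (WhileTrue v r v')
    have "t = v \<and> s' = r" by (rule WhileTrue.IH(1)) (rule WhileTrue(3))
    moreover from this have "t' = v' \<and> s2 = s''" by (intro WhileTrue.IH(2)) (simp add: WhileTrue(4))
    ultimately show ?thesis using WhileTrue(1) by simp
  qed
qed

primrec sample_free :: "com \<Rightarrow> bool" where
  "sample_free Skip = True"
| "sample_free (NAssign v e) = True"
| "sample_free (RAssign v e) = True"
| "sample_free (NStore a i j e) = True"
| "sample_free (RStore a i j e) = True"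
| "sample_free (Uniform v) = False"
| "sample_free (Gauss v) = False"
| "sample_free (Seq p q) = (sample_free p \<and> sample_free q)"
| "sample_free (If b p q) = (sample_free p \<and> sample_free q)"
| "sample_free (While b p) = sample_free p"

text \<open>
  Input and output conventions.  Natural variables 0 and 1 hold \<open>n\<close> and \<open>d\<close>, real variable 0
  holds \<open>\<epsilon>\<close>, and row \<open>i\<close> of real array 0 holds the point \<open>x i\<close>; all other memory is
  initially 0.  A query vector is placed in row 0 of real array 1, and the answer is read from
  row 0 of real array 2.
\<close>

definition input :: "nat \<Rightarrow> nat \<Rightarrow> real \<Rightarrow> (nat \<Rightarrow> real vec) \<Rightarrow> state" where
  "input n d \<epsilon> x = \<lparr>
     nvar = (\<lambda>_. 0)(0 := n, 1 := d),
     rvar = (\<lambda>_. 0)(0 := \<epsilon>),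
     narr = (\<lambda>_ _ _. 0),
     rarr = (\<lambda>_ _ _. 0)(0 := (\<lambda>i j. if i < n \<and> j < d then vec_index (x i) j else 0)),
     pos = 0\<rparr>"

definition load_query :: "nat \<Rightarrow> real vec \<Rightarrow> state \<Rightarrow> state" where
  "load_query n y s = s\<lparr>rarr := (rarr s)(1 := (\<lambda>i j.
     if i = 0 \<and> j < n then vec_index y j else rarr s 1 i j))\<rparr>"

definition answer :: "nat \<Rightarrow> state \<Rightarrow> real vec" where
  "answer n s = vec n (\<lambda>i. rarr s 2 0 i)"

definition norm2 :: "real vec \<Rightarrow> real" where
  "norm2 v = sqrt (\<Sum>k<dim_vec v. (vec_index v k)\<^sup>2)"

definition frobenius_norm :: "real mat \<Rightarrow> real" where
  "frobenius_norm M = sqrt (\<Sum>i<dim_row M. \<Sum>j<dim_col M. (M $$ (i, j))\<^sup>2)"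

definition distance_matrix :: "nat \<Rightarrow> (nat \<Rightarrow> real vec) \<Rightarrow> real mat" where
  "distance_matrix n x = mat n n (\<lambda>(i, j). norm2 (x i - x j))"

text \<open>
  After preprocessing with time bound \<open>T\<close> the memory represents \<open>B\<close> implicitly: every query
  started from that memory computes \<open>B y\<close> exactly within time \<open>T'\<close>.  The query program is run
  on the same tape, so it has to be free of sampling commands for the matrix to be determined
  by the preprocessed memory; the theorem requires this.
\<close>

definition implements ::
  "com \<Rightarrow> com \<Rightarrow> tape \<Rightarrow> nat \<Rightarrow> state \<Rightarrow> real \<Rightarrow> real \<Rightarrow> real mat \<Rightarrow> bool" where
  "implements prep query \<omega> n s\<^sub>0 T T' B \<longleftrightarrow>
     (\<exists>t s. exec \<omega> prep s\<^sub>0 t s \<and> real t \<le> T \<and>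
       (\<forall>y\<in>carrier_vec n. \<exists>t' s'.
          exec \<omega> query (load_query n y s) t' s' \<and> real t' \<le> T' \<and>
          answer n s' = B *\<^sub>v y))"

end

theory Submission
  imports Defs "HOL-Real_Asymp.Real_Asymp"
begin

text \<open>
  A point difference is hit by random signs, a fast Hadamard transform, a Gaussian diagonal and a
  second Hadamard transform; the mean of the absolute values of \<open>\<rho>\<close> output coordinates, averaged
  over \<open>N \<approx> K / (\<rho> \<epsilon>\<^sup>2)\<close> independent blocks, estimates the distance.  Each output is
  exactly Gaussian and two outputs are nearly uncorrelated, so the variance is of order
  \<open>1 / (N \<rho>)\<close>, and a moment generating function bound controls single pairs.  A good
  estimate in the Frobenius norm thus has constant probability.  To amplify it, \<open>log n\<close>
  independent candidates are compared on random pairs, drawn with probabilities roughly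
  proportional to the squared distances to the mean, and the best candidate is kept.
  The matrix of a candidate is a sum of one-dimensional distance matrices, to which sorting and
  prefix sums apply in almost linear time.  If \<open>\<rho> < d\<close> the projections fit into the preprocessing
  budget; otherwise \<open>\<epsilon>\<close> is so small that they fit into a query, and for still smaller
  \<open>\<epsilon>\<close> the exact matrix is affordable.
\<close>

section \<open>Gaussian sequences\<close>

text \<open>Two constraints shape the construction. Preprocessing time must not depend on
  \<epsilon>, while about K/\<epsilon>^2 projected coordinates per point are needed. So many
  coordinates come from one fast transform; they are dependent, and the price is a weak tail bound.
  That bound cannot control every pair at accuracy \<epsilon>, but it only has to make the tested
  squared errors bounded, by a threshold almost n times larger than \<epsilon>^2; this suffices for
  random pairs to separate good candidates from bad ones. The machine has no floor and cannot
  multiply natural numbers. Sizes are therefore found by counting, powers of two by doubling, and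
  random indices from the signs of normal numbers; an index out of range counts as a sample of value
  zero instead of being redrawn. Hence the time bounds hold on every tape and only the accuracy is
  random. Comparisons of powers of log n with n are asymptotic. Below a threshold \<open>n0\<close>,
  a constant of the program, the exact matrix is stored and its cost is absorbed by the final
  constant.\<close>

abbreviation stdn :: "real measure" where
  "stdn \<equiv> density lborel (\<lambda>x. ennreal (std_normal_density x))"

lemma prob_space_stdn: "prob_space stdn"
  by (rule prob_space_normal_density) simp

interpretation stdn: prob_space stdn
  by (rule prob_space_stdn)

interpretation gs: sequence_space stdn
  by unfold_locales

abbreviation gseq :: "(nat => real) measure" where
  "gseq \<equiv> \<Pi>\<^sub>M i\<in>(UNIV :: nat set). stdn"

interpretation stdn_pair: pair_prob_space stdn stdn ..
interpretation stdn_gseq: pair_prob_space stdn gseq ..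
interpretation gseq_pair: pair_prob_space gseq gseq ..

lemma space_gseq [simp]: "space gseq = UNIV"
  by (simp add: space_PiM)

lemma measurable_gseq_component [measurable]: "(\<lambda>g. g i) \<in> borel_measurable gseq"
proof -
  have "(\<lambda>g. g i) \<in> measurable gseq stdn"
   by (rule measurable_component_singleton) simp
  then show ?thesis
   by (simp cong: measurable_cong_sets)
qed

lemma prob_space_unit_interval: "prob_space (restrict_space lborel {0..1::real})"
  by (rule prob_spaceI) (simp add: space_restrict_space emeasure_restrict_space)

lemma space_tapes: "space tapes = {\<omega>. \<forall>q. fst (\<omega> q) \<in> {0..1}}"
  by (auto simp: tapes_def space_PiM space_pair_measure space_restrict_space PiE_def extensional_def mem_Times_iff Pi_iff)

lemma measurable_tape_gaussians: "(\<lambda>\<omega> q. snd (\<omega> q)) \<in> measurable tapes gseq"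
  unfolding tapes_def by (rule measurable_PiM_single') (auto simp: space_PiM)

text \<open>The programs draw only normal numbers, so all events concern the normal components, and
  this identity moves their probabilities to a plain product measure. Both measures are compared on
  cylinders, where the uniform factors contribute 1.\<close>

lemma distr_tapes: "distr tapes gseq (\<lambda>\<omega> q. snd (\<omega> q)) = gseq"
proof -
  let ?U = "restrict_space lborel {0..1::real}"
  let ?M = "?U \<Otimes>\<^sub>M stdn"
  interpret U: prob_space ?U by (rule prob_space_unit_interval)
  interpret P: pair_prob_space ?U stdn ..
  interpret T: sequence_space ?M by unfold_locales
  note measurable_tape_gaussians[measurable]
  have sU: "{0..1} \<in> sets ?U" by (auto simp: sets_restrict_space image_iff intro!: bexI[of _ UNIV])
  show ?thesis
  proof (rule gs.PiM_eq)
   fix J F assume J: "finite J" "J \<subseteq> (UNIV :: nat set)" "\<And>j. j \<in> J ==> F j \<in> sets stdn"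
   let ?X = "prod_emb UNIV (\<lambda>_. stdn) J (Pi\<^sub>E J F)"
   have X: "?X \<in> sets gseq"
    using J by (intro sets_PiM_I) auto
   have eq: "(\<lambda>\<omega> q. snd (\<omega> q)) -` ?X \<inter> space tapes =
     prod_emb UNIV (\<lambda>_. ?M) J (\<Pi>\<^sub>E j\<in>J. space ?U \<times> F j)"
    by (auto simp: prod_emb_def space_tapes space_PiM space_pair_measure PiE_iff extensional_def
      space_restrict_space mem_Times_iff tapes_def)
   have "emeasure (distr tapes gseq (\<lambda>\<omega> q. snd (\<omega> q))) ?X =
     emeasure tapes (prod_emb UNIV (\<lambda>_. ?M) J (\<Pi>\<^sub>E j\<in>J. space ?U \<times> F j))"
    using X by (simp add: emeasure_distr eq)
   also have "... = (\<Prod>j\<in>J. emeasure ?M (space ?U \<times> F j))"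
    unfolding tapes_def using J sU by (intro T.emeasure_PiM_emb) (auto simp: space_restrict_space)
   also have "... = (\<Prod>j\<in>J. emeasure stdn (F j))"
   proof (rule prod.cong[OF refl])
    fix j assume "j \<in> J"
    then have "emeasure ?M (space ?U \<times> F j) = emeasure ?U (space ?U) * emeasure stdn (F j)"
     using J(3) sU by (intro stdn.emeasure_pair_measure_Times) (auto simp: space_restrict_space)
    then show "emeasure ?M (space ?U \<times> F j) = emeasure stdn (F j)"
     by (simp only: U.emeasure_space_1 mult_1)
   qed
   finally show "emeasure (distr tapes gseq (\<lambda>\<omega> q. snd (\<omega> q))) ?X = (\<Prod>j\<in>J. emeasure stdn (F j))" .
  qed simp
qed

text \<open>Fubini's theorem for the first \<open>k\<close> coordinates against the rest.
  Conditioning on an initial part of the random numbers always takes this form below.\<close>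

lemma nn_integral_gseq_comb_seq:
  assumes [measurable]: "F \<in> borel_measurable gseq"
  shows "(\<integral>\<^sup>+g. F g \<partial>gseq) = (\<integral>\<^sup>+g. \<integral>\<^sup>+h. F (comb_seq k g h) \<partial>gseq \<partial>gseq)"
proof -
  have "(\<integral>\<^sup>+g. F g \<partial>gseq) = (\<integral>\<^sup>+g. F g \<partial>distr (gseq \<Otimes>\<^sub>M gseq) gseq (\<lambda>(g, h). comb_seq k g h))"
   by (simp add: gs.PiM_comb_seq)
  also have "... = (\<integral>\<^sup>+z. F (comb_seq k (fst z) (snd z)) \<partial>(gseq \<Otimes>\<^sub>M gseq))"
   by (subst nn_integral_distr) (auto simp: split_beta')
  also have "... = (\<integral>\<^sup>+g. \<integral>\<^sup>+h. F (comb_seq k g h) \<partial>gseq \<partial>gseq)"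
   by (subst gs.P.nn_integral_fst[symmetric]) auto
  finally show ?thesis .
qed

lemma measurable_case_nat_gseq [measurable]:
  "(\<lambda>z. case_nat (fst z) (snd z)) \<in> measurable (stdn \<Otimes>\<^sub>M gseq) gseq"
  by measurable

lemma nn_integral_gseq_case_nat:
  assumes [measurable]: "F \<in> borel_measurable gseq"
  shows "(\<integral>\<^sup>+g. F g \<partial>gseq) = (\<integral>\<^sup>+x. \<integral>\<^sup>+g. F (case_nat x g) \<partial>gseq \<partial>stdn)"
proof -
  have "(\<integral>\<^sup>+g. F g \<partial>gseq) = (\<integral>\<^sup>+g. F g \<partial>distr (stdn \<Otimes>\<^sub>M gseq) gseq (\<lambda>(x, g). case_nat x g))"
   by (simp add: gs.PiM_iter)
  also have "... = (\<integral>\<^sup>+z. F (case_nat (fst z) (snd z)) \<partial>(stdn \<Otimes>\<^sub>M gseq))"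
   by (subst nn_integral_distr) (auto simp: split_beta')
  also have "... = (\<integral>\<^sup>+x. \<integral>\<^sup>+g. F (case_nat x g) \<partial>gseq \<partial>stdn)"
   by (subst gs.P.nn_integral_fst[symmetric]) auto
  finally show ?thesis .
qed

section \<open>Rotation invariance and linear forms of Gaussian sequences\<close>

lemma nn_integral_stdn:
  "f \<in> borel_measurable borel ==>
   (\<integral>\<^sup>+x. f x \<partial>stdn) = (\<integral>\<^sup>+x. ennreal (std_normal_density x) * f x \<partial>lborel)"
  by (subst nn_integral_density) auto

lemma std_normal_density_minus [simp]: "std_normal_density (- x) = std_normal_density x"
  by (simp add: std_normal_density_def)

lemma nn_integral_stdn_uminus:
  assumes [measurable]: "f \<in> borel_measurable borel"
  shows "(\<integral>\<^sup>+x. f (- x) \<partial>stdn) = (\<integral>\<^sup>+x. f x \<partial>stdn)"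
  using nn_integral_real_affine[of "\<lambda>x. ennreal (std_normal_density x) * f x" "-1" 0]
  by (simp add: nn_integral_stdn)

text \<open>Instead of a two-dimensional change of variables, two one-dimensional substitutions are
  used with Fubini in between: \<open>x\<close> becomes \<open>(u - s * y) / c\<close>, then
  \<open>y\<close> becomes \<open>s * u + c * v\<close>. The factors 1/c and c cancel, and
  \<open>c > 0\<close> keeps both substitutions free of absolute values.\<close>

lemma stdn_rotation:
  fixes F :: "real => real => ennreal"
  assumes [measurable]: "case_prod F \<in> borel_measurable (borel \<Otimes>\<^sub>M borel)"
   and c: "c > 0" and cs: "c\<^sup>2 + s\<^sup>2 = 1"
  shows "(\<integral>\<^sup>+x. \<integral>\<^sup>+y. F (c * x + s * y) (c * y - s * x) \<partial>stdn \<partial>stdn) = (\<integral>\<^sup>+x. \<integral>\<^sup>+y. F x y \<partial>stdn \<partial>stdn)"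
proof -
  have [measurable]: "(\<lambda>x. F (f x) (h x)) \<in> borel_measurable M"
   if "f \<in> borel_measurable M" "h \<in> borel_measurable M" for f h and M :: "'b measure"
   using measurable_compose[OF measurable_Pair[OF that] assms(1)] by simp
  let ?\<phi> = "\<lambda>x. ennreal (std_normal_density x)"
  have "(\<integral>\<^sup>+x. \<integral>\<^sup>+y. F (c * x + s * y) (c * y - s * x) \<partial>stdn \<partial>stdn) =
    (\<integral>\<^sup>+x. \<integral>\<^sup>+y. ?\<phi> x * ?\<phi> y * F (c * x + s * y) (c * y - s * x) \<partial>lborel \<partial>lborel)"
   by (simp add: nn_integral_stdn nn_integral_cmult[symmetric] mult.assoc)
  also have "... = (\<integral>\<^sup>+y. \<integral>\<^sup>+x. ?\<phi> x * ?\<phi> y * F (c * x + s * y) (c * y - s * x) \<partial>lborel \<partial>lborel)"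
   by (rule lborel_pair.Fubini'[symmetric]) measurable
  also have "... = (\<integral>\<^sup>+y. \<integral>\<^sup>+u. (1/c) * (?\<phi> ((u - s * y) / c) * ?\<phi> y * F u ((y - s * u) / c)) \<partial>lborel \<partial>lborel)"
  proof (rule nn_integral_cong)
   fix y :: real
   have 1: "c * (- s * y / c + 1 / c * u) + s * y = u" for u
    using c by (simp add: field_simps)
   have "c * y - s * (- s * y / c + 1 / c * u) = ((c\<^sup>2 + s\<^sup>2) * y - s * u) / c" for u
    using c by (simp add: field_simps power2_eq_square)
   then have 2: "c * y - s * (- s * y / c + 1 / c * u) = (y - s * u) / c" for u
    using cs by simp
   have 3: "- s * y / c + 1 / c * u = (u - s * y) / c" for u
    using c by (simp add: field_simps)
   show "(\<integral>\<^sup>+x. ?\<phi> x * ?\<phi> y * F (c * x + s * y) (c * y - s * x) \<partial>lborel) =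
    (\<integral>\<^sup>+u. (1/c) * (?\<phi> ((u - s * y) / c) * ?\<phi> y * F u ((y - s * u) / c)) \<partial>lborel)"
    apply (subst nn_integral_real_affine[where c = "1/c" and t = "- s * y / c"])
    using c apply simp
    using c apply simp
    unfolding 1 2 unfolding 3 using c by (simp add: nn_integral_cmult[symmetric] del: times_divide_eq_left)
  qed
  also have "... = (\<integral>\<^sup>+u. \<integral>\<^sup>+y. (1/c) * (?\<phi> ((u - s * y) / c) * ?\<phi> y * F u ((y - s * u) / c)) \<partial>lborel \<partial>lborel)"
   by (rule lborel_pair.Fubini') measurable
  also have "... = (\<integral>\<^sup>+u. \<integral>\<^sup>+v. ?\<phi> u * ?\<phi> v * F u v \<partial>lborel \<partial>lborel)"
  proof (rule nn_integral_cong)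
   fix u :: real
   have 1: "(u - s * (s * u + c * v)) / c = c * u - s * v" for v
   proof -
    have "(u - s * (s * u + c * v)) = (c\<^sup>2 + s\<^sup>2) * u - s * (s * u + c * v)" using cs by simp
    also have "... = c * (c * u - s * v)" by (simp add: algebra_simps power2_eq_square)
    finally show ?thesis using c by simp
   qed
   have 2: "?\<phi> (c * u - s * v) * ?\<phi> (s * u + c * v) = ?\<phi> u * ?\<phi> v" for v
   proof -
    have "(c * u - s * v)\<^sup>2 + (s * u + c * v)\<^sup>2 = (c\<^sup>2 + s\<^sup>2) * (u\<^sup>2 + v\<^sup>2)"
     by (simp add: algebra_simps power2_eq_square)
    then have "- (c * u - s * v)\<^sup>2 / 2 + - (s * u + c * v)\<^sup>2 / 2 = - u\<^sup>2 / 2 + - v\<^sup>2 / 2"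
     using cs by simp
    then have "std_normal_density (c * u - s * v) * std_normal_density (s * u + c * v) =
      std_normal_density u * std_normal_density v"
     unfolding std_normal_density_def by (simp add: exp_add[symmetric] mult.assoc mult.left_commute)
    then show ?thesis
     by (simp add: ennreal_mult[symmetric])
   qed
   have 4: "ennreal c * (ennreal (1/c) * z) = z" for z
    using c by (simp add: ennreal_mult[symmetric] mult.assoc[symmetric])
   show "(\<integral>\<^sup>+y. (1/c) * (?\<phi> ((u - s * y) / c) * ?\<phi> y * F u ((y - s * u) / c)) \<partial>lborel) =
    (\<integral>\<^sup>+v. ?\<phi> u * ?\<phi> v * F u v \<partial>lborel)"
    apply (subst nn_integral_real_affine[where c = c and t = "s * u"])
    using c apply simp
    using c apply simp
    unfolding 1 2 using c by (simp add: nn_integral_cmult[symmetric] 4)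
  qed
  also have "... = (\<integral>\<^sup>+x. \<integral>\<^sup>+y. F x y \<partial>stdn \<partial>stdn)"
   by (simp add: nn_integral_stdn nn_integral_cmult[symmetric] mult.assoc)
  finally show ?thesis .
qed

text \<open>For \<open>a > 0\<close> the coefficients divided by their length form the first row of
  a rotation, and the second rotated coordinate integrates out. A negative \<open>a\<close> is
  reflected away; for \<open>a = 0\<close> the symmetry of the density is enough.\<close>

lemma stdn_add:
  fixes f :: "real => ennreal"
  assumes [measurable]: "f \<in> borel_measurable borel"
  shows "(\<integral>\<^sup>+x. \<integral>\<^sup>+y. f (a * x + b * y) \<partial>stdn \<partial>stdn) = (\<integral>\<^sup>+x. f (sqrt (a\<^sup>2 + b\<^sup>2) * x) \<partial>stdn)"
proof -
  have pos: "(\<integral>\<^sup>+x. \<integral>\<^sup>+y. f (a * x + b * y) \<partial>stdn \<partial>stdn) = (\<integral>\<^sup>+x. f (sqrt (a\<^sup>2 + b\<^sup>2) * x) \<partial>stdn)"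
   if a: "a > 0" for a
  proof -
   define \<sigma> where "\<sigma> = sqrt (a\<^sup>2 + b\<^sup>2)"
   have \<sigma>: "\<sigma> > 0" "\<sigma>\<^sup>2 = a\<^sup>2 + b\<^sup>2"
    using a by (auto simp: \<sigma>_def add_pos_nonneg)
   have "(\<integral>\<^sup>+x. \<integral>\<^sup>+y. f (\<sigma> * (a / \<sigma> * x + b / \<sigma> * y)) \<partial>stdn \<partial>stdn) = (\<integral>\<^sup>+x. \<integral>\<^sup>+y. f (\<sigma> * x) \<partial>stdn \<partial>stdn)"
    using a \<sigma> by (intro stdn_rotation[where F = "\<lambda>u v. f (\<sigma> * u)"])
     (auto simp: power_divide add_divide_distrib[symmetric])
   then show ?thesis
    using \<sigma> by (simp add: distrib_left \<sigma>_def[symmetric] stdn.emeasure_space_1[simplified])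
  qed
  consider "a > 0" | "a < 0" | "a = 0" by linarith
  then show ?thesis
  proof cases
   case 2
   have "(\<integral>\<^sup>+x. \<integral>\<^sup>+y. f (a * x + b * y) \<partial>stdn \<partial>stdn) = (\<integral>\<^sup>+x. \<integral>\<^sup>+y. f (- a * x + b * y) \<partial>stdn \<partial>stdn)"
    using nn_integral_stdn_uminus[of "\<lambda>x. \<integral>\<^sup>+y. f (- a * x + b * y) \<partial>stdn"] by simp
   then show ?thesis using pos[of "- a"] 2 by simp
  next
   case 3
   have "(\<integral>\<^sup>+y. f (b * y) \<partial>stdn) = (\<integral>\<^sup>+y. f (\<bar>b\<bar> * y) \<partial>stdn)"
    using nn_integral_stdn_uminus[of "\<lambda>y. f (b * y)"] by (cases "b \<ge> 0") auto
   then show ?thesis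
    using 3 by (simp add: stdn.emeasure_space_1[simplified])
  qed (rule pos)
qed

lemma nn_integral_stdn_const [simp]: "(\<integral>\<^sup>+x. c \<partial>stdn) = c"
  using stdn.emeasure_space_1 by (simp add: nn_integral_const)

lemma nn_integral_gseq_const [simp]: "(\<integral>\<^sup>+x. c \<partial>gseq) = c"
  using gs.P.emeasure_space_1 by (simp add: nn_integral_const)

lemma emeasure_stdn_UNIV [simp]: "emeasure stdn UNIV = 1"
  using stdn.emeasure_space_1 by simp

lemma emeasure_gseq_UNIV [simp]: "emeasure gseq UNIV = 1"
  using gs.P.emeasure_space_1 by simp

text \<open>Linear forms with disjoint supports are independent Gaussians, and this is their joint
  law. The induction removes coordinate 0, which enters at most one of the forms and is merged into
  the Gaussian of that form by \<open>stdn_add\<close>.\<close>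

lemma gseq_two_forms:
  fixes F :: "real => real => ennreal"
  assumes F: "case_prod F \<in> borel_measurable (borel \<Otimes>\<^sub>M borel)"
   and ab: "\<And>c. c < D ==> a c = 0 \<or> b c = 0"
  shows "(\<integral>\<^sup>+g. F (\<Sum>c<D. a c * g c) (\<Sum>c<D. b c * g c) \<partial>gseq) =
   (\<integral>\<^sup>+x. \<integral>\<^sup>+y. F (sqrt (\<Sum>c<D. (a c)\<^sup>2) * x) (sqrt (\<Sum>c<D. (b c)\<^sup>2) * y) \<partial>stdn \<partial>stdn)"
  using F ab
proof (induction D arbitrary: a b F)
  case 0
  then show ?case by simp
next
  case (Suc D)
  have m [measurable]: "(\<lambda>x. F (f x) (h x)) \<in> borel_measurable M"
   if "f \<in> borel_measurable M" "h \<in> borel_measurable M" for f h and M :: "'b measure"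
   using measurable_compose[OF measurable_Pair[OF that] Suc.prems(1)] by simp
  let ?A = "sqrt (\<Sum>c<D. (a (Suc c))\<^sup>2)" and ?B = "sqrt (\<Sum>c<D. (b (Suc c))\<^sup>2)"
  have "(\<integral>\<^sup>+g. F (\<Sum>c<Suc D. a c * g c) (\<Sum>c<Suc D. b c * g c) \<partial>gseq) =
    (\<integral>\<^sup>+x. \<integral>\<^sup>+g. F (a 0 * x + (\<Sum>c<D. a (Suc c) * g c)) (b 0 * x + (\<Sum>c<D. b (Suc c) * g c)) \<partial>gseq \<partial>stdn)"
   by (subst nn_integral_gseq_case_nat) (simp_all add: sum.lessThan_Suc_shift del: sum.lessThan_Suc)
  also have "... = (\<integral>\<^sup>+x. \<integral>\<^sup>+u. \<integral>\<^sup>+v. F (a 0 * x + ?A * u) (b 0 * x + ?B * v) \<partial>stdn \<partial>stdn \<partial>stdn)"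
   using Suc.prems(2) by (intro nn_integral_cong Suc.IH[where F = "\<lambda>u v. F (a 0 * _ + u) (b 0 * _ + v)"]) auto
  also have "... = (\<integral>\<^sup>+x. \<integral>\<^sup>+y. F (sqrt ((a 0)\<^sup>2 + ?A\<^sup>2) * x) (sqrt ((b 0)\<^sup>2 + ?B\<^sup>2) * y) \<partial>stdn \<partial>stdn)"
  proof (cases "b 0 = 0")
   case True
   have B: "?B = sqrt ((b 0)\<^sup>2 + ?B\<^sup>2)" using True by (simp add: sum_nonneg)
   have "(\<integral>\<^sup>+x. \<integral>\<^sup>+u. \<integral>\<^sup>+v. F (a 0 * x + ?A * u) (b 0 * x + ?B * v) \<partial>stdn \<partial>stdn \<partial>stdn)
     = (\<integral>\<^sup>+x. \<integral>\<^sup>+u. (\<lambda>w. \<integral>\<^sup>+v. F w (?B * v) \<partial>stdn) (a 0 * x + ?A * u) \<partial>stdn \<partial>stdn)"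
    using True by simp
   also have "... = (\<integral>\<^sup>+x. (\<lambda>w. \<integral>\<^sup>+v. F w (?B * v) \<partial>stdn) (sqrt ((a 0)\<^sup>2 + ?A\<^sup>2) * x) \<partial>stdn)"
    by (rule stdn_add) simp
   finally show ?thesis using B by simp
  next
   case False
   then have a0: "a 0 = 0" using Suc.prems(2)[of 0] by simp
   have "(\<integral>\<^sup>+x. \<integral>\<^sup>+u. \<integral>\<^sup>+v. F (a 0 * x + ?A * u) (b 0 * x + ?B * v) \<partial>stdn \<partial>stdn \<partial>stdn)
     = (\<integral>\<^sup>+u. \<integral>\<^sup>+x. \<integral>\<^sup>+v. F (?A * u) (b 0 * x + ?B * v) \<partial>stdn \<partial>stdn \<partial>stdn)"
    unfolding a0 by (simp, subst stdn_pair.Fubini'[symmetric]) simp_all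
   also have "... = (\<integral>\<^sup>+u. \<integral>\<^sup>+x. F (?A * u) (sqrt ((b 0)\<^sup>2 + ?B\<^sup>2) * x) \<partial>stdn \<partial>stdn)"
    by (intro nn_integral_cong stdn_add) simp
   finally show ?thesis by (simp add: a0 sum_nonneg)
  qed
  finally show ?case
   by (simp add: sum.lessThan_Suc_shift sum_nonneg del: sum.lessThan_Suc)
qed

lemma gseq_form:
  fixes f :: "real => ennreal"
  assumes [measurable]: "f \<in> borel_measurable borel"
  shows "(\<integral>\<^sup>+g. f (\<Sum>c<D. a c * g c) \<partial>gseq) = (\<integral>\<^sup>+x. f (sqrt (\<Sum>c<D. (a c)\<^sup>2) * x) \<partial>stdn)"
  using gseq_two_forms[of "\<lambda>x y. f x" D a "\<lambda>_. 0"] by simp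

section \<open>Moments of normal variables and of products of two correlated ones\<close>

lemma nn_integral_stdn_eq:
  assumes "has_bochner_integral lborel (\<lambda>x. std_normal_density x * f x) v" "\<And>x. 0 \<le> f x"
   and [measurable]: "f \<in> borel_measurable borel"
  shows "(\<integral>\<^sup>+x. ennreal (f x) \<partial>stdn) = ennreal v"
proof -
  have "(\<integral>\<^sup>+x. ennreal (f x) \<partial>stdn) = (\<integral>\<^sup>+x. ennreal (std_normal_density x * f x) \<partial>lborel)"
   by (subst nn_integral_stdn) (auto simp: ennreal_mult assms(2))
  also have "... = ennreal v"
   using assms(1,2) by (subst nn_integral_eq_integral) (auto simp: has_bochner_integral_iff)
  finally show ?thesis .
qed

lemma stdn_abs: "(\<integral>\<^sup>+x. ennreal \<bar>x\<bar> \<partial>stdn) = ennreal (sqrt (2/pi))"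
  using nn_integral_stdn_eq[of "\<lambda>x. \<bar>x\<bar>"] std_normal_moment_abs_odd[of 0] by simp

lemma stdn_abs3: "(\<integral>\<^sup>+x. ennreal (\<bar>x\<bar>^3) \<partial>stdn) = ennreal (2 * sqrt (2/pi))"
  using nn_integral_stdn_eq[of "\<lambda>x. \<bar>x\<bar>^3"] std_normal_moment_abs_odd[of 1] by (simp add: eval_nat_numeral)

lemma stdn_sq: "(\<integral>\<^sup>+x. ennreal (x\<^sup>2) \<partial>stdn) = 1"
  using nn_integral_stdn_eq[of "\<lambda>x. x\<^sup>2"] std_normal_moment_even[of 1] by simp

lemma stdn_exp: "(\<integral>\<^sup>+x. ennreal (exp (t * x)) \<partial>stdn) = ennreal (exp (t\<^sup>2 / 2))"
proof -
  have "std_normal_density x * exp (t * x) = exp (t\<^sup>2 / 2) * normal_density t 1 x" for x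
  proof -
   have "- x\<^sup>2 / 2 + t * x = t\<^sup>2 / 2 + - (x - t)\<^sup>2 / 2"
    by (simp add: power2_eq_square field_simps)
   then show ?thesis
    unfolding std_normal_density_def normal_density_def by (simp add: exp_add[symmetric] mult.left_commute)
  qed
  then have "has_bochner_integral lborel (\<lambda>x. std_normal_density x * exp (t * x)) (exp (t\<^sup>2 / 2))"
   by (simp add: has_bochner_integral_iff)
  then show ?thesis by (intro nn_integral_stdn_eq) auto
qed

lemma stdn_exp_abs: "(\<integral>\<^sup>+x. ennreal (exp (t * \<bar>x\<bar>)) \<partial>stdn) \<le> ennreal (2 * exp (t\<^sup>2 / 2))"
proof -
  have "(\<integral>\<^sup>+x. ennreal (exp (t * \<bar>x\<bar>)) \<partial>stdn) \<le> (\<integral>\<^sup>+x. ennreal (exp (t * x)) + ennreal (exp (- t * x)) \<partial>stdn)"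
   by (intro nn_integral_mono) (auto simp: ennreal_plus[symmetric] abs_if simp del: ennreal_plus)
  also have "... = ennreal (2 * exp (t\<^sup>2 / 2))"
   using stdn_exp[of t] stdn_exp[of "- t"]
   by (subst nn_integral_add) (auto simp: ennreal_plus[symmetric] simp del: ennreal_plus)
  finally show ?thesis .
qed

lemma emeasure_stdn_interval: "r \<ge> 0 ==> emeasure stdn {-r..r} \<le> ennreal (r * sqrt (2/pi))"
proof -
  assume r: "r \<ge> 0"
  have "emeasure stdn {-r..r} = (\<integral>\<^sup>+x. ennreal (std_normal_density x) * indicator {-r..r} x \<partial>lborel)"
   by (rule emeasure_density) auto
  also have "... \<le> (\<integral>\<^sup>+x. ennreal (1 / sqrt (2 * pi)) * indicator {-r..r} x \<partial>lborel)"
   by (intro nn_integral_mono mult_right_mono ennreal_leI) (auto simp: std_normal_density_def divide_right_mono)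
  also have "... = ennreal (1 / sqrt (2 * pi)) * ennreal (2 * r)"
   using r by (subst nn_integral_cmult) auto
  also have "... = ennreal (r * sqrt (2/pi))"
  proof -
   have "1 / sqrt (2 * pi) * (2 * r) = r * sqrt (2/pi)"
    by (simp add: real_sqrt_mult real_sqrt_divide field_simps)
   then show ?thesis using r by (simp add: ennreal_mult[symmetric] mult.commute)
  qed
  finally show ?thesis .
qed

text \<open>Averaging over \<open>v\<close> and \<open>-v\<close> replaces the integrand by max
  (|A|, B |v|). The shift A is thus felt only for |v| <= |A|/B, an event of probability of order
  |A|/B, so that it adds a term of order A^2/B instead of |A|.\<close>

lemma stdn_abs_affine:
  assumes B: "B > 0"
  shows "(\<integral>\<^sup>+v. ennreal \<bar>A + B * v\<bar> \<partial>stdn) \<le> ennreal (sqrt (2/pi) * (B + A\<^sup>2 / B))"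
proof -
  have "2 * (\<integral>\<^sup>+v. ennreal \<bar>A + B * v\<bar> \<partial>stdn) =
    (\<integral>\<^sup>+v. ennreal \<bar>A + B * v\<bar> \<partial>stdn) + (\<integral>\<^sup>+v. ennreal \<bar>A - B * v\<bar> \<partial>stdn)"
   using nn_integral_stdn_uminus[of "\<lambda>v. ennreal \<bar>A + B * v\<bar>"] by (simp add: mult_2)
  also have "... = (\<integral>\<^sup>+v. 2 * ennreal (max \<bar>A\<bar> (B * \<bar>v\<bar>)) \<partial>stdn)"
  proof (subst nn_integral_add[symmetric], simp, simp, intro nn_integral_cong)
   fix v :: real
   have "B * \<bar>v\<bar> = \<bar>B * v\<bar>" using B by (simp add: abs_mult)
   then have "\<bar>A + B * v\<bar> + \<bar>A - B * v\<bar> = 2 * max \<bar>A\<bar> (B * \<bar>v\<bar>)" by auto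
   then show "ennreal \<bar>A + B * v\<bar> + ennreal \<bar>A - B * v\<bar> = 2 * ennreal (max \<bar>A\<bar> (B * \<bar>v\<bar>))"
    by (simp add: ennreal_plus[symmetric] ennreal_mult''[symmetric] ennreal_numeral[symmetric] del: ennreal_plus ennreal_numeral)
  qed
  also have "... = 2 * (\<integral>\<^sup>+v. ennreal (max \<bar>A\<bar> (B * \<bar>v\<bar>)) \<partial>stdn)"
   by (rule nn_integral_cmult) simp
  finally have "(\<integral>\<^sup>+v. ennreal \<bar>A + B * v\<bar> \<partial>stdn) = (\<integral>\<^sup>+v. ennreal (max \<bar>A\<bar> (B * \<bar>v\<bar>)) \<partial>stdn)"
   by (simp add: ennreal_mult_cancel_left)
  also have "... \<le> (\<integral>\<^sup>+v. ennreal B * ennreal \<bar>v\<bar> + ennreal \<bar>A\<bar> * indicator {-\<bar>A\<bar>/B..\<bar>A\<bar>/B} v \<partial>stdn)"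
  proof (intro nn_integral_mono)
   fix v :: real
   have 1: "v \<in> {-\<bar>A\<bar>/B..\<bar>A\<bar>/B} \<longleftrightarrow> B * \<bar>v\<bar> \<le> \<bar>A\<bar>"
   proof -
    have "v \<in> {-\<bar>A\<bar>/B..\<bar>A\<bar>/B} \<longleftrightarrow> \<bar>v\<bar> \<le> \<bar>A\<bar> / B" by auto
    then show ?thesis using B by (simp add: pos_le_divide_eq mult.commute)
   qed
   show "ennreal (max \<bar>A\<bar> (B * \<bar>v\<bar>)) \<le> ennreal B * ennreal \<bar>v\<bar> + ennreal \<bar>A\<bar> * indicator {-\<bar>A\<bar>/B..\<bar>A\<bar>/B} v"
   proof (cases "B * \<bar>v\<bar> \<le> \<bar>A\<bar>")
    case True
    then show ?thesis using B 1 by (simp add: max_def ennreal_leI add_increasing)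
   next
    case False
    then show ?thesis using B 1 by (simp add: max_def ennreal_mult)
   qed
  qed
  also have "... = ennreal B * ennreal (sqrt (2/pi)) + ennreal \<bar>A\<bar> * emeasure stdn {-\<bar>A\<bar>/B..\<bar>A\<bar>/B}"
   by (subst nn_integral_add) (auto simp: nn_integral_cmult stdn_abs)
  also have "... \<le> ennreal B * ennreal (sqrt (2/pi)) + ennreal \<bar>A\<bar> * ennreal (\<bar>A\<bar> / B * sqrt (2/pi))"
   using emeasure_stdn_interval[of "\<bar>A\<bar>/B"] B by (intro add_left_mono mult_left_mono) auto
  also have "... = ennreal (sqrt (2/pi) * (B + A\<^sup>2 / B))"
  proof -
   have "A\<^sup>2 = \<bar>A\<bar> * \<bar>A\<bar>" by (simp add: power2_eq_square)
   then have "B * sqrt (2/pi) + \<bar>A\<bar> * (\<bar>A\<bar> / B * sqrt (2/pi)) = sqrt (2/pi) * (B + A\<^sup>2 / B)"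
    using B by (simp add: field_simps)
   then show ?thesis
    using B by (simp add: ennreal_mult[symmetric] ennreal_plus[symmetric] del: ennreal_plus)
  qed
  finally show ?thesis .
qed

text \<open>The correlation of \<open>U + V\<close> and \<open>U - V\<close> enters only quadratically; this is what makes
  the rows of one random block almost as good as independent ones.\<close>

lemma stdn_abs_product:
  assumes "\<alpha> \<ge> 0" "\<beta> \<ge> 0" and \<sigma>: "\<sigma> > 0" "\<sigma>\<^sup>2 = \<alpha>\<^sup>2 + \<beta>\<^sup>2" and r: "r = \<alpha>\<^sup>2 - \<beta>\<^sup>2"
  shows "(\<integral>\<^sup>+x. \<integral>\<^sup>+y. ennreal (\<bar>\<alpha> * x + \<beta> * y\<bar> * \<bar>\<alpha> * x - \<beta> * y\<bar>) \<partial>stdn \<partial>stdn)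
   \<le> ennreal (2/pi * \<sigma>\<^sup>2 + 4 * r\<^sup>2 / \<sigma>\<^sup>2)"
\<comment> \<open>For strongly correlated forms \<open>4 * r\<^sup>2 / \<sigma>\<^sup>2\<close>
  alone exceeds \<open>\<sigma>\<^sup>2\<close>, and |U^2 - V^2| <= U^2 + V^2 is enough. Otherwise
  the deviation \<tau> introduced below is at least \<sigma>/2, so that dividing by it is
  harmless.\<close>
proof (cases "4 * r\<^sup>2 \<le> \<sigma>\<^sup>2 * \<sigma>\<^sup>2")
  case False
  have "(\<integral>\<^sup>+x. \<integral>\<^sup>+y. ennreal (\<bar>\<alpha> * x + \<beta> * y\<bar> * \<bar>\<alpha> * x - \<beta> * y\<bar>) \<partial>stdn \<partial>stdn)
   \<le> (\<integral>\<^sup>+x. \<integral>\<^sup>+y. ennreal (\<alpha>\<^sup>2) * ennreal (x\<^sup>2) + ennreal (\<beta>\<^sup>2) * ennreal (y\<^sup>2) \<partial>stdn \<partial>stdn)"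
  proof (intro nn_integral_mono)
   fix x y :: real
   have "\<bar>\<alpha> * x + \<beta> * y\<bar> * \<bar>\<alpha> * x - \<beta> * y\<bar> = \<bar>\<alpha>\<^sup>2 * x\<^sup>2 - \<beta>\<^sup>2 * y\<^sup>2\<bar>"
    by (simp add: abs_mult[symmetric] power2_eq_square algebra_simps)
   also have "... \<le> \<alpha>\<^sup>2 * x\<^sup>2 + \<beta>\<^sup>2 * y\<^sup>2" by (auto simp: abs_le_iff)
   finally show "ennreal (\<bar>\<alpha> * x + \<beta> * y\<bar> * \<bar>\<alpha> * x - \<beta> * y\<bar>) \<le> ennreal (\<alpha>\<^sup>2) * ennreal (x\<^sup>2) + ennreal (\<beta>\<^sup>2) * ennreal (y\<^sup>2)"
    by (simp add: ennreal_mult[symmetric] ennreal_plus[symmetric] ennreal_leI del: ennreal_plus)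
  qed
  also have "... = ennreal (\<sigma>\<^sup>2)"
   by (simp add: nn_integral_add nn_integral_cmult stdn_sq \<sigma>(2))
  also have "... \<le> ennreal (2/pi * \<sigma>\<^sup>2 + 4 * r\<^sup>2 / \<sigma>\<^sup>2)"
  proof (rule ennreal_leI)
   have "\<sigma>\<^sup>2 \<le> 4 * r\<^sup>2 / \<sigma>\<^sup>2" using False \<sigma>(1) by (simp add: pos_le_divide_eq)
   then show "\<sigma>\<^sup>2 \<le> 2/pi * \<sigma>\<^sup>2 + 4 * r\<^sup>2 / \<sigma>\<^sup>2" by (intro add_increasing) auto
  qed
  finally show ?thesis .
next
  case True
  \<comment> \<open>After the rotation with \<alpha> x + \<beta> y = \<sigma> u, the other form is
    (r/\<sigma>) u - \<tau> v with v independent of u: \<tau> is its conditional standard deviation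
    given u.\<close>
  define \<tau> where "\<tau> = 2 * \<alpha> * \<beta> / \<sigma>"
  have rr: "\<sigma>\<^sup>2 * \<tau>\<^sup>2 = \<sigma>\<^sup>2 * \<sigma>\<^sup>2 - r\<^sup>2"
  proof -
   have "\<sigma>\<^sup>2 * \<tau>\<^sup>2 = (2 * \<alpha> * \<beta>)\<^sup>2" using \<sigma>(1) by (simp add: \<tau>_def power_divide)
   also have "... = (\<alpha>\<^sup>2 + \<beta>\<^sup>2) * (\<alpha>\<^sup>2 + \<beta>\<^sup>2) - (\<alpha>\<^sup>2 - \<beta>\<^sup>2)\<^sup>2"
    by (simp add: power2_eq_square algebra_simps)
   finally show ?thesis by (simp only: \<sigma>(2) r)
  qed
  have \<tau>nn: "0 \<le> \<tau>" using assms(1,2) \<sigma>(1) by (simp add: \<tau>_def)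
  have "\<sigma>\<^sup>2 * \<tau>\<^sup>2 \<ge> \<sigma>\<^sup>2 * (\<sigma>/2)\<^sup>2" 
  proof -
   have 1: "\<sigma>\<^sup>2 * (\<sigma>/2)\<^sup>2 = \<sigma>\<^sup>2 * \<sigma>\<^sup>2 / 4" by (simp add: power_divide)
   have 2: "4 * q \<le> X ==> 0 \<le> X ==> X / 4 \<le> X - q" for X q :: real by linarith
   show ?thesis unfolding rr 1 by (rule 2[OF True]) simp
  qed
  then have "(\<sigma>/2)\<^sup>2 \<le> \<tau>\<^sup>2"
   by (rule mult_left_le_imp_le) (use \<sigma>(1) in simp)
  then have \<tau>1: "\<sigma>/2 \<le> \<tau>" by (rule power2_le_imp_le[OF _ \<tau>nn])
  have "\<sigma>\<^sup>2 * \<tau>\<^sup>2 \<le> \<sigma>\<^sup>2 * \<sigma>\<^sup>2" unfolding rr by simp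
  then have "\<tau>\<^sup>2 \<le> \<sigma>\<^sup>2"
   by (rule mult_left_le_imp_le) (use \<sigma>(1) in simp)
  then have \<tau>2: "\<tau> \<le> \<sigma>" using \<sigma>(1) by (rule power2_le_imp_le[OF _ less_imp_le])
  have \<tau>0: "\<tau> > 0" using \<tau>1 \<sigma>(1) by linarith
  have \<alpha>: "\<alpha> > 0" using \<tau>0 assms(1) less_eq_real_def[of 0 \<alpha>] by (auto simp: \<tau>_def)
  let ?F = "\<lambda>u v. ennreal (\<bar>\<sigma> * u\<bar> * \<bar>r / \<sigma> * u - \<tau> * v\<bar>)"
  have "(\<integral>\<^sup>+x. \<integral>\<^sup>+y. ennreal (\<bar>\<alpha> * x + \<beta> * y\<bar> * \<bar>\<alpha> * x - \<beta> * y\<bar>) \<partial>stdn \<partial>stdn) =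
    (\<integral>\<^sup>+x. \<integral>\<^sup>+y. ?F (\<alpha> / \<sigma> * x + \<beta> / \<sigma> * y) (\<alpha> / \<sigma> * y - \<beta> / \<sigma> * x) \<partial>stdn \<partial>stdn)"
  proof (intro nn_integral_cong)
   fix x y :: real
   have 1: "\<sigma> * (\<alpha> / \<sigma> * x + \<beta> / \<sigma> * y) = \<alpha> * x + \<beta> * y"
    using \<sigma>(1) by (simp add: distrib_left)
   have "r / \<sigma> * (\<alpha> / \<sigma> * x + \<beta> / \<sigma> * y) - \<tau> * (\<alpha> / \<sigma> * y - \<beta> / \<sigma> * x) =
     (r * (\<alpha> * x + \<beta> * y) - 2 * \<alpha> * \<beta> * (\<alpha> * y - \<beta> * x)) / \<sigma>\<^sup>2"
    using \<sigma>(1) by (simp add: \<tau>_def divide_inverse algebra_simps power2_eq_square)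
   also have "r * (\<alpha> * x + \<beta> * y) - 2 * \<alpha> * \<beta> * (\<alpha> * y - \<beta> * x) = \<sigma>\<^sup>2 * (\<alpha> * x - \<beta> * y)"
    unfolding r \<sigma>(2) by (simp add: power2_eq_square algebra_simps)
   finally have 2: "r / \<sigma> * (\<alpha> / \<sigma> * x + \<beta> / \<sigma> * y) - \<tau> * (\<alpha> / \<sigma> * y - \<beta> / \<sigma> * x) = \<alpha> * x - \<beta> * y"
    using \<sigma>(1) by simp
   show "ennreal (\<bar>\<alpha> * x + \<beta> * y\<bar> * \<bar>\<alpha> * x - \<beta> * y\<bar>) = ?F (\<alpha> / \<sigma> * x + \<beta> / \<sigma> * y) (\<alpha> / \<sigma> * y - \<beta> / \<sigma> * x)"
    unfolding 1 2 ..
  qed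
  also have "... = (\<integral>\<^sup>+x. \<integral>\<^sup>+y. ?F x y \<partial>stdn \<partial>stdn)"
   using \<alpha> \<sigma> by (intro stdn_rotation) (auto simp: power_divide add_divide_distrib[symmetric])
  also have "... = (\<integral>\<^sup>+u. ennreal \<bar>\<sigma> * u\<bar> * (\<integral>\<^sup>+v. ennreal \<bar>- (r / \<sigma> * u) + \<tau> * v\<bar> \<partial>stdn) \<partial>stdn)"
   by (simp add: ennreal_mult nn_integral_cmult abs_minus_commute)
  also have "... \<le> (\<integral>\<^sup>+u. ennreal \<bar>\<sigma> * u\<bar> * ennreal (sqrt (2/pi) * (\<tau> + (- (r / \<sigma> * u))\<^sup>2 / \<tau>)) \<partial>stdn)"
   using \<tau>0 by (intro nn_integral_mono mult_left_mono stdn_abs_affine) auto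
  also have "... = (\<integral>\<^sup>+u. ennreal (sqrt (2/pi) * \<sigma> * \<tau>) * ennreal \<bar>u\<bar> + ennreal (sqrt (2/pi) * r\<^sup>2 / (\<sigma> * \<tau>)) * ennreal (\<bar>u\<bar>^3) \<partial>stdn)"
  proof (intro nn_integral_cong)
   fix u :: real
   have gen: "\<sigma> * U * (s * (\<tau> + r\<^sup>2 * U\<^sup>2 / \<sigma>\<^sup>2 / \<tau>)) = (s * \<sigma> * \<tau>) * U + (s * r\<^sup>2 / (\<sigma> * \<tau>)) * U^3" for s U
    using \<sigma>(1) \<tau>0 by (simp add: field_simps power2_eq_square power3_eq_cube)
   have "(- (r / \<sigma> * u))\<^sup>2 = r\<^sup>2 * \<bar>u\<bar>\<^sup>2 / \<sigma>\<^sup>2" "\<bar>\<sigma> * u\<bar> = \<sigma> * \<bar>u\<bar>"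
    using \<sigma>(1) by (simp_all add: power_mult_distrib power_divide abs_mult)
   then have "\<bar>\<sigma> * u\<bar> * (sqrt (2/pi) * (\<tau> + (- (r / \<sigma> * u))\<^sup>2 / \<tau>)) =
     (sqrt (2/pi) * \<sigma> * \<tau>) * \<bar>u\<bar> + (sqrt (2/pi) * r\<^sup>2 / (\<sigma> * \<tau>)) * \<bar>u\<bar>^3"
    using gen[of "\<bar>u\<bar>" "sqrt (2/pi)"] by (simp only:)
   then show "ennreal \<bar>\<sigma> * u\<bar> * ennreal (sqrt (2/pi) * (\<tau> + (- (r / \<sigma> * u))\<^sup>2 / \<tau>)) =
    ennreal (sqrt (2/pi) * \<sigma> * \<tau>) * ennreal \<bar>u\<bar> + ennreal (sqrt (2/pi) * r\<^sup>2 / (\<sigma> * \<tau>)) * ennreal (\<bar>u\<bar>^3)"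
    using \<sigma>(1) \<tau>0 by (simp add: ennreal_mult[symmetric] ennreal_plus[symmetric] del: ennreal_plus)
  qed
  also have "... = ennreal (sqrt (2/pi) * \<sigma> * \<tau>) * ennreal (sqrt (2/pi)) + ennreal (sqrt (2/pi) * r\<^sup>2 / (\<sigma> * \<tau>)) * ennreal (2 * sqrt (2/pi))"
   by (simp add: nn_integral_add nn_integral_cmult stdn_abs stdn_abs3)
  also have "... = ennreal (2/pi * \<sigma> * \<tau> + 4/pi * r\<^sup>2 / (\<sigma> * \<tau>))"
  proof -
   have q: "sqrt (2/pi) * sqrt (2/pi) = 2/pi" by simp
   have gen: "(s * \<sigma> * \<tau>) * s + (s * r\<^sup>2 / (\<sigma> * \<tau>)) * (2 * s) = (s * s) * (\<sigma> * \<tau> + 2 * r\<^sup>2 / (\<sigma> * \<tau>))" for s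
    using \<sigma>(1) \<tau>0 by (simp add: field_simps)
   have "(sqrt (2/pi) * \<sigma> * \<tau>) * sqrt (2/pi) + (sqrt (2/pi) * r\<^sup>2 / (\<sigma> * \<tau>)) * (2 * sqrt (2/pi)) =
    (sqrt (2/pi) * sqrt (2/pi)) * (\<sigma> * \<tau> + 2 * r\<^sup>2 / (\<sigma> * \<tau>))"
    by (rule gen)
   also have "... = 2/pi * \<sigma> * \<tau> + 4/pi * r\<^sup>2 / (\<sigma> * \<tau>)" unfolding q by (simp add: field_simps)
   finally show ?thesis
    using \<sigma>(1) \<tau>0 by (simp add: ennreal_mult[symmetric] ennreal_plus[symmetric] del: ennreal_plus)
  qed
  also have "... \<le> ennreal (2/pi * \<sigma>\<^sup>2 + 4 * r\<^sup>2 / \<sigma>\<^sup>2)"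
  proof (rule ennreal_leI, rule add_mono)
   show "2/pi * \<sigma> * \<tau> \<le> 2/pi * \<sigma>\<^sup>2" using \<tau>2 \<sigma>(1) by (simp add: power2_eq_square divide_right_mono)
   have "\<sigma>\<^sup>2 \<le> 2 * (\<sigma> * \<tau>)" using mult_left_mono[OF \<tau>1, of \<sigma>] \<sigma>(1) by (simp add: power2_eq_square)
   also have "... \<le> pi * (\<sigma> * \<tau>)" using \<sigma>(1) \<tau>0 pi_ge_two by (intro mult_right_mono) auto
   finally have "r\<^sup>2 / (pi * (\<sigma> * \<tau>)) \<le> r\<^sup>2 / \<sigma>\<^sup>2" using \<sigma>(1) \<tau>0 by (intro divide_left_mono) auto
   then show "4/pi * r\<^sup>2 / (\<sigma> * \<tau>) \<le> 4 * r\<^sup>2 / \<sigma>\<^sup>2" by simp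
  qed
  finally show ?thesis .
qed

section \<open>Random signs\<close>

definition sg :: "real => real" where
  "sg x = (if x < 0 then -1 else 1)"

lemma measurable_sg [measurable]: "sg \<in> borel_measurable borel"
  unfolding sg_def by measurable

lemma abs_sg [simp]: "\<bar>sg x\<bar> = 1" and sg_sq [simp]: "(sg x)\<^sup>2 = 1"
  by (auto simp: sg_def)

text \<open>The sign of a normal number is a fair coin: adding the integral over -x pairs the values
  at 1 and -1 everywhere except at 0, a null set. There \<open>sg\<close> is 1, in agreement with
  the comparison made by the programs. Doubling avoids a division of extended reals.\<close>

lemma nn_integral_stdn_sg: "2 * (\<integral>\<^sup>+x. f (sg x) \<partial>stdn) = f 1 + f (-1)"
proof -
  have [measurable]: "(\<lambda>x. f (sg x)) \<in> borel_measurable borel"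
  proof -
   have "(\<lambda>x. f (sg x)) = (\<lambda>x. if x < 0 then f (-1) else f 1)" by (auto simp: sg_def)
   then show ?thesis by simp
  qed
  have ne: "AE x in stdn. x \<noteq> 0"
   by (subst AE_density) (auto intro!: AE_I'[of "{0}"])
  have "2 * (\<integral>\<^sup>+x. f (sg x) \<partial>stdn) = (\<integral>\<^sup>+x. f (sg x) \<partial>stdn) + (\<integral>\<^sup>+x. f (sg (- x)) \<partial>stdn)"
   using nn_integral_stdn_uminus[of "\<lambda>x. f (sg x)"] by (simp add: mult_2)
  also have "... = (\<integral>\<^sup>+x. f (sg x) + f (sg (- x)) \<partial>stdn)"
   by (subst nn_integral_add) auto
  also have "... = (\<integral>\<^sup>+x. f 1 + f (-1) \<partial>stdn)"
   using ne
  proof (intro nn_integral_cong_AE, eventually_elim)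
   fix x :: real assume "x \<noteq> 0"
   then show "f (sg x) + f (sg (- x)) = f 1 + f (-1)"
    by (cases "x < 0") (auto simp: sg_def intro: add.commute)
  qed
  finally show ?thesis by simp
qed

lemma nn_integral_stdn_sg': "(\<integral>\<^sup>+x. ennreal (f (sg x)) \<partial>stdn) = ennreal ((f 1 + f (-1)) / 2)"
  if "f 1 \<ge> 0" "f (-1) \<ge> 0"
proof -
  have "2 * (\<integral>\<^sup>+x. ennreal (f (sg x)) \<partial>stdn) = 2 * ennreal ((f 1 + f (-1)) / 2)"
   using that nn_integral_stdn_sg[of "\<lambda>x. ennreal (f x)"]
   by (simp add: ennreal_plus[symmetric] ennreal_numeral[symmetric] ennreal_mult[symmetric] del: ennreal_plus ennreal_numeral)
  then show ?thesis by (simp add: ennreal_mult_cancel_left)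
qed

lemma nn_integral_gseq_sg_Suc:
  assumes "\<And>x. 0 \<le> F x"  and [measurable]: "F \<in> borel_measurable borel"
  shows "(\<integral>\<^sup>+g. ennreal (F (\<Sum>c<Suc D. sg (g c) * a c)) \<partial>gseq) =
   (\<integral>\<^sup>+g. ennreal ((F ((\<Sum>c<D. sg (g c) * a (Suc c)) + a 0) + F ((\<Sum>c<D. sg (g c) * a (Suc c)) - a 0)) / 2) \<partial>gseq)"
proof -
  have "(\<integral>\<^sup>+g. ennreal (F (\<Sum>c<Suc D. sg (g c) * a c)) \<partial>gseq) =
    (\<integral>\<^sup>+x. \<integral>\<^sup>+g. ennreal (F (sg x * a 0 + (\<Sum>c<D. sg (g c) * a (Suc c)))) \<partial>gseq \<partial>stdn)"
   by (subst nn_integral_gseq_case_nat) (simp_all add: sum.lessThan_Suc_shift del: sum.lessThan_Suc)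
  also have "... = (\<integral>\<^sup>+g. \<integral>\<^sup>+x. ennreal (F (sg x * a 0 + (\<Sum>c<D. sg (g c) * a (Suc c)))) \<partial>stdn \<partial>gseq)"
   by (rule stdn_gseq.Fubini'[symmetric]) measurable
  also have "... = (\<integral>\<^sup>+g. ennreal ((F (1 * a 0 + (\<Sum>c<D. sg (g c) * a (Suc c))) + F (-1 * a 0 + (\<Sum>c<D. sg (g c) * a (Suc c)))) / 2) \<partial>gseq)"
   using assms(1) by (intro nn_integral_cong nn_integral_stdn_sg') auto
  finally show ?thesis by (simp add: add.commute)
qed

lemma signed_sum_square:
  "(\<integral>\<^sup>+g. ennreal ((\<Sum>c<D. sg (g c) * a c)\<^sup>2) \<partial>gseq) = ennreal (\<Sum>c<D. (a c)\<^sup>2)"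
proof (induction D arbitrary: a)
  case (Suc D)
  have e: "((x + a 0)\<^sup>2 + (x - a 0)\<^sup>2) / 2 = x\<^sup>2 + (a 0)\<^sup>2" for x
   by (simp add: power2_eq_square field_simps)
  have "(\<integral>\<^sup>+g. ennreal ((\<Sum>c<Suc D. sg (g c) * a c)\<^sup>2) \<partial>gseq) =
    (\<integral>\<^sup>+g. ennreal ((\<Sum>c<D. sg (g c) * a (Suc c))\<^sup>2) + ennreal ((a 0)\<^sup>2) \<partial>gseq)"
   by (subst nn_integral_gseq_sg_Suc, simp, simp, simp only: e) simp
  also have "... = ennreal (\<Sum>c<D. (a (Suc c))\<^sup>2) + ennreal ((a 0)\<^sup>2)"
   by (subst nn_integral_add) (auto simp: Suc)
  finally show ?case
   by (simp add: sum.lessThan_Suc_shift sum_nonneg ennreal_plus[symmetric] add.commute del: sum.lessThan_Suc ennreal_plus)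
qed simp

text \<open>Khinchine's inequality for the fourth moment. Averaging over the first sign cancels the
  odd powers, and the surviving mixed term is exactly the one in
  \<open>3 * ((a 0)\<^sup>2 + A)\<^sup>2\<close>, where A is the sum of the other squares; hence the
  constant 3.\<close>

lemma signed_sum_power4:
  "(\<integral>\<^sup>+g. ennreal ((\<Sum>c<D. sg (g c) * a c)^4) \<partial>gseq) \<le> ennreal (3 * (\<Sum>c<D. (a c)\<^sup>2)\<^sup>2)"
proof (induction D arbitrary: a)
  case (Suc D)
  let ?S = "\<lambda>g. \<Sum>c<D. sg (g c) * a (Suc c)" and ?A = "\<Sum>c<D. (a (Suc c))\<^sup>2"
  have e: "((x + a 0)^4 + (x - a 0)^4) / 2 = x^4 + 6 * (a 0)\<^sup>2 * x\<^sup>2 + (a 0)^4" for x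
   by (simp add: eval_nat_numeral field_simps)
  have "(\<integral>\<^sup>+g. ennreal ((\<Sum>c<Suc D. sg (g c) * a c)^4) \<partial>gseq) =
    (\<integral>\<^sup>+g. ennreal ((?S g)^4 + 6 * (a 0)\<^sup>2 * (?S g)\<^sup>2 + (a 0)^4) \<partial>gseq)"
   by (subst nn_integral_gseq_sg_Suc, simp, simp, simp only: e)
  also have "... = (\<integral>\<^sup>+g. ennreal ((?S g)^4) + ennreal (6 * (a 0)\<^sup>2) * ennreal ((?S g)\<^sup>2) + ennreal ((a 0)^4) \<partial>gseq)"
   by (intro nn_integral_cong) (auto simp: ennreal_mult)
  also have "... = (\<integral>\<^sup>+g. ennreal ((?S g)^4) \<partial>gseq) + ennreal (6 * (a 0)\<^sup>2) * ennreal ?A + ennreal ((a 0)^4)"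
   by (simp add: nn_integral_add nn_integral_cmult signed_sum_square)
  also have "... \<le> ennreal (3 * ?A\<^sup>2) + ennreal (6 * (a 0)\<^sup>2) * ennreal ?A + ennreal ((a 0)^4)"
   by (intro add_right_mono Suc)
  also have "... = ennreal (3 * ?A\<^sup>2 + 6 * (a 0)\<^sup>2 * ?A + (a 0)^4)"
   by (simp add: ennreal_mult sum_nonneg)
  also have "... \<le> ennreal (3 * (\<Sum>c<Suc D. (a c)\<^sup>2)\<^sup>2)"
  proof (rule ennreal_leI)
   have "3 * ((a 0)\<^sup>2 + ?A)\<^sup>2 = 3 * ?A\<^sup>2 + 6 * (a 0)\<^sup>2 * ?A + 3 * (a 0)^4"
    by (simp add: eval_nat_numeral algebra_simps)
   moreover have "(a 0)^4 \<ge> 0" by simp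
   ultimately show "3 * ?A\<^sup>2 + 6 * (a 0)\<^sup>2 * ?A + (a 0)^4 \<le> 3 * (\<Sum>c<Suc D. (a c)\<^sup>2)\<^sup>2"
    unfolding sum.lessThan_Suc_shift by linarith
  qed
  finally show ?case .
qed simp

section \<open>The Hadamard transform and random projections\<close>

text \<open>One butterfly stage of the Walsh-Hadamard transform in constant-geometry form:
  neighbours are read, and their sum and difference go to the two halves of the output,
  \<open>h\<close> being half the length. All stages address memory in the same way, so no strides
  and no bit operations on indices are needed.\<close>

definition fw_step :: "nat => (nat => real) => nat => real" where
  "fw_step h v j = (if j < h then v (2 * j) + v (2 * j + 1) else v (2 * (j - h)) - v (2 * (j - h) + 1))"

primrec fw :: "nat => nat => (nat => real) => nat => real" where
  "fw h 0 v = v"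
| "fw h (Suc t) v = fw_step h (fw h t v)"

lemma fw_diff: "fw h t (\<lambda>c. u c - v c) j = fw h t u j - fw h t v j"
  by (induction t arbitrary: j) (auto simp: fw_step_def)

lemma measurable_fw [measurable (raw)]:
  assumes "\<And>c. (\<lambda>x. v x c) \<in> borel_measurable M"
  shows "(\<lambda>x. fw h t (v x) j) \<in> borel_measurable M"
proof (induction t arbitrary: j)
  case (Suc t)
  note Suc[measurable]
  show ?case by (simp add: fw_step_def)
qed (simp add: assms)

lemma sum_even_odd:
  fixes f :: "nat => 'a :: comm_monoid_add"
  shows "(\<Sum>c<2*h. f c) = (\<Sum>j<h. f (2 * j) + f (2 * j + 1))"
  by (induction h) (auto simp: add.assoc)

lemma sum_two_halves:
  fixes f :: "nat => 'a :: comm_monoid_add"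
  shows "(\<Sum>c<2*h. f c) = (\<Sum>j<h. f j + f (h + j))"
proof -
  have "(\<Sum>c<h + m. f c) = (\<Sum>j<h. f j) + (\<Sum>j<m. f (h + j))" for m
   by (induction m) (auto simp: add.assoc)
  from this[of h] show ?thesis by (simp add: mult_2 sum.distrib)
qed

lemma fw_step_norm: "(\<Sum>j<2*h. (fw_step h v j)\<^sup>2) = 2 * (\<Sum>c<2*h. (v c)\<^sup>2)"
proof -
  have "(\<Sum>j<2*h. (fw_step h v j)\<^sup>2) = (\<Sum>j<h. (v (2*j) + v (2*j+1))\<^sup>2 + (v (2*j) - v (2*j+1))\<^sup>2)"
   unfolding sum_two_halves by (intro sum.cong) (auto simp: fw_step_def)
  also have "... = (\<Sum>j<h. 2 * ((v (2*j))\<^sup>2 + (v (2*j+1))\<^sup>2))"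
   by (intro sum.cong) (auto simp: power2_eq_square algebra_simps)
  finally show ?thesis unfolding sum_even_odd by (simp only: sum_distrib_left)
qed

text \<open>The alternative \<open>t = 0\<close> admits vectors of length 1, where half the length
  rounds to 0 and no stage is performed.\<close>

lemma fw_norm:
  assumes "t = 0 \<or> D = 2 * h"
  shows "(\<Sum>j<D. (fw h t v j)\<^sup>2) = 2 ^ t * (\<Sum>c<D. (v c)\<^sup>2)"
  using assms by (induction t) (auto simp: fw_step_norm)

text \<open>After \<open>t\<close> stages an entry is a signed sum over an aligned block of 2^t
  inputs. Entry j is made from the entries 2 j' and 2 j' + 1, where j' is j reduced to the lower
  half; their blocks are adjacent, so the block of j is found from j modulo 2^(l-t). The signs stay
  anonymous, because orthogonality is used only through preservation of the norm.\<close>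

lemma fw_block_signs:
  assumes "t \<le> l" "j < 2 ^ l"
  shows "\<exists>s. (\<forall>c. \<bar>s c\<bar> = 1) \<and>
   (\<forall>v. fw (2 ^ l div 2) t v j = (\<Sum>c\<in>{2^t * (j mod 2^(l-t))..<2^t * (j mod 2^(l-t)) + 2^t}. s c * v c))"
  using assms
proof (induction t arbitrary: j)
  case 0
  then show ?case by (intro exI[of _ "\<lambda>_. 1"]) simp
next
  case (Suc t)
  define h :: nat where "h = 2 ^ l div 2"
  define m :: nat where "m = 2 ^ (l - Suc t)"
  obtain l' where l: "l = Suc l'" using Suc.prems by (cases l) auto
  have h: "h = 2 ^ l'" by (simp add: h_def l)
  have m2: "2 ^ (l - t) = 2 * m" using Suc.prems by (simp add: m_def Suc_diff_Suc flip: power_Suc)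
  have mh: "m dvd h" unfolding m_def h using l by (simp add: le_imp_power_dvd)
  define j' where "j' = (if j < h then j else j - h)"
  define e :: real where "e = (if j < h then 1 else -1)"
  have j: "j < 2 * h" using Suc.prems by (simp add: h l)
  then have j': "j' < h" by (auto simp: j'_def)
  have jm: "j mod m = j' mod m"
  proof (cases "j < h")
   case False
   obtain k where "h = m * k" using mh by (auto simp: dvd_def)
   then have "j = j' + m * k" using False by (simp add: j'_def)
   then show ?thesis by simp
  qed (simp add: j'_def)
  define q where "q = j mod m"
  have q1: "(2 * j') mod (2 * m) = 2 * q" unfolding q_def jm by simp
  have q2: "(2 * j' + 1) mod (2 * m) = 2 * q + 1"
   unfolding q_def jm by (simp add: mod_mult2_eq)
  have lt: "2 * j' < 2 ^ l" "2 * j' + 1 < 2 ^ l"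
   using j' by (auto simp: h l)
  obtain s1 where s1: "\<And>c. \<bar>s1 c\<bar> = 1"
   "\<And>v. fw h t v (2 * j') = (\<Sum>c\<in>{2^t * (2 * q)..<2^t * (2 * q) + 2^t}. s1 c * v c)"
   using Suc.IH[of "2 * j'"] Suc.prems lt unfolding m2 q1 h_def by auto
  obtain s2 where s2: "\<And>c. \<bar>s2 c\<bar> = 1"
   "\<And>v. fw h t v (2 * j' + 1) = (\<Sum>c\<in>{2^t * (2 * q + 1)..<2^t * (2 * q + 1) + 2^t}. s2 c * v c)"
   using Suc.IH[of "2 * j' + 1"] Suc.prems lt unfolding m2 q2 h_def by auto
  define s where "s c = (if c < 2^t * (2 * q + 1) then s1 c else e * s2 c)" for c
  have "fw h (Suc t) v j = (\<Sum>c\<in>{2^Suc t * q..<2^Suc t * q + 2^Suc t}. s c * v c)" for v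
  proof -
   have "fw h (Suc t) v j = fw h t v (2 * j') + e * fw h t v (2 * j' + 1)"
    by (simp add: fw_step_def j'_def e_def)
   also have "... = (\<Sum>c\<in>{2^t * (2 * q)..<2^t * (2 * q + 1)}. s c * v c) +
     (\<Sum>c\<in>{2^t * (2 * q + 1)..<2^t * (2 * q + 1) + 2^t}. s c * v c)"
    unfolding s1 s2 sum_distrib_left
    by (intro arg_cong2[where f = "(+)"] sum.cong) (auto simp: s_def algebra_simps)
   also have "... = (\<Sum>c\<in>{2^t * (2 * q)..<2^t * (2 * q + 1) + 2^t}. s c * v c)"
    by (rule sum.atLeastLessThan_concat) auto
   finally show ?thesis by (simp add: algebra_simps)
  qed
  moreover have "\<bar>s c\<bar> = 1" for c
   using s1 s2 by (simp add: s_def e_def abs_mult)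
  ultimately show ?case
   unfolding h_def m_def[symmetric] q_def by (intro exI[of _ s]) auto
qed

lemma fw_signs:
  assumes "j < 2 ^ l"
  obtains s where "\<And>c. \<bar>s c\<bar> = (1::real)" "\<And>v. fw (2 ^ l div 2) l v j = (\<Sum>c<2^l. s c * v c)"
proof -
  have *: "{2 ^ l * (j mod 2 ^ (l - l))..<2 ^ l * (j mod 2 ^ (l - l)) + 2 ^ l} = {..<2 ^ l}"
   by auto
  show ?thesis
   using fw_block_signs[OF order_refl assms] that unfolding * by blast
qed

lemma fw_norm_power:
  "(\<Sum>j<2^l. (fw (2 ^ l div 2) l v j)\<^sup>2) = 2 ^ l * (\<Sum>c<2^l. (v c)\<^sup>2)"
  by (rule fw_norm) (cases l, auto)

section \<open>Projections by one random block\<close>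

definition spread :: "nat => (nat => real) => (nat => real) => nat => real" where
  "spread l g x = fw (2 ^ l div 2) l (\<lambda>c. sg (g c) * x c)"

text \<open>The first 2^l entries of \<open>g\<close> supply the signs and the next 2^l the Gaussian
  diagonal, so one block consumes 2 * 2^l numbers. Neither transform is normalised;
  \<open>block_norm\<close> corrects for this.\<close>

definition proj :: "nat => (nat => real) => (nat => real) => nat => real" where
  "proj l g x = fw (2 ^ l div 2) l (\<lambda>c. g (2 ^ l + c) * spread l g x c)"

lemma proj_diff: "proj l g (\<lambda>c. x c - y c) a = proj l g x a - proj l g y a"
  by (simp add: proj_def spread_def fw_diff right_diff_distrib)

lemma measurable_spread [measurable (raw)]:
  assumes [measurable]: "\<And>c. (\<lambda>y. g y c) \<in> borel_measurable M"
  shows "(\<lambda>y. spread l (g y) x j) \<in> borel_measurable M"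
  unfolding spread_def by (rule measurable_fw) measurable

lemma measurable_proj [measurable (raw)]:
  assumes [measurable]: "\<And>c. (\<lambda>y. g y c) \<in> borel_measurable M"
  shows "(\<lambda>y. proj l (g y) x j) \<in> borel_measurable M"
  unfolding proj_def by (rule measurable_fw) measurable

lemma spread_norm: "(\<Sum>j<2^l. (spread l g x j)\<^sup>2) = 2 ^ l * (\<Sum>c<2^l. (x c)\<^sup>2)"
  by (simp add: spread_def fw_norm_power power_mult_distrib)

lemma spread_power4:
  assumes "j < 2 ^ l"
  shows "(\<integral>\<^sup>+g. ennreal ((spread l g x j)^4) \<partial>gseq) \<le> ennreal (3 * (\<Sum>c<2^l. (x c)\<^sup>2)\<^sup>2)"
proof -
  obtain s where s: "\<And>c. \<bar>s c\<bar> = (1::real)" "\<And>v. fw (2 ^ l div 2) l v j = (\<Sum>c<2^l. s c * v c)"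
   using fw_signs[OF assms] by blast
  have "(s c)\<^sup>2 = 1" for c using s(1)[of c] by (metis power2_abs power_one)
  then show ?thesis
   using signed_sum_power4[where a = "\<lambda>c. s c * x c" and D = "2^l"]
   by (simp add: spread_def s(2) power_mult_distrib mult.left_commute)
qed

lemma spread_comb_seq:
  assumes "j < 2 ^ l"
  shows "spread l (comb_seq (2 ^ l) g h) x j = spread l g x j"
proof -
  obtain s where "\<And>c. \<bar>s c\<bar> = (1::real)" and s: "\<And>v. fw (2 ^ l div 2) l v j = (\<Sum>c<2^l. s c * v c)"
   using fw_signs[OF assms] by blast
  show ?thesis unfolding spread_def s by (simp add: comb_seq_less)
qed

lemma proj_comb_seq:
  assumes "a < 2 ^ l"
  shows "proj l (comb_seq (2 ^ l) g h) x a = fw (2 ^ l div 2) l (\<lambda>c. h c * spread l g x c) a"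
proof -
  obtain s where "\<And>c. \<bar>s c\<bar> = (1::real)" and s: "\<And>v. fw (2 ^ l div 2) l v a = (\<Sum>c<2^l. s c * v c)"
   using fw_signs[OF assms] by blast
  have "comb_seq (2 ^ l) g h (2 ^ l + c) = h c" for c
   by (simp add: comb_seq_def)
  then show ?thesis
   unfolding proj_def s by (intro sum.cong refl) (simp add: spread_comb_seq)
qed

text \<open>The first transform preserves the norm, so a single output of the second one is exactly
  Gaussian, whatever the signs are.\<close>

lemma proj_gaussian:
  assumes a: "a < 2 ^ l" and [measurable]: "f \<in> borel_measurable borel"
  shows "(\<integral>\<^sup>+g. f (proj l g x a) \<partial>gseq) = (\<integral>\<^sup>+y. f (sqrt (2 ^ l * (\<Sum>c<2^l. (x c)\<^sup>2)) * y) \<partial>stdn)"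
proof -
  obtain s where s: "\<And>c. \<bar>s c\<bar> = (1::real)" "\<And>v. fw (2 ^ l div 2) l v a = (\<Sum>c<2^l. s c * v c)"
   using fw_signs[OF a] by blast
  have s2: "(s c)\<^sup>2 = 1" for c using s(1)[of c] by (metis power2_abs power_one)
  have "(\<integral>\<^sup>+g. f (proj l g x a) \<partial>gseq) =
    (\<integral>\<^sup>+g. \<integral>\<^sup>+h. f (\<Sum>c<2^l. (s c * spread l g x c) * h c) \<partial>gseq \<partial>gseq)"
   by (subst nn_integral_gseq_comb_seq[where k = "2^l"]) (auto simp: proj_comb_seq[OF a] s(2) mult_ac)
  also have "... = (\<integral>\<^sup>+g. \<integral>\<^sup>+y. f (sqrt (2 ^ l * (\<Sum>c<2^l. (x c)\<^sup>2)) * y) \<partial>stdn \<partial>gseq)"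
   by (subst gseq_form) (auto simp: power_mult_distrib s2 spread_norm)
  finally show ?thesis by simp
qed

text \<open>Half the sum and half the difference of two sign vectors have disjoint supports. The two
  forms are therefore U + V and U - V with independent Gaussians U and V, and
  \<open>stdn_abs_product\<close> applies with their covariance as \<open>r\<close>.\<close>

lemma two_signed_forms:
  fixes s s' :: "nat => real"
  assumes s: "\<And>c. \<bar>s c\<bar> = 1" and s': "\<And>c. \<bar>s' c\<bar> = 1" and pos: "(\<Sum>c<D. (w c)\<^sup>2) = \<sigma>\<^sup>2" "\<sigma> > 0"
  shows "(\<integral>\<^sup>+h. ennreal (\<bar>\<Sum>c<D. s c * (h c * w c)\<bar> * \<bar>\<Sum>c<D. s' c * (h c * w c)\<bar>) \<partial>gseq) \<le>
   ennreal (2/pi * \<sigma>\<^sup>2 + 4 * (\<Sum>c<D. s c * s' c * (w c)\<^sup>2)\<^sup>2 / \<sigma>\<^sup>2)"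
proof -
  define p where "p c = (s c + s' c) / 2 * w c" for c
  define m where "m c = (s c - s' c) / 2 * w c" for c
  have cs: "(s c = 1 \<or> s c = -1) \<and> (s' c = 1 \<or> s' c = -1)" for c
   using s[of c] s'[of c] by (auto simp: abs_if split: if_splits)
  have pm: "p c = 0 \<or> m c = 0" for c
   using cs[of c] by (auto simp: p_def m_def)
  have sq: "(p c)\<^sup>2 + (m c)\<^sup>2 = (w c)\<^sup>2" "(p c)\<^sup>2 - (m c)\<^sup>2 = s c * s' c * (w c)\<^sup>2" for c
   using cs[of c] by (auto simp: p_def m_def)
  have "(\<Sum>c<D. s c * (h c * w c)) = (\<Sum>c<D. p c * h c) + (\<Sum>c<D. m c * h c)"
   "(\<Sum>c<D. s' c * (h c * w c)) = (\<Sum>c<D. p c * h c) - (\<Sum>c<D. m c * h c)" for h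
   unfolding sum.distrib[symmetric] sum_subtractf[symmetric]
   by (auto intro!: sum.cong simp: p_def m_def field_simps)
  then have "(\<integral>\<^sup>+h. ennreal (\<bar>\<Sum>c<D. s c * (h c * w c)\<bar> * \<bar>\<Sum>c<D. s' c * (h c * w c)\<bar>) \<partial>gseq) =
   (\<integral>\<^sup>+h. (\<lambda>u v. ennreal (\<bar>u + v\<bar> * \<bar>u - v\<bar>)) (\<Sum>c<D. p c * h c) (\<Sum>c<D. m c * h c) \<partial>gseq)"
   by simp
  also have "... = (\<integral>\<^sup>+x. \<integral>\<^sup>+y. ennreal (\<bar>sqrt (\<Sum>c<D. (p c)\<^sup>2) * x + sqrt (\<Sum>c<D. (m c)\<^sup>2) * y\<bar> *
    \<bar>sqrt (\<Sum>c<D. (p c)\<^sup>2) * x - sqrt (\<Sum>c<D. (m c)\<^sup>2) * y\<bar>) \<partial>stdn \<partial>stdn)"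
   using pm by (subst gseq_two_forms) auto
  also have "... \<le> ennreal (2/pi * \<sigma>\<^sup>2 + 4 * (\<Sum>c<D. s c * s' c * (w c)\<^sup>2)\<^sup>2 / \<sigma>\<^sup>2)"
  proof (rule stdn_abs_product)
   show "\<sigma>\<^sup>2 = (sqrt (\<Sum>c<D. (p c)\<^sup>2))\<^sup>2 + (sqrt (\<Sum>c<D. (m c)\<^sup>2))\<^sup>2"
    by (simp add: sum_nonneg sum.distrib[symmetric] sq pos)
   show "(\<Sum>c<D. s c * s' c * (w c)\<^sup>2) = (sqrt (\<Sum>c<D. (p c)\<^sup>2))\<^sup>2 - (sqrt (\<Sum>c<D. (m c)\<^sup>2))\<^sup>2"
    by (simp add: sum_nonneg sum_subtractf[symmetric] sq)
  qed (use pos in \<open>auto intro: sum_nonneg\<close>)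
  finally show ?thesis .
qed

text \<open>Given the random signs, a pair of outputs contributes the product of the means plus a
  term quadratic in its covariance. The covariances of one output with all others form a Hadamard
  transform of the signed squares of the spread vector, so by preservation of the norm their squares
  add up to 2^l times its sum of fourth powers, which the random signs keep small on average. This
  makes the excess linear in \<rho> rather than quadratic.\<close>

lemma proj_abs_sum_square:
  assumes \<rho>: "\<rho> \<le> 2 ^ l" and n2: "n2 = (\<Sum>c<2^l. (x c)\<^sup>2)" "n2 > 0"
  shows "(\<integral>\<^sup>+g. ennreal ((\<Sum>a<\<rho>. \<bar>proj l g x a\<bar>)\<^sup>2) \<partial>gseq) \<le> ennreal (2 ^ l * n2 * (2/pi * real \<rho> ^ 2 + 12 * real \<rho>))"
proof -
  define D :: nat where "D = 2 ^ l"
  define \<sigma> where "\<sigma> = sqrt (D * n2)"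
  have \<sigma>: "\<sigma> > 0" "\<sigma>\<^sup>2 = D * n2" using n2(2) by (auto simp: \<sigma>_def D_def)
  have "\<exists>s. (\<forall>c. \<bar>s c\<bar> = (1::real)) \<and> (\<forall>v. fw (2 ^ l div 2) l v a = (\<Sum>c<D. s c * v c))" if "a < D" for a
   using fw_signs[of a l] that unfolding D_def by metis
  then obtain s where s: "\<And>a c. a < D ==> \<bar>s a c\<bar> = (1::real)"
   "\<And>a v. a < D ==> fw (2 ^ l div 2) l v a = (\<Sum>c<D. s a c * v c)"
   by metis
  have s2: "(s a c)\<^sup>2 = 1" if "a < D" for a c using s(1)[OF that, of c] by (metis power2_abs power_one)
  let ?W = "\<lambda>g c. spread l g x c"
  have inner: "(\<integral>\<^sup>+h. ennreal ((\<Sum>a<\<rho>. \<bar>proj l (comb_seq D g h) x a\<bar>)\<^sup>2) \<partial>gseq) \<le>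
    ennreal (2/pi * \<sigma>\<^sup>2 * real \<rho> ^ 2) + ennreal (4 * \<rho> * D / \<sigma>\<^sup>2) * (\<Sum>c<D. ennreal ((?W g c)^4))" for g
  proof -
   have "(\<Sum>a<\<rho>. \<bar>proj l (comb_seq D g h) x a\<bar>)\<^sup>2 =
     (\<Sum>a<\<rho>. \<Sum>b<\<rho>. \<bar>\<Sum>c<D. s a c * (h c * ?W g c)\<bar> * \<bar>\<Sum>c<D. s b c * (h c * ?W g c)\<bar>)" for h
    unfolding power2_eq_square sum_product
   proof (intro sum.cong refl)
    fix a b assume "a \<in> {..<\<rho>}" "b \<in> {..<\<rho>}"
    then have "a < D" "b < D" using \<rho> by (auto simp: D_def)
    then show "\<bar>proj l (comb_seq D g h) x a\<bar> * \<bar>proj l (comb_seq D g h) x b\<bar> =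
     \<bar>\<Sum>c<D. s a c * (h c * ?W g c)\<bar> * \<bar>\<Sum>c<D. s b c * (h c * ?W g c)\<bar>"
     using proj_comb_seq[of a l g h x] proj_comb_seq[of b l g h x] s(2) unfolding D_def[symmetric] by simp
   qed
   then have "(\<integral>\<^sup>+h. ennreal ((\<Sum>a<\<rho>. \<bar>proj l (comb_seq D g h) x a\<bar>)\<^sup>2) \<partial>gseq) =
     (\<Sum>a<\<rho>. \<Sum>b<\<rho>. (\<integral>\<^sup>+h. ennreal (\<bar>\<Sum>c<D. s a c * (h c * ?W g c)\<bar> * \<bar>\<Sum>c<D. s b c * (h c * ?W g c)\<bar>) \<partial>gseq))"
    by (simp add: sum_ennreal[symmetric] nn_integral_sum sum_nonneg del: sum_ennreal)
   also have "... \<le> (\<Sum>a<\<rho>. \<Sum>b<\<rho>. ennreal (2/pi * \<sigma>\<^sup>2 + 4 * (\<Sum>c<D. s a c * s b c * (?W g c)\<^sup>2)\<^sup>2 / \<sigma>\<^sup>2))"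
   proof (intro sum_mono two_signed_forms)
    show "(\<Sum>c<D. (?W g c)\<^sup>2) = \<sigma>\<^sup>2" using spread_norm[of l g x] by (simp add: \<sigma> D_def n2)
   qed (use s(1) \<rho> \<sigma> in \<open>auto simp: D_def\<close>)
   also have "... = ennreal (\<Sum>a<\<rho>. \<Sum>b<\<rho>. 2/pi * \<sigma>\<^sup>2 + 4 * (\<Sum>c<D. s a c * s b c * (?W g c)\<^sup>2)\<^sup>2 / \<sigma>\<^sup>2)"
    by (subst sum_ennreal, simp, subst sum_ennreal) (auto intro!: sum_nonneg)
   also have "... \<le> ennreal (2/pi * \<sigma>\<^sup>2 * real \<rho> ^ 2 + 4 * \<rho> * D / \<sigma>\<^sup>2 * (\<Sum>c<D. (?W g c)^4))"
   proof (rule ennreal_leI)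
    have "(\<Sum>b<\<rho>. (\<Sum>c<D. s a c * s b c * (?W g c)\<^sup>2)\<^sup>2) \<le> D * (\<Sum>c<D. (?W g c)^4)" if a: "a < \<rho>" for a
    proof -
     have aD: "a < D" using a \<rho> by (simp add: D_def)
     have "(\<Sum>b<\<rho>. (\<Sum>c<D. s a c * s b c * (?W g c)\<^sup>2)\<^sup>2) \<le> (\<Sum>b<D. (\<Sum>c<D. s a c * s b c * (?W g c)\<^sup>2)\<^sup>2)"
      using \<rho> by (intro sum_mono2) (auto simp: D_def)
     also have "... = (\<Sum>b<D. (fw (2 ^ l div 2) l (\<lambda>c. s a c * (?W g c)\<^sup>2) b)\<^sup>2)"
      by (intro sum.cong) (auto simp: s(2) mult_ac)
     also have "... = D * (\<Sum>c<D. (s a c * (?W g c)\<^sup>2)\<^sup>2)"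
      unfolding D_def fw_norm_power by simp
     also have "... = D * (\<Sum>c<D. (?W g c)^4)"
      using s2[OF aD] by (simp add: power_mult_distrib flip: power_mult)
     finally show ?thesis .
    qed
    then have "(\<Sum>a<\<rho>. \<Sum>b<\<rho>. (\<Sum>c<D. s a c * s b c * (?W g c)\<^sup>2)\<^sup>2) \<le> (\<Sum>a<\<rho>. D * (\<Sum>c<D. (?W g c)^4))"
     by (intro sum_mono) auto
    then have 1: "4 / \<sigma>\<^sup>2 * (\<Sum>a<\<rho>. \<Sum>b<\<rho>. (\<Sum>c<D. s a c * s b c * (?W g c)\<^sup>2)\<^sup>2) \<le> 4 / \<sigma>\<^sup>2 * (\<rho> * (D * (\<Sum>c<D. (?W g c)^4)))"
     by (intro mult_left_mono) auto
    have "(\<Sum>a<\<rho>. \<Sum>b<\<rho>. 2/pi * \<sigma>\<^sup>2 + 4 * (\<Sum>c<D. s a c * s b c * (?W g c)\<^sup>2)\<^sup>2 / \<sigma>\<^sup>2) =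
     2/pi * \<sigma>\<^sup>2 * real \<rho> ^ 2 + 4 / \<sigma>\<^sup>2 * (\<Sum>a<\<rho>. \<Sum>b<\<rho>. (\<Sum>c<D. s a c * s b c * (?W g c)\<^sup>2)\<^sup>2)"
     by (simp add: sum.distrib sum_distrib_left power2_eq_square[of "real \<rho>"])
    also have "... \<le> 2/pi * \<sigma>\<^sup>2 * real \<rho> ^ 2 + 4 / \<sigma>\<^sup>2 * (\<rho> * (D * (\<Sum>c<D. (?W g c)^4)))"
     using 1 by simp
    finally show "(\<Sum>a<\<rho>. \<Sum>b<\<rho>. 2/pi * \<sigma>\<^sup>2 + 4 * (\<Sum>c<D. s a c * s b c * (?W g c)\<^sup>2)\<^sup>2 / \<sigma>\<^sup>2) \<le>
     2/pi * \<sigma>\<^sup>2 * real \<rho> ^ 2 + 4 * \<rho> * D / \<sigma>\<^sup>2 * (\<Sum>c<D. (?W g c)^4)"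
     by (simp add: mult.assoc)
   qed
   also have "... = ennreal (2/pi * \<sigma>\<^sup>2 * real \<rho> ^ 2) + ennreal (4 * \<rho> * D / \<sigma>\<^sup>2) * (\<Sum>c<D. ennreal ((?W g c)^4))"
    by (subst ennreal_plus) (simp_all add: ennreal_mult[symmetric] sum_nonneg)
   finally show ?thesis .
  qed
  have "(\<integral>\<^sup>+g. ennreal ((\<Sum>a<\<rho>. \<bar>proj l g x a\<bar>)\<^sup>2) \<partial>gseq) =
    (\<integral>\<^sup>+g. \<integral>\<^sup>+h. ennreal ((\<Sum>a<\<rho>. \<bar>proj l (comb_seq D g h) x a\<bar>)\<^sup>2) \<partial>gseq \<partial>gseq)"
   by (subst nn_integral_gseq_comb_seq[where k = D]) auto
  also have "... \<le> (\<integral>\<^sup>+g. ennreal (2/pi * \<sigma>\<^sup>2 * real \<rho> ^ 2) + ennreal (4 * \<rho> * D / \<sigma>\<^sup>2) * (\<Sum>c<D. ennreal ((?W g c)^4)) \<partial>gseq)"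
   by (intro nn_integral_mono inner)
  also have "... = ennreal (2/pi * \<sigma>\<^sup>2 * real \<rho> ^ 2) + ennreal (4 * \<rho> * D / \<sigma>\<^sup>2) * (\<Sum>c<D. (\<integral>\<^sup>+g. ennreal ((?W g c)^4) \<partial>gseq))"
   by (simp add: nn_integral_add nn_integral_cmult nn_integral_sum del: sum_ennreal)
  also have "... \<le> ennreal (2/pi * \<sigma>\<^sup>2 * real \<rho> ^ 2) + ennreal (4 * \<rho> * D / \<sigma>\<^sup>2) * (\<Sum>c<D. ennreal (3 * n2\<^sup>2))"
   using spread_power4[of _ l x] by (intro add_left_mono mult_left_mono sum_mono) (auto simp: D_def n2)
  also have "... = ennreal (2 ^ l * n2 * (2/pi * real \<rho> ^ 2 + 12 * real \<rho>))"
  proof -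
   have D: "(2::real) ^ l = D" by (simp add: D_def)
   have "D > 0" by (simp add: D_def)
   then have "2/pi * \<sigma>\<^sup>2 * real \<rho> ^ 2 + (4 * \<rho> * D / \<sigma>\<^sup>2) * (D * (3 * n2\<^sup>2)) = D * n2 * (2/pi * real \<rho> ^ 2 + 12 * real \<rho>)"
    using n2(2) unfolding \<sigma>(2) by (simp add: field_simps power2_eq_square)
   then show ?thesis
    using n2(2) unfolding D
    by (simp add: ennreal_mult[symmetric] ennreal_plus[symmetric] ennreal_of_nat_eq_real_of_nat del: ennreal_plus)
  qed
  finally show ?thesis .
qed

section \<open>The relative error of one block\<close>

lemma exp_mean_le:
  fixes y :: "nat => real"
  assumes "0 < \<rho>"
  shows "exp ((\<Sum>a<\<rho>. y a) / \<rho>) \<le> (\<Sum>a<\<rho>. exp (y a)) / \<rho>"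
proof -
  let ?m = "(\<Sum>a<\<rho>. y a) / \<rho>"
  have "exp ?m * (1 + (y a - ?m)) \<le> exp (y a)" for a
   using exp_ge_add_one_self[of "y a - ?m"] by (simp add: exp_diff pos_le_divide_eq mult.commute)
  then have "(\<Sum>a<\<rho>. exp ?m * (1 + (y a - ?m))) \<le> (\<Sum>a<\<rho>. exp (y a))"
   by (rule sum_mono)
  moreover have "(\<Sum>a<\<rho>. exp ?m * (1 + (y a - ?m))) = exp ?m * \<rho>"
   using assms by (simp add: sum_distrib_left[symmetric] sum.distrib sum_subtractf)
  ultimately show ?thesis using assms by (simp add: pos_le_divide_eq)
qed

text \<open>Taylor's formula with the remainder in Lagrange's form; between 0 and x the second
  derivative is at most exp |x|.\<close>

lemma exp_le_quadratic:
  fixes x :: real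
  shows "exp x \<le> 1 + x + x\<^sup>2 * exp \<bar>x\<bar>"
proof -
  obtain t where t: "\<bar>t\<bar> \<le> \<bar>x\<bar>" "exp x = (\<Sum>m<2. x ^ m / fact m) + exp t / fact 2 * x ^ 2"
   using Maclaurin_exp_le[of x 2] by auto
  have "exp t \<le> exp \<bar>x\<bar>" using t(1) by simp
  then have "exp t / 2 \<le> exp \<bar>x\<bar>" using exp_gt_zero[of t] by linarith
  then have "exp t / 2 * x\<^sup>2 \<le> exp \<bar>x\<bar> * x\<^sup>2"
   by (rule mult_right_mono) simp
  then show ?thesis using t(2) by (simp add: eval_nat_numeral mult.commute)
qed

text \<open>\<open>sqrt (pi / 2)\<close> is the reciprocal of the mean of |g| for a standard normal
  g, and an output of \<open>proj\<close> has variance 2^l times the squared norm.\<close>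

definition block_norm :: "nat => nat => (nat => real) => (nat => real) => real" where
  "block_norm l \<rho> x g = sqrt (pi / 2) / sqrt (2 ^ l) * ((\<Sum>a<\<rho>. \<bar>proj l g x a\<bar>) / \<rho>)"

text \<open>For the zero vector the division by zero yields the value -1, so coinciding points are
  always treated separately.\<close>

definition block_error :: "nat => nat => (nat => real) => (nat => real) => real" where
  "block_error l \<rho> x g = block_norm l \<rho> x g / sqrt (\<Sum>c<2^l. (x c)\<^sup>2) - 1"

lemma measurable_block_error [measurable (raw)]:
  assumes [measurable]: "\<And>c. (\<lambda>y. g y c) \<in> borel_measurable M"
  shows "(\<lambda>y. block_error l \<rho> x (g y)) \<in> borel_measurable M"
  unfolding block_error_def block_norm_def by measurable

text \<open>Bounds the mean of exp (4 |b|) for a block error b: exp 4 pays for the offset in |b| <=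
  1 + (relative estimate), and 2 exp (4 pi) for one output, as (4 sqrt (pi/2))^2 / 2 = 4 pi.\<close>

definition exp_const :: real where
  "exp_const = 2 * exp 4 * exp (4 * pi)"

definition mgf_const :: real where
  "mgf_const = (24 + exp_const) / 2"

context
  fixes l \<rho> :: nat and x :: "nat => real" and n2 :: real
  assumes \<rho>: "0 < \<rho>" "\<rho> \<le> 2 ^ l" and n2: "n2 = (\<Sum>c<2^l. (x c)\<^sup>2)" "0 < n2"
begin

private abbreviation b where "b \<equiv> block_error l \<rho> x"
private definition "\<sigma> = sqrt (2 ^ l * n2)"
private definition "S g = (\<Sum>a<\<rho>. \<bar>proj l g x a\<bar>)"

private lemma \<sigma>_pos: "0 < \<sigma>"
  using n2(2) by (simp add: \<sigma>_def)

private lemma b_eq: "b g = sqrt (pi / 2) * S g / (\<rho> * \<sigma>) - 1"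
  by (simp add: block_error_def block_norm_def S_def \<sigma>_def n2(1)[symmetric] real_sqrt_mult)

private lemma S_nonneg: "0 \<le> S g"
  by (simp add: S_def sum_nonneg)

private lemma measurable_S [measurable]: "S \<in> borel_measurable gseq"
  unfolding S_def by measurable

private lemma S_mean: "(\<integral>\<^sup>+g. ennreal (S g) \<partial>gseq) = ennreal (\<rho> * \<sigma> * sqrt (2/pi))"
proof -
  have "(\<integral>\<^sup>+g. ennreal \<bar>proj l g x a\<bar> \<partial>gseq) = ennreal (\<sigma> * sqrt (2/pi))" if "a < \<rho>" for a
  proof -
   have "a < 2 ^ l" using that \<rho> by simp
   then have "(\<integral>\<^sup>+g. ennreal \<bar>proj l g x a\<bar> \<partial>gseq) = (\<integral>\<^sup>+y. ennreal \<bar>\<sigma> * y\<bar> \<partial>stdn)"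
    using proj_gaussian[of a l "\<lambda>u. ennreal \<bar>u\<bar>" x] by (simp add: \<sigma>_def n2(1)[symmetric])
   also have "... = ennreal \<sigma> * (\<integral>\<^sup>+y. ennreal \<bar>y\<bar> \<partial>stdn)"
    using \<sigma>_pos by (subst nn_integral_cmult[symmetric]) (auto simp: abs_mult ennreal_mult)
   finally show ?thesis using \<sigma>_pos by (simp add: stdn_abs ennreal_mult)
  qed
  then have "(\<integral>\<^sup>+g. ennreal (S g) \<partial>gseq) = (\<Sum>a<\<rho>. ennreal (\<sigma> * sqrt (2/pi)))"
   by (simp add: S_def sum_ennreal[symmetric] nn_integral_sum del: sum_ennreal)
  also have "... = ennreal (\<rho> * (\<sigma> * sqrt (2/pi)))"
   using \<sigma>_pos by (simp add: ennreal_mult ennreal_of_nat_eq_real_of_nat)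
  finally show ?thesis by (simp add: mult.assoc)
qed

text \<open>The outputs of a block are dependent, but by convexity the exponential of their mean is
  at most the mean of their exponentials, and each output alone is exactly Gaussian. The exponent 4
  is what the square of |b| exp |b| requires in \<open>block_error_mgf\<close>.\<close>

private lemma exp_b: "(\<integral>\<^sup>+g. ennreal (exp (4 * \<bar>b g\<bar>)) \<partial>gseq) \<le> ennreal exp_const"
proof -
  define k where "k = 4 * sqrt (pi / 2) / \<sigma>"
  have k: "0 \<le> k" using \<sigma>_pos by (simp add: k_def)
  have pw: "exp (4 * \<bar>b g\<bar>) \<le> exp 4 / \<rho> * (\<Sum>a<\<rho>. exp (k * \<bar>proj l g x a\<bar>))" for g
  proof -
   have "\<bar>b g\<bar> \<le> 1 + sqrt (pi / 2) * S g / (\<rho> * \<sigma>)"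
    unfolding b_eq using S_nonneg[of g] \<sigma>_pos by (auto simp: abs_le_iff)
   moreover have "(\<Sum>a<\<rho>. k * \<bar>proj l g x a\<bar>) / \<rho> = 4 * (sqrt (pi / 2) * S g / (\<rho> * \<sigma>))"
   proof -
    have "(\<Sum>a<\<rho>. k * \<bar>proj l g x a\<bar>) = k * S g" by (simp add: S_def sum_distrib_left)
    then show ?thesis by (simp add: k_def mult_ac)
   qed
   ultimately have "exp (4 * \<bar>b g\<bar>) \<le> exp (4 + (\<Sum>a<\<rho>. k * \<bar>proj l g x a\<bar>) / \<rho>)"
    by simp
   also have "... \<le> exp 4 * ((\<Sum>a<\<rho>. exp (k * \<bar>proj l g x a\<bar>)) / \<rho>)"
    unfolding exp_add by (intro mult_left_mono exp_mean_le[OF \<rho>(1)]) simp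
   finally show ?thesis by simp
  qed
  have one: "(\<integral>\<^sup>+g. ennreal (exp (k * \<bar>proj l g x a\<bar>)) \<partial>gseq) \<le> ennreal (2 * exp (4 * pi))" if "a < \<rho>" for a
  proof -
   have "a < 2 ^ l" using that \<rho> by simp
   then have "(\<integral>\<^sup>+g. ennreal (exp (k * \<bar>proj l g x a\<bar>)) \<partial>gseq) = (\<integral>\<^sup>+y. ennreal (exp (k * \<bar>\<sigma> * y\<bar>)) \<partial>stdn)"
    using proj_gaussian[of a l "\<lambda>u. ennreal (exp (k * \<bar>u\<bar>))" x] by (simp add: \<sigma>_def n2(1)[symmetric])
   also have "... = (\<integral>\<^sup>+y. ennreal (exp (4 * sqrt (pi / 2) * \<bar>y\<bar>)) \<partial>stdn)"
    using \<sigma>_pos by (simp add: k_def abs_mult mult.assoc)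
   also have "... \<le> ennreal (2 * exp ((4 * sqrt (pi / 2))\<^sup>2 / 2))"
    by (rule stdn_exp_abs)
   also have "(4 * sqrt (pi / 2))\<^sup>2 / 2 = 4 * pi"
    by (simp add: power_mult_distrib)
   finally show ?thesis .
  qed
  have "(\<integral>\<^sup>+g. ennreal (exp (4 * \<bar>b g\<bar>)) \<partial>gseq) \<le>
    (\<integral>\<^sup>+g. ennreal (exp 4 / \<rho>) * (\<Sum>a<\<rho>. ennreal (exp (k * \<bar>proj l g x a\<bar>))) \<partial>gseq)"
   using pw by (intro nn_integral_mono) (simp add: ennreal_mult[symmetric] sum_nonneg ennreal_leI)
  also have "... = ennreal (exp 4 / \<rho>) * (\<Sum>a<\<rho>. \<integral>\<^sup>+g. ennreal (exp (k * \<bar>proj l g x a\<bar>)) \<partial>gseq)"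
   by (simp add: nn_integral_cmult nn_integral_sum del: sum_ennreal)
  also have "... \<le> ennreal (exp 4 / \<rho>) * (\<Sum>a<\<rho>. ennreal (2 * exp (4 * pi)))"
   using one by (intro mult_left_mono sum_mono) auto
  also have "... = ennreal exp_const"
   using \<rho>(1) by (simp add: exp_const_def ennreal_mult[symmetric] ennreal_of_nat_eq_real_of_nat)
  finally show ?thesis .
qed

private lemma integrable_exp_b: "integrable gseq (\<lambda>g. exp (4 * \<bar>b g\<bar>))"
proof (rule integrableI_bounded)
  show "(\<integral>\<^sup>+g. ennreal (norm (exp (4 * \<bar>b g\<bar>))) \<partial>gseq) < \<infinity>"
   using exp_b by (auto intro: le_less_trans)
qed measurable

private lemma integrable_dominated:
  assumes [measurable]: "f \<in> borel_measurable gseq" and "\<And>g. \<bar>f g\<bar> \<le> exp (4 * \<bar>b g\<bar>)"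
  shows "integrable gseq f"
  by (rule Bochner_Integration.integrable_bound[OF integrable_exp_b]) (use assms in auto)

private lemma sq_le_exp: "y\<^sup>2 \<le> exp (2 * \<bar>y\<bar>)" for y :: real
proof -
  have "\<bar>y\<bar> \<le> exp \<bar>y\<bar>" using exp_ge_add_one_self[of "\<bar>y\<bar>"] by linarith
  then have "\<bar>y\<bar>\<^sup>2 \<le> (exp \<bar>y\<bar>)\<^sup>2" by (intro power_mono) auto
  then show ?thesis by (simp add: exp_double)
qed

lemma block_error_integrable: "integrable gseq b"
proof (rule integrable_dominated)
  fix g
  have "\<bar>b g\<bar> \<le> exp \<bar>b g\<bar>" using exp_ge_add_one_self[of "\<bar>b g\<bar>"] by linarith
  also have "... \<le> exp (4 * \<bar>b g\<bar>)" by simp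
  finally show "\<bar>b g\<bar> \<le> exp (4 * \<bar>b g\<bar>)" .
qed measurable

lemma block_error_sq_integrable: "integrable gseq (\<lambda>g. (b g)\<^sup>2)"
proof (rule integrable_dominated)
  fix g
  have "(b g)\<^sup>2 \<le> exp (2 * \<bar>b g\<bar>)" by (rule sq_le_exp)
  also have "... \<le> exp (4 * \<bar>b g\<bar>)" by simp
  finally show "\<bar>(b g)\<^sup>2\<bar> \<le> exp (4 * \<bar>b g\<bar>)" by simp
qed measurable

private lemma S_conv: "S g = (\<rho> * \<sigma>) / sqrt (pi / 2) * (b g + 1)"
  using \<rho>(1) \<sigma>_pos by (simp add: b_eq)

private lemma integrable_S: "integrable gseq S"
  unfolding S_conv using block_error_integrable by auto

private lemma integrable_S2: "integrable gseq (\<lambda>g. (S g)\<^sup>2)"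
proof -
  have "(S g)\<^sup>2 = ((\<rho> * \<sigma>) / sqrt (pi / 2))\<^sup>2 * ((b g)\<^sup>2 + 2 * b g + 1)" for g
   unfolding S_conv power_mult_distrib by (simp add: power2_eq_square algebra_simps)
  then show ?thesis using block_error_integrable block_error_sq_integrable by auto
qed

private lemma integral_S: "integral\<^sup>L gseq S = \<rho> * \<sigma> * sqrt (2/pi)"
  using S_mean S_nonneg \<sigma>_pos by (subst integral_eq_nn_integral) auto

private lemma integral_S2: "(\<integral>g. (S g)\<^sup>2 \<partial>gseq) \<le> \<sigma>\<^sup>2 * (2/pi * real \<rho> ^ 2 + 12 * real \<rho>)"
proof -
  have "(\<integral>\<^sup>+g. ennreal ((S g)\<^sup>2) \<partial>gseq) \<le> ennreal (2 ^ l * n2 * (2/pi * real \<rho> ^ 2 + 12 * real \<rho>))"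
   unfolding S_def using proj_abs_sum_square[OF \<rho>(2) n2] .
  moreover have "2 ^ l * n2 = \<sigma>\<^sup>2" using n2(2) by (simp add: \<sigma>_def)
  ultimately show ?thesis
   using integrable_S2 by (simp add: nn_integral_eq_integral integral_nonneg_AE)
qed

lemma block_error_mean: "integral\<^sup>L gseq b = 0"
proof -
  have "integral\<^sup>L gseq b = sqrt (pi / 2) / (\<rho> * \<sigma>) * integral\<^sup>L gseq S - 1"
   unfolding b_eq[abs_def] using integrable_S gs.P.prob_space by simp
  also have "... = (sqrt (pi / 2) * sqrt (2 / pi)) - 1"
   using \<rho>(1) \<sigma>_pos by (simp add: integral_S)
  also have "sqrt (pi / 2) * sqrt (2 / pi) = 1"
   by (simp add: real_sqrt_mult[symmetric])
  finally show ?thesis by simp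
qed

text \<open>The leading term of \<open>integral_S2\<close> cancels against the squared mean and 6 pi
  / \<rho> is left: dependence between the outputs costs only a constant factor.\<close>

lemma block_error_variance: "(\<integral>g. (b g)\<^sup>2 \<partial>gseq) \<le> 24 / \<rho>"
proof -
  have *: "(b g)\<^sup>2 = (pi / 2) / (\<rho> * \<sigma>)\<^sup>2 * (S g)\<^sup>2 - 2 * b g - 1" for g
  proof -
   have "(b g + 1)\<^sup>2 = (pi / 2) / (\<rho> * \<sigma>)\<^sup>2 * (S g)\<^sup>2"
    unfolding b_eq by (simp add: power_divide power_mult_distrib)
   then show ?thesis by (simp add: power2_eq_square algebra_simps)
  qed
  have "(\<integral>g. (b g)\<^sup>2 \<partial>gseq) = (pi / 2) / (\<rho> * \<sigma>)\<^sup>2 * (\<integral>g. (S g)\<^sup>2 \<partial>gseq) - 1"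
   unfolding * using integrable_S2 block_error_integrable block_error_mean gs.P.prob_space by simp
  also have "... \<le> (pi / 2) / (\<rho> * \<sigma>)\<^sup>2 * (\<sigma>\<^sup>2 * (2/pi * real \<rho> ^ 2 + 12 * real \<rho>)) - 1"
   by (intro diff_right_mono mult_left_mono integral_S2) auto
  also have "... = 6 * pi / \<rho>"
   using \<rho>(1) \<sigma>_pos by (simp add: field_simps power2_eq_square)
  also have "... \<le> 24 / \<rho>"
   using pi_less_4 by (intro divide_right_mono) auto
  finally show ?thesis .
qed

text \<open>Bounding \<open>b\<^sup>2 e\<^sup>|\<^sup>b\<^sup>|\<close> by AM-GM with weight \<open>sqrt \<rho>\<close> combines the small variance with the
  crude exponential moment; the factor \<open>1 / sqrt \<rho>\<close> is enough for the selection step.\<close>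

lemma block_error_mgf:
  assumes \<kappa>: "\<bar>\<kappa>\<bar> \<le> 1"
  shows "(\<integral>\<^sup>+g. ennreal (exp (\<kappa> * b g)) \<partial>gseq) \<le> ennreal (exp (mgf_const * \<kappa>\<^sup>2 / sqrt \<rho>))"
proof -
  let ?r = "sqrt \<rho>"
  have r: "0 < ?r" using \<rho>(1) by simp
  have pw: "exp (\<kappa> * b g) \<le> 1 + \<kappa> * b g + \<kappa>\<^sup>2 * ((?r * (b g)\<^sup>2 + exp (4 * \<bar>b g\<bar>) / ?r) / 2)" for g
  proof -
   have "exp (\<kappa> * b g) \<le> 1 + \<kappa> * b g + (\<kappa> * b g)\<^sup>2 * exp \<bar>\<kappa> * b g\<bar>"
    by (rule exp_le_quadratic)
   also have "(\<kappa> * b g)\<^sup>2 * exp \<bar>\<kappa> * b g\<bar> \<le> \<kappa>\<^sup>2 * ((?r * (b g)\<^sup>2 + exp (4 * \<bar>b g\<bar>) / ?r) / 2)"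
   proof -
    have "\<bar>\<kappa> * b g\<bar> \<le> \<bar>b g\<bar>"
     using \<kappa> mult_right_mono[of "\<bar>\<kappa>\<bar>" 1 "\<bar>b g\<bar>"] by (simp add: abs_mult)
    then have "(\<kappa> * b g)\<^sup>2 * exp \<bar>\<kappa> * b g\<bar> \<le> \<kappa>\<^sup>2 * ((b g)\<^sup>2 * exp \<bar>b g\<bar>)"
     by (simp add: power_mult_distrib mult.assoc mult_left_mono)
    also have "(b g)\<^sup>2 * exp \<bar>b g\<bar> \<le> (?r * (b g)\<^sup>2 + exp (4 * \<bar>b g\<bar>) / ?r) / 2"
    proof -
     define u where "u = \<bar>b g\<bar>"
     define v where "v = u * exp u"
     have "0 \<le> (?r * u - v)\<^sup>2" by simp
     then have "2 * (?r * u * v) \<le> ?r\<^sup>2 * u\<^sup>2 + v\<^sup>2" by (simp add: power2_eq_square algebra_simps)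
     then have 1: "2 * (u * v) \<le> ?r * u\<^sup>2 + v\<^sup>2 / ?r"
      using r by (simp add: field_simps power2_eq_square)
     have "v\<^sup>2 = u\<^sup>2 * exp (2 * u)" by (simp add: v_def power_mult_distrib exp_double)
     also have "... \<le> exp (2 * u) * exp (2 * u)"
      using sq_le_exp[of u] by (intro mult_right_mono) (auto simp: u_def)
     also have "... = exp (4 * u)" by (simp add: exp_add[symmetric])
     finally have "v\<^sup>2 / ?r \<le> exp (4 * u) / ?r" using r by (intro divide_right_mono) auto
     with 1 have "u * v \<le> (?r * u\<^sup>2 + exp (4 * u) / ?r) / 2" by simp
     then show ?thesis by (simp add: u_def v_def power2_eq_square mult.assoc)
    qed
    finally show ?thesis by (simp add: mult_left_mono)
   qed
   finally show ?thesis by simp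
  qed
  have int: "integrable gseq (\<lambda>g. exp (\<kappa> * b g))"
  proof (rule integrable_dominated)
   fix g
   have "\<kappa> * b g \<le> \<bar>b g\<bar>"
    using \<kappa> mult_right_mono[of "\<bar>\<kappa>\<bar>" 1 "\<bar>b g\<bar>"] abs_ge_self[of "\<kappa> * b g"] by (simp add: abs_mult)
   then show "\<bar>exp (\<kappa> * b g)\<bar> \<le> exp (4 * \<bar>b g\<bar>)" by simp
  qed auto
  have "(\<integral>\<^sup>+g. ennreal (exp (\<kappa> * b g)) \<partial>gseq) = ennreal (\<integral>g. exp (\<kappa> * b g) \<partial>gseq)"
   using int by (rule nn_integral_eq_integral) simp
  also have "... \<le> ennreal (\<integral>g. 1 + \<kappa> * b g + \<kappa>\<^sup>2 * ((?r * (b g)\<^sup>2 + exp (4 * \<bar>b g\<bar>) / ?r) / 2) \<partial>gseq)"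
   using block_error_integrable block_error_sq_integrable integrable_exp_b
   by (intro ennreal_leI integral_mono pw int) auto
  also have "(\<integral>g. 1 + \<kappa> * b g + \<kappa>\<^sup>2 * ((?r * (b g)\<^sup>2 + exp (4 * \<bar>b g\<bar>) / ?r) / 2) \<partial>gseq) =
    1 + \<kappa>\<^sup>2 * ((?r * (\<integral>g. (b g)\<^sup>2 \<partial>gseq) + (\<integral>g. exp (4 * \<bar>b g\<bar>) \<partial>gseq) / ?r) / 2)"
   using block_error_integrable block_error_sq_integrable integrable_exp_b block_error_mean gs.P.prob_space by simp
  also have "... \<le> 1 + \<kappa>\<^sup>2 * ((?r * (24 / \<rho>) + exp_const / ?r) / 2)"
  proof -
   have "(\<integral>g. exp (4 * \<bar>b g\<bar>) \<partial>gseq) \<le> exp_const"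
    using exp_b integrable_exp_b by (simp add: nn_integral_eq_integral exp_const_def)
   then show ?thesis
    using block_error_variance r
    by (intro add_left_mono mult_left_mono divide_right_mono add_mono) auto
  qed
  also have "... = 1 + mgf_const * \<kappa>\<^sup>2 / ?r"
  proof -
   have "?r * (24 / \<rho>) = 24 / ?r"
    using \<rho>(1) real_sqrt_mult_self[of "real \<rho>"] by (simp add: field_simps)
   moreover have "\<kappa>\<^sup>2 * ((24 / s + e / s) / 2) = (24 + e) / 2 * \<kappa>\<^sup>2 / s" if "0 < s" for s e :: real
    using that by (simp add: field_simps)
   ultimately show ?thesis using r by (simp add: mgf_const_def)
  qed
  also have "... \<le> exp (mgf_const * \<kappa>\<^sup>2 / ?r)" by (rule exp_ge_add_one_self)
  finally show ?thesis by (simp add: ennreal_leI)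
qed

end

section \<open>Independent blocks and random samples\<close>

definition after :: "nat => (nat => real) => nat => real" where
  "after k g = (\<lambda>q. g (k + q))"

lemma after_apply: "after k g q = g (k + q)"
  by (simp add: after_def)

lemma after_0 [simp]: "after 0 g = g"
  by (simp add: after_def)

lemma after_after [simp]: "after k (after m g) = after (m + k) g"
  by (simp add: after_def add.assoc)

lemma after_comb_seq [simp]: "after k (comb_seq k g h) = h"
  by (auto simp: after_def comb_seq_def)

lemma after_add_comb_seq: "after (k + m) (comb_seq k g h) = after m h"
  by (auto simp: after_def comb_seq_def)

lemma measurable_after [measurable]: "after k \<in> measurable gseq gseq"
  unfolding after_def by (rule measurable_PiM_single') (auto simp: space_PiM)

lemma measurable_after_compose [measurable (raw)]:
  "f \<in> measurable M gseq ==> (\<lambda>x. after k (f x)) \<in> measurable M gseq"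
  by (rule measurable_compose[OF _ measurable_after])

text \<open>Dependence on the first \<open>k\<close> coordinates only. Together with
  \<open>after\<close> it expresses independence of consecutive blocks without mentioning generated
  \<sigma>-algebras.\<close>

definition initial :: "nat => ((nat => real) => 'a) => bool" where
  "initial k f \<longleftrightarrow> (\<forall>g g'. (\<forall>q<k. g q = g' q) --> f g = f g')"

lemma initialD: "initial k f ==> (\<And>q. q < k ==> g q = g' q) ==> f g = f g'"
  by (auto simp: initial_def)

lemma initial_comb_seq: "initial k f ==> f (comb_seq k g h) = f g"
  by (erule initialD) (simp add: comb_seq_less)

lemma initial_after_comb_seq: "initial k f ==> m + k \<le> n ==> f (after m (comb_seq n g h)) = f (after m g)"
  by (erule initialD) (simp add: comb_seq_less after_apply)

text \<open>Independence of consecutive blocks of length \<open>k\<close>: the induction integrates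
  out the first block and shifts the others.\<close>

lemma nn_integral_blocks_prod:
  fixes F :: "nat => (nat => real) => ennreal"
  assumes [measurable]: "\<And>b. F b \<in> borel_measurable gseq" and loc: "\<And>b. initial k (F b)"
  shows "(\<integral>\<^sup>+g. (\<Prod>b<N. F b (after (b * k) g)) \<partial>gseq) = (\<Prod>b<N. \<integral>\<^sup>+g. F b g \<partial>gseq)"
  using assms
proof (induction N arbitrary: F)
  case (Suc N)
  note Suc.prems(1)[measurable]
  have "(\<integral>\<^sup>+g. (\<Prod>b<Suc N. F b (after (b * k) g)) \<partial>gseq) =
    (\<integral>\<^sup>+g. \<integral>\<^sup>+h. F 0 g * (\<Prod>b<N. F (Suc b) (after (b * k) h)) \<partial>gseq \<partial>gseq)"
   by (subst nn_integral_gseq_comb_seq[where k = k])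
    (simp_all add: prod.lessThan_Suc_shift initial_comb_seq[OF Suc.prems(2)] after_add_comb_seq del: prod.lessThan_Suc)
  also have "... = (\<integral>\<^sup>+g. F 0 g \<partial>gseq) * (\<integral>\<^sup>+h. (\<Prod>b<N. F (Suc b) (after (b * k) h)) \<partial>gseq)"
   by (simp add: nn_integral_cmult nn_integral_multc)
  also have "... = (\<integral>\<^sup>+g. F 0 g \<partial>gseq) * (\<Prod>b<N. \<integral>\<^sup>+g. F (Suc b) g \<partial>gseq)"
   using Suc.prems by (subst Suc.IH) auto
  finally show ?case by (simp add: prod.lessThan_Suc_shift del: prod.lessThan_Suc)
qed simp

lemma
  fixes f s :: "(nat => real) => real"
  assumes f: "integrable gseq f" "initial k f" and s: "integrable gseq s"
  shows integrable_mult_after: "integrable gseq (\<lambda>g. f g * s (after k g))"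
   and integral_mult_after: "(\<integral>g. f g * s (after k g) \<partial>gseq) = integral\<^sup>L gseq f * integral\<^sup>L gseq s"
proof -
  have [measurable]: "f \<in> borel_measurable gseq" "s \<in> borel_measurable gseq" using f s by auto
  let ?c = "\<lambda>(g, h). comb_seq k g h"
  have c: "?c \<in> measurable (gseq \<Otimes>\<^sub>M gseq) gseq" by (rule measurable_comb_seq)
  have int: "integrable (gseq \<Otimes>\<^sub>M gseq) (\<lambda>z. f (fst z) * s (snd z))"
   by (rule gseq_pair.Fubini_integrable) (use f s in \<open>auto simp: abs_mult\<close>)
  have comp: "f (?c z) * s (after k (?c z)) = f (fst z) * s (snd z)" for z
   by (simp add: split_beta' initial_comb_seq[OF f(2)])
  have "integrable (distr (gseq \<Otimes>\<^sub>M gseq) gseq ?c) (\<lambda>g. f g * s (after k g))"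
   by (subst integrable_distr_eq[OF c]) (use int in \<open>simp_all add: comp\<close>)
  then show "integrable gseq (\<lambda>g. f g * s (after k g))" by (simp add: gs.PiM_comb_seq)
  have "(\<integral>g. f g * s (after k g) \<partial>gseq) = (\<integral>g. f g * s (after k g) \<partial>distr (gseq \<Otimes>\<^sub>M gseq) gseq ?c)"
   by (simp add: gs.PiM_comb_seq)
  also have "... = (\<integral>z. f (fst z) * s (snd z) \<partial>(gseq \<Otimes>\<^sub>M gseq))"
   by (subst integral_distr[OF c]) (simp_all add: comp)
  also have "... = (\<integral>g. \<integral>h. f g * s h \<partial>gseq \<partial>gseq)"
   using gseq_pair.integral_fst'[OF int] by simp
  finally show "(\<integral>g. f g * s (after k g) \<partial>gseq) = integral\<^sup>L gseq f * integral\<^sup>L gseq s" by simp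
qed

lemma initial_const: "initial k (\<lambda>_. c)"
  by (simp add: initial_def)

text \<open>Variances of independent centred blocks add up, because the mixed term factorises by
  \<open>integral_mult_after\<close> and vanishes. Integrability and the mean are carried along
  since the step from N to N + 1 relies on them.\<close>

lemma blocks_sum_moments:
  fixes f :: "(nat => real) => real"
  assumes f: "integrable gseq f" "initial k f" "integral\<^sup>L gseq f = 0"
   and f2: "integrable gseq (\<lambda>g. (f g)\<^sup>2)" "(\<integral>g. (f g)\<^sup>2 \<partial>gseq) \<le> v"
  defines "S \<equiv> (\<lambda>N g. \<Sum>b<N. f (after (b * k) g))"
  shows "integrable gseq (S N) \<and> integral\<^sup>L gseq (S N) = 0 \<and> integrable gseq (\<lambda>g. (S N g)\<^sup>2) \<and>
   (\<integral>g. (S N g)\<^sup>2 \<partial>gseq) \<le> N * v"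
proof (induction N)
  case 0
  then show ?case by (simp add: S_def)
next
  case (Suc N)
  note IH = conjunct1[OF Suc] conjunct1[OF conjunct2[OF Suc]] conjunct1[OF conjunct2[OF conjunct2[OF Suc]]]
   conjunct2[OF conjunct2[OF conjunct2[OF Suc]]]
  have S: "S (Suc N) g = f g + S N (after k g)" for g
   by (simp add: S_def sum.lessThan_Suc_shift del: sum.lessThan_Suc)
  have S2: "(S (Suc N) g)\<^sup>2 = (f g)\<^sup>2 + 2 * (f g * S N (after k g)) + (S N (after k g))\<^sup>2" for g
   unfolding S by (simp add: power2_eq_square algebra_simps)
  note one = initial_const[of k "1::real"]
  have i1: "integrable gseq (\<lambda>g. S N (after k g))" "(\<integral>g. S N (after k g) \<partial>gseq) = 0"
   using integrable_mult_after[OF _ one IH(1)] integral_mult_after[OF _ one IH(1)] IH(2) by auto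
  have i2: "integrable gseq (\<lambda>g. (S N (after k g))\<^sup>2)" "(\<integral>g. (S N (after k g))\<^sup>2 \<partial>gseq) = (\<integral>g. (S N g)\<^sup>2 \<partial>gseq)"
   using integrable_mult_after[OF _ one IH(3)] integral_mult_after[OF _ one IH(3)] gs.P.prob_space by auto
  have i3: "integrable gseq (\<lambda>g. f g * S N (after k g))" "(\<integral>g. f g * S N (after k g) \<partial>gseq) = 0"
   using integrable_mult_after[OF f(1,2) IH(1)] integral_mult_after[OF f(1,2) IH(1)] f(3) by auto
  show ?case
   unfolding S2 unfolding S[abs_def]
   using f f2 i1 i2 i3 IH by (auto simp: distrib_right intro: add_mono)
qed

section \<open>Uniform random indices from signs\<close>

primrec bits :: "nat => (nat => real) => nat" where
  "bits 0 g = 0"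
| "bits (Suc k) g = bits k g + bits k g + (if g k < 0 then 1 else 0)"

lemma initial_bits: "initial k (bits k)"
proof (induction k)
  case (Suc k)
  show ?case unfolding initial_def
  proof (intro allI impI)
   fix g g' :: "nat => real" assume "\<forall>q<Suc k. g q = g' q"
   then have "g k = g' k" "bits k g = bits k g'" using initialD[OF Suc, of g g'] by auto
   then show "bits (Suc k) g = bits (Suc k) g'" by simp
  qed
qed (simp add: initial_def)

lemma measurable_bits [measurable]: "bits k \<in> measurable gseq (count_space UNIV)"
  by (induction k) (simp_all, measurable)

lemma nn_integral_gseq_0:
  "f \<in> borel_measurable borel ==> (\<integral>\<^sup>+g. f (g 0) \<partial>gseq) = (\<integral>\<^sup>+x. f x \<partial>stdn)"
  by (subst nn_integral_gseq_case_nat) simp_all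

text \<open>The number with these binary digits, most significant first, is uniform: a fair last
  digit sends v to 2 v or 2 v + 1. The factor 2^k stands on the left to avoid a division of extended
  reals.\<close>

lemma nn_integral_bits:
  fixes F :: "nat => ennreal"
  shows "2 ^ k * (\<integral>\<^sup>+g. F (bits k g) \<partial>gseq) = (\<Sum>v<2^k. F v)"
proof (induction k arbitrary: F)
  case 0
  then show ?case by simp
next
  case (Suc k)
  have e1: "(\<integral>\<^sup>+g. F (bits (Suc k) g) \<partial>gseq) =
    (\<integral>\<^sup>+g. \<integral>\<^sup>+h. F (bits k g + bits k g + (if h 0 < 0 then 1 else 0)) \<partial>gseq \<partial>gseq)"
   by (subst nn_integral_gseq_comb_seq[where k = k])
    (simp_all add: initial_comb_seq[OF initial_bits] comb_seq_def cong: if_cong)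
  have e2: "2 * (\<integral>\<^sup>+g. \<integral>\<^sup>+h. F (bits k g + bits k g + (if h 0 < 0 then 1 else 0)) \<partial>gseq \<partial>gseq) =
    (\<integral>\<^sup>+g. 2 * (\<integral>\<^sup>+h. F (bits k g + bits k g + (if h 0 < 0 then 1 else 0)) \<partial>gseq) \<partial>gseq)"
   by (subst nn_integral_cmult) auto
  have e3: "(\<integral>\<^sup>+g. 2 * (\<integral>\<^sup>+h. F (bits k g + bits k g + (if h 0 < 0 then 1 else 0)) \<partial>gseq) \<partial>gseq) =
    (\<integral>\<^sup>+g. F (2 * bits k g) + F (2 * bits k g + 1) \<partial>gseq)"
  proof (rule nn_integral_cong)
   fix g :: "nat => real"
   have "(\<integral>\<^sup>+h. F (bits k g + bits k g + (if h 0 < 0 then 1 else 0)) \<partial>gseq) =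
     (\<integral>\<^sup>+x. F (bits k g + bits k g + (if x < 0 then 1 else 0)) \<partial>stdn)"
    by (rule nn_integral_gseq_0) simp
   also have "... = (\<integral>\<^sup>+x. (\<lambda>s. F (bits k g + bits k g + (if s < 0 then 1 else 0))) (sg x) \<partial>stdn)"
    by (intro nn_integral_cong) (simp add: sg_def)
   finally show "2 * (\<integral>\<^sup>+h. F (bits k g + bits k g + (if h 0 < 0 then 1 else 0)) \<partial>gseq) =
     F (2 * bits k g) + F (2 * bits k g + 1)"
    using nn_integral_stdn_sg[of "\<lambda>s. F (bits k g + bits k g + (if s < 0 then 1 else 0))"]
    by (simp add: mult_2)
  qed
  have "2 ^ Suc k * (\<integral>\<^sup>+g. F (bits (Suc k) g) \<partial>gseq) =
    2 ^ k * (2 * (\<integral>\<^sup>+g. F (bits (Suc k) g) \<partial>gseq))"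
   by (simp only: power_Suc mult_ac)
  also have "... = 2 ^ k * (\<integral>\<^sup>+g. F (2 * bits k g) + F (2 * bits k g + 1) \<partial>gseq)"
   unfolding e1 e2 e3 ..
  also have "... = (\<Sum>v<2^k. F (2 * v) + F (2 * v + 1))"
   by (rule Suc)
  also have "... = (\<Sum>v<2^Suc k. F v)"
   by (simp add: sum_even_odd)
  finally show ?case .
qed

text \<open>A function of two independent uniform indices of \<open>a\<close> and \<open>b\<close>
  bits. The value type is left open, because real and extended real functions are both
  sampled.\<close>

definition sample :: "nat => nat => (nat => nat => 'a) => (nat => real) => 'a" where
  "sample a b y g = y (bits a g) (bits b (after a g))"

lemma initial_sample: "initial (a + b) (sample a b y)"
  unfolding initial_def sample_def
proof (intro allI impI)
  fix g g' :: "nat => real" assume g: "\<forall>q<a + b. g q = g' q"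
  then have "bits a g = bits a g'" "bits b (after a g) = bits b (after a g')"
   using initialD[OF initial_bits, of a g g'] initialD[OF initial_bits, of b "after a g" "after a g'"] by (auto simp: after_apply)
  then show "y (bits a g) (bits b (after a g)) = y (bits a g') (bits b (after a g'))" by simp
qed

lemma measurable_sample [measurable (raw)]:
  assumes "\<And>u v. (\<lambda>x. y x u v) \<in> borel_measurable M" and [measurable]: "f \<in> measurable M gseq"
  shows "(\<lambda>x. sample a b (y x) (f x)) \<in> borel_measurable M"
proof -
  have "(\<lambda>x. y x u (bits b (after a (f x)))) \<in> borel_measurable M" for u
   by (rule measurable_compose_countable[where g = "\<lambda>x. bits b (after a (f x))" and f = "\<lambda>v x. y x u v"])
    (use assms(1) in auto)
  then show ?thesis unfolding sample_def
   by (rule measurable_compose_countable[where g = "\<lambda>x. bits a (f x)"]) auto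
qed

lemma nn_integral_sample:
  fixes F :: "nat => nat => ennreal"
  shows "2 ^ (a + b) * (\<integral>\<^sup>+g. sample a b F g \<partial>gseq) = (\<Sum>u<2^a. \<Sum>v<2^b. F u v)"
proof -
  have "(\<integral>\<^sup>+g. sample a b F g \<partial>gseq) = (\<integral>\<^sup>+g. \<integral>\<^sup>+h. F (bits a g) (bits b h) \<partial>gseq \<partial>gseq)"
   by (subst nn_integral_gseq_comb_seq[where k = a])
    (simp_all add: sample_def[abs_def] initial_comb_seq[OF initial_bits])
  then have "2 ^ (a + b) * (\<integral>\<^sup>+g. sample a b F g \<partial>gseq) =
    2 ^ a * (\<integral>\<^sup>+g. 2 ^ b * (\<integral>\<^sup>+h. F (bits a g) (bits b h) \<partial>gseq) \<partial>gseq)"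
   by (simp add: nn_integral_cmult power_add mult_ac)
  also have "... = (\<Sum>u<2^a. \<Sum>v<2^b. F u v)"
   using nn_integral_bits[of a "\<lambda>u. \<Sum>v<2^b. F u v"] by (simp add: nn_integral_bits)
  finally show ?thesis .
qed

lemma sets_gseq_Collect: "Measurable.pred gseq P ==> {g. P g} \<in> sets gseq"
  by (simp add: pred_def)

section \<open>Exponential moments and locality of the projections\<close>

lemma emeasure_le_exp_moment:
  assumes [measurable]: "f \<in> borel_measurable gseq" and k: "0 \<le> k"
  shows "emeasure gseq {g. t \<le> f g} \<le> ennreal (exp (- k * t)) * (\<integral>\<^sup>+g. ennreal (exp (k * f g)) \<partial>gseq)"
proof -
  have "emeasure gseq {g. t \<le> f g} = (\<integral>\<^sup>+g. indicator {g. t \<le> f g} g \<partial>gseq)"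
   by (rule nn_integral_indicator[symmetric], rule sets_gseq_Collect) measurable
  also have "... \<le> (\<integral>\<^sup>+g. ennreal (exp (- k * t)) * ennreal (exp (k * f g)) \<partial>gseq)"
   using k by (intro nn_integral_mono)
    (auto simp: indicator_def ennreal_mult[symmetric] exp_add[symmetric] mult_left_mono)
  also have "... = ennreal (exp (- k * t)) * (\<integral>\<^sup>+g. ennreal (exp (k * f g)) \<partial>gseq)"
   by (rule nn_integral_cmult) measurable
  finally show ?thesis .
qed

lemma fw_cong:
  assumes a: "a < 2 ^ l" and uv: "\<And>c. c < 2 ^ l ==> u c = v c"
  shows "fw (2 ^ l div 2) l u a = fw (2 ^ l div 2) l v a"
proof -
  obtain s where "\<And>c. \<bar>s c\<bar> = (1::real)" and s: "\<And>v. fw (2 ^ l div 2) l v a = (\<Sum>c<2^l. s c * v c)"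
   using fw_signs[OF a] by blast
  show ?thesis unfolding s using uv by (intro sum.cong) auto
qed

lemma proj_cong:
  assumes a: "a < 2 ^ l" and g: "\<And>q. q < 2 * 2 ^ l ==> g q = g' q"
  shows "proj l g x a = proj l g' x a"
proof -
  have "spread l g x c = spread l g' x c" if "c < 2 ^ l" for c
   unfolding spread_def using that g by (intro fw_cong) auto
  then show ?thesis unfolding proj_def using a g by (intro fw_cong) auto
qed

lemma initial_block_error:
  assumes "\<rho> \<le> 2 ^ l"
  shows "initial (2 * 2 ^ l) (block_error l \<rho> x)"
  unfolding initial_def
proof (intro allI impI)
  fix g g' :: "nat => real" assume g: "\<forall>q<2 * 2 ^ l. g q = g' q"
  have "proj l g x a = proj l g' x a" if "a < 2 ^ l" for a using that g by (intro proj_cong) auto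
  then have "(\<Sum>a<\<rho>. \<bar>proj l g x a\<bar>) = (\<Sum>a<\<rho>. \<bar>proj l g' x a\<bar>)"
   using assms by (intro sum.cong) auto
  then show "block_error l \<rho> x g = block_error l \<rho> x g'"
   by (simp add: block_error_def block_norm_def)
qed

section \<open>The mean error of independent blocks\<close>

definition group_error :: "nat => nat => nat => (nat => real) => (nat => real) => real" where
  "group_error l \<rho> N x g = (\<Sum>b<N. block_error l \<rho> x (after (b * (2 * 2 ^ l)) g)) / N"

lemma measurable_group_error [measurable]: "group_error l \<rho> N x \<in> borel_measurable gseq"
  unfolding group_error_def by measurable

context
  fixes l \<rho> N :: nat and x :: "nat => real"
  assumes \<rho>: "0 < \<rho>" "\<rho> \<le> 2 ^ l" and x: "0 < (\<Sum>c<2^l. (x c)\<^sup>2)" and N: "0 < N"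
begin

lemma group_error_variance:
  "(\<integral>\<^sup>+g. ennreal ((group_error l \<rho> N x g)\<^sup>2) \<partial>gseq) \<le> ennreal (24 / (N * \<rho>))"
proof -
  note b = blocks_sum_moments[OF block_error_integrable[OF \<rho> refl x] initial_block_error[OF \<rho>(2), of x]
   block_error_mean[OF \<rho> refl x] block_error_sq_integrable[OF \<rho> refl x] block_error_variance[OF \<rho> refl x], of N]
  define S where "S g = (\<Sum>b<N. block_error l \<rho> x (after (b * (2 * 2 ^ l)) g))" for g
  have S: "integrable gseq (\<lambda>g. (S g)\<^sup>2)" "(\<integral>g. (S g)\<^sup>2 \<partial>gseq) \<le> N * (24 / \<rho>)"
   using b by (auto simp: S_def)
  have "(\<integral>\<^sup>+g. ennreal ((group_error l \<rho> N x g)\<^sup>2) \<partial>gseq) = ennreal (\<integral>g. (group_error l \<rho> N x g)\<^sup>2 \<partial>gseq)"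
   by (rule nn_integral_eq_integral) (use S(1) in \<open>auto simp: group_error_def S_def power_divide\<close>)
  also have "(\<integral>g. (group_error l \<rho> N x g)\<^sup>2 \<partial>gseq) = (\<integral>g. (S g)\<^sup>2 \<partial>gseq) / (real N)\<^sup>2"
   by (simp add: group_error_def S_def[symmetric] power_divide)
  also have "... \<le> (N * (24 / \<rho>)) / (real N)\<^sup>2"
   using S(2) by (intro divide_right_mono) auto
  also have "... = 24 / (N * \<rho>)"
   using N by (simp add: power2_eq_square)
  finally show ?thesis by (simp add: ennreal_leI)
qed

lemma group_error_mgf:
  assumes "\<bar>k\<bar> \<le> 1"
  shows "(\<integral>\<^sup>+g. ennreal (exp (k * (N * group_error l \<rho> N x g))) \<partial>gseq) \<le> ennreal (exp (N * (mgf_const * k\<^sup>2 / sqrt \<rho>)))"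
proof -
  let ?b = "block_error l \<rho> x"
  have "(\<integral>\<^sup>+g. ennreal (exp (k * (N * group_error l \<rho> N x g))) \<partial>gseq) =
    (\<integral>\<^sup>+g. (\<Prod>b<N. ennreal (exp (k * ?b (after (b * (2 * 2 ^ l)) g)))) \<partial>gseq)"
  proof -
   have "N * group_error l \<rho> N x g = (\<Sum>b<N. ?b (after (b * (2 * 2 ^ l)) g))" for g
    using N by (simp add: group_error_def)
   then show ?thesis by (simp add: prod_ennreal exp_sum[symmetric] sum_distrib_left)
  qed
  also have "... = (\<Prod>b<N. \<integral>\<^sup>+g. ennreal (exp (k * ?b g)) \<partial>gseq)"
   by (rule nn_integral_blocks_prod)
    (use initial_block_error[OF \<rho>(2), of x] in \<open>auto simp: initial_def\<close>)
  also have "... \<le> (\<Prod>b<N. ennreal (exp (mgf_const * k\<^sup>2 / sqrt \<rho>)))"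
   by (intro prod_mono_ennreal block_error_mgf[OF \<rho> refl x assms])
  also have "... = ennreal (exp (N * (mgf_const * k\<^sup>2 / sqrt \<rho>)))"
   by (simp add: ennreal_power exp_of_nat_mult[symmetric])
  finally show ?thesis .
qed

text \<open>Chernoff's method for both signs of the error. The parameter \<open>k\<close> stays
  free: the moment bound holds only for |k| <= 1, so the best choice for large \<open>t\<close>
  differs from that for small \<open>t\<close>.\<close>

lemma group_error_tail:
  assumes k: "0 \<le> k" "k \<le> 1"
  shows "emeasure gseq {g. t \<le> \<bar>group_error l \<rho> N x g\<bar>} \<le>
   ennreal (2 * exp (N * (mgf_const * k\<^sup>2 / sqrt \<rho> - k * t)))"
proof -
  let ?e = "group_error l \<rho> N x"
  have one: "emeasure gseq {g. N * t \<le> s * (N * ?e g)} \<le> ennreal (exp (N * (mgf_const * k\<^sup>2 / sqrt \<rho> - k * t)))"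
   if s: "s = 1 \<or> s = -1" for s :: real
  proof -
   have "emeasure gseq {g. N * t \<le> s * (N * ?e g)} \<le>
     ennreal (exp (- k * (N * t))) * (\<integral>\<^sup>+g. ennreal (exp (k * (s * (N * ?e g)))) \<partial>gseq)"
    by (rule emeasure_le_exp_moment) (use k in auto)
   also have "(\<integral>\<^sup>+g. ennreal (exp (k * (s * (N * ?e g)))) \<partial>gseq) = (\<integral>\<^sup>+g. ennreal (exp ((k * s) * (N * ?e g))) \<partial>gseq)"
    by (simp add: mult.assoc)
   also have "... \<le> ennreal (exp (N * (mgf_const * (k * s)\<^sup>2 / sqrt \<rho>)))"
    by (rule group_error_mgf) (use s k in auto)
   also have "(k * s)\<^sup>2 = k\<^sup>2" using s by auto
   also have "ennreal (exp (- k * (N * t))) * ennreal (exp (N * (mgf_const * k\<^sup>2 / sqrt \<rho>))) =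
     ennreal (exp (N * (mgf_const * k\<^sup>2 / sqrt \<rho> - k * t)))"
    by (simp add: ennreal_mult[symmetric] exp_add[symmetric] algebra_simps)
   finally show ?thesis by (simp add: mult_left_mono)
  qed
  have sA: "{g. N * t \<le> 1 * (N * ?e g)} \<in> sets gseq"
   by (rule sets_gseq_Collect) measurable
  have sB: "{g. N * t \<le> -1 * (N * ?e g)} \<in> sets gseq"
   by (rule sets_gseq_Collect) measurable
  have "{g. t \<le> \<bar>?e g\<bar>} \<subseteq> {g. N * t \<le> 1 * (N * ?e g)} \<union> {g. N * t \<le> -1 * (N * ?e g)}"
  proof
   fix g assume "g \<in> {g. t \<le> \<bar>?e g\<bar>}"
   then have "t \<le> ?e g \<or> t \<le> - ?e g" by auto
   then show "g \<in> {g. N * t \<le> 1 * (N * ?e g)} \<union> {g. N * t \<le> -1 * (N * ?e g)}"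
    using mult_left_mono[of t "?e g" "real N"] mult_left_mono[of t "- ?e g" "real N"] by auto
  qed
  then have "emeasure gseq {g. t \<le> \<bar>?e g\<bar>} \<le> emeasure gseq ({g. N * t \<le> 1 * (N * ?e g)} \<union> {g. N * t \<le> -1 * (N * ?e g)})"
   by (rule emeasure_mono) (use sA sB in blast)
  also have "... \<le> emeasure gseq {g. N * t \<le> 1 * (N * ?e g)} + emeasure gseq {g. N * t \<le> -1 * (N * ?e g)}"
   by (rule emeasure_subadditive[OF sA sB])
  also have "... \<le> ennreal (exp (N * (mgf_const * k\<^sup>2 / sqrt \<rho> - k * t))) + ennreal (exp (N * (mgf_const * k\<^sup>2 / sqrt \<rho> - k * t)))"
   by (intro add_mono one) auto
  finally show ?thesis by (simp add: ennreal_plus[symmetric] del: ennreal_plus)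
qed

end

section \<open>Lower tails of sampled sums\<close>

lemma exp_neg_le_linear:
  fixes z :: real
  assumes "0 \<le> z" "z \<le> 1"
  shows "exp (- z) \<le> 1 - z / 2"
proof -
  have "exp (- z) \<le> inverse (1 + z)"
   using exp_ge_add_one_self[of z] assms by (simp add: exp_minus le_imp_inverse_le)
  also have "... \<le> 1 - z / 2"
  proof -
   have "z * z \<le> z" using assms mult_left_mono[of z 1 z] by simp
   then have "1 \<le> (1 - z / 2) * (1 + z)" by (simp add: algebra_simps)
   then show ?thesis using assms by (simp add: inverse_eq_divide pos_divide_le_eq)
  qed
  finally show ?thesis .
qed

lemma sample_mgf:
  fixes y :: "nat => nat => real"
  assumes y: "\<And>u v. u < 2^a ==> v < 2^b ==> 0 \<le> y u v" "\<And>u v. u < 2^a ==> v < 2^b ==> y u v \<le> \<tau>" and \<tau>: "0 < \<tau>"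
   and \<mu>: "\<mu> = (\<Sum>u<2^a. \<Sum>v<2^b. y u v) / 2 ^ (a + b)"
  shows "(\<integral>\<^sup>+g. ennreal (exp (- sample a b y g / \<tau>)) \<partial>gseq) \<le> ennreal (exp (- \<mu> / (2 * \<tau>)))"
proof -
  have "2 ^ (a + b) * (\<integral>\<^sup>+g. ennreal (exp (- sample a b y g / \<tau>)) \<partial>gseq) =
    2 ^ (a + b) * (\<integral>\<^sup>+g. sample a b (\<lambda>u v. ennreal (exp (- y u v / \<tau>))) g \<partial>gseq)"
   by (simp add: sample_def)
  also have "... = (\<Sum>u<2^a. \<Sum>v<2^b. ennreal (exp (- y u v / \<tau>)))"
   by (rule nn_integral_sample)
  also have "... = ennreal (\<Sum>u<2^a. \<Sum>v<2^b. exp (- y u v / \<tau>))"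
   by (subst sum_ennreal, simp, subst sum_ennreal) (auto intro: sum_nonneg)
  also have "... \<le> ennreal (\<Sum>u<2^a. \<Sum>v<2^b. 1 - y u v / (2 * \<tau>))"
  proof (intro ennreal_leI sum_mono)
   fix u v :: nat assume "u \<in> {..<2^a}" "v \<in> {..<2^b}"
   then show "exp (- y u v / \<tau>) \<le> 1 - y u v / (2 * \<tau>)"
    using exp_neg_le_linear[of "y u v / \<tau>"] y[of u v] \<tau> by simp
  qed
  also have "(\<Sum>u<2^a. \<Sum>v<2^b. 1 - y u v / (2 * \<tau>)) = 2 ^ (a + b) * (1 - \<mu> / (2 * \<tau>))"
   unfolding \<mu> by (simp add: sum_subtractf sum_divide_distrib[symmetric] power_add field_simps)
  also have "... \<le> 2 ^ (a + b) * exp (- \<mu> / (2 * \<tau>))"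
   using exp_ge_add_one_self[of "- \<mu> / (2 * \<tau>)"] by (intro mult_left_mono) auto
  also have "ennreal (2 ^ (a + b) * exp (- \<mu> / (2 * \<tau>))) = 2 ^ (a + b) * ennreal (exp (- \<mu> / (2 * \<tau>)))"
   by (simp add: ennreal_mult ennreal_power[symmetric])
  finally have "2 ^ (a + b) * (\<integral>\<^sup>+g. ennreal (exp (- sample a b y g / \<tau>)) \<partial>gseq) \<le>
    2 ^ (a + b) * ennreal (exp (- \<mu> / (2 * \<tau>)))"
   by (simp add: ennreal_leI)
  then show ?thesis
   by (subst (asm) ennreal_mult_le_mult_iff) (simp_all add: power_eq_top_ennreal)
qed

definition sample_sum :: "nat => nat => nat => (nat => nat => real) => (nat => real) => real" where
  "sample_sum a b m y g = (\<Sum>t<m. sample a b y (after (t * (a + b)) g))"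

lemma measurable_sample_sum [measurable (raw)]:
  assumes [measurable]: "\<And>u v. (\<lambda>x. y x u v) \<in> borel_measurable M" "f \<in> measurable M gseq"
  shows "(\<lambda>x. sample_sum a b m (y x) (f x)) \<in> borel_measurable M"
  unfolding sample_sum_def by measurable

lemma sample_sum_lower_tail:
  fixes y :: "nat => nat => real"
  assumes y: "\<And>u v. u < 2^a ==> v < 2^b ==> 0 \<le> y u v" "\<And>u v. u < 2^a ==> v < 2^b ==> y u v \<le> \<tau>" and \<tau>: "0 < \<tau>"
   and \<mu>: "\<mu> \<le> (\<Sum>u<2^a. \<Sum>v<2^b. y u v) / 2 ^ (a + b)"
  shows "emeasure gseq {g. sample_sum a b m y g \<le> m * \<mu> / 4} \<le> ennreal (exp (- (m * \<mu> / (4 * \<tau>))))"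
proof -
  let ?\<mu> = "(\<Sum>u<2^a. \<Sum>v<2^b. y u v) / 2 ^ (a + b)"
  have "emeasure gseq {g. sample_sum a b m y g \<le> m * \<mu> / 4} = emeasure gseq {g. - (m * \<mu> / 4) \<le> - sample_sum a b m y g}"
   by simp
  also have "... \<le> ennreal (exp (- (1 / \<tau>) * (- (m * \<mu> / 4)))) * (\<integral>\<^sup>+g. ennreal (exp ((1 / \<tau>) * (- sample_sum a b m y g))) \<partial>gseq)"
   by (rule emeasure_le_exp_moment) (use \<tau> in auto)
  also have "(\<integral>\<^sup>+g. ennreal (exp ((1 / \<tau>) * (- sample_sum a b m y g))) \<partial>gseq) =
    (\<integral>\<^sup>+g. (\<Prod>t<m. ennreal (exp (- sample a b y (after (t * (a + b)) g) / \<tau>))) \<partial>gseq)"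
   by (simp add: sample_sum_def prod_ennreal exp_sum[symmetric] sum_divide_distrib sum_negf)
  also have "... = (\<Prod>t<m. \<integral>\<^sup>+g. ennreal (exp (- sample a b y g / \<tau>)) \<partial>gseq)"
   by (rule nn_integral_blocks_prod) (use initial_sample[of a b y] in \<open>auto simp: initial_def\<close>)
  also have "... \<le> (\<Prod>t<m. ennreal (exp (- ?\<mu> / (2 * \<tau>))))"
   by (intro prod_mono_ennreal sample_mgf y \<tau> refl)
  also have "... \<le> (\<Prod>t<m. ennreal (exp (- \<mu> / (2 * \<tau>))))"
  proof (intro prod_mono_ennreal ennreal_leI)
   have "\<mu> / (2 * \<tau>) \<le> ?\<mu> / (2 * \<tau>)" using \<mu> \<tau> by (intro divide_right_mono) auto
   then show "exp (- ?\<mu> / (2 * \<tau>)) \<le> exp (- \<mu> / (2 * \<tau>))"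
    unfolding exp_le_cancel_iff minus_divide_left[symmetric] by (rule le_imp_neg_le)
  qed
  also have "... = ennreal (exp (m * (- \<mu> / (2 * \<tau>))))"
   by (simp add: ennreal_power exp_of_nat_mult[symmetric])
  also have "ennreal (exp (- (1 / \<tau>) * (- (m * \<mu> / 4)))) * ennreal (exp (m * (- \<mu> / (2 * \<tau>)))) = ennreal (exp (- (m * \<mu> / (4 * \<tau>))))"
   using \<tau> by (simp add: ennreal_mult[symmetric] exp_add[symmetric] field_simps)
  finally show ?thesis by (simp add: mult_left_mono)
qed

section \<open>Choosing among independent candidates\<close>

lemma emeasure_gseq_comb_seq:
  assumes "Measurable.pred gseq P"
  shows "emeasure gseq {g. P g} = (\<integral>\<^sup>+g. emeasure gseq {h. P (comb_seq k g h)} \<partial>gseq)"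
proof -
  note assms[measurable]
  have "emeasure gseq {g. P g} = (\<integral>\<^sup>+g. indicator {g. P g} g \<partial>gseq)"
   by (rule nn_integral_indicator[symmetric], rule sets_gseq_Collect, fact)
  also have "... = (\<integral>\<^sup>+g. \<integral>\<^sup>+h. indicator {g. P g} (comb_seq k g h) \<partial>gseq \<partial>gseq)"
   by (rule nn_integral_gseq_comb_seq) (auto intro!: borel_measurable_indicator sets_gseq_Collect)
  also have "... = (\<integral>\<^sup>+g. \<integral>\<^sup>+h. indicator {h. P (comb_seq k g h)} h \<partial>gseq \<partial>gseq)"
   by (simp add: indicator_def)
  also have "... = (\<integral>\<^sup>+g. emeasure gseq {h. P (comb_seq k g h)} \<partial>gseq)"
   by (intro nn_integral_cong nn_integral_indicator sets_gseq_Collect) measurable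
  finally show ?thesis .
qed

text \<open>The minimiser can be bad in three ways only: some candidate has an error above \<tau>;
  or every candidate has a large test sum; or some bad candidate with errors at most \<tau> has a
  small test sum. The second event is exponentially unlikely in \<open>L\<close> although all
  candidates share the test pairs: once these are fixed, the candidates are independent and Markov's
  inequality applies to each of them.\<close>

lemma selection:
  fixes y :: "nat => nat => (nat => real) => real" and L k a b m :: nat and w \<tau> \<mu> p :: real
  assumes meas [measurable]: "\<And>u v. y u v \<in> borel_measurable gseq"
   and init: "\<And>u v. initial k (y u v)" and nonneg: "\<And>u v g. 0 \<le> y u v g"
   and mean: "\<And>u v. (\<integral>\<^sup>+g. ennreal (y u v g) \<partial>gseq) \<le> ennreal w" "0 \<le> w"
   and bound: "emeasure gseq {g. \<exists>u<2^a. \<exists>v<2^b. \<tau> < y u v g} \<le> ennreal p" "0 \<le> p"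
   and pos: "0 < \<tau>" "0 < \<mu>" "0 < m"
  defines "T \<equiv> (\<lambda>q g. sample_sum a b m (\<lambda>u v. y u v (after (q * k) g)) (after (L * k) g))"
  shows "emeasure gseq {g. \<exists>q<L. (\<forall>q'<L. T q g \<le> T q' g) \<and> \<mu> * 2 ^ (a + b) < (\<Sum>u<2^a. \<Sum>v<2^b. y u v (after (q * k) g))}
   \<le> ennreal (L * p + (4 * w / \<mu>) ^ L + L * exp (- (m * \<mu> / (4 * \<tau>))))"
proof -
  define M where "M q g = (\<Sum>u<2^a. \<Sum>v<2^b. y u v (after (q * k) g))" for q g
  \<comment> \<open>A quarter of the expected test sum of a candidate with mean error \<mu>, the
    threshold of \<open>sample_sum_lower_tail\<close>.\<close>
  define t where "t = m * \<mu> / 4"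
  have t: "0 < t" using pos by (simp add: t_def)
  define V1 where "V1 q = {g. \<exists>u<2^a. \<exists>v<2^b. \<tau> < y u v (after (q * k) g)}" for q
  define V2 where "V2 = {g. \<forall>q<L. t < T q g}"
  define V3 where "V3 q = {g. (\<forall>u<2^a. \<forall>v<2^b. y u v (after (q * k) g) \<le> \<tau>) \<and> \<mu> * 2 ^ (a + b) < M q g \<and> T q g \<le> t}" for q
  have [measurable]: "T q \<in> borel_measurable gseq" for q unfolding T_def by measurable
  have [measurable]: "M q \<in> borel_measurable gseq" for q unfolding M_def by measurable
  have s1: "V1 q \<in> sets gseq" for q unfolding V1_def by (rule sets_gseq_Collect) measurable
  have s2: "V2 \<in> sets gseq" unfolding V2_def by (rule sets_gseq_Collect) measurable
  have s3: "V3 q \<in> sets gseq" for q unfolding V3_def by (rule sets_gseq_Collect) measurable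
  have y_comb: "y u v (after (q * k) (comb_seq (L * k) g h)) = y u v (after (q * k) g)" if "q < L" for u v q g h
  proof (rule initial_after_comb_seq[OF init])
   have "q * k + k = Suc q * k" by simp
   also have "... \<le> L * k" using that by (intro mult_le_mono1) simp
   finally show "q * k + k \<le> L * k" .
  qed
  have e1: "emeasure gseq (V1 q) \<le> ennreal p" for q
  proof -
   have "emeasure gseq (V1 q) = (\<integral>\<^sup>+g. emeasure gseq {g. \<exists>u<2^a. \<exists>v<2^b. \<tau> < y u v g} \<partial>gseq)"
    unfolding V1_def by (subst emeasure_gseq_comb_seq[where k = "q * k"]) (simp_all add: after_comb_seq)
   then show ?thesis using bound by simp
  qed
  have e2: "emeasure gseq V2 \<le> ennreal ((4 * w / \<mu>) ^ L)"
  proof -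
   let ?Z = "\<lambda>g h. ennreal (sample_sum a b m (\<lambda>u v. y u v g) h / t)"
   have "emeasure gseq V2 = (\<integral>\<^sup>+g. indicator V2 g \<partial>gseq)"
    using s2 by (rule nn_integral_indicator[symmetric])
   also have "... \<le> (\<integral>\<^sup>+g. (\<Prod>q<L. ?Z (after (q * k) g) (after (L * k) g)) \<partial>gseq)"
   proof (rule nn_integral_mono)
    fix g
    show "indicator V2 g \<le> (\<Prod>q<L. ?Z (after (q * k) g) (after (L * k) g))"
    proof (cases "g \<in> V2")
     case True
     then have "1 \<le> ?Z (after (q * k) g) (after (L * k) g)" if "q < L" for q
      using that t unfolding V2_def T_def by (auto simp: ennreal_ge_1 intro: less_imp_le)
     then have "(\<Prod>q<L. 1) \<le> (\<Prod>q<L. ?Z (after (q * k) g) (after (L * k) g))"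
      by (intro prod_mono_ennreal) auto
     then show ?thesis using True by simp
    qed simp
   qed
   also have "... = (\<integral>\<^sup>+g. \<integral>\<^sup>+h. (\<Prod>q<L. ?Z (after (q * k) g) h) \<partial>gseq \<partial>gseq)"
   proof (subst nn_integral_gseq_comb_seq[where k = "L * k"])
    show "(\<integral>\<^sup>+g. \<integral>\<^sup>+h. (\<Prod>q<L. ?Z (after (q * k) (comb_seq (L * k) g h)) (after (L * k) (comb_seq (L * k) g h))) \<partial>gseq \<partial>gseq) =
     (\<integral>\<^sup>+g. \<integral>\<^sup>+h. (\<Prod>q<L. ?Z (after (q * k) g) h) \<partial>gseq \<partial>gseq)"
     by (intro nn_integral_cong prod.cong refl) (simp add: y_comb)
   qed measurable
   \<comment> \<open>Exchanging the integrals fixes the test pairs \<open>h\<close> first; the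
     factors then belong to disjoint blocks of \<open>g\<close>.\<close>
   also have "... = (\<integral>\<^sup>+h. \<integral>\<^sup>+g. (\<Prod>q<L. ?Z (after (q * k) g) h) \<partial>gseq \<partial>gseq)"
    by (rule gseq_pair.Fubini'[symmetric]) measurable
   also have "... = (\<integral>\<^sup>+h. (\<Prod>q<L. \<integral>\<^sup>+g. ?Z g h \<partial>gseq) \<partial>gseq)"
   proof (intro nn_integral_cong nn_integral_blocks_prod)
    fix h show "initial k (\<lambda>g. ?Z g h)"
     unfolding initial_def
    proof (intro allI impI)
     fix g g' :: "nat => real" assume "\<forall>q<k. g q = g' q"
     then have "(\<lambda>u v. y u v g) = (\<lambda>u v. y u v g')"
      by (intro ext initialD[OF init]) auto
     then show "?Z g h = ?Z g' h" by simp
    qed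
   qed measurable
   also have "... \<le> (\<integral>\<^sup>+h. (\<Prod>q<L. ennreal (4 * w / \<mu>)) \<partial>gseq)"
   proof (intro nn_integral_mono prod_mono_ennreal)
    fix h :: "nat => real"
    have "(\<integral>\<^sup>+g. ?Z g h \<partial>gseq) = (\<integral>\<^sup>+g. (\<Sum>i<m. ennreal (sample a b (\<lambda>u v. y u v g) (after (i * (a + b)) h))) * ennreal (1 / t) \<partial>gseq)"
     using t nonneg by (intro nn_integral_cong)
      (simp add: sample_sum_def sample_def ennreal_mult[symmetric] sum_nonneg)
    also have "... = (\<Sum>i<m. \<integral>\<^sup>+g. ennreal (sample a b (\<lambda>u v. y u v g) (after (i * (a + b)) h)) \<partial>gseq) * ennreal (1 / t)"
     by (simp add: nn_integral_multc nn_integral_sum del: sum_ennreal)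
    also have "... \<le> (\<Sum>i<m. ennreal w) * ennreal (1 / t)"
     unfolding sample_def by (intro mult_right_mono sum_mono mean) auto
    also have "... = ennreal (m * w / t)"
     using t mean(2) by (simp add: ennreal_mult[symmetric] ennreal_of_nat_eq_real_of_nat)
    also have "m * w / t = 4 * w / \<mu>"
     using pos by (simp add: t_def)
    finally show "(\<integral>\<^sup>+g. ?Z g h \<partial>gseq) \<le> ennreal (4 * w / \<mu>)" .
   qed
   also have "... = ennreal ((4 * w / \<mu>) ^ L)"
    using mean(2) pos by (simp add: ennreal_power)
   finally show ?thesis .
  qed
  have e3: "emeasure gseq (V3 q) \<le> ennreal (exp (- (m * \<mu> / (4 * \<tau>))))" if q: "q < L" for q
  proof -
   have "emeasure gseq (V3 q) = (\<integral>\<^sup>+g. emeasure gseq {h. (\<forall>u<2^a. \<forall>v<2^b. y u v (after (q * k) g) \<le> \<tau>) \<and>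
     \<mu> * 2 ^ (a + b) < M q g \<and> sample_sum a b m (\<lambda>u v. y u v (after (q * k) g)) h \<le> t} \<partial>gseq)"
    unfolding V3_def by (subst emeasure_gseq_comb_seq[where k = "L * k"])
     (simp_all add: y_comb[OF q] M_def T_def)
   also have "... \<le> (\<integral>\<^sup>+g. ennreal (exp (- (m * \<mu> / (4 * \<tau>)))) \<partial>gseq)"
   proof (rule nn_integral_mono)
    fix g
    let ?Y = "\<lambda>u v. y u v (after (q * k) g)"
    show "emeasure gseq {h. (\<forall>u<2^a. \<forall>v<2^b. ?Y u v \<le> \<tau>) \<and> \<mu> * 2 ^ (a + b) < M q g \<and>
      sample_sum a b m ?Y h \<le> t} \<le> ennreal (exp (- (m * \<mu> / (4 * \<tau>))))"
    proof (cases "(\<forall>u<2^a. \<forall>v<2^b. ?Y u v \<le> \<tau>) \<and> \<mu> * 2 ^ (a + b) < M q g")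
     case True
     then have "\<mu> \<le> (\<Sum>u<2^a. \<Sum>v<2^b. ?Y u v) / 2 ^ (a + b)"
      by (simp add: M_def pos_le_divide_eq)
     then have "emeasure gseq {h. sample_sum a b m ?Y h \<le> m * \<mu> / 4} \<le> ennreal (exp (- (m * \<mu> / (4 * \<tau>))))"
      using True by (intro sample_sum_lower_tail pos nonneg) auto
     then show ?thesis using True by (simp add: t_def)
    next
     case False
     then have "{h. (\<forall>u<2^a. \<forall>v<2^b. ?Y u v \<le> \<tau>) \<and> \<mu> * 2 ^ (a + b) < M q g \<and> sample_sum a b m ?Y h \<le> t} = {}"
      by blast
     then show ?thesis by (simp only: emeasure_empty zero_le)
    qed
   qed
   finally show ?thesis by simp
  qed
  have "{g. \<exists>q<L. (\<forall>q'<L. T q g \<le> T q' g) \<and> \<mu> * 2 ^ (a + b) < M q g} \<subseteq> ((\<Union>q<L. V1 q) \<union> V2) \<union> (\<Union>q<L. V3 q)"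
  proof
   fix g assume "g \<in> {g. \<exists>q<L. (\<forall>q'<L. T q g \<le> T q' g) \<and> \<mu> * 2 ^ (a + b) < M q g}"
   then obtain q where q: "q < L" "\<And>q'. q' < L ==> T q g \<le> T q' g" "\<mu> * 2 ^ (a + b) < M q g" by auto
   show "g \<in> ((\<Union>q<L. V1 q) \<union> V2) \<union> (\<Union>q<L. V3 q)"
   proof (cases "g \<in> V1 q \<or> g \<in> V2")
    case False
    then obtain q' where q': "q' < L" "T q' g \<le> t" by (auto simp: V2_def not_less)
    then have "T q g \<le> t" using q(2)[of q'] by simp
    moreover have "y u v (after (q * k) g) \<le> \<tau>" if "u < 2^a" "v < 2^b" for u v
    proof (rule ccontr)
     assume "\<not> y u v (after (q * k) g) \<le> \<tau>"
     then have "g \<in> V1 q" using that by (auto simp: V1_def not_le)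
     then show False using False by simp
    qed
    ultimately have "g \<in> V3 q" using q by (simp add: V3_def)
    then show ?thesis using q(1) by blast
   qed (use q(1) in blast)
  qed
  then have "emeasure gseq {g. \<exists>q<L. (\<forall>q'<L. T q g \<le> T q' g) \<and> \<mu> * 2 ^ (a + b) < M q g} \<le>
    emeasure gseq (((\<Union>q<L. V1 q) \<union> V2) \<union> (\<Union>q<L. V3 q))"
   by (rule emeasure_mono) (use s1 s2 s3 in auto)
  also have "... \<le> emeasure gseq ((\<Union>q<L. V1 q) \<union> V2) + emeasure gseq (\<Union>q<L. V3 q)"
   by (rule emeasure_subadditive) (use s1 s2 s3 in auto)
  also have "... \<le> (emeasure gseq (\<Union>q<L. V1 q) + emeasure gseq V2) + emeasure gseq (\<Union>q<L. V3 q)"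
   by (intro add_right_mono emeasure_subadditive) (use s1 s2 in auto)
  also have "... \<le> ((\<Sum>q<L. emeasure gseq (V1 q)) + emeasure gseq V2) + (\<Sum>q<L. emeasure gseq (V3 q))"
   by (intro add_mono emeasure_subadditive_finite order_refl) (use s1 s3 in auto)
  also have "... \<le> ((\<Sum>q<L. ennreal p) + ennreal ((4 * w / \<mu>) ^ L)) + (\<Sum>q<L. ennreal (exp (- (m * \<mu> / (4 * \<tau>)))))"
   by (intro add_mono sum_mono e1 e2 e3) auto
  also have "... = ennreal (L * p + (4 * w / \<mu>) ^ L + L * exp (- (m * \<mu> / (4 * \<tau>))))"
   using bound(2) mean(2) pos
   by (simp add: ennreal_mult[symmetric] ennreal_plus[symmetric] ennreal_of_nat_eq_real_of_nat del: ennreal_plus)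
  finally show ?thesis unfolding M_def .
qed

section \<open>The best of several candidates\<close>

definition dst :: "nat => (nat => nat => real) => nat => nat => real" where
  "dst d X i j = sqrt (\<Sum>c<d. (X i c - X j c)\<^sup>2)"

definition est :: "nat => nat => nat => (nat => nat => real) => (nat => real) => nat => nat => real" where
  "est l \<rho> N X g i j = sqrt (pi / 2) / (sqrt (2 ^ l) * (real N * real \<rho>)) *
   (\<Sum>b<N. \<Sum>a<\<rho>. \<bar>proj l (after (b * (2 * 2 ^ l)) g) (X i) a - proj l (after (b * (2 * 2 ^ l)) g) (X j) a\<bar>)"

text \<open>Importance sampling: point i owns r i slots and is drawn through a slot, its partner
  uniformly. Division by r i + r j makes the sum over all slots and partners exactly half of the
  total squared error, and it keeps single values bounded. Numbers beyond the slots or the points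
  give 0, which replaces rejection sampling.\<close>

definition test_value :: "nat => nat => nat => nat => (nat => nat => real) => nat => nat => (nat => nat) => (nat => nat) =>
   nat => nat => (nat => real) => real" where
  "test_value l \<rho> N d X n R own r u v g = (if u < R \<and> v < n then
   (dst d X (own u) v - est l \<rho> N X g (own u) v)\<^sup>2 / (real (r (own u)) + real (r v)) else 0)"

lemma dst_nonneg [simp]: "0 \<le> dst d X i j"
  by (simp add: dst_def sum_nonneg)

lemma dst_commute: "dst d X i j = dst d X j i"
  unfolding dst_def by (simp add: power2_commute)

lemma est_commute: "est l \<rho> N X g i j = est l \<rho> N X g j i"
  unfolding est_def by (simp add: abs_minus_commute)

lemma measurable_est [measurable]: "(\<lambda>g. est l \<rho> N X g i j) \<in> borel_measurable gseq"
  unfolding est_def by measurable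

lemma est_eq_block_norm:
  "est l \<rho> N X g i j = (\<Sum>b<N. block_norm l \<rho> (\<lambda>c. X i c - X j c) (after (b * (2 * 2 ^ l)) g)) / N"
  unfolding est_def block_norm_def proj_diff
  by (simp add: sum_divide_distrib[symmetric] sum_distrib_left[symmetric])

lemma proj_zero: "proj l g (\<lambda>_. 0) a = 0"
  using proj_diff[of l g "\<lambda>_. 0" "\<lambda>_. 0" a] by simp

context
  fixes l \<rho> N d n :: nat and X :: "nat => nat => real"
  assumes \<rho>: "0 < \<rho>" "\<rho> \<le> 2 ^ l" and N: "0 < N" and d: "d \<le> 2 ^ l"
   and X0: "\<And>i c. i < n ==> d \<le> c ==> X i c = 0"
begin

lemma dst_sq_padded:
  assumes "i < n" "j < n"
  shows "(\<Sum>c<2^l. (X i c - X j c)\<^sup>2) = (dst d X i j)\<^sup>2"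
proof -
  have "(\<Sum>c<2^l. (X i c - X j c)\<^sup>2) = (\<Sum>c<d. (X i c - X j c)\<^sup>2)"
   using d X0 assms by (intro sum.mono_neutral_right) auto
  then show ?thesis by (simp add: dst_def sum_nonneg)
qed

text \<open>For different points this unfolds the relative error. Coinciding points have identical
  projections, so the identity also holds where the relative error carries no information.\<close>

lemma est_error:
  assumes ij: "i < n" "j < n"
  shows "est l \<rho> N X g i j - dst d X i j = dst d X i j * group_error l \<rho> N (\<lambda>c. X i c - X j c) g"
proof (cases "dst d X i j = 0")
  case True
  then have "(\<Sum>c<2^l. (X i c - X j c)\<^sup>2) = 0" using dst_sq_padded[OF ij] by simp
  then have "X i c - X j c = 0" if "c < 2 ^ l" for c
   using that by (subst (asm) sum_nonneg_eq_0_iff) auto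
  moreover have "X i c - X j c = 0" if "\<not> c < 2 ^ l" for c
   using that d X0[OF ij(1), of c] X0[OF ij(2), of c] by simp
  ultimately have "(\<lambda>c. X i c - X j c) = (\<lambda>_. 0)" by blast
  then have "est l \<rho> N X g i j = 0"
   by (simp add: est_eq_block_norm block_norm_def proj_zero)
  then show ?thesis using True by simp
next
  case False
  have "sqrt (\<Sum>c<2^l. (X i c - X j c)\<^sup>2) = dst d X i j"
   unfolding dst_sq_padded[OF ij] by simp
  then have "block_norm l \<rho> (\<lambda>c. X i c - X j c) h = dst d X i j * (block_error l \<rho> (\<lambda>c. X i c - X j c) h + 1)" for h
   using False by (simp add: block_error_def)
  then have "est l \<rho> N X g i j = dst d X i j * (((\<Sum>b<N. block_error l \<rho> (\<lambda>c. X i c - X j c) (after (b * (2 * 2 ^ l)) g)) + N) / N)"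
   by (simp add: est_eq_block_norm sum_distrib_left[symmetric] sum.distrib)
  also have "... = dst d X i j * (group_error l \<rho> N (\<lambda>c. X i c - X j c) g + 1)"
   unfolding group_error_def add_divide_distrib using N by simp
  finally have "est l \<rho> N X g i j = dst d X i j * (group_error l \<rho> N (\<lambda>c. X i c - X j c) g + 1)" .
  then show ?thesis by (simp add: algebra_simps)
qed

lemma initial_est:
  assumes ij: "i < n" "j < n"
  shows "initial (N * (2 * 2 ^ l)) (\<lambda>g. est l \<rho> N X g i j)"
proof -
  have *: "est l \<rho> N X g i j = dst d X i j + dst d X i j * group_error l \<rho> N (\<lambda>c. X i c - X j c) g" for g
   using est_error[OF ij, of g] by simp
  have "group_error l \<rho> N x g = group_error l \<rho> N x g'" if g: "\<forall>q<N * (2 * 2 ^ l). g q = g' q" for g g' x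
   unfolding group_error_def
  proof (intro arg_cong2[where f = "(/)"] sum.cong refl initialD[OF initial_block_error[OF \<rho>(2)]])
   fix b q :: nat assume "b \<in> {..<N}" "q < 2 * 2 ^ l"
   then have "b * (2 * 2 ^ l) + q < Suc b * (2 * 2 ^ l)" by simp
   also have "... \<le> N * (2 * 2 ^ l)" using \<open>b \<in> {..<N}\<close> by (intro mult_le_mono1) simp
   finally show "after (b * (2 * 2 ^ l)) g q = after (b * (2 * 2 ^ l)) g' q"
    using g by (simp add: after_apply)
  qed
  then show ?thesis unfolding * initial_def by metis
qed

end

lemma sets_argmin:
  fixes T W :: "nat => (nat => real) => real"
  assumes [measurable]: "\<And>q. T q \<in> borel_measurable gseq" "\<And>q. W q \<in> borel_measurable gseq"
  shows "{g. \<exists>q<L. (\<forall>q'<L. T q g \<le> T q' g) \<and> s < W q g} \<in> sets gseq"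
proof -
  have le: "{g \<in> space gseq. T q g \<le> T q' g} \<in> sets gseq" for q q'
   by (intro borel_measurable_le assms)
  have "{g \<in> space gseq. \<forall>q'\<in>{..<L}. T q g \<le> T q' g} \<in> sets gseq" for q
   by (rule sets.sets_Collect_finite_All[OF le]) simp
  moreover have "{g \<in> space gseq. s < W q g} \<in> sets gseq" for q
   by (intro borel_measurable_less borel_measurable_const assms)
  ultimately have "(\<Union>q\<in>{..<L}. {g \<in> space gseq. \<forall>q'\<in>{..<L}. T q g \<le> T q' g} \<inter> {g \<in> space gseq. s < W q g}) \<in> sets gseq"
   by (intro sets.finite_UN sets.Int) auto
  also have "(\<Union>q\<in>{..<L}. {g \<in> space gseq. \<forall>q'\<in>{..<L}. T q g \<le> T q' g} \<inter> {g \<in> space gseq. s < W q g}) =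
    {g. \<exists>q<L. (\<forall>q'<L. T q g \<le> T q' g) \<and> s < W q g}"
   by auto
  finally show ?thesis .
qed

text \<open>An instance of \<open>selection\<close>. Measured in units of \<alpha> (r i + r j), a
  single squared error has to stay only below t0^2, which exceeds \<epsilon>^2 by the factor n / (C
  L^2). This slack makes the weak tail bound for dependent outputs sufficient; the two conditions on
  \<rho> belong to its two regimes.\<close>

lemma good_group_probability:
  fixes l \<rho> N d n R a b m L c :: nat and X :: "nat => nat => real" and own r :: "nat => nat" and \<epsilon> K :: real
  assumes \<rho>: "0 < \<rho>" "\<rho> \<le> 2 ^ l" and N: "0 < N" and d: "d \<le> 2 ^ l"
   and X0: "\<And>i c. i < n ==> d \<le> c ==> X i c = 0"
   and \<epsilon>: "0 < \<epsilon>" and n: "2 \<le> n"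
   and own: "\<And>u. u < R ==> own u < n" "\<And>i. i < n ==> card {u\<in>{..<R}. own u = i} = r i" "\<And>i. i < n ==> 0 < r i"
   and F: "F = (\<Sum>i<n. \<Sum>j<n. (dst d X i j)\<^sup>2)" "0 < F"
   and dr: "\<And>i j. i < n ==> j < n ==> (dst d X i j)\<^sup>2 \<le> F / (real n)\<^sup>2 * (real (r i) + real (r j))"
   and sizes: "R \<le> 2 ^ a" "n \<le> 2 ^ b" "(2::real) ^ (a + b) \<le> 8 * (real n)\<^sup>2" "n \<le> 2 ^ L" "0 < L" "L \<le> n"
   and m: "n \<le> m * L" and N\<rho>: "K / \<epsilon>\<^sup>2 \<le> N * \<rho>"
   and \<rho>1: "(real \<rho> * real L ^ 2)\<^sup>2 \<le> K / \<epsilon>\<^sup>2 * n" and \<rho>2: "real \<rho> * real L ^ 6 \<le> (real n)\<^sup>2"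
   and K: "1536 * 2 ^ (c + 2) \<le> K" "4 * (64 * (c + 3)) * (c + 5)\<^sup>2 \<le> K" "4 * (c + 5) * mgf_const * (64 * (c + 3)) \<le> K"
  defines "k \<equiv> N * (2 * 2 ^ l)"
  defines "T \<equiv> (\<lambda>q g. sample_sum a b m (\<lambda>u v. test_value l \<rho> N d X n R own r u v (after (q * k) g)) (after (L * k) g))"
  shows "emeasure gseq {g. \<exists>q<L. (\<forall>q'<L. T q g \<le> T q' g) \<and>
    \<epsilon>\<^sup>2 * F < (\<Sum>i<n. \<Sum>j<n. (dst d X i j - est l \<rho> N X (after (q * k) g) i j)\<^sup>2)} \<le> ennreal (1 / real n ^ c)"
proof -
  define \<alpha> where "\<alpha> = F / (real n)\<^sup>2"
  define \<kappa> where "\<kappa> = K / \<epsilon>\<^sup>2"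
  \<comment> \<open>Chosen together with \<open>t0\<close> so that m \<mu> / (4 \<tau>) = (c + 3) L
    (m L / n), which is at least (c + 3) L.\<close>
  define C where "C = 64 * (real c + 3)"
  define t0 where "t0 = \<epsilon> * sqrt (n / C) / L"
  define \<tau> where "\<tau> = t0\<^sup>2 * \<alpha>"
  \<comment> \<open>The sampled values add up to half of the squared error, so the threshold for
    their sum is \<epsilon>^2 F / 2. Spread over the at most 8 n^2 index pairs this is \<epsilon>^2
    \<alpha> / 16.\<close>
  define \<mu> where "\<mu> = \<epsilon>\<^sup>2 * \<alpha> / 16"
  \<comment> \<open>From the variance bound 24 / (N \<rho>) with N \<rho> at least \<kappa>;
    consequently 4 w / \<mu> = 1536 / K, where the constant in the first condition on K comes
    from.\<close>
  define w where "w = 24 * \<alpha> / \<kappa>"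
  \<comment> \<open>As exp (-L) <= 1/n, this exponent leaves n^-(c+2) after a union bound over n^2
    pairs and at most n candidates.\<close>
  define X' where "X' = (real c + 5) * L"
  define y where "y = test_value l \<rho> N d X n R own r"
  have C: "0 < C" by (simp add: C_def)
  have n0: "0 < real n" using n by simp
  have L0: "0 < real L" using sizes by simp
  have \<alpha>: "0 < \<alpha>" using F(2) n0 by (simp add: \<alpha>_def)
  have "(0::real) < 1536 * 2 ^ (c + 2)" by simp
  then have Kpos: "0 < K" using K(1) by linarith
  have \<kappa>: "0 < \<kappa>" using Kpos \<epsilon> by (simp add: \<kappa>_def)
  have M: "0 < mgf_const" by (simp add: mgf_const_def exp_const_def add_pos_pos)
  have t0: "0 < t0" using \<epsilon> n0 C L0 by (simp add: t0_def)
  have t02: "t0\<^sup>2 = \<epsilon>\<^sup>2 * n / (C * (real L)\<^sup>2)"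
   using C n0 by (simp add: t0_def power_mult_distrib power_divide)
  have meas: "y u v \<in> borel_measurable gseq" for u v
   unfolding y_def test_value_def[abs_def] by (cases "u < R \<and> v < n") simp_all
  have init: "initial k (y u v)" for u v
  proof (cases "u < R \<and> v < n")
   case True
   then have "initial k (\<lambda>g. est l \<rho> N X g (own u) v)"
    unfolding k_def using own(1) by (intro initial_est[OF \<rho> N d X0]) auto
   then show ?thesis using True unfolding y_def test_value_def initial_def by metis
  qed (auto simp: y_def test_value_def[abs_def] initial_def)
  have nonneg: "0 \<le> y u v g" for u v g
   by (simp add: y_def test_value_def)
  have yb: "y u v g \<le> \<alpha> * (group_error l \<rho> N (\<lambda>c. X (own u) c - X v c) g)\<^sup>2" if uv: "u < R" "v < n" for u v g
  proof -
   let ?e = "group_error l \<rho> N (\<lambda>c. X (own u) c - X v c) g"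
   have i: "own u < n" using own(1) uv by simp
   have e: "(dst d X (own u) v - est l \<rho> N X g (own u) v)\<^sup>2 = (dst d X (own u) v)\<^sup>2 * ?e\<^sup>2"
   proof -
    have "est l \<rho> N X g (own u) v - dst d X (own u) v = dst d X (own u) v * ?e"
     by (rule est_error[OF \<rho> N d X0 i uv(2)])
    then show ?thesis by (metis power2_commute power_mult_distrib)
   qed
   have rr: "0 < real (r (own u)) + real (r v)" using own(3)[OF i] by simp
   have "(dst d X (own u) v)\<^sup>2 * ?e\<^sup>2 \<le> \<alpha> * (real (r (own u)) + real (r v)) * ?e\<^sup>2"
    using dr[OF i uv(2)] by (intro mult_right_mono) (auto simp: \<alpha>_def)
   then show ?thesis
    using uv rr by (simp add: y_def test_value_def e pos_divide_le_eq mult_ac)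
  qed
  have y0: "y u v g = 0" if "\<not> (u < R \<and> v < n)" for u v g
   using that by (auto simp: y_def test_value_def)
  have y_dst0: "y u v g = 0" if uv: "u < R" "v < n" and "dst d X (own u) v = 0" for u v g
  proof -
   have i: "own u < n" using own(1) uv by simp
   have "est l \<rho> N X g (own u) v - dst d X (own u) v =
     dst d X (own u) v * group_error l \<rho> N (\<lambda>c. X (own u) c - X v c) g"
    by (rule est_error[OF \<rho> N d X0 i uv(2)])
   then show ?thesis using that(3) by (simp add: y_def test_value_def)
  qed
  have padded_pos: "0 < (\<Sum>c<2^l. (X i c - X j c)\<^sup>2)" if "i < n" "j < n" "dst d X i j \<noteq> 0" for i j
  proof -
   have "(\<Sum>c<2^l. (X i c - X j c)\<^sup>2) = (dst d X i j)\<^sup>2"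
    by (rule dst_sq_padded[OF \<rho> N d _ that(1,2)]) (rule X0)
   then show ?thesis using that(3) by simp
  qed
  have mean: "(\<integral>\<^sup>+g. ennreal (y u v g) \<partial>gseq) \<le> ennreal w" for u v
  proof (cases "u < R \<and> v < n \<and> dst d X (own u) v \<noteq> 0")
   case True
   let ?e = "group_error l \<rho> N (\<lambda>c. X (own u) c - X v c)"
   have i: "own u < n" using own(1) True by simp
   have "(\<integral>\<^sup>+g. ennreal (y u v g) \<partial>gseq) \<le> (\<integral>\<^sup>+g. ennreal \<alpha> * ennreal ((?e g)\<^sup>2) \<partial>gseq)"
    using True yb \<alpha> by (intro nn_integral_mono) (auto simp: ennreal_mult[symmetric] intro: ennreal_leI)
   also have "... = ennreal \<alpha> * (\<integral>\<^sup>+g. ennreal ((?e g)\<^sup>2) \<partial>gseq)"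
    by (rule nn_integral_cmult) measurable
   also have "... \<le> ennreal \<alpha> * ennreal (24 / (N * \<rho>))"
    using True i by (intro mult_left_mono group_error_variance[OF \<rho> padded_pos N]) auto
   also have "... \<le> ennreal \<alpha> * ennreal (24 / \<kappa>)"
    using N\<rho> N \<rho>(1) Kpos \<epsilon> by (intro mult_left_mono ennreal_leI divide_left_mono) (auto simp: \<kappa>_def)
   also have "... = ennreal w" using \<alpha> \<kappa> by (simp add: w_def ennreal_mult[symmetric])
   finally show ?thesis .
  next
   case False
   then have "y u v g = 0" for g using y0[of u v] y_dst0[of u v] by blast
   then show ?thesis by simp
  qed
  \<comment> \<open>The minimiser of the Chernoff exponent, capped at 1, up to which the moment
    bound is valid.\<close>
  define kk where "kk = min 1 (t0 * sqrt \<rho> / (2 * mgf_const))"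
  have kk: "0 \<le> kk" "kk \<le> 1" using t0 M by (auto simp: kk_def)
  have \<rho>0: "0 < sqrt \<rho>" using \<rho>(1) by simp
  have N\<kappa>: "\<kappa> / \<rho> \<le> N" using N\<rho>[folded \<kappa>_def] \<rho>(1) by (simp add: pos_divide_le_eq)
  have exponent: "N * (mgf_const * kk\<^sup>2 / sqrt \<rho> - kk * t0) \<le> - X'"
  proof (cases "2 * mgf_const \<le> t0 * sqrt \<rho>")
   case True
   then have k1: "kk = 1" using M by (simp add: kk_def min_def pos_le_divide_eq)
   have "mgf_const / sqrt \<rho> \<le> t0 / 2" using True \<rho>0 by (simp add: pos_divide_le_eq mult_ac)
   moreover have "mgf_const * kk\<^sup>2 / sqrt \<rho> = mgf_const / sqrt \<rho>" "kk * t0 = t0" by (simp_all add: k1)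
   ultimately have "mgf_const * kk\<^sup>2 / sqrt \<rho> - kk * t0 \<le> - (t0 / 2)" by linarith
   then have "N * (mgf_const * kk\<^sup>2 / sqrt \<rho> - kk * t0) \<le> N * (- (t0 / 2))"
    by (intro mult_left_mono) auto
   also have "... = - (N * (t0 / 2))" by simp
   also have "... \<le> - X'"
   proof -
    \<comment> \<open>For large deviations the exponent is -N t0 / 2 or less. The first condition on
      \<rho> keeps the number of blocks, at least \<kappa>/\<rho>, large enough.\<close>
    have "(\<rho> * L^2) \<le> sqrt (\<kappa> * n)"
     using \<rho>1 by (intro real_le_rsqrt) (simp add: \<kappa>_def)
    then have "sqrt \<kappa> * (\<rho> * L^2) \<le> sqrt \<kappa> * sqrt (\<kappa> * n)"
     using \<kappa> by (intro mult_left_mono) auto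
    also have "... = \<kappa> * sqrt n" using \<kappa> by (simp add: real_sqrt_mult)
    finally have 1: "sqrt \<kappa> * L^2 / sqrt n \<le> \<kappa> / \<rho>"
     using \<rho>(1) n0 by (simp add: field_simps)
    have "sqrt \<kappa> = sqrt K / \<epsilon>" using \<epsilon> by (simp add: \<kappa>_def real_sqrt_divide)
    then have 2: "sqrt \<kappa> * L^2 / sqrt n * (t0 / 2) = sqrt K * L / (2 * sqrt C)"
     using \<epsilon> n0 L0 C unfolding t0_def by (simp add: real_sqrt_divide power2_eq_square)
    have "(2 * sqrt C * (c + 5))\<^sup>2 \<le> K"
     using K(2) C by (simp add: C_def power_mult_distrib)
    then have "2 * sqrt C * (c + 5) \<le> sqrt K" by (rule real_le_rsqrt)
    then have "(real c + 5) * real L \<le> sqrt K / (2 * sqrt C) * L"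
     using C by (intro mult_right_mono) (auto simp: pos_le_divide_eq mult_ac)
    then have "X' \<le> sqrt \<kappa> * L^2 / sqrt n * (t0 / 2)" unfolding 2 by (simp add: X'_def)
    also have "... \<le> N * (t0 / 2)"
     using 1 N\<kappa> t0 by (intro mult_right_mono) auto
    finally show ?thesis by simp
   qed
   finally show ?thesis .
  next
   case False
   then have k1: "kk = t0 * sqrt \<rho> / (2 * mgf_const)" using M by (simp add: kk_def min_def pos_le_divide_eq)
   have "mgf_const * kk\<^sup>2 / sqrt \<rho> - kk * t0 = - (t0\<^sup>2 * sqrt \<rho> / (4 * mgf_const))"
   proof -
    have "M * (t * s / (2 * M))\<^sup>2 / s - t * s / (2 * M) * t = - (t\<^sup>2 * s / (4 * M))" if "0 < M" "0 < s" for M s t :: real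
     using that by (simp add: field_simps power2_eq_square)
    then show ?thesis unfolding k1 using M \<rho>0 by blast
   qed
   then have "N * (mgf_const * kk\<^sup>2 / sqrt \<rho> - kk * t0) = - (N * (t0\<^sup>2 * sqrt \<rho> / (4 * mgf_const)))" by simp
   also have "... \<le> - X'"
   proof -
    \<comment> \<open>For small deviations the exponent is -N t0^2 sqrt \<rho> / (4
      \<open>mgf_const\<close>), and the second condition on \<rho> enters.\<close>
    have "(sqrt \<rho> * L^3)\<^sup>2 \<le> (real n)\<^sup>2"
     using \<rho>2 by (simp add: power_mult_distrib flip: power_mult)
    then have q: "sqrt \<rho> * L^3 \<le> n" by (rule power2_le_imp_le) simp
    have "\<kappa> / \<rho> * (t0\<^sup>2 * sqrt \<rho> / (4 * mgf_const)) = K * n / (4 * mgf_const * C * (real L)\<^sup>2 * sqrt \<rho>)"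
    proof -
     have s: "real \<rho> = sqrt \<rho> * sqrt \<rho>" by simp
     have "K / e / (s * s) * (e * n' / (C * L') * s / (4 * M)) = K * n' / (4 * M * C * L' * s)"
      if "0 < e" "0 < s" for e s n' L' M :: real
      using that by (simp add: field_simps)
     from this[of "\<epsilon>\<^sup>2" "sqrt \<rho>"] show ?thesis
      unfolding t02 \<kappa>_def using \<epsilon> \<rho>0 s by (metis zero_less_power)
    qed
    moreover have "X' \<le> K * n / (4 * mgf_const * C * (real L)\<^sup>2 * sqrt \<rho>)"
    proof -
     have "4 * (c + 5) * mgf_const * C * (sqrt \<rho> * L^3) \<le> K * n"
      using K(3) q M C \<rho>0 Kpos by (intro mult_mono) (auto simp: C_def)
     then have "X' * (4 * mgf_const * C * (real L)\<^sup>2 * sqrt \<rho>) \<le> K * n"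
      by (simp add: X'_def power2_eq_square power3_eq_cube mult_ac)
     then show ?thesis using M C L0 \<rho>0 by (simp add: pos_le_divide_eq)
    qed
    moreover have "\<kappa> / \<rho> * (t0\<^sup>2 * sqrt \<rho> / (4 * mgf_const)) \<le> N * (t0\<^sup>2 * sqrt \<rho> / (4 * mgf_const))"
     using N\<kappa> M by (intro mult_right_mono) auto
    ultimately show ?thesis by linarith
   qed
   finally show ?thesis .
  qed
  define p where "p = (real n)\<^sup>2 * (2 * exp (- X'))"
  have bound: "emeasure gseq {g. \<exists>u<2^a. \<exists>v<2^b. \<tau> < y u v g} \<le> ennreal p"
  proof -
   \<comment> \<open>Pairs at distance 0 are left out: their test values vanish, whereas
     \<open>group_error\<close> of the zero vector does not.\<close>
   define V where "V i j = (if dst d X i j = 0 then {} else {g. t0 \<le> \<bar>group_error l \<rho> N (\<lambda>c. X i c - X j c) g\<bar>})" for i j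
   have Vs: "V i j \<in> sets gseq" for i j
   proof -
    have "{g. t0 \<le> \<bar>group_error l \<rho> N (\<lambda>c. X i c - X j c) g\<bar>} \<in> sets gseq"
     by (rule sets_gseq_Collect) measurable
    then show ?thesis by (simp add: V_def)
   qed
   have Vp: "emeasure gseq (V i j) \<le> ennreal (2 * exp (- X'))" if "i < n" "j < n" for i j
   proof (cases "dst d X i j = 0")
    case False
    have "emeasure gseq (V i j) \<le> ennreal (2 * exp (N * (mgf_const * kk\<^sup>2 / sqrt \<rho> - kk * t0)))"
     using False group_error_tail[OF \<rho> padded_pos[OF that False] N kk] by (simp add: V_def)
    also have "... \<le> ennreal (2 * exp (- X'))" using exponent by (intro ennreal_leI) simp
    finally show ?thesis .
   qed (simp add: V_def)
   have "{g. \<exists>u<2^a. \<exists>v<2^b. \<tau> < y u v g} \<subseteq> (\<Union>i<n. \<Union>j<n. V i j)"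
   proof
    fix g assume "g \<in> {g. \<exists>u<2^a. \<exists>v<2^b. \<tau> < y u v g}"
    then obtain u v where uv: "\<tau> < y u v g" by auto
    have "0 \<le> \<tau>" using \<alpha> by (simp add: \<tau>_def)
    then have ne: "y u v g \<noteq> 0" using uv by auto
    then have uR: "u < R" "v < n" using y0[of u v g] by auto
    have dn: "dst d X (own u) v \<noteq> 0" using y_dst0[OF uR] ne by auto
    let ?e = "group_error l \<rho> N (\<lambda>c. X (own u) c - X v c) g"
    have "\<alpha> * t0\<^sup>2 \<le> \<alpha> * ?e\<^sup>2" using uv yb[OF uR, of g] by (simp add: \<tau>_def mult.commute)
    then have "t0\<^sup>2 \<le> \<bar>?e\<bar>\<^sup>2" using \<alpha> by simp
    then have "t0 \<le> \<bar>?e\<bar>" by (rule power2_le_imp_le) simp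
    then have "g \<in> V (own u) v" using dn by (simp add: V_def)
    then show "g \<in> (\<Union>i<n. \<Union>j<n. V i j)" using own(1)[OF uR(1)] uR(2) by blast
   qed
   then have "emeasure gseq {g. \<exists>u<2^a. \<exists>v<2^b. \<tau> < y u v g} \<le> emeasure gseq (\<Union>i<n. \<Union>j<n. V i j)"
    by (rule emeasure_mono) (use Vs in auto)
   also have "... \<le> (\<Sum>i<n. emeasure gseq (\<Union>j<n. V i j))"
    by (rule emeasure_subadditive_finite) (use Vs in auto)
   also have "... \<le> (\<Sum>i<n. \<Sum>j<n. emeasure gseq (V i j))"
    by (intro sum_mono emeasure_subadditive_finite) (use Vs in auto)
   also have "... \<le> (\<Sum>i<n. \<Sum>j<n. ennreal (2 * exp (- X')))"
    by (intro sum_mono Vp) auto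
   also have "... = ennreal p"
    by (simp add: p_def ennreal_mult power2_eq_square ennreal_of_nat_eq_real_of_nat mult.assoc)
   finally show ?thesis .
  qed
  \<comment> \<open>An ordered pair occurs with weight r i / (r i + r j); this and the weight of the
    reversed pair add up to 1.\<close>
  have half: "(\<Sum>u<2^a. \<Sum>v<2^b. y u v g) = (\<Sum>i<n. \<Sum>j<n. (dst d X i j - est l \<rho> N X g i j)\<^sup>2) / 2" for g
  proof -
   define e where "e i j = (dst d X i j - est l \<rho> N X g i j)\<^sup>2" for i j
   have e: "e i j = e j i" for i j unfolding e_def using dst_commute est_commute by metis
   define z where "z i = (\<Sum>j<n. e i j / (real (r i) + real (r j)))" for i
   have "(\<Sum>u<2^a. \<Sum>v<2^b. y u v g) = (\<Sum>u<R. \<Sum>v<2^b. y u v g)"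
    using sizes(1) y0 by (intro sum.mono_neutral_right) auto
   also have "... = (\<Sum>u<R. \<Sum>v<n. y u v g)"
    using sizes(2) y0 by (intro sum.cong sum.mono_neutral_right) auto
   also have "... = (\<Sum>u<R. z (own u))"
    by (simp add: z_def e_def y_def test_value_def)
   also have "... = (\<Sum>i<n. \<Sum>u\<in>{u\<in>{..<R}. own u = i}. z (own u))"
    using own(1) by (intro sum.group[symmetric]) auto
   also have "... = (\<Sum>i<n. real (r i) * z i)"
    by (intro sum.cong) (auto simp: own(2)[symmetric])
   also have "... = (\<Sum>i<n. \<Sum>j<n. real (r i) / (real (r i) + real (r j)) * e i j)"
    by (simp add: z_def sum_distrib_left)
   finally have 1: "(\<Sum>u<2^a. \<Sum>v<2^b. y u v g) = (\<Sum>i<n. \<Sum>j<n. real (r i) / (real (r i) + real (r j)) * e i j)" .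
   also have "... = (\<Sum>i<n. \<Sum>j<n. real (r j) / (real (r i) + real (r j)) * e i j)"
    by (subst sum.swap) (simp add: add.commute e[of _ _])
   finally have 2: "(\<Sum>u<2^a. \<Sum>v<2^b. y u v g) = (\<Sum>i<n. \<Sum>j<n. real (r j) / (real (r i) + real (r j)) * e i j)" .
   have "2 * (\<Sum>u<2^a. \<Sum>v<2^b. y u v g) = (\<Sum>i<n. \<Sum>j<n. real (r i) / (real (r i) + real (r j)) * e i j +
     real (r j) / (real (r i) + real (r j)) * e i j)"
    unfolding sum.distrib 1[symmetric] 2[symmetric] by simp
   also have "... = (\<Sum>i<n. \<Sum>j<n. e i j)"
   proof (intro sum.cong refl)
    fix i j assume "i \<in> {..<n}"
    then have "0 < real (r i) + real (r j)" using own(3)[of i] by simp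
    then show "real (r i) / (real (r i) + real (r j)) * e i j + real (r j) / (real (r i) + real (r j)) * e i j = e i j"
     by (simp add: distrib_right[symmetric] add_divide_distrib[symmetric])
   qed
   finally show ?thesis by (simp add: e_def)
  qed
  have target: "\<mu> * 2 ^ (a + b) \<le> \<epsilon>\<^sup>2 * F / 2"
  proof -
   have "\<mu> * 2 ^ (a + b) \<le> \<mu> * (8 * (real n)\<^sup>2)" using \<alpha> sizes(3) by (intro mult_left_mono) (auto simp: \<mu>_def)
   also have "... = \<epsilon>\<^sup>2 * F / 2" using n0 by (simp add: \<mu>_def \<alpha>_def)
   finally show ?thesis .
  qed
  have "emeasure gseq {g. \<exists>q<L. (\<forall>q'<L. T q g \<le> T q' g) \<and>
    \<epsilon>\<^sup>2 * F < (\<Sum>i<n. \<Sum>j<n. (dst d X i j - est l \<rho> N X (after (q * k) g) i j)\<^sup>2)} \<le>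
   emeasure gseq {g. \<exists>q<L. (\<forall>q'<L. T q g \<le> T q' g) \<and> \<mu> * 2 ^ (a + b) < (\<Sum>u<2^a. \<Sum>v<2^b. y u v (after (q * k) g))}"
  proof (rule emeasure_mono)
   note meas[measurable]
   have [measurable]: "T q \<in> borel_measurable gseq" for q
    unfolding T_def y_def[symmetric] by measurable
   define W where "W q g = (\<Sum>u<2^a. \<Sum>v<2^b. y u v (after (q * k) g))" for q g
   have [measurable]: "W q \<in> borel_measurable gseq" for q
    unfolding W_def by (intro borel_measurable_sum measurable_compose[OF measurable_after meas])
   show "{g. \<exists>q<L. (\<forall>q'<L. T q g \<le> T q' g) \<and> \<mu> * 2 ^ (a + b) < (\<Sum>u<2^a. \<Sum>v<2^b. y u v (after (q * k) g))} \<in> sets gseq"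
    unfolding W_def[symmetric] by (rule sets_argmin) simp_all
   show "{g. \<exists>q<L. (\<forall>q'<L. T q g \<le> T q' g) \<and>
    \<epsilon>\<^sup>2 * F < (\<Sum>i<n. \<Sum>j<n. (dst d X i j - est l \<rho> N X (after (q * k) g) i j)\<^sup>2)} \<subseteq>
   {g. \<exists>q<L. (\<forall>q'<L. T q g \<le> T q' g) \<and> \<mu> * 2 ^ (a + b) < (\<Sum>u<2^a. \<Sum>v<2^b. y u v (after (q * k) g))}"
    unfolding half using target by force
  qed
  also have "... \<le> ennreal (L * p + (4 * w / \<mu>) ^ L + L * exp (- (m * \<mu> / (4 * \<tau>))))"
   unfolding T_def y_def[symmetric]
  proof (rule selection[OF meas init nonneg mean _ bound])
   show "0 \<le> w" "0 \<le> p" "0 < \<tau>" "0 < \<mu>" using \<alpha> \<kappa> t0 \<epsilon> by (auto simp: w_def p_def \<tau>_def \<mu>_def)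
   show "0 < m" using m n by (cases m) auto
  qed
  also have "... \<le> ennreal (1 / real n ^ c)"
  proof (rule ennreal_leI)
   have nE: "exp (- real L) \<le> 1 / n"
   proof -
    have "real n \<le> 2 ^ L" using sizes(4) by (metis of_nat_le_iff of_nat_numeral of_nat_power)
    also have "... \<le> exp 1 ^ L" using exp_ge_add_one_self[of 1] by (intro power_mono) auto
    also have "... = exp L" by (simp add: exp_of_nat_mult[symmetric])
    finally show ?thesis using n0 by (simp add: exp_minus inverse_eq_divide divide_left_mono)
   qed
   have En: "exp (- (real j * real L)) \<le> 1 / real n ^ j" for j
   proof -
    have "exp (- (real j * real L)) = exp (- real L) ^ j"
     by (simp add: exp_of_nat_mult[symmetric])
    also have "... \<le> (1 / real n) ^ j" using nE by (intro power_mono) auto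
    finally show ?thesis by (simp add: power_divide)
   qed
   have Ln: "real L \<le> n" using sizes by simp
   have p1: "L * p \<le> 2 * (1 / real n ^ (c + 2))"
   proof -
    have "L * p \<le> n * ((real n)\<^sup>2 * (2 * (1 / real n ^ (c + 5))))"
     unfolding p_def X'_def using Ln En[of "c + 5"] by (intro mult_mono) auto
    also have "... = 2 * (1 / real n ^ (c + 2))"
     using n0 by (simp add: field_simps eval_nat_numeral)
    finally show ?thesis .
   qed
   have p2: "(4 * w / \<mu>) ^ L \<le> 1 / real n ^ (c + 2)"
   proof -
    have "4 * w / \<mu> = 1536 / K"
     using \<alpha> \<epsilon> Kpos by (simp add: w_def \<mu>_def \<kappa>_def)
    also have "... \<le> 1536 / (1536 * 2 ^ (c + 2))"
     using K(1) Kpos by (intro divide_left_mono) auto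
    also have "... = 1 / 2 ^ (c + 2)" by simp
    finally have "(4 * w / \<mu>) ^ L \<le> (1 / 2 ^ (c + 2)) ^ L"
     using \<alpha> \<kappa> \<epsilon> by (intro power_mono) (auto simp: w_def \<mu>_def)
    also have "... = 1 / (2 ^ L) ^ (c + 2)"
    proof -
     have "((2::real) ^ (c + 2)) ^ L = (2 ^ L) ^ (c + 2)" by (simp only: power_mult[symmetric] mult.commute)
     then show ?thesis by (simp only: power_divide power_one)
    qed
    also have "... \<le> 1 / real n ^ (c + 2)"
    proof -
     have "real n \<le> 2 ^ L" using sizes(4) by (metis of_nat_le_iff of_nat_numeral of_nat_power)
     then show ?thesis using n0 by (intro divide_left_mono power_mono) auto
    qed
    finally show ?thesis .
   qed
   have p3: "L * exp (- (m * \<mu> / (4 * \<tau>))) \<le> 1 / real n ^ (c + 2)"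
   proof -
    have "m * \<mu> / (4 * \<tau>) = m * (C * (real L)\<^sup>2) / (64 * n)"
     unfolding \<mu>_def \<tau>_def t02 using \<alpha> \<epsilon> n0 C L0 by (simp add: field_simps)
    also have "... = (real c + 3) * L * ((m * L) / n)"
     using n0 by (simp add: C_def power2_eq_square field_simps)
    also have "... \<ge> (real c + 3) * L * 1"
     using m n0 by (intro mult_left_mono) (auto simp flip: of_nat_mult)
    finally have "exp (- (m * \<mu> / (4 * \<tau>))) \<le> exp (- (real (c + 3) * L))" by simp
    also have "... \<le> 1 / real n ^ (c + 3)" by (rule En)
    finally have "L * exp (- (m * \<mu> / (4 * \<tau>))) \<le> n * (1 / real n ^ (c + 3))"
     using Ln by (intro mult_mono) auto
    also have "... = 1 / real n ^ (c + 2)" using n0 by (simp add: field_simps eval_nat_numeral)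
    finally show ?thesis .
   qed
   \<comment> \<open>The union bound contributes two copies of n^-(c+2), the other two events one
     copy each; n >= 2 absorbs the factor 4.\<close>
   have "4 * (1 / real n ^ (c + 2)) \<le> 1 / real n ^ c"
   proof -
    have "4 \<le> (real n)\<^sup>2" using n power_mono[of 2 "real n" 2] by simp
    then show ?thesis using n0 by (simp add: power_add field_simps power2_eq_square)
   qed
   then show "L * p + (4 * w / \<mu>) ^ L + L * exp (- (m * \<mu> / (4 * \<tau>))) \<le> 1 / real n ^ c"
    using p1 p2 p3 by linarith
  qed
  finally show ?thesis .
qed

section \<open>Running times of programs\<close>

text \<open>A total correctness triple with a time bound. Because execution on a fixed tape is
  deterministic, the existence of one such run determines the behaviour.\<close>

definition runs :: "tape => com => state => nat => (state => bool) => bool" where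
  "runs \<omega> p s T Q \<longleftrightarrow> (\<exists>t s'. exec \<omega> p s t s' \<and> t \<le> T \<and> Q s')"

lemma runsI: "exec \<omega> p s t s' ==> t \<le> T ==> Q s' ==> runs \<omega> p s T Q"
  unfolding runs_def by blast

lemma runs_mono: "runs \<omega> p s T Q ==> T \<le> T' ==> (\<And>s'. Q s' ==> Q' s') ==> runs \<omega> p s T' Q'"
  unfolding runs_def by (meson order_trans)

lemma runs_Seq:
  assumes "runs \<omega> p s T Q" "\<And>s'. Q s' ==> runs \<omega> q s' T' Q'"
  shows "runs \<omega> (Seq p q) s (T + T') Q'"
proof -
  obtain t s' where 1: "exec \<omega> p s t s'" "t \<le> T" "Q s'" using assms(1) by (auto simp: runs_def)
  obtain t' s'' where 2: "exec \<omega> q s' t' s''" "t' \<le> T'" "Q' s''" using assms(2)[OF 1(3)] by (auto simp: runs_def)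
  show ?thesis by (rule runsI[OF exec.Seq[OF 1(1) 2(1)]]) (use 1 2 in auto)
qed

lemma runs_If:
  assumes "bval b s ==> runs \<omega> p s T Q" "\<not> bval b s ==> runs \<omega> q s T Q"
  shows "runs \<omega> (If b p q) s (1 + bcost b + T) Q"
proof (cases "bval b s")
  case True
  then obtain t s' where 1: "exec \<omega> p s t s'" "t \<le> T" "Q s'" using assms(1) by (auto simp: runs_def)
  show ?thesis by (rule runsI[OF exec.IfTrue[OF True 1(1)]]) (use 1 in auto)
next
  case False
  then obtain t s' where 1: "exec \<omega> q s t s'" "t \<le> T" "Q s'" using assms(2) by (auto simp: runs_def)
  show ?thesis by (rule runsI[OF exec.IfFalse[OF False 1(1)]]) (use 1 in auto)
qed

text \<open>Weakest preconditions for loop-free programs; a loop has none, so that no side condition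
  is needed.\<close>

primrec wp :: "tape => com => (state => bool) => state => bool" where
  "wp \<omega> Skip Q s = Q s"
| "wp \<omega> (NAssign v e) Q s = Q (s\<lparr>nvar := (nvar s)(v := nval e s)\<rparr>)"
| "wp \<omega> (RAssign v e) Q s = Q (s\<lparr>rvar := (rvar s)(v := rval e s)\<rparr>)"
| "wp \<omega> (NStore a i j e) Q s = Q (s\<lparr>narr := upd2 (narr s) a (nval i s) (nval j s) (nval e s)\<rparr>)"
| "wp \<omega> (RStore a i j e) Q s = Q (s\<lparr>rarr := upd2 (rarr s) a (nval i s) (nval j s) (rval e s)\<rparr>)"
| "wp \<omega> (Uniform v) Q s = Q (s\<lparr>rvar := (rvar s)(v := fst (\<omega> (pos s))), pos := pos s + 1\<rparr>)"
| "wp \<omega> (Gauss v) Q s = Q (s\<lparr>rvar := (rvar s)(v := snd (\<omega> (pos s))), pos := pos s + 1\<rparr>)"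
| "wp \<omega> (Seq p q) Q s = wp \<omega> p (wp \<omega> q Q) s"
| "wp \<omega> (If b p q) Q s = (if bval b s then wp \<omega> p Q s else wp \<omega> q Q s)"
| "wp \<omega> (While b p) Q s = False"

text \<open>A bound for the cost wherever \<open>wp\<close> holds. A conditional is charged for both
  branches, and a loop gets 0 because its precondition is false.\<close>

primrec csize :: "com => nat" where
  "csize Skip = 1"
| "csize (NAssign v e) = 1 + ncost e"
| "csize (RAssign v e) = 1 + rcost e"
| "csize (NStore a i j e) = 1 + ncost i + ncost j + ncost e"
| "csize (RStore a i j e) = 1 + ncost i + ncost j + rcost e"
| "csize (Uniform v) = 1"
| "csize (Gauss v) = 1"
| "csize (Seq p q) = csize p + csize q"
| "csize (If b p q) = 1 + bcost b + (csize p + csize q)"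
| "csize (While b p) = 0"

lemma runs_wp: "wp \<omega> p Q s ==> runs \<omega> p s (csize p) Q"
proof (induction p arbitrary: Q s)
  case (Seq p q)
  have "runs \<omega> p s (csize p) (wp \<omega> q Q)" using Seq.prems by (intro Seq.IH(1)) simp
  then show ?case unfolding csize.simps by (rule runs_Seq) (rule Seq.IH(2))
next
  case (If b p q)
  show ?case unfolding csize.simps
  proof (rule runs_If)
   show "runs \<omega> p s (csize p + csize q) Q" if "bval b s"
    using If.IH(1)[of Q s] If.prems that by (auto intro: runs_mono[where T = "csize p"])
   show "runs \<omega> q s (csize p + csize q) Q" if "\<not> bval b s"
    using If.IH(2)[of Q s] If.prems that by (auto intro: runs_mono[where T = "csize q"])
  qed
qed (auto simp: runs_def intro!: exI exec.intros)

section \<open>Write sets and frame conditions\<close>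

primrec wn :: "com => name set" where
  "wn Skip = {}" | "wn (NAssign v e) = {v}" | "wn (RAssign v e) = {}" | "wn (NStore a i j e) = {}"
| "wn (RStore a i j e) = {}" | "wn (Uniform v) = {}" | "wn (Gauss v) = {}" | "wn (Seq p q) = wn p \<union> wn q"
| "wn (If b p q) = wn p \<union> wn q" | "wn (While b p) = wn p"

primrec wr :: "com => name set" where
  "wr Skip = {}" | "wr (NAssign v e) = {}" | "wr (RAssign v e) = {v}" | "wr (NStore a i j e) = {}"
| "wr (RStore a i j e) = {}" | "wr (Uniform v) = {v}" | "wr (Gauss v) = {v}" | "wr (Seq p q) = wr p \<union> wr q"
| "wr (If b p q) = wr p \<union> wr q" | "wr (While b p) = wr p"

primrec wna :: "com => name set" where
  "wna Skip = {}" | "wna (NAssign v e) = {}" | "wna (RAssign v e) = {}" | "wna (NStore a i j e) = {a}"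
| "wna (RStore a i j e) = {}" | "wna (Uniform v) = {}" | "wna (Gauss v) = {}" | "wna (Seq p q) = wna p \<union> wna q"
| "wna (If b p q) = wna p \<union> wna q" | "wna (While b p) = wna p"

primrec wra :: "com => name set" where
  "wra Skip = {}" | "wra (NAssign v e) = {}" | "wra (RAssign v e) = {}" | "wra (NStore a i j e) = {}"
| "wra (RStore a i j e) = {a}" | "wra (Uniform v) = {}" | "wra (Gauss v) = {}" | "wra (Seq p q) = wra p \<union> wra q"
| "wra (If b p q) = wra p \<union> wra q" | "wra (While b p) = wra p"

text \<open>The syntactic frame condition. It spares the loop invariants a list of everything that
  stays unchanged; only the entries that are written need to be described.\<close>

definition same :: "com => state => state => bool" where
  "same p s s' \<longleftrightarrow> (\<forall>v. v \<notin> wn p --> nvar s' v = nvar s v) \<and> (\<forall>v. v \<notin> wr p --> rvar s' v = rvar s v) \<and>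
   (\<forall>a. a \<notin> wna p --> narr s' a = narr s a) \<and> (\<forall>a. a \<notin> wra p --> rarr s' a = rarr s a) \<and>
   (sample_free p --> pos s' = pos s)"

lemma upd2_apply: "upd2 m a i j z b k l = (if b = a \<and> k = i \<and> l = j then z else m b k l)"
  by (simp add: upd2_def)

lemma upd2_other: "b \<noteq> a ==> upd2 m a i j z b = m b"
  by (simp add: upd2_def)

lemma exec_same: "exec \<omega> p s t s' ==> same p s s'"
  by (induction rule: exec.induct) (auto simp: same_def upd2_other)

lemma runs_same: "runs \<omega> p s T Q ==> runs \<omega> p s T (\<lambda>s'. Q s' \<and> same p s s')"
  unfolding runs_def using exec_same by blast

lemma same_refl: "same p s s"
  by (simp add: same_def)

lemma same_nvar: "same p s s' ==> v \<notin> wn p ==> nvar s' v = nvar s v"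
  and same_rvar: "same p s s' ==> v \<notin> wr p ==> rvar s' v = rvar s v"
  and same_narr: "same p s s' ==> a \<notin> wna p ==> narr s' a = narr s a"
  and same_rarr: "same p s s' ==> a \<notin> wra p ==> rarr s' a = rarr s a"
  and same_pos: "same p s s' ==> sample_free p ==> pos s' = pos s"
  by (auto simp: same_def)

lemmas sameD = same_nvar same_rvar same_narr same_rarr same_pos

text \<open>The invariant is indexed by the number of completed rounds and must bound it by
  \<open>m\<close>. Termination, the summed time and the final invariant then come from one
  induction on \<open>m - k\<close>.\<close>

lemma runs_While:
  assumes inv: "\<And>i s'. I i s' ==> i \<le> m"
   and step: "\<And>i s'. I i s' ==> bval b s' ==> i < m \<and> runs \<omega> p s' (T i) (I (Suc i))"
   and start: "I k s"
  shows "runs \<omega> (While b p) s ((\<Sum>i\<in>{k..<m}. T i + 1 + bcost b) + 1 + bcost b) (\<lambda>s'. (\<exists>i. I i s') \<and> \<not> bval b s')"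
  using start
proof (induction "m - k" arbitrary: k s rule: less_induct)
  case less
  show ?case
  proof (cases "bval b s")
   case False
   then show ?thesis
    by (intro runsI[OF exec.WhileFalse]) (use less.prems in auto)
  next
   case True
   have k: "k < m" using step[OF less.prems True] by simp
   obtain t s1 where 1: "exec \<omega> p s t s1" "t \<le> T k" "I (Suc k) s1"
    using step[OF less.prems True] by (auto simp: runs_def)
   have "m - Suc k < m - k" using k by simp
   from less.hyps[OF this 1(3)]
   obtain t' s2 where 2: "exec \<omega> (While b p) s1 t' s2"
    "t' \<le> (\<Sum>i\<in>{Suc k..<m}. T i + 1 + bcost b) + 1 + bcost b" "(\<exists>i. I i s2) \<and> \<not> bval b s2"
    unfolding runs_def by blast
   have "{k..<m} = insert k {Suc k..<m}" using k by auto
   then have "(\<Sum>i\<in>{k..<m}. T i + 1 + bcost b) = T k + 1 + bcost b + (\<Sum>i\<in>{Suc k..<m}. T i + 1 + bcost b)"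
    by simp
   then have "1 + bcost b + t + t' \<le> (\<Sum>i\<in>{k..<m}. T i + 1 + bcost b) + 1 + bcost b"
    using 1(2) 2(2) by simp
   then show ?thesis
    unfolding runs_def using exec.WhileTrue[OF True 1(1) 2(1)] 2(3) by blast
  qed
qed

definition For :: "name => nexp => com => com" where
  "For v e p = Seq (NAssign v (NConst 0)) (While (NLess (NVar v) e) (Seq p (NAssign v (NAdd (NVar v) (NConst 1)))))"

lemma For_sets [simp]:
  "wn (For v e p) = insert v (wn p)" "wr (For v e p) = wr p" "wna (For v e p) = wna p" "wra (For v e p) = wra p"
  "sample_free (For v e p) = sample_free p"
  by (auto simp: For_def)

text \<open>The bound \<open>e\<close> is evaluated anew in every round, hence the frame hypothesis
  on it. \<open>indep\<close> keeps the counter out of the invariant, since it is incremented after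
  the body has established the next instance; the body learns its value from a separate
  hypothesis.\<close>

lemma runs_For_sum_exp:
  assumes v: "v \<notin> wn p"
   and e: "\<And>s'. same (For v e p) s s' ==> nval e s' = m"
   and start: "J 0 (s\<lparr>nvar := (nvar s)(v := 0)\<rparr>)"
   and step: "\<And>i s'. i < m ==> same (For v e p) s s' ==> nvar s' v = i ==> J i s' ==> runs \<omega> p s' (T i) (J (Suc i))"
   and indep: "\<And>i s' x. J i s' ==> J i (s'\<lparr>nvar := (nvar s')(v := x)\<rparr>)"
  shows "runs \<omega> (For v e p) s ((\<Sum>i<m. T i) + (m + 1) * (ncost e + 8)) (\<lambda>s'. J m s' \<and> same (For v e p) s s')"
proof -
  let ?I = "\<lambda>i s'. i \<le> m \<and> nvar s' v = i \<and> J i s' \<and> same (For v e p) s s'"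
  let ?b = "NLess (NVar v) e" and ?p = "Seq p (NAssign v (NAdd (NVar v) (NConst 1)))"
  have sv: "same (For v e p) s (s'\<lparr>nvar := (nvar s')(v := x)\<rparr>)" if "same (For v e p) s s'" for s' x
   using that by (auto simp: same_def)
  have W: "runs \<omega> (While ?b ?p) (s\<lparr>nvar := (nvar s)(v := 0)\<rparr>)
    ((\<Sum>i\<in>{0..<m}. (T i + 4) + 1 + bcost ?b) + 1 + bcost ?b) (\<lambda>s'. (\<exists>i. ?I i s') \<and> \<not> bval ?b s')"
  proof (rule runs_While)
   fix i s' assume I: "?I i s'" and b: "bval ?b s'"
   have im: "i < m" using I b e[of s'] by simp
   have "runs \<omega> p s' (T i) (\<lambda>s''. J (Suc i) s'' \<and> same p s' s'')"
    using I im by (intro runs_same step) auto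
   then have "runs \<omega> ?p s' (T i + csize (NAssign v (NAdd (NVar v) (NConst 1)))) (?I (Suc i))"
   proof (rule runs_Seq)
    fix s'' assume s'': "J (Suc i) s'' \<and> same p s' s''"
    have "same (For v e p) s s''" using s'' I by (auto simp: same_def)
    moreover have "nvar s'' v = i" using s'' I v same_nvar by metis
    ultimately show "runs \<omega> (NAssign v (NAdd (NVar v) (NConst 1))) s'' (csize (NAssign v (NAdd (NVar v) (NConst 1)))) (?I (Suc i))"
     using s'' im indep[of "Suc i" s''] sv by (intro runs_wp) auto
   qed
   then have "runs \<omega> ?p s' (T i + 4) (?I (Suc i))"
    by (rule runs_mono) auto
   then show "i < m \<and> runs \<omega> ?p s' (T i + 4) (?I (Suc i))"
    using im by blast
  next
   show "?I 0 (s\<lparr>nvar := (nvar s)(v := 0)\<rparr>)" using start sv[OF same_refl] by simp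
  qed simp
  have "runs \<omega> (NAssign v (NConst 0)) s 2 (\<lambda>s'. s' = s\<lparr>nvar := (nvar s)(v := 0)\<rparr>)"
   using runs_wp[of \<omega> "NAssign v (NConst 0)" "\<lambda>s'. s' = s\<lparr>nvar := (nvar s)(v := 0)\<rparr>" s] by (simp add: numeral_2_eq_2)
  then have "runs \<omega> (Seq (NAssign v (NConst 0)) (While ?b ?p)) s
    (2 + ((\<Sum>i\<in>{0..<m}. (T i + 4) + 1 + bcost ?b) + 1 + bcost ?b)) (\<lambda>s'. (\<exists>i. ?I i s') \<and> \<not> bval ?b s')"
   by (rule runs_Seq) (use W in \<open>simp only:\<close>)
  then have "runs \<omega> (For v e p) s (2 + ((\<Sum>i\<in>{0..<m}. (T i + 4) + 1 + bcost ?b) + 1 + bcost ?b)) (\<lambda>s'. (\<exists>i. ?I i s') \<and> \<not> bval ?b s')"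
   by (simp only: For_def)
  then show ?thesis
  proof (rule runs_mono)
   have "(\<Sum>i\<in>{0..<m}. (T i + 4) + 1 + bcost ?b) = (\<Sum>i<m. T i) + m * (ncost e + 7)"
    by (simp add: sum.distrib atLeast0LessThan algebra_simps)
   then show "2 + ((\<Sum>i\<in>{0..<m}. (T i + 4) + 1 + bcost ?b) + 1 + bcost ?b) \<le> (\<Sum>i<m. T i) + (m + 1) * (ncost e + 8)"
    by (simp add: algebra_simps)
   fix s' assume s': "(\<exists>i. ?I i s') \<and> \<not> bval ?b s'"
   then obtain i where i: "?I i s'" by blast
   then have "i = m" using s' e[of s'] by simp
   then show "J m s' \<and> same (For v e p) s s'" using i by simp
  qed
qed

lemma runs_For_sum:
  assumes "v \<notin> wn p" "w \<notin> insert v (wn p)" "nvar s w = m"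
   and "J 0 (s\<lparr>nvar := (nvar s)(v := 0)\<rparr>)"
   and "\<And>i s'. i < m ==> same (For v (NVar w) p) s s' ==> nvar s' v = i ==> J i s' ==> runs \<omega> p s' (T i) (J (Suc i))"
   and "\<And>i s' x. J i s' ==> J i (s'\<lparr>nvar := (nvar s')(v := x)\<rparr>)"
  shows "runs \<omega> (For v (NVar w) p) s ((\<Sum>i<m. T i) + (m + 1) * 9) (\<lambda>s'. J m s' \<and> same (For v (NVar w) p) s s')"
  using runs_For_sum_exp[of v p "NVar w" s m J] assms by (simp add: same_def)

lemma runs_For:
  assumes "v \<notin> wn p" "w \<notin> insert v (wn p)" "nvar s w = m"
   and "J 0 (s\<lparr>nvar := (nvar s)(v := 0)\<rparr>)"
   and "\<And>i s'. i < m ==> same (For v (NVar w) p) s s' ==> nvar s' v = i ==> J i s' ==> runs \<omega> p s' T (J (Suc i))"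
   and "\<And>i s' x. J i s' ==> J i (s'\<lparr>nvar := (nvar s')(v := x)\<rparr>)"
  shows "runs \<omega> (For v (NVar w) p) s ((m + 1) * (T + 9)) (\<lambda>s'. J m s' \<and> same (For v (NVar w) p) s s')"
  using runs_For_sum[OF assms] by (rule runs_mono) (auto simp: algebra_simps)

lemma runs_For_wp:
  assumes "v \<notin> wn p" "w \<notin> insert v (wn p)" "nvar s w = m"
   and "J 0 (s\<lparr>nvar := (nvar s)(v := 0)\<rparr>)"
   and "\<And>i s'. i < m ==> same (For v (NVar w) p) s s' ==> nvar s' v = i ==> J i s' ==> wp \<omega> p (J (Suc i)) s'"
   and "\<And>i s' x. J i s' ==> J i (s'\<lparr>nvar := (nvar s')(v := x)\<rparr>)"
   and "csize p + 9 \<le> T"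
  shows "runs \<omega> (For v (NVar w) p) s ((m + 1) * T) (\<lambda>s'. J m s' \<and> same (For v (NVar w) p) s s')"
proof (rule runs_mono)
  show "runs \<omega> (For v (NVar w) p) s ((m + 1) * (csize p + 9)) (\<lambda>s'. J m s' \<and> same (For v (NVar w) p) s s')"
   by (rule runs_For[OF assms(1-4) runs_wp[OF assms(5)] assms(6)])
  show "(m + 1) * (csize p + 9) \<le> (m + 1) * T"
   using assms(7) by (rule mult_le_mono2)
qed

lemma runs_Seq_wp:
  assumes "wp \<omega> p Q s" "\<And>s'. Q s' ==> same p s s' ==> runs \<omega> q s' T Q'" "csize p + T \<le> T'"
  shows "runs \<omega> (Seq p q) s T' Q'"
  by (rule runs_mono[OF runs_Seq[OF runs_same[OF runs_wp[OF assms(1)]]]]) (use assms in auto)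

lemma runs_Seq_same:
  assumes "runs \<omega> p s T Q" "\<And>s'. Q s' ==> same p s s' ==> runs \<omega> q s' T' Q'" "T + T' \<le> T''"
  shows "runs \<omega> (Seq p q) s T'' Q'"
  by (rule runs_mono[OF runs_Seq[OF runs_same[OF assms(1)]]]) (use assms in auto)

text \<open>Memory layout. Real arrays: 0 the points, 1 the query, 2 the answer, 4 the centroid (row
  0) and the weights (row 1), 5 the random numbers with one row per block, 7 the stages of the
  transform, 8 the coordinates of the first point of a pair, 9 one row of projected coordinates per
  direction, 10 exact distances. Arrays of naturals: 0 the owners of the slots, 1 the numbers of
  slots, 2 the test pairs, 3 the merge passes, 4 the sorted order of each direction. Real variables:
  0 is \<epsilon>, 1 is \<kappa> = K/\<epsilon>^2, 2 the normalisation of the estimate, 4 the total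
  weight. Variable 13 is the first random row of the candidate under test, 12 that of the best one
  so far.\<close>

abbreviation (input) "v_n \<equiv> (0 :: name)"
abbreviation (input) "v_d \<equiv> (1 :: name)"
abbreviation (input) "v_L \<equiv> (2 :: name)"
abbreviation (input) "v_D \<equiv> (3 :: name)"
abbreviation (input) "v_l \<equiv> (4 :: name)"
abbreviation (input) "v_rho \<equiv> (5 :: name)"
abbreviation (input) "v_N \<equiv> (6 :: name)"
abbreviation (input) "v_m \<equiv> (7 :: name)"
abbreviation (input) "v_mode \<equiv> (8 :: name)"
abbreviation (input) "v_PW \<equiv> (9 :: name)"
abbreviation (input) "v_half \<equiv> (10 :: name)"
abbreviation (input) "v_best \<equiv> (12 :: name)"
abbreviation (input) "v_rb \<equiv> (13 :: name)"
abbreviation (input) "v_R \<equiv> (14 :: name)"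
abbreviation (input) "v_K \<equiv> (15 :: name)"

section \<open>Programs for the transform and the projection\<close>

abbreviation (input) FWHT_STEP :: com where
  "FWHT_STEP \<equiv> Seq (RStore 7 (NAdd (NVar 20) (NConst 1)) (NVar 21)
     (RAdd (RRead 7 (NVar 20) (NAdd (NVar 21) (NVar 21))) (RRead 7 (NVar 20) (NAdd (NAdd (NVar 21) (NVar 21)) (NConst 1)))))
    (RStore 7 (NAdd (NVar 20) (NConst 1)) (NAdd (NVar v_half) (NVar 21))
     (RSub (RRead 7 (NVar 20) (NAdd (NVar 21) (NVar 21))) (RRead 7 (NVar 20) (NAdd (NAdd (NVar 21) (NVar 21)) (NConst 1)))))"

text \<open>Row t of array 7 receives the vector after t stages, so a stage never overwrites its own
  input.\<close>

definition FWHT :: com where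
  "FWHT = For 20 (NVar v_l) (For 21 (NVar v_half)
   FWHT_STEP)"

lemma FWHT_sets [simp]: "wn FWHT = {20, 21}" "wr FWHT = {}" "wna FWHT = {}" "wra FWHT = {7}" "sample_free FWHT"
  by (auto simp: FWHT_def)

lemma runs_FWHT:
  assumes l: "nvar s v_l = l" and h: "nvar s v_half = 2 ^ l div 2"
  shows "runs \<omega> FWHT s ((l + 1) * ((2 ^ l + 1) * 50 + 10))
   (\<lambda>s'. (\<forall>t\<le>l. \<forall>j<2^l. rarr s' 7 t j = fw (2 ^ l div 2) t (rarr s 7 0) j) \<and> same FWHT s s')"
proof -
  define h where "h = (2::nat) ^ l div 2"
  have h2: "l \<noteq> 0 ==> (2::nat) ^ l = 2 * h" by (cases l) (auto simp: h_def)
  define J where "J t s' \<longleftrightarrow> (\<forall>t'\<le>t. \<forall>j<2^l. rarr s' 7 t' j = fw h t' (rarr s 7 0) j)" for t and s' :: state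
  let ?inner = "For 21 (NVar v_half)
   FWHT_STEP"
  have "runs \<omega> (For 20 (NVar v_l) ?inner) s ((l + 1) * ((h + 1) * 50 + 9))
   (\<lambda>s'. J l s' \<and> same (For 20 (NVar v_l) ?inner) s s')"
  proof (rule runs_For)
   show "J 0 (s\<lparr>nvar := (nvar s)(20 := 0)\<rparr>)" by (simp add: J_def)
   show "J i (s'\<lparr>nvar := (nvar s')(20 := x)\<rparr>)" if "J i s'" for i s' x
    using that by (simp add: J_def)
   fix t s1 assume t: "t < l" and s1: "same (For 20 (NVar v_l) ?inner) s s1" "nvar s1 20 = t" "J t s1"
   have h1: "nvar s1 v_half = h" using sameD[OF s1(1)] h by (simp add: h_def)
   have D: "2 ^ l = 2 * h" using t h2 by simp
   define J' where "J' j s' \<longleftrightarrow> J t s' \<and>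
     (\<forall>j'<j. rarr s' 7 (Suc t) j' = fw h (Suc t) (rarr s 7 0) j' \<and> rarr s' 7 (Suc t) (h + j') = fw h (Suc t) (rarr s 7 0) (h + j'))"
    for j and s' :: state
   have "runs \<omega> ?inner s1 ((h + 1) * (csize FWHT_STEP + 9))
    (\<lambda>s'. J' h s' \<and> same ?inner s1 s')"
   proof (rule runs_For)
    show "J' 0 (s1\<lparr>nvar := (nvar s1)(21 := 0)\<rparr>)" using s1 by (simp add: J'_def J_def)
    show "J' i (s'\<lparr>nvar := (nvar s')(21 := x)\<rparr>)" if "J' i s'" for i s' x
     using that by (simp add: J'_def J_def)
    fix j s2 assume j: "j < h" and s2: "same ?inner s1 s2" "nvar s2 21 = j" "J' j s2"
    have v: "nvar s2 20 = t" "nvar s2 v_half = h" using sameD[OF s2(1)] s1 h1 by auto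
    have r: "rarr s2 7 t (j + j) = fw h t (rarr s 7 0) (2 * j)"
     "rarr s2 7 t (Suc (j + j)) = fw h t (rarr s 7 0) (Suc (2 * j))"
     using s2(3) j D by (auto simp: J'_def J_def mult_2)
    show "runs \<omega> FWHT_STEP
     s2 (csize FWHT_STEP) (J' (Suc j))"
     using s2(3) j
     by (intro runs_wp) (auto simp: v s2(2) r J'_def J_def upd2_apply less_Suc_eq fw_step_def)
   qed (use h1 in auto)
   then show "runs \<omega> ?inner s1 ((h + 1) * 50) (J (Suc t))"
   proof (rule runs_mono)
    fix s' assume s': "J' h s' \<and> same ?inner s1 s'"
    have "rarr s' 7 (Suc t) j = fw h (Suc t) (rarr s 7 0) j" if "j < 2 ^ l" for j
     using s' that D unfolding J'_def
     by (cases "j < h") (auto dest!: spec[of _ "j - h"])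
    then show "J (Suc t) s'" using s' by (auto simp: J'_def J_def le_Suc_eq)
   qed simp
  qed (use l in auto)
  then show ?thesis
   unfolding FWHT_def
  proof (rule runs_mono)
   have "h \<le> 2 ^ l" by (simp add: h_def)
   then show "(l + 1) * ((h + 1) * 50 + 9) \<le> (l + 1) * ((2 ^ l + 1) * 50 + 10)"
    by (intro mult_le_mono) auto
  qed (simp add: J_def h_def)
qed

abbreviation (input) SIGN_STEP :: com where
  "SIGN_STEP \<equiv> If (RLess (RRead 5 (NVar 31) (NVar 22)) (RConst 0))
     (RStore 7 (NConst 0) (NVar 22) (RSub (RConst 0) (RRead 0 (NVar 30) (NVar 22))))
     (RStore 7 (NConst 0) (NVar 22) (RRead 0 (NVar 30) (NVar 22)))"

abbreviation (input) SCALE_STEP :: com where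
  "SCALE_STEP \<equiv> RStore 7 (NConst 0) (NVar 22) (RMul (RRead 5 (NVar 31) (NAdd (NVar v_D) (NVar 22))) (RRead 7 (NVar v_l) (NVar 22)))"

definition PROJ :: com where
  "PROJ = Seq (For 22 (NVar v_D) SIGN_STEP)
   (Seq FWHT (Seq (For 22 (NVar v_D)
     SCALE_STEP)
    FWHT))"

lemma PROJ_sets [simp]: "wn PROJ = {20, 21, 22}" "wr PROJ = {}" "wna PROJ = {}" "wra PROJ = {7}" "sample_free PROJ"
  by (auto simp: PROJ_def)

abbreviation proj_time :: "nat => nat" where
  "proj_time l \<equiv> 200 * ((l + 1) * (2 ^ l + 1))"

text \<open>With \<open>l = 0\<close> the transformed vector and its input are the same row of the work array, which
  is overwritten in place; this is harmless because entry \<open>c\<close> is read just before it is written.\<close>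

lemma runs_PROJ:
  assumes s: "nvar s v_l = l" "nvar s v_D = 2 ^ l" "nvar s v_half = 2 ^ l div 2"
  shows "runs \<omega> PROJ s (proj_time l)
   (\<lambda>s'. (\<forall>a<2^l. rarr s' 7 l a = proj l (rarr s 5 (nvar s 31)) (rarr s 0 (nvar s 30)) a) \<and> same PROJ s s')"
proof -
  define g where "g = rarr s 5 (nvar s 31)"
  define x where "x = rarr s 0 (nvar s 30)"
  let ?f = "(l + 1) * ((2 ^ l + 1) * 50 + 10)"
  have "runs \<omega> PROJ s (((2 ^ l + 1) * 30) + (?f + (((2 ^ l + 1) * 30) + ?f)))
   (\<lambda>s'. \<forall>a<2^l. rarr s' 7 l a = proj l g x a)"
   unfolding PROJ_def
  proof (rule runs_Seq_same)
   let ?p = "SIGN_STEP"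
   show "runs \<omega> (For 22 (NVar v_D) ?p) s ((2 ^ l + 1) * 30)
     (\<lambda>s'. (\<forall>c<2^l. rarr s' 7 0 c = sg (g c) * x c) \<and> same (For 22 (NVar v_D) ?p) s s')"
   proof (rule runs_For_wp)
    fix i s' assume h: "same (For 22 (NVar v_D) ?p) s s'" and "nvar s' 22 = i" "\<forall>c<i. rarr s' 7 0 c = sg (g c) * x c"
    then show "wp \<omega> ?p (\<lambda>s'. \<forall>c<Suc i. rarr s' 7 0 c = sg (g c) * x c) s'"
     by (auto simp: sameD[OF h] g_def x_def upd2_apply less_Suc_eq sg_def)
   qed (auto simp: s)
   fix s1 assume s1: "(\<forall>c<2^l. rarr s1 7 0 c = sg (g c) * x c) \<and> same (For 22 (NVar v_D) ?p) s s1"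
   have v1: "nvar s1 v_l = l" "nvar s1 v_D = 2 ^ l" "nvar s1 v_half = 2 ^ l div 2" "nvar s1 31 = nvar s 31" "rarr s1 5 = rarr s 5"
    using s by (auto simp: sameD[OF conjunct2[OF s1]])
   show "runs \<omega> (Seq FWHT (Seq (For 22 (NVar v_D)
     SCALE_STEP)
    FWHT)) s1 (?f + (((2 ^ l + 1) * 30) + ?f)) (\<lambda>s'. \<forall>a<2^l. rarr s' 7 l a = proj l g x a)"
   proof (rule runs_Seq_same[OF runs_FWHT[OF v1(1,3)]])
    fix s2 assume s2: "(\<forall>t\<le>l. \<forall>j<2^l. rarr s2 7 t j = fw (2 ^ l div 2) t (rarr s1 7 0) j) \<and> same FWHT s1 s2"
    have v2: "nvar s2 v_l = l" "nvar s2 v_D = 2 ^ l" "nvar s2 v_half = 2 ^ l div 2" "nvar s2 31 = nvar s 31" "rarr s2 5 = rarr s 5"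
     using v1 by (auto simp: sameD[OF conjunct2[OF s2]])
    have w2: "rarr s2 7 l c = spread l g x c" if "c < 2 ^ l" for c
    proof -
     have "rarr s2 7 l c = fw (2 ^ l div 2) l (rarr s1 7 0) c" using s2 that by blast
     also have "... = fw (2 ^ l div 2) l (\<lambda>c. sg (g c) * x c) c" using that s1 by (intro fw_cong) auto
     finally show ?thesis by (simp add: spread_def)
    qed
    let ?q = "SCALE_STEP"
    let ?J = "\<lambda>i s'. (\<forall>c<i. rarr s' 7 0 c = g (2 ^ l + c) * spread l g x c) \<and> (\<forall>c. i \<le> c --> c < 2 ^ l --> rarr s' 7 l c = spread l g x c)"
    show "runs \<omega> (Seq (For 22 (NVar v_D) ?q) FWHT) s2 (((2 ^ l + 1) * 30) + ?f) (\<lambda>s'. \<forall>a<2^l. rarr s' 7 l a = proj l g x a)"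
    proof (rule runs_Seq_same)
     show "runs \<omega> (For 22 (NVar v_D) ?q) s2 ((2 ^ l + 1) * 30) (\<lambda>s'. ?J (2 ^ l) s' \<and> same (For 22 (NVar v_D) ?q) s2 s')"
     proof (rule runs_For_wp[where J = ?J])
      fix i s' assume h: "same (For 22 (NVar v_D) ?q) s2 s'" and "i < 2 ^ l" "nvar s' 22 = i" "?J i s'"
      then show "wp \<omega> ?q (?J (Suc i)) s'"
       by (auto simp: v2 sameD[OF h] g_def upd2_apply less_Suc_eq)
     qed (auto simp: v2 w2)
     fix s3 assume s3: "?J (2 ^ l) s3 \<and> same (For 22 (NVar v_D) ?q) s2 s3"
     have v3: "nvar s3 v_l = l" "nvar s3 v_half = 2 ^ l div 2"
      using v2 by (auto simp: sameD[OF conjunct2[OF s3]])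
     show "runs \<omega> FWHT s3 ?f (\<lambda>s'. \<forall>a<2^l. rarr s' 7 l a = proj l g x a)"
     proof (rule runs_mono[OF runs_FWHT[OF v3]])
      fix s4 assume s4: "(\<forall>t\<le>l. \<forall>j<2^l. rarr s4 7 t j = fw (2 ^ l div 2) t (rarr s3 7 0) j) \<and> same FWHT s3 s4"
      show "\<forall>a<2^l. rarr s4 7 l a = proj l g x a"
      proof (intro allI impI)
       fix a :: nat assume a: "a < 2 ^ l"
       have "rarr s4 7 l a = fw (2 ^ l div 2) l (rarr s3 7 0) a" using s4 a by blast
       also have "... = proj l g x a" unfolding proj_def using a s3 by (intro fw_cong) auto
       finally show "rarr s4 7 l a = proj l g x a" .
      qed
     qed simp
    qed simp
   qed simp
  qed simp
  then have "runs \<omega> PROJ s (((2 ^ l + 1) * 30) + (?f + (((2 ^ l + 1) * 30) + ?f)))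
   (\<lambda>s'. (\<forall>a<2^l. rarr s' 7 l a = proj l g x a) \<and> same PROJ s s')"
   by (rule runs_same)
  then show ?thesis
   by (rule runs_mono) (auto simp: g_def x_def algebra_simps)
qed

section \<open>Exact and estimated distance of one pair\<close>

definition DIST :: com where
  "DIST = Seq (RAssign 10 (RConst 0)) (Seq (For 23 (NVar v_d) (RAssign 10 (RAdd (RVar 10)
    (RMul (RSub (RRead 0 (NVar 33) (NVar 23)) (RRead 0 (NVar 34) (NVar 23)))
       (RSub (RRead 0 (NVar 33) (NVar 23)) (RRead 0 (NVar 34) (NVar 23)))))))
   (RAssign 10 (RSqrt (RVar 10))))"

lemma DIST_sets [simp]: "wn DIST = {23}" "wr DIST = {10}" "wna DIST = {}" "wra DIST = {}" "sample_free DIST"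
  by (auto simp: DIST_def)

lemma runs_DIST:
  assumes s: "nvar s v_d = d"
  shows "runs \<omega> DIST s ((d + 1) * 50)
   (\<lambda>s'. rvar s' 10 = dst d (rarr s 0) (nvar s 33) (nvar s 34) \<and> same DIST s s')"
proof -
  define f where "f c = (rarr s 0 (nvar s 33) c - rarr s 0 (nvar s 34) c)\<^sup>2" for c
  have "runs \<omega> DIST s (2 + ((d + 1) * 40 + 3)) (\<lambda>s'. rvar s' 10 = dst d (rarr s 0) (nvar s 33) (nvar s 34))"
   unfolding DIST_def
  proof (rule runs_Seq_wp)
   show "wp \<omega> (RAssign 10 (RConst 0)) (\<lambda>s'. rvar s' 10 = 0) s" by simp
   let ?p = "RAssign 10 (RAdd (RVar 10)
    (RMul (RSub (RRead 0 (NVar 33) (NVar 23)) (RRead 0 (NVar 34) (NVar 23)))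
       (RSub (RRead 0 (NVar 33) (NVar 23)) (RRead 0 (NVar 34) (NVar 23)))))"
   fix s1 assume s1: "rvar s1 10 = 0" "same (RAssign 10 (RConst 0)) s s1"
   show "runs \<omega> (Seq (For 23 (NVar v_d) ?p) (RAssign 10 (RSqrt (RVar 10)))) s1 ((d + 1) * 40 + 3)
    (\<lambda>s'. rvar s' 10 = dst d (rarr s 0) (nvar s 33) (nvar s 34))"
   proof (rule runs_Seq_same)
    show "runs \<omega> (For 23 (NVar v_d) ?p) s1 ((d + 1) * 40) (\<lambda>s'. rvar s' 10 = (\<Sum>c<d. f c) \<and> same (For 23 (NVar v_d) ?p) s1 s')"
    proof (rule runs_For_wp)
     fix i s' assume h: "same (For 23 (NVar v_d) ?p) s1 s'" and "nvar s' 23 = i" "rvar s' 10 = (\<Sum>c<i. f c)"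
     then show "wp \<omega> ?p (\<lambda>s'. rvar s' 10 = (\<Sum>c<Suc i. f c)) s'"
      using s1 by (simp add: sameD[OF h] sameD[OF s1(2)] f_def power2_eq_square)
    qed (use s s1 in \<open>auto simp: sameD[OF s1(2)]\<close>)
    fix s2 assume "rvar s2 10 = (\<Sum>c<d. f c) \<and> same (For 23 (NVar v_d) ?p) s1 s2"
    then show "runs \<omega> (RAssign 10 (RSqrt (RVar 10))) s2 (csize (RAssign 10 (RSqrt (RVar 10)))) (\<lambda>s'. rvar s' 10 = dst d (rarr s 0) (nvar s 33) (nvar s 34))"
     by (intro runs_wp) (simp add: dst_def f_def)
   qed simp
  qed simp
  then show ?thesis
   by (rule runs_mono[OF runs_same]) auto
qed

text \<open>Both projections are recomputed for each pair. All candidates together are tested on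
  about n pairs only, whereas projecting all points for every candidate would cost a factor L
  more.\<close>

definition EST :: com where
  "EST = Seq (RAssign 11 (RConst 0)) (Seq (NAssign 31 (NVar v_rb)) (For 24 (NVar v_N)
   (Seq (NAssign 30 (NVar 33)) (Seq PROJ
   (Seq (For 25 (NVar v_rho) (RStore 8 (NConst 0) (NVar 25) (RRead 7 (NVar v_l) (NVar 25))))
   (Seq (NAssign 30 (NVar 34)) (Seq PROJ
   (Seq (For 26 (NVar v_rho) (If (RLess (RRead 8 (NConst 0) (NVar 26)) (RRead 7 (NVar v_l) (NVar 26)))
     (RAssign 11 (RAdd (RVar 11) (RSub (RRead 7 (NVar v_l) (NVar 26)) (RRead 8 (NConst 0) (NVar 26)))))
     (RAssign 11 (RAdd (RVar 11) (RSub (RRead 8 (NConst 0) (NVar 26)) (RRead 7 (NVar v_l) (NVar 26)))))))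
   (NAssign 31 (NAdd (NVar 31) (NConst 1)))))))))))"

lemma EST_sets [simp]: "wn EST = {20, 21, 22, 24, 25, 26, 30, 31}" "wr EST = {11}" "wna EST = {}" "wra EST = {7, 8}" "sample_free EST"
  by (auto simp: EST_def)

lemma runs_EST:
  assumes s: "nvar s v_l = l" "nvar s v_D = 2 ^ l" "nvar s v_half = 2 ^ l div 2" "nvar s v_rho = \<rho>" "nvar s v_N = N"
   and \<rho>: "\<rho> \<le> 2 ^ l"
  shows "runs \<omega> EST s ((N + 1) * (4 * proj_time l))
   (\<lambda>s'. rvar s' 11 = (\<Sum>b<N. \<Sum>a<\<rho>. \<bar>proj l (rarr s 5 (nvar s v_rb + b)) (rarr s 0 (nvar s 33)) a -
    proj l (rarr s 5 (nvar s v_rb + b)) (rarr s 0 (nvar s 34)) a\<bar>) \<and> same EST s s')"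
proof -
  define P where "P i b a = proj l (rarr s 5 (nvar s v_rb + b)) (rarr s 0 (nvar s i)) a" for i b a
  let ?c1 = "For 25 (NVar v_rho) (RStore 8 (NConst 0) (NVar 25) (RRead 7 (NVar v_l) (NVar 25)))"
  let ?q = "If (RLess (RRead 8 (NConst 0) (NVar 26)) (RRead 7 (NVar v_l) (NVar 26)))
     (RAssign 11 (RAdd (RVar 11) (RSub (RRead 7 (NVar v_l) (NVar 26)) (RRead 8 (NConst 0) (NVar 26)))))
     (RAssign 11 (RAdd (RVar 11) (RSub (RRead 8 (NConst 0) (NVar 26)) (RRead 7 (NVar v_l) (NVar 26)))))"
  let ?c2 = "For 26 (NVar v_rho) ?q"
  let ?body = "Seq (NAssign 30 (NVar 33)) (Seq PROJ (Seq ?c1 (Seq (NAssign 30 (NVar 34)) (Seq PROJ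
   (Seq ?c2 (NAssign 31 (NAdd (NVar 31) (NConst 1))))))))"
  define J where "J b s' \<longleftrightarrow> rvar s' 11 = (\<Sum>b<b. \<Sum>a<\<rho>. \<bar>P 33 b a - P 34 b a\<bar>) \<and> nvar s' 31 = nvar s v_rb + b" for b and s' :: state
  have body: "runs \<omega> ?body s1 (2 + (proj_time l + ((2 ^ l + 1) * 20 + (2 + (proj_time l + ((2 ^ l + 1) * 40 + 4)))))) (J (Suc b))"
   if s1: "same EST s s1" "J b s1" for s1 b
  proof -
   have v1: "nvar s1 v_l = l" "nvar s1 v_D = 2 ^ l" "nvar s1 v_half = 2 ^ l div 2" "nvar s1 v_rho = \<rho>"
    "rarr s1 5 = rarr s 5" "rarr s1 0 = rarr s 0" "nvar s1 33 = nvar s 33" "nvar s1 34 = nvar s 34"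
    using s by (auto simp: sameD[OF s1(1)])
   have J1: "nvar s1 31 = nvar s v_rb + b" using s1(2) by (simp add: J_def)
   show ?thesis
   proof (rule runs_Seq_wp)
    show "wp \<omega> (NAssign 30 (NVar 33)) (\<lambda>s'. nvar s' 30 = nvar s 33) s1" by (simp add: v1)
    fix s2 assume "nvar s2 30 = nvar s 33" and s2: "same (NAssign 30 (NVar 33)) s1 s2"
    then have v2: "nvar s2 v_l = l" "nvar s2 v_D = 2 ^ l" "nvar s2 v_half = 2 ^ l div 2" "nvar s2 v_rho = \<rho>"
     "rarr s2 5 = rarr s 5" "rarr s2 0 = rarr s 0" "nvar s2 34 = nvar s 34" "nvar s2 30 = nvar s 33" "nvar s2 31 = nvar s v_rb + b"
     "rvar s2 11 = rvar s1 11"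
     using v1 J1 by (auto simp: sameD[OF s2])
    show "runs \<omega> (Seq PROJ (Seq ?c1 (Seq (NAssign 30 (NVar 34)) (Seq PROJ (Seq ?c2 (NAssign 31 (NAdd (NVar 31) (NConst 1)))))))) s2
     (proj_time l + ((2 ^ l + 1) * 20 + (2 + (proj_time l + ((2 ^ l + 1) * 40 + 4))))) (J (Suc b))"
    proof (rule runs_Seq_same[OF runs_PROJ[OF v2(1-3)]])
     fix s3 assume h3: "(\<forall>a<2^l. rarr s3 7 l a = proj l (rarr s2 5 (nvar s2 31)) (rarr s2 0 (nvar s2 30)) a) \<and> same PROJ s2 s3"
     have s3: "same PROJ s2 s3" using h3 by simp
     have w3: "rarr s3 7 l a = P 33 b a" if "a < 2 ^ l" for a using h3 that by (simp add: v2 P_def)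
     have v3: "nvar s3 v_l = l" "nvar s3 v_D = 2 ^ l" "nvar s3 v_half = 2 ^ l div 2" "nvar s3 v_rho = \<rho>"
      "rarr s3 5 = rarr s 5" "rarr s3 0 = rarr s 0" "nvar s3 34 = nvar s 34" "nvar s3 31 = nvar s v_rb + b" "rvar s3 11 = rvar s1 11"
      using v2 by (auto simp: sameD[OF s3])
     show "runs \<omega> (Seq ?c1 (Seq (NAssign 30 (NVar 34)) (Seq PROJ (Seq ?c2 (NAssign 31 (NAdd (NVar 31) (NConst 1))))))) s3
      ((2 ^ l + 1) * 20 + (2 + (proj_time l + ((2 ^ l + 1) * 40 + 4)))) (J (Suc b))"
     proof (rule runs_Seq_same)
      show "runs \<omega> ?c1 s3 ((\<rho> + 1) * 20) (\<lambda>s'. (\<forall>a<\<rho>. rarr s' 8 0 a = P 33 b a) \<and> same ?c1 s3 s')"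
      proof (rule runs_For_wp)
       fix i s' assume h: "same ?c1 s3 s'" and "i < \<rho>" "nvar s' 25 = i" "\<forall>a<i. rarr s' 8 0 a = P 33 b a"
       then show "wp \<omega> (RStore 8 (NConst 0) (NVar 25) (RRead 7 (NVar v_l) (NVar 25))) (\<lambda>s'. \<forall>a<Suc i. rarr s' 8 0 a = P 33 b a) s'"
        using \<rho> w3 by (auto simp: sameD[OF h] v3 upd2_apply less_Suc_eq)
      qed (auto simp: v3)
      show "(\<rho> + 1) * 20 + (2 + (proj_time l + ((2 ^ l + 1) * 40 + 4))) \<le> (2 ^ l + 1) * 20 + (2 + (proj_time l + ((2 ^ l + 1) * 40 + 4)))"
       using \<rho> by simp
      fix s4 assume h4: "(\<forall>a<\<rho>. rarr s4 8 0 a = P 33 b a) \<and> same ?c1 s3 s4"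
      have s4: "same ?c1 s3 s4" using h4 by simp
      have v4: "nvar s4 v_l = l" "nvar s4 v_D = 2 ^ l" "nvar s4 v_half = 2 ^ l div 2" "nvar s4 v_rho = \<rho>"
       "rarr s4 5 = rarr s 5" "rarr s4 0 = rarr s 0" "nvar s4 34 = nvar s 34" "nvar s4 31 = nvar s v_rb + b" "rvar s4 11 = rvar s1 11"
       using v3 by (auto simp: sameD[OF s4])
      show "runs \<omega> (Seq (NAssign 30 (NVar 34)) (Seq PROJ (Seq ?c2 (NAssign 31 (NAdd (NVar 31) (NConst 1)))))) s4
       (2 + (proj_time l + ((2 ^ l + 1) * 40 + 4))) (J (Suc b))"
      proof (rule runs_Seq_wp)
       show "wp \<omega> (NAssign 30 (NVar 34)) (\<lambda>s'. nvar s' 30 = nvar s 34) s4" by (simp add: v4)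
       fix s5 assume "nvar s5 30 = nvar s 34" and s5: "same (NAssign 30 (NVar 34)) s4 s5"
       then have v5: "nvar s5 v_l = l" "nvar s5 v_D = 2 ^ l" "nvar s5 v_half = 2 ^ l div 2" "nvar s5 v_rho = \<rho>"
        "rarr s5 5 = rarr s 5" "rarr s5 0 = rarr s 0" "nvar s5 30 = nvar s 34" "nvar s5 31 = nvar s v_rb + b" "rvar s5 11 = rvar s1 11"
        "rarr s5 8 = rarr s4 8"
        using v4 by (auto simp: sameD[OF s5])
       show "runs \<omega> (Seq PROJ (Seq ?c2 (NAssign 31 (NAdd (NVar 31) (NConst 1))))) s5
        (proj_time l + ((2 ^ l + 1) * 40 + 4)) (J (Suc b))"
       proof (rule runs_Seq_same[OF runs_PROJ[OF v5(1-3)]])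
        fix s6 assume h6: "(\<forall>a<2^l. rarr s6 7 l a = proj l (rarr s5 5 (nvar s5 31)) (rarr s5 0 (nvar s5 30)) a) \<and> same PROJ s5 s6"
        have s6: "same PROJ s5 s6" using h6 by simp
        have w6: "rarr s6 7 l a = P 34 b a" "rarr s6 8 0 a = P 33 b a" if "a < \<rho>" for a
         using h6 h4 that \<rho> by (auto simp: v5 P_def sameD[OF s6])
        have v6: "nvar s6 v_l = l" "nvar s6 v_rho = \<rho>" "nvar s6 31 = nvar s v_rb + b" "rvar s6 11 = rvar s1 11"
         using v5 by (auto simp: sameD[OF s6])
        show "runs \<omega> (Seq ?c2 (NAssign 31 (NAdd (NVar 31) (NConst 1)))) s6 ((2 ^ l + 1) * 40 + 4) (J (Suc b))"
        proof (rule runs_Seq_same)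
         show "runs \<omega> ?c2 s6 ((\<rho> + 1) * 40) (\<lambda>s'. rvar s' 11 = rvar s1 11 + (\<Sum>a<\<rho>. \<bar>P 33 b a - P 34 b a\<bar>) \<and> same ?c2 s6 s')"
         proof (rule runs_For_wp)
          fix i s' assume h: "same ?c2 s6 s'" and "i < \<rho>" "nvar s' 26 = i" "rvar s' 11 = rvar s1 11 + (\<Sum>a<i. \<bar>P 33 b a - P 34 b a\<bar>)"
          then show "wp \<omega> ?q (\<lambda>s'. rvar s' 11 = rvar s1 11 + (\<Sum>a<Suc i. \<bar>P 33 b a - P 34 b a\<bar>)) s'"
           by (auto simp: sameD[OF h] v6 w6)
         qed (auto simp: v6)
         show "(\<rho> + 1) * 40 + 4 \<le> (2 ^ l + 1) * 40 + 4" using \<rho> by simp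
         fix s7 assume h7: "rvar s7 11 = rvar s1 11 + (\<Sum>a<\<rho>. \<bar>P 33 b a - P 34 b a\<bar>) \<and> same ?c2 s6 s7"
         have "runs \<omega> (NAssign 31 (NAdd (NVar 31) (NConst 1))) s7 (csize (NAssign 31 (NAdd (NVar 31) (NConst 1)))) (J (Suc b))"
          using s1(2) v6 conjunct1[OF h7] by (intro runs_wp) (auto simp: J_def sameD[OF conjunct2[OF h7]])
         then show "runs \<omega> (NAssign 31 (NAdd (NVar 31) (NConst 1))) s7 4 (J (Suc b))"
          by (rule runs_mono) auto
        qed
       qed simp
      qed simp
     qed
    qed simp
   qed simp
  qed
  have "runs \<omega> EST s (4 + (N + 1) * (2 * proj_time l + ((2 ^ l + 1) * 60 + 17))) (\<lambda>s'. rvar s' 11 = (\<Sum>b<N. \<Sum>a<\<rho>. \<bar>P 33 b a - P 34 b a\<bar>))"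
   unfolding EST_def
  proof (rule runs_Seq_wp)
   show "wp \<omega> (RAssign 11 (RConst 0)) (\<lambda>s'. rvar s' 11 = 0) s" by simp
   fix s1 assume s1: "rvar s1 11 = 0" "same (RAssign 11 (RConst 0)) s s1"
   show "runs \<omega> (Seq (NAssign 31 (NVar v_rb)) (For 24 (NVar v_N) ?body)) s1 (2 + (N + 1) * (2 * proj_time l + ((2 ^ l + 1) * 60 + 17)))
    (\<lambda>s'. rvar s' 11 = (\<Sum>b<N. \<Sum>a<\<rho>. \<bar>P 33 b a - P 34 b a\<bar>))"
   proof (rule runs_Seq_wp)
    show "wp \<omega> (NAssign 31 (NVar v_rb)) (\<lambda>s'. J 0 s' \<and> same EST s s') s1"
     using s1 by (auto simp: J_def same_def)
    fix s2 assume s2: "J 0 s2 \<and> same EST s s2"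
    have same_trans: "same EST s s'" if "same (For 24 (NVar v_N) ?body) s2 s'" for s'
     using s2 that by (auto simp: same_def)
    show "runs \<omega> (For 24 (NVar v_N) ?body) s2 ((N + 1) * (2 * proj_time l + ((2 ^ l + 1) * 60 + 17)))
     (\<lambda>s'. rvar s' 11 = (\<Sum>b<N. \<Sum>a<\<rho>. \<bar>P 33 b a - P 34 b a\<bar>))"
    proof (rule runs_mono)
     show "runs \<omega> (For 24 (NVar v_N) ?body) s2 ((N + 1) * ((2 + (proj_time l + ((2 ^ l + 1) * 20 + (2 + (proj_time l + ((2 ^ l + 1) * 40 + 4)))))) + 9))
      (\<lambda>s'. J N s' \<and> same (For 24 (NVar v_N) ?body) s2 s')"
     proof (rule runs_For)
      fix i s' assume "same (For 24 (NVar v_N) ?body) s2 s'" "J i s'"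
      then show "runs \<omega> ?body s' (2 + (proj_time l + ((2 ^ l + 1) * 20 + (2 + (proj_time l + ((2 ^ l + 1) * 40 + 4)))))) (J (Suc i))"
       by (intro body same_trans)
     qed (use s2 s in \<open>auto simp: J_def sameD[OF conjunct2[OF s2]]\<close>)
    qed (simp_all add: J_def)
   qed simp
  qed simp
  then show ?thesis
  proof (rule runs_mono[OF runs_same])
   have "4 + (N + 1) * (2 * proj_time l + ((2 ^ l + 1) * 60 + 17)) \<le> (N + 1) * (2 * proj_time l + ((2 ^ l + 1) * 60 + 21))"
    by simp
   also have "... \<le> (N + 1) * (4 * proj_time l)"
    by (intro mult_le_mono2) (simp add: algebra_simps)
   finally show "4 + (N + 1) * (2 * proj_time l + ((2 ^ l + 1) * 60 + 17)) \<le> (N + 1) * (4 * proj_time l)" .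
  qed (simp add: P_def)
qed

section \<open>Sorting\<close>

definition sorted_block :: "(nat => real) => (nat => nat) => nat => nat => bool" where
  "sorted_block key P a b \<longleftrightarrow> P ` {a..<b} = {a..<b} \<and> (\<forall>x y. a \<le> x --> x < y --> y < b --> key (P x) \<le> key (P y))"

text \<open>The state of a bottom-up merge pass before output position \<open>z\<close>: the current
  output block starts at \<open>a\<close>, and \<open>i\<close> and \<open>j\<close> are the heads
  of its two input runs. A full block is left only at the beginning of the next step, so
  \<open>z = a + 2 * w\<close> can occur.\<close>

definition merge_inv :: "nat => (nat => real) => (nat => nat) => (nat => nat) => nat => nat => nat => nat => bool" where
  "merge_inv w key P out z a i j \<longleftrightarrow> 2 * w dvd a \<and> a \<le> i \<and> i \<le> a + w \<and> a + w \<le> j \<and> j \<le> a + 2 * w \<and> z + a + w = i + j \<and>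
   out ` {a..<z} = P ` ({a..<i} \<union> {a + w..<j}) \<and>
   (\<forall>x y. a \<le> x --> x < y --> y < z --> key (out x) \<le> key (out y)) \<and>
   (\<forall>x\<in>{a..<z}. \<forall>y\<in>{i..<a + w} \<union> {j..<a + 2 * w}. key (out x) \<le> key (P y)) \<and>
   (\<forall>q. 2 * w * Suc q \<le> a --> sorted_block key out (2 * w * q) (2 * w * Suc q))"

lemma merge_inv_start: "merge_inv w key P out 0 0 0 w"
  by (auto simp: merge_inv_def sorted_block_def)

lemma merge_inv_block:
  assumes inv: "merge_inv w key P out z a i j" and w: "0 < w"
   and P: "\<And>q. w * Suc q \<le> M ==> sorted_block key P (w * q) (w * Suc q)"
   and full: "z = a + 2 * w" "z \<le> M"
  shows "\<forall>q. 2 * w * Suc q \<le> z --> sorted_block key out (2 * w * q) (2 * w * Suc q)"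
proof (intro allI impI)
  fix q assume q: "2 * w * Suc q \<le> z"
  obtain c where c: "a = 2 * w * c" using inv by (auto simp: merge_inv_def dvd_def)
  have "2 * w * Suc q \<le> 2 * w * Suc c" using q full c by simp
  then have "Suc q \<le> Suc c" using w by (simp only: mult_le_cancel1)
  then consider "Suc q \<le> c" | "q = c" by linarith
  then show "sorted_block key out (2 * w * q) (2 * w * Suc q)"
  proof cases
   case 1
   then have "2 * w * Suc q \<le> a" unfolding c by (rule mult_le_mono2)
   then show ?thesis using inv by (simp add: merge_inv_def)
  next
   case 2
   have ij: "i = a + w" "j = a + 2 * w" using inv full by (auto simp: merge_inv_def)
   have b1: "sorted_block key P a (a + w)"
    using P[of "2 * c"] full by (simp add: c algebra_simps)
   have b2: "sorted_block key P (a + w) (a + 2 * w)"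
    using P[of "2 * c + 1"] full by (simp add: c algebra_simps)
   have "P ` ({a..<a + w} \<union> {a + w..<a + 2 * w}) = {a..<a + w} \<union> {a + w..<a + 2 * w}"
    using b1 b2 by (simp add: sorted_block_def image_Un)
   also have "... = {a..<a + 2 * w}" by auto
   finally have "out ` {a..<z} = {a..<z}"
    using inv ij full by (simp add: merge_inv_def)
   moreover have "\<forall>x y. a \<le> x --> x < y --> y < z --> key (out x) \<le> key (out y)"
    using inv by (simp add: merge_inv_def)
   ultimately have "sorted_block key out a z" by (simp add: sorted_block_def)
   then show ?thesis using 2 c full by (simp add: algebra_simps)
  qed
qed

lemma merge_inv_reset:
  assumes "merge_inv w key P out z a i j" "0 < w"
   and "\<And>q. w * Suc q \<le> M ==> sorted_block key P (w * q) (w * Suc q)"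
   and "z = a + 2 * w" "z \<le> M"
  shows "merge_inv w key P out z z z (z + w)"
  using merge_inv_block[OF assms] assms(1,4) by (auto simp: merge_inv_def)

lemma sorted_block_cong: "(\<And>x. x < b ==> P x = P' x) ==> sorted_block key P a b = sorted_block key P' a b"
  unfolding sorted_block_def by (auto simp: image_def)

text \<open>The chosen head is above all written keys by the old invariant, and below all remaining
  keys because both runs are sorted and it won the comparison of the heads.\<close>

lemma merge_inv_step:
  assumes inv: "merge_inv w key P out z a i j" and w: "0 < w"
   and P: "\<And>q. w * Suc q \<le> M ==> sorted_block key P (w * q) (w * Suc q)"
   and z: "z < a + 2 * w" and M: "a + 2 * w \<le> M"
   and left: "left \<longleftrightarrow> i < a + w \<and> \<not> (j < a + 2 * w \<and> key (P j) < key (P i))"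
  shows "merge_inv w key P (out(z := if left then P i else P j)) (Suc z) a (if left then Suc i else i) (if left then j else Suc j)"
proof -
  let ?k = "if left then i else j"
  let ?out = "out(z := P ?k)"
  have zz: "z + a + w = i + j" "a \<le> i" "i \<le> a + w" "a + w \<le> j" "j \<le> a + 2 * w" "2 * w dvd a"
   using inv by (auto simp: merge_inv_def)
  have az: "a \<le> z" using zz by linarith
  have jr: "j < a + 2 * w" if "\<not> left"
  proof (cases "i < a + w")
   case True then show ?thesis using that left by simp
  next
   case False then show ?thesis using zz z by linarith
  qed
  obtain c where c: "a = 2 * w * c" using zz(6) by (auto simp: dvd_def)
  have wc: "w * (2 * c) = a" "w * Suc (2 * c) = a + w" "w * Suc (Suc (2 * c)) = a + 2 * w"
   by (simp_all add: c)
  have b1: "sorted_block key P a (a + w)" "sorted_block key P (a + w) (a + 2 * w)"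
   using P[of "2 * c"] P[of "Suc (2 * c)"] M unfolding wc by simp_all
  have m1: "key (P x) \<le> key (P y)" if "a \<le> x" "x \<le> y" "y < a + w" for x y
   using b1(1) that unfolding sorted_block_def by (cases "x = y") auto
  have m2: "key (P x) \<le> key (P y)" if "a + w \<le> x" "x \<le> y" "y < a + 2 * w" for x y
   using b1(2) that unfolding sorted_block_def by (cases "x = y") auto
  have old: "\<And>x. x \<in> {a..<z} ==> key (out x) \<le> key (P ?k)"
   using inv left jr unfolding merge_inv_def by (auto split: if_splits)
  have new: "key (P ?k) \<le> key (P y)" if y: "y \<in> {(if left then Suc i else i)..<a + w} \<union> {(if left then j else Suc j)..<a + 2 * w}" for y
  proof (cases left)
   case True
   then have i: "i < a + w" using left by simp
   show ?thesis
   proof (cases "y < a + w")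
    case True
    then show ?thesis using y \<open>left\<close> zz by (auto intro: m1)
   next
    case False
    then have y2: "j \<le> y" "y < a + 2 * w" using y \<open>left\<close> by auto
    then have "key (P i) \<le> key (P j)" using \<open>left\<close> left by auto
    also have "... \<le> key (P y)" using y2 zz by (intro m2) auto
    finally show ?thesis using \<open>left\<close> by simp
   qed
  next
   case False
   show ?thesis
   proof (cases "y < a + w")
    case True
    then have y2: "i \<le> y" using y False zz by auto
    then have "key (P j) < key (P i)" using False left True by auto
    also have "... \<le> key (P y)" using y2 True zz by (intro m1) auto
    finally show ?thesis using False by simp
   next
    case y3: False
    then show ?thesis using y False zz by (auto intro: m2)
   qed
  qed
  have img: "?out ` {a..<Suc z} = P ` ({a..<(if left then Suc i else i)} \<union> {a + w..<(if left then j else Suc j)})"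
  proof -
   have "{a..<Suc z} = insert z {a..<z}" using az by auto
   then have "?out ` {a..<Suc z} = insert (P ?k) (out ` {a..<z})" by auto
   also have "out ` {a..<z} = P ` ({a..<i} \<union> {a + w..<j})" using inv by (simp add: merge_inv_def)
   also have "insert (P ?k) ... = P ` (insert ?k ({a..<i} \<union> {a + w..<j}))" by simp
   also have "insert ?k ({a..<i} \<union> {a + w..<j}) = {a..<(if left then Suc i else i)} \<union> {a + w..<(if left then j else Suc j)}"
    using zz by auto
   finally show ?thesis .
  qed
  have srt: "\<forall>x y. a \<le> x --> x < y --> y < Suc z --> key (?out x) \<le> key (?out y)"
  proof (intro allI impI)
   fix x y assume xy: "a \<le> x" "x < y" "y < Suc z"
   show "key (?out x) \<le> key (?out y)"
   proof (cases "y = z")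
    case True
    then show ?thesis using xy old[of x] by simp
   next
    case False
    then show ?thesis using xy inv unfolding merge_inv_def by simp
   qed
  qed
  have dom: "key (?out x) \<le> key (P y)" if "x \<in> {a..<Suc z}" "y \<in> {(if left then Suc i else i)..<a + w} \<union> {(if left then j else Suc j)..<a + 2 * w}" for x y
  proof (cases "x = z")
   case True
   then show ?thesis using new[OF that(2)] by simp
  next
   case False
   then have "x \<in> {a..<z}" using that by auto
   moreover have "y \<in> {i..<a + w} \<union> {j..<a + 2 * w}" using that(2) by (auto split: if_splits)
   ultimately have "key (out x) \<le> key (P y)" using inv unfolding merge_inv_def by blast
   then show ?thesis using False by simp
  qed
  have blk: "sorted_block key ?out (2 * w * q) (2 * w * Suc q)" if "2 * w * Suc q \<le> a" for q
  proof -
   have "sorted_block key ?out (2 * w * q) (2 * w * Suc q) = sorted_block key out (2 * w * q) (2 * w * Suc q)"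
    by (rule sorted_block_cong) (use that az in auto)
   then show ?thesis using inv that by (simp add: merge_inv_def)
  qed
  have e: "(if left then P i else P j) = P ?k" by simp
  have "(if left then Suc i else i) \<le> a + w" using left zz by auto
  moreover have "(if left then j else Suc j) \<le> a + 2 * w" using jr zz by auto
  moreover have "Suc z + a + w = (if left then Suc i else i) + (if left then j else Suc j)" using zz by auto
  moreover have "a \<le> (if left then Suc i else i)" "a + w \<le> (if left then j else Suc j)" using zz by auto
  ultimately show ?thesis
   unfolding e merge_inv_def using zz(6) img srt dom blk by blast
qed

text \<open>The last block is not followed by a reset, so at the end of a pass it may still be the
  current one and has to be read off the invariant separately.\<close>

lemma merge_inv_end:
  assumes inv: "merge_inv w key P out M a i j" and w: "0 < w" and M: "2 * w dvd M"
   and P: "\<And>q. w * Suc q \<le> M ==> sorted_block key P (w * q) (w * Suc q)"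
   and q: "2 * w * Suc q \<le> M"
  shows "sorted_block key out (2 * w * q) (2 * w * Suc q)"
proof -
  have z: "a \<le> M" "M \<le> a + 2 * w" "2 * w dvd a" using inv by (auto simp: merge_inv_def)
  obtain c e where c: "a = 2 * w * c" "M = 2 * w * e" using z(3) M by (auto simp: dvd_def)
  have "c \<le> e" using z(1) w by (simp add: c)
  then consider "c = e" | "Suc c \<le> e" by linarith
  then show ?thesis
  proof cases
   case 1
   then show ?thesis using inv q c by (simp add: merge_inv_def)
  next
   case 2
   then have "2 * w * Suc c \<le> 2 * w * e" by (rule mult_le_mono2)
   then have "M = a + 2 * w" using z c by simp
   then show ?thesis using merge_inv_block[OF inv w P] q by blast
  qed
qed

section \<open>The merge sort program\<close>

definition MERGE_STEP :: com where
  "MERGE_STEP = Seq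
   (If (NLess (NVar 44) (NAdd (NAdd (NVar 41) (NVar 39)) (NVar 39))) Skip
    (Seq (NAssign 41 (NVar 44)) (Seq (NAssign 42 (NVar 44)) (NAssign 43 (NAdd (NVar 44) (NVar 39))))))
   (If (BAnd (NLess (NVar 42) (NAdd (NVar 41) (NVar 39)))
      (BNot (BAnd (NLess (NVar 43) (NAdd (NAdd (NVar 41) (NVar 39)) (NVar 39)))
       (RLess (RRead 9 (NVar 37) (NRead 3 (NVar 40) (NVar 43))) (RRead 9 (NVar 37) (NRead 3 (NVar 40) (NVar 42)))))))
    (Seq (NStore 3 (NAdd (NVar 40) (NConst 1)) (NVar 44) (NRead 3 (NVar 40) (NVar 42))) (NAssign 42 (NAdd (NVar 42) (NConst 1))))
    (Seq (NStore 3 (NAdd (NVar 40) (NConst 1)) (NVar 44) (NRead 3 (NVar 40) (NVar 43))) (NAssign 43 (NAdd (NVar 43) (NConst 1)))))"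

text \<open>Each step writes exactly one output and changes the block by itself when necessary, so a
  pass is a single counting loop of 2^L rounds instead of a nest of loops over blocks.\<close>

definition MERGE_PASS :: com where
  "MERGE_PASS = Seq (Seq (NAssign 41 (NConst 0)) (Seq (NAssign 42 (NConst 0)) (NAssign 43 (NVar 39))))
   (Seq (For 44 (NVar v_PW) MERGE_STEP) (NAssign 39 (NAdd (NVar 39) (NVar 39))))"

definition SORT :: com where
  "SORT = Seq (For 38 (NVar v_PW) (NStore 3 (NConst 0) (NVar 38) (NVar 38))) (Seq (NAssign 39 (NConst 1))
   (Seq (For 40 (NVar v_L) MERGE_PASS) (For 38 (NVar v_PW) (NStore 4 (NVar 37) (NVar 38) (NRead 3 (NVar v_L) (NVar 38))))))"

lemma MERGE_STEP_sets [simp]: "wn MERGE_STEP = {41, 42, 43}" "wr MERGE_STEP = {}" "wna MERGE_STEP = {3}" "wra MERGE_STEP = {}"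
  "sample_free MERGE_STEP" "csize MERGE_STEP \<le> 91"
  by (auto simp: MERGE_STEP_def)

lemma MERGE_PASS_sets [simp]: "wn MERGE_PASS = {39, 41, 42, 43, 44}" "wr MERGE_PASS = {}" "wna MERGE_PASS = {3}" "wra MERGE_PASS = {}"
  "sample_free MERGE_PASS"
  by (auto simp: MERGE_PASS_def)

lemma SORT_sets [simp]: "wn SORT = {38, 39, 40, 41, 42, 43, 44}" "wr SORT = {}" "wna SORT = {3, 4}" "wra SORT = {}" "sample_free SORT"
  by (auto simp: SORT_def)

lemma wp_MERGE_STEP:
  assumes inv: "merge_inv w key P (narr s 3 (Suc t)) z (nvar s 41) (nvar s 42) (nvar s 43)" and w: "0 < w"
   and P: "\<And>q. w * Suc q \<le> M ==> sorted_block key P (w * q) (w * Suc q)"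
   and M: "2 * w dvd M" "z < M"
   and v: "nvar s 44 = z" "nvar s 39 = w" "nvar s 40 = t" "narr s 3 t = P" "rarr s 9 (nvar s 37) = key"
  shows "wp \<omega> MERGE_STEP (\<lambda>s'. merge_inv w key P (narr s' 3 (Suc t)) (Suc z) (nvar s' 41) (nvar s' 42) (nvar s' 43) \<and> narr s' 3 t = P) s"
proof -
  define a i j where "a = (if z < nvar s 41 + w + w then nvar s 41 else z)"
   and "i = (if z < nvar s 41 + w + w then nvar s 42 else z)" and "j = (if z < nvar s 41 + w + w then nvar s 43 else z + w)"
  have inv': "merge_inv w key P (narr s 3 (Suc t)) z a i j \<and> z < a + 2 * w"
  proof (cases "z < nvar s 41 + w + w")
   case True
   then show ?thesis using inv by (simp add: a_def i_def j_def)
  next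
   case False
   then have "z = nvar s 41 + 2 * w" using inv by (auto simp: merge_inv_def)
   then show ?thesis using False merge_inv_reset[OF inv w P] M w by (simp add: a_def i_def j_def)
  qed
  have "2 * w dvd a" "a \<le> z" using inv' by (auto simp: merge_inv_def)
  have aM: "a + 2 * w \<le> M"
  proof -
   obtain c e where c: "a = 2 * w * c" "M = 2 * w * e" using \<open>2 * w dvd a\<close> M by (auto simp: dvd_def)
   have "c < e" using \<open>a \<le> z\<close> M(2) c by (metis le_less_trans mult_le_mono2 not_le)
   then have "2 * w * Suc c \<le> 2 * w * e" by (intro mult_le_mono2) simp
   then show ?thesis by (simp add: c)
  qed
  let ?left = "i < a + w \<and> \<not> (j < a + 2 * w \<and> key (P j) < key (P i))"
  note st = merge_inv_step[OF conjunct1[OF inv'] w P conjunct2[OF inv'] aM refl]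
  have r: "upd2 (narr s) 3 (Suc t) z x 3 (Suc t) = (narr s 3 (Suc t))(z := x)" "upd2 (narr s) 3 (Suc t) z x 3 t = P" for x
   by (auto simp: upd2_def v)
  show ?thesis
  proof (cases "z < nvar s 41 + w + w")
   case True
   then have "a = nvar s 41" "i = nvar s 42" "j = nvar s 43" by (auto simp: a_def i_def j_def)
   then show ?thesis using True st by (auto simp: MERGE_STEP_def v r mult_2 add.assoc split: if_splits)
  next
   case False
   then have "a = z" "i = z" "j = z + w" by (auto simp: a_def i_def j_def)
   then show ?thesis using False st by (auto simp: MERGE_STEP_def v r mult_2 add.assoc split: if_splits)
  qed
qed

lemma runs_MERGE_PASS:
  assumes P: "\<And>q. 2 ^ t * Suc q \<le> 2 ^ L ==> sorted_block (rarr s 9 (nvar s 37)) (narr s 3 t) (2 ^ t * q) (2 ^ t * Suc q)"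
   and t: "t < L" and v: "nvar s 39 = 2 ^ t" "nvar s 40 = t" "nvar s v_PW = 2 ^ L"
  shows "runs \<omega> MERGE_PASS s ((2 ^ L + 1) * 120)
   (\<lambda>s'. (\<forall>q. 2 ^ Suc t * Suc q \<le> 2 ^ L --> sorted_block (rarr s 9 (nvar s 37)) (narr s' 3 (Suc t)) (2 ^ Suc t * q) (2 ^ Suc t * Suc q))
    \<and> nvar s' 39 = 2 ^ Suc t)"
proof -
  define w where "w = (2::nat) ^ t"
  define M where "M = (2::nat) ^ L"
  define key where "key = rarr s 9 (nvar s 37)"
  define R where "R = narr s 3 t"
  have w: "0 < w" by (simp add: w_def)
  have dvd: "2 * w dvd M" unfolding w_def M_def using t by (simp add: le_imp_power_dvd flip: power_Suc)
  let ?J = "\<lambda>z s'. merge_inv w key R (narr s' 3 (Suc t)) z (nvar s' 41) (nvar s' 42) (nvar s' 43) \<and> narr s' 3 t = R"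
  let ?p = "For 44 (NVar v_PW) MERGE_STEP"
  let ?i = "Seq (NAssign 41 (NConst 0)) (Seq (NAssign 42 (NConst 0)) (NAssign 43 (NVar 39)))"
  have "runs \<omega> (Seq ?i (Seq ?p (NAssign 39 (NAdd (NVar 39) (NVar 39))))) s (6 + ((M + 1) * 100 + 4))
   (\<lambda>s'. (\<forall>q. 2 * w * Suc q \<le> M --> sorted_block key (narr s' 3 (Suc t)) (2 * w * q) (2 * w * Suc q)) \<and> nvar s' 39 = 2 * w)"
  proof (rule runs_Seq_wp)
   show "wp \<omega> ?i (\<lambda>s'. nvar s' 41 = 0 \<and> nvar s' 42 = 0 \<and> nvar s' 43 = w) s" by (simp add: v w_def)
   fix s1 assume h1: "nvar s1 41 = 0 \<and> nvar s1 42 = 0 \<and> nvar s1 43 = w" and s1: "same ?i s s1"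
   have v1: "nvar s1 39 = w" "nvar s1 40 = t" "nvar s1 v_PW = M" "narr s1 3 t = R" "rarr s1 9 (nvar s1 37) = key"
    using v by (simp_all add: sameD[OF s1] w_def M_def R_def key_def)
   show "runs \<omega> (Seq ?p (NAssign 39 (NAdd (NVar 39) (NVar 39)))) s1 ((M + 1) * 100 + 4)
   (\<lambda>s'. (\<forall>q. 2 * w * Suc q \<le> M --> sorted_block key (narr s' 3 (Suc t)) (2 * w * q) (2 * w * Suc q)) \<and> nvar s' 39 = 2 * w)"
   proof (rule runs_Seq_same)
    show "runs \<omega> ?p s1 ((M + 1) * 100) (\<lambda>s'. ?J M s' \<and> same ?p s1 s')"
    proof (rule runs_For_wp[where J = ?J])
     fix z s' assume z: "z < M" and h: "same ?p s1 s'" "nvar s' 44 = z" "?J z s'"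
     show "wp \<omega> MERGE_STEP (?J (Suc z)) s'"
     proof (rule wp_MERGE_STEP[OF _ w _ dvd z])
      show "merge_inv w key R (narr s' 3 (Suc t)) z (nvar s' 41) (nvar s' 42) (nvar s' 43)" using h by blast
      show "sorted_block key R (w * q) (w * Suc q)" if "w * Suc q \<le> M" for q
       using P that by (simp add: w_def M_def key_def R_def)
     qed (use h v1 in \<open>auto simp: sameD[OF h(1)]\<close>)
    qed (use v1 h1 merge_inv_start in auto)
    fix s2 assume h2: "?J M s2 \<and> same ?p s1 s2"
    have "sorted_block key (narr s2 3 (Suc t)) (2 * w * q) (2 * w * Suc q)" if "2 * w * Suc q \<le> M" for q
    proof (rule merge_inv_end[OF _ w dvd _ that])
     show "merge_inv w key R (narr s2 3 (Suc t)) M (nvar s2 41) (nvar s2 42) (nvar s2 43)" using h2 by blast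
     show "sorted_block key R (w * q) (w * Suc q)" if "w * Suc q \<le> M" for q
      using P that by (simp add: w_def M_def key_def R_def)
    qed
    moreover have "nvar s2 39 = w" using v1 by (simp add: sameD[OF conjunct2[OF h2]])
    ultimately have "runs \<omega> (NAssign 39 (NAdd (NVar 39) (NVar 39))) s2 (csize (NAssign 39 (NAdd (NVar 39) (NVar 39))))
     (\<lambda>s'. (\<forall>q. 2 * w * Suc q \<le> M --> sorted_block key (narr s' 3 (Suc t)) (2 * w * q) (2 * w * Suc q)) \<and> nvar s' 39 = 2 * w)"
     by (intro runs_wp) (simp add: mult_2)
    then show "runs \<omega> (NAssign 39 (NAdd (NVar 39) (NVar 39))) s2 4
     (\<lambda>s'. (\<forall>q. 2 * w * Suc q \<le> M --> sorted_block key (narr s' 3 (Suc t)) (2 * w * q) (2 * w * Suc q)) \<and> nvar s' 39 = 2 * w)"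
     by (rule runs_mono) auto
   qed simp
  qed simp
  from this[folded MERGE_PASS_def] show ?thesis
   by (rule runs_mono) (auto simp: w_def M_def key_def)
qed

text \<open>All 2^L columns are sorted, also those beyond n that merely pad the length to a power of
  two. This is harmless because the query vector is zero there.\<close>

lemma runs_SORT:
  assumes v: "nvar s v_L = L" "nvar s v_PW = 2 ^ L"
  shows "runs \<omega> SORT s ((L + 1) * ((2 ^ L + 1) * 200))
   (\<lambda>s'. sorted_block (rarr s 9 (nvar s 37)) (narr s' 4 (nvar s 37)) 0 (2 ^ L) \<and>
    (\<forall>k. k \<noteq> nvar s 37 --> narr s' 4 k = narr s 4 k) \<and> same SORT s s')"
proof -
  define M where "M = (2::nat) ^ L"
  define dir where "dir = nvar s 37"
  define key where "key = rarr s 9 dir"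
  let ?p1 = "For 38 (NVar v_PW) (NStore 3 (NConst 0) (NVar 38) (NVar 38))"
  let ?p2 = "For 40 (NVar v_L) MERGE_PASS"
  let ?p3 = "For 38 (NVar v_PW) (NStore 4 (NVar 37) (NVar 38) (NRead 3 (NVar v_L) (NVar 38)))"
  let ?Q = "\<lambda>s'. sorted_block key (narr s' 4 dir) 0 M \<and> (\<forall>k. k \<noteq> dir --> narr s' 4 k = narr s 4 k)"
  have "runs \<omega> SORT s ((M + 1) * 30 + (2 + ((L + 1) * ((M + 1) * 120 + 9) + (M + 1) * 30))) ?Q"
   unfolding SORT_def
  proof (rule runs_Seq_same)
   show "runs \<omega> ?p1 s ((M + 1) * 30) (\<lambda>s'. (\<forall>z<M. narr s' 3 0 z = z) \<and> same ?p1 s s')"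
    by (rule runs_For_wp) (auto simp: v M_def upd2_apply less_Suc_eq)
   fix s1 assume h1: "(\<forall>z<M. narr s1 3 0 z = z) \<and> same ?p1 s s1"
   note s1 = conjunct2[OF h1]
   show "runs \<omega> (Seq (NAssign 39 (NConst 1)) (Seq ?p2 ?p3)) s1 (2 + ((L + 1) * ((M + 1) * 120 + 9) + (M + 1) * 30)) ?Q"
   proof (rule runs_Seq_wp)
    show "wp \<omega> (NAssign 39 (NConst 1)) (\<lambda>s'. nvar s' 39 = 1) s1" by simp
    fix s2 assume h2: "nvar s2 39 = 1" and s2: "same (NAssign 39 (NConst 1)) s1 s2"
    have v2: "nvar s2 v_L = L" "nvar s2 v_PW = M" "nvar s2 37 = dir" "rarr s2 9 = rarr s 9" "narr s2 4 = narr s 4" "narr s2 3 = narr s1 3"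
     using v by (simp_all add: sameD[OF s1] sameD[OF s2] M_def dir_def)
    let ?J = "\<lambda>t s'. nvar s' 39 = 2 ^ t \<and>
     (\<forall>q. 2 ^ t * Suc q \<le> M --> sorted_block key (narr s' 3 t) (2 ^ t * q) (2 ^ t * Suc q))"
    show "runs \<omega> (Seq ?p2 ?p3) s2 ((L + 1) * ((M + 1) * 120 + 9) + (M + 1) * 30) ?Q"
    proof (rule runs_Seq_same)
     show "runs \<omega> ?p2 s2 ((L + 1) * ((M + 1) * 120 + 9)) (\<lambda>s'. ?J L s' \<and> same ?p2 s2 s')"
     proof (rule runs_For[where J = ?J])
      have "sorted_block key (narr s2 3 0) q (Suc q)" if "Suc q \<le> M" for q
       using h1 that by (auto simp: sorted_block_def v2)
      then show "?J 0 (s2\<lparr>nvar := (nvar s2)(40 := 0)\<rparr>)" using h2 by simp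
      fix t s' assume t: "t < L" and h: "same ?p2 s2 s'" "nvar s' 40 = t" "?J t s'"
      have v': "rarr s' 9 (nvar s' 37) = key" "nvar s' v_PW = 2 ^ L"
       using v2 by (simp_all add: sameD[OF h(1)] key_def M_def)
      have "runs \<omega> MERGE_PASS s' ((2 ^ L + 1) * 120)
       (\<lambda>s''. (\<forall>q. 2 ^ Suc t * Suc q \<le> 2 ^ L --> sorted_block (rarr s' 9 (nvar s' 37)) (narr s'' 3 (Suc t)) (2 ^ Suc t * q) (2 ^ Suc t * Suc q))
        \<and> nvar s'' 39 = 2 ^ Suc t)"
       by (rule runs_MERGE_PASS[OF _ t]) (use h v' in \<open>auto simp: M_def\<close>)
      then show "runs \<omega> MERGE_PASS s' ((M + 1) * 120) (?J (Suc t))"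
       unfolding v' M_def[symmetric] by (rule runs_mono) auto
     qed (use v2 in auto)
     fix s3 assume h3: "?J L s3 \<and> same ?p2 s2 s3"
     note s3 = conjunct2[OF h3]
     have v3: "nvar s3 v_L = L" "nvar s3 v_PW = M" "nvar s3 37 = dir" "narr s3 4 = narr s 4"
      using v2 by (simp_all add: sameD[OF s3])
     have srt: "sorted_block key (narr s3 3 L) 0 M"
      using conjunct2[OF conjunct1[OF h3], rule_format, of 0] by (simp add: M_def)
     let ?K = "\<lambda>m s'. (\<forall>z<m. narr s' 4 dir z = narr s3 3 L z) \<and> (\<forall>k. k \<noteq> dir --> narr s' 4 k = narr s 4 k)"
     have "runs \<omega> ?p3 s3 ((M + 1) * 30) (\<lambda>s'. ?K M s' \<and> same ?p3 s3 s')"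
     proof (rule runs_For_wp[where J = ?K])
      fix i s' assume h: "same ?p3 s3 s'" "nvar s' 38 = i" "?K i s'"
      then show "wp \<omega> (NStore 4 (NVar 37) (NVar 38) (NRead 3 (NVar v_L) (NVar 38))) (?K (Suc i)) s'"
       by (auto simp: sameD[OF h(1)] v3 upd2_def less_Suc_eq)
     qed (auto simp: v3)
     then show "runs \<omega> ?p3 s3 ((M + 1) * 30) ?Q"
     proof (rule runs_mono)
      fix s4 assume h4: "?K M s4 \<and> same ?p3 s3 s4"
      then have "sorted_block key (narr s4 4 dir) 0 M = sorted_block key (narr s3 3 L) 0 M"
       by (intro sorted_block_cong) auto
      then show "?Q s4" using srt h4 by blast
     qed simp
    qed simp
   qed simp
  qed simp
  then have "runs \<omega> SORT s ((M + 1) * 30 + (2 + ((L + 1) * ((M + 1) * 120 + 9) + (M + 1) * 30))) (\<lambda>s'. ?Q s' \<and> same SORT s s')"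
   by (rule runs_same)
  then show ?thesis
  proof (rule runs_mono)
   have "(M + 1) * 30 + (2 + ((L + 1) * ((M + 1) * 120 + 9) + (M + 1) * 30)) \<le> (L + 1) * ((M + 1) * 120 + 9) + (L + 1) * ((M + 1) * 62)"
    by (simp add: algebra_simps)
   also have "... = (L + 1) * ((M + 1) * 182 + 9)" by (simp add: algebra_simps)
   also have "... \<le> (L + 1) * ((2 ^ L + 1) * 200)" by (intro mult_le_mono2) (simp add: M_def)
   finally show "(M + 1) * 30 + (2 + ((L + 1) * ((M + 1) * 120 + 9) + (M + 1) * 30)) \<le> (L + 1) * ((2 ^ L + 1) * 200)" .
  qed (auto simp: M_def dir_def key_def)
qed

section \<open>Selecting a candidate\<close>

definition params :: "nat => nat => nat => nat => nat => nat => nat => nat => state => bool" where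
  "params n d L l \<rho> N m R s \<longleftrightarrow> nvar s v_n = n \<and> nvar s v_d = d \<and> nvar s v_L = L \<and> nvar s v_PW = 2 ^ L \<and>
   nvar s v_l = l \<and> nvar s v_D = 2 ^ l \<and> nvar s v_half = 2 ^ l div 2 \<and> nvar s v_rho = \<rho> \<and> nvar s v_N = N \<and>
   nvar s v_m = m \<and> nvar s v_R = R"

lemma params_same:
  assumes "params n d L l \<rho> N m R s" "same p s s'" "wn p \<inter> {0, 1, 2, 3, 4, 5, 6, 7, 9, 10, 14} = {}"
  shows "params n d L l \<rho> N m R s'"
  using assms by (auto simp: params_def same_def)

definition abs_sum :: "nat => nat => nat => state => nat => nat => nat => real" where
  "abs_sum l \<rho> N s r i j = (\<Sum>b<N. \<Sum>a<\<rho>. \<bar>proj l (rarr s 5 (r + b)) (rarr s 0 i) a - proj l (rarr s 5 (r + b)) (rarr s 0 j) a\<bar>)"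

text \<open>\<open>test_value\<close> as it is read off the memory; \<open>sketch_test\<close>
  identifies the two for prepared states.\<close>

definition test_term :: "nat => nat => nat => nat => nat => nat => state => nat => nat => real" where
  "test_term n d l \<rho> N R s r t = (if narr s 2 t 0 < R \<and> narr s 2 t 1 < n then
   (dst d (rarr s 0) (narr s 0 0 (narr s 2 t 0)) (narr s 2 t 1) -
    rvar s 2 * abs_sum l \<rho> N s r (narr s 0 0 (narr s 2 t 0)) (narr s 2 t 1))\<^sup>2 /
   (real (narr s 1 0 (narr s 0 0 (narr s 2 t 0))) + real (narr s 1 0 (narr s 2 t 1))) else 0)"

definition TEST_BODY :: com where
  "TEST_BODY = Seq (Seq (NAssign 35 (NRead 2 (NVar 27) (NConst 0))) (NAssign 34 (NRead 2 (NVar 27) (NConst 1))))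
   (If (BAnd (NLess (NVar 35) (NVar v_R)) (NLess (NVar 34) (NVar v_n)))
    (Seq (NAssign 33 (NRead 0 (NConst 0) (NVar 35))) (Seq DIST (Seq EST
     (RAssign 12 (RAdd (RVar 12) (RDiv (RMul (RSub (RVar 10) (RMul (RVar 2) (RVar 11))) (RSub (RVar 10) (RMul (RVar 2) (RVar 11))))
      (RAdd (ROfNat (NRead 1 (NConst 0) (NVar 33))) (ROfNat (NRead 1 (NConst 0) (NVar 34))))))))))
    Skip)"

definition TEST :: com where
  "TEST = Seq (RAssign 12 (RConst 0)) (For 27 (NVar v_m) TEST_BODY)"

text \<open>Only a strictly smaller test sum replaces the current choice, so the least minimiser
  wins, in agreement with \<open>choice\<close>. The test of counter 28 accepts the first candidate
  unconditionally and stands in for an infinite initial value.\<close>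

definition SELECT_BODY :: com where
  "SELECT_BODY = Seq TEST (Seq (If (BAnd (NLess (NConst 0) (NVar 28)) (BNot (RLess (RVar 12) (RVar 13)))) Skip
    (Seq (RAssign 13 (RVar 12)) (NAssign v_best (NVar v_rb))))
   (NAssign v_rb (NAdd (NVar v_rb) (NVar v_N))))"

definition SELECT :: com where
  "SELECT = Seq (Seq (NAssign v_rb (NConst 0)) (NAssign v_best (NConst 0))) (For 28 (NVar v_L) SELECT_BODY)"

lemma TEST_BODY_sets [simp]: "wn TEST_BODY = {20, 21, 22, 23, 24, 25, 26, 30, 31, 33, 34, 35}" "wr TEST_BODY = {10, 11, 12}"
  "wna TEST_BODY = {}" "wra TEST_BODY = {7, 8}" "sample_free TEST_BODY"
  by (auto simp: TEST_BODY_def)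

lemma TEST_sets [simp]: "wn TEST = {20, 21, 22, 23, 24, 25, 26, 27, 30, 31, 33, 34, 35}" "wr TEST = {10, 11, 12}"
  "wna TEST = {}" "wra TEST = {7, 8}" "sample_free TEST"
  by (auto simp: TEST_def)

lemma SELECT_BODY_sets [simp]: "wn SELECT_BODY = {12, 13, 20, 21, 22, 23, 24, 25, 26, 27, 30, 31, 33, 34, 35}"
  "wr SELECT_BODY = {10, 11, 12, 13}" "wna SELECT_BODY = {}" "wra SELECT_BODY = {7, 8}" "sample_free SELECT_BODY"
  by (auto simp: SELECT_BODY_def)

lemma SELECT_sets [simp]: "wn SELECT = {12, 13, 20, 21, 22, 23, 24, 25, 26, 27, 28, 30, 31, 33, 34, 35}"
  "wr SELECT = {10, 11, 12, 13}" "wna SELECT = {}" "wra SELECT = {7, 8}" "sample_free SELECT"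
  by (auto simp: SELECT_def)

lemma proj_time_ge: "d \<le> 2 ^ l ==> (d + 1) * 50 + 150 \<le> proj_time l"
  by (simp add: algebra_simps)

lemma runs_TEST_BODY:
  assumes s: "params n d L l \<rho> N m R s" and \<rho>: "\<rho> \<le> 2 ^ l" and d: "d \<le> 2 ^ l"
  shows "runs \<omega> TEST_BODY s ((N + 1) * (5 * proj_time l))
   (\<lambda>s'. rvar s' 12 = rvar s 12 + test_term n d l \<rho> N R s (nvar s v_rb) (nvar s 27))"
proof -
  define t where "t = nvar s 27"
  let ?a = "Seq (NAssign 35 (NRead 2 (NVar 27) (NConst 0))) (NAssign 34 (NRead 2 (NVar 27) (NConst 1)))"
  let ?f = "RAssign 12 (RAdd (RVar 12) (RDiv (RMul (RSub (RVar 10) (RMul (RVar 2) (RVar 11))) (RSub (RVar 10) (RMul (RVar 2) (RVar 11))))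
      (RAdd (ROfNat (NRead 1 (NConst 0) (NVar 33))) (ROfNat (NRead 1 (NConst 0) (NVar 34))))))"
  let ?Q = "\<lambda>s'. rvar s' 12 = rvar s 12 + test_term n d l \<rho> N R s (nvar s v_rb) t"
  let ?T = "4 + ((d + 1) * 50 + ((N + 1) * (4 * proj_time l) + 30))"
  have "runs \<omega> TEST_BODY s (8 + (1 + bcost (BAnd (NLess (NVar 35) (NVar v_R)) (NLess (NVar 34) (NVar v_n))) + ?T)) ?Q"
   unfolding TEST_BODY_def
  proof (rule runs_Seq_wp)
   show "wp \<omega> ?a (\<lambda>s'. nvar s' 35 = narr s 2 t 0 \<and> nvar s' 34 = narr s 2 t 1) s" by (simp add: t_def)
   fix s1 assume h1: "nvar s1 35 = narr s 2 t 0 \<and> nvar s1 34 = narr s 2 t 1" and s1: "same ?a s s1"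
   have st1: "params n d L l \<rho> N m R s1" by (rule params_same[OF s s1]) auto
   have v1: "nvar s1 v_R = R" "nvar s1 v_n = n" using st1 by (auto simp: params_def)
   show "runs \<omega> (If (BAnd (NLess (NVar 35) (NVar v_R)) (NLess (NVar 34) (NVar v_n)))
    (Seq (NAssign 33 (NRead 0 (NConst 0) (NVar 35))) (Seq DIST (Seq EST ?f))) Skip) s1
    (1 + bcost (BAnd (NLess (NVar 35) (NVar v_R)) (NLess (NVar 34) (NVar v_n))) + ?T) ?Q"
   proof (rule runs_If)
    assume "\<not> bval (BAnd (NLess (NVar 35) (NVar v_R)) (NLess (NVar 34) (NVar v_n))) s1"
    then have "test_term n d l \<rho> N R s (nvar s v_rb) t = 0" using h1 v1 by (auto simp: test_term_def)
    then have "runs \<omega> Skip s1 (csize Skip) ?Q" by (intro runs_wp) (simp add: sameD[OF s1])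
    then show "runs \<omega> Skip s1 ?T ?Q" by (rule runs_mono) auto
   next
    assume "bval (BAnd (NLess (NVar 35) (NVar v_R)) (NLess (NVar 34) (NVar v_n))) s1"
    then have b: "narr s 2 t 0 < R" "narr s 2 t 1 < n" using h1 v1 by auto
    define i where "i = narr s 0 0 (narr s 2 t 0)"
    define j where "j = narr s 2 t 1"
    show "runs \<omega> (Seq (NAssign 33 (NRead 0 (NConst 0) (NVar 35))) (Seq DIST (Seq EST ?f))) s1 ?T ?Q"
    proof (rule runs_Seq_wp)
     show "wp \<omega> (NAssign 33 (NRead 0 (NConst 0) (NVar 35))) (\<lambda>s'. nvar s' 33 = i) s1"
      using h1 by (simp add: sameD[OF s1] i_def)
     fix s2 assume h2: "nvar s2 33 = i" and s2: "same (NAssign 33 (NRead 0 (NConst 0) (NVar 35))) s1 s2"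
     have st2: "params n d L l \<rho> N m R s2" by (rule params_same[OF st1 s2]) auto
     have v2: "nvar s2 34 = j" using h1 by (simp add: sameD[OF s2] j_def)
     have d2: "nvar s2 v_d = d" using st2 by (simp add: params_def)
     show "runs \<omega> (Seq DIST (Seq EST ?f)) s2 ((d + 1) * 50 + ((N + 1) * (4 * proj_time l) + 30)) ?Q"
     proof (rule runs_Seq_same[OF runs_DIST[OF d2]])
      fix s3 assume h3: "rvar s3 10 = dst d (rarr s2 0) (nvar s2 33) (nvar s2 34) \<and> same DIST s2 s3"
      note s3 = conjunct2[OF h3]
      have st3: "params n d L l \<rho> N m R s3" by (rule params_same[OF st2 s3]) auto
      have w3: "nvar s3 v_l = l" "nvar s3 v_D = 2 ^ l" "nvar s3 v_half = 2 ^ l div 2" "nvar s3 v_rho = \<rho>" "nvar s3 v_N = N"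
       using st3 by (auto simp: params_def)
      have r3: "rvar s3 10 = dst d (rarr s 0) i j"
       using h3 by (simp add: h2 v2 sameD[OF s2] sameD[OF s1])
      show "runs \<omega> (Seq EST ?f) s3 ((N + 1) * (4 * proj_time l) + 30) ?Q"
      proof (rule runs_Seq_same[OF runs_EST[OF w3 \<rho>]])
       fix s4 assume h4: "rvar s4 11 = (\<Sum>b<N. \<Sum>a<\<rho>. \<bar>proj l (rarr s3 5 (nvar s3 v_rb + b)) (rarr s3 0 (nvar s3 33)) a -
        proj l (rarr s3 5 (nvar s3 v_rb + b)) (rarr s3 0 (nvar s3 34)) a\<bar>) \<and> same EST s3 s4"
       note s4 = conjunct2[OF h4]
       have e: "rvar s4 11 = abs_sum l \<rho> N s (nvar s v_rb) i j"
        using conjunct1[OF h4] by (simp add: abs_sum_def h2 v2 sameD[OF s3] sameD[OF s2] sameD[OF s1])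
       have v4: "rvar s4 10 = dst d (rarr s 0) i j" "rvar s4 2 = rvar s 2" "rvar s4 12 = rvar s 12"
        "nvar s4 33 = i" "nvar s4 34 = j" "narr s4 1 = narr s 1"
        by (simp_all add: sameD[OF s4] r3 h2 v2 sameD[OF s3] sameD[OF s2] sameD[OF s1])
       have tt: "test_term n d l \<rho> N R s (nvar s v_rb) t = (dst d (rarr s 0) i j - rvar s 2 * abs_sum l \<rho> N s (nvar s v_rb) i j)\<^sup>2 /
         (real (narr s 1 0 i) + real (narr s 1 0 j))"
        using b by (simp add: test_term_def i_def j_def)
       have "runs \<omega> ?f s4 (csize ?f) ?Q"
        by (rule runs_wp) (simp add: v4[unfolded One_nat_def] e tt[unfolded One_nat_def] power2_eq_square)
       then show "runs \<omega> ?f s4 30 ?Q" by (rule runs_mono) auto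
      qed simp
     qed simp
    qed simp
   qed
  qed simp
  then show ?thesis
  proof (rule runs_mono)
   have "8 + (1 + bcost (BAnd (NLess (NVar 35) (NVar v_R)) (NLess (NVar 34) (NVar v_n))) + ?T) \<le> (N + 1) * (4 * proj_time l) + ((d + 1) * 50 + 150)"
    by simp
   also have "... \<le> (N + 1) * (4 * proj_time l) + proj_time l" using proj_time_ge[OF d] by (rule add_left_mono)
   also have "... \<le> (N + 1) * (5 * proj_time l)" by simp
   finally show "8 + (1 + bcost (BAnd (NLess (NVar 35) (NVar v_R)) (NLess (NVar 34) (NVar v_n))) + ?T) \<le> (N + 1) * (5 * proj_time l)" .
  qed (simp add: t_def)
qed

lemma test_term_same:
  assumes "same p s s'" "wr p \<inter> {2} = {}" "wna p \<inter> {0, 1, 2} = {}" "wra p \<inter> {0, 5} = {}"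
  shows "test_term n d l \<rho> N R s' r t = test_term n d l \<rho> N R s r t"
proof -
  have "rvar s' 2 = rvar s 2" "narr s' 0 = narr s 0" "narr s' 1 = narr s 1" "narr s' 2 = narr s 2" "rarr s' 0 = rarr s 0" "rarr s' 5 = rarr s 5"
   using assms by (auto simp: same_def)
  then show ?thesis by (simp add: test_term_def abs_sum_def)
qed

lemma runs_TEST:
  assumes s: "params n d L l \<rho> N m R s" and \<rho>: "\<rho> \<le> 2 ^ l" and d: "d \<le> 2 ^ l"
  shows "runs \<omega> TEST s ((m + 1) * ((N + 1) * (6 * proj_time l)))
   (\<lambda>s'. rvar s' 12 = (\<Sum>t<m. test_term n d l \<rho> N R s (nvar s v_rb) t) \<and> same TEST s s')"
proof -
  let ?J = "\<lambda>t s'. rvar s' 12 = (\<Sum>t<t. test_term n d l \<rho> N R s (nvar s v_rb) t)"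
  let ?p = "For 27 (NVar v_m) TEST_BODY"
  have "runs \<omega> TEST s (2 + (m + 1) * ((N + 1) * (5 * proj_time l) + 9)) (?J m)"
   unfolding TEST_def
  proof (rule runs_Seq_wp)
   show "wp \<omega> (RAssign 12 (RConst 0)) (\<lambda>s'. rvar s' 12 = 0) s" by simp
   fix s1 assume h1: "rvar s1 12 = 0" and s1: "same (RAssign 12 (RConst 0)) s s1"
   have st1: "params n d L l \<rho> N m R s1" by (rule params_same[OF s s1]) auto
   have "runs \<omega> ?p s1 ((m + 1) * ((N + 1) * (5 * proj_time l) + 9)) (\<lambda>s'. ?J m s' \<and> same ?p s1 s')"
   proof (rule runs_For[where J = ?J])
    show "nvar s1 v_m = m" using st1 by (simp add: params_def)
    fix t s' assume h: "same ?p s1 s'" "nvar s' 27 = t" "?J t s'"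
    have st: "params n d L l \<rho> N m R s'" by (rule params_same[OF st1 h(1)]) auto
    have "test_term n d l \<rho> N R s' (nvar s' v_rb) t = test_term n d l \<rho> N R s (nvar s v_rb) t"
     using test_term_same[OF h(1)] test_term_same[OF s1] by (simp add: sameD[OF h(1)] sameD[OF s1])
    then show "runs \<omega> TEST_BODY s' ((N + 1) * (5 * proj_time l)) (?J (Suc t))"
     using runs_TEST_BODY[OF st \<rho> d, of \<omega>] h by (auto elim!: runs_mono)
   qed (use h1 in auto)
   then show "runs \<omega> ?p s1 ((m + 1) * ((N + 1) * (5 * proj_time l) + 9)) (?J m)"
    by (rule runs_mono) auto
  qed simp
  then show ?thesis
  proof (rule runs_mono[OF runs_same])
   have "2 + (m + 1) * ((N + 1) * (5 * proj_time l) + 9) \<le> (m + 1) * ((N + 1) * (5 * proj_time l) + 11)"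
    by simp
   also have "... \<le> (m + 1) * ((N + 1) * (6 * proj_time l))"
    by (intro mult_le_mono2) (simp add: algebra_simps)
   finally show "2 + (m + 1) * ((N + 1) * (5 * proj_time l) + 9) \<le> (m + 1) * ((N + 1) * (6 * proj_time l))" .
  qed auto
qed

lemma runs_SELECT:
  assumes s: "params n d L l \<rho> N m R s" and \<rho>: "\<rho> \<le> 2 ^ l" and d: "d \<le> 2 ^ l" and L: "0 < L"
  defines "TT \<equiv> (\<lambda>q. \<Sum>t<m. test_term n d l \<rho> N R s (q * N) t)"
  shows "runs \<omega> SELECT s ((L + 1) * ((m + 1) * ((N + 1) * (7 * proj_time l))))
   (\<lambda>s'. (\<exists>q<L. nvar s' v_best = q * N \<and> (\<forall>q'<L. TT q \<le> TT q') \<and> (\<forall>q'<q. TT q < TT q')) \<and> same SELECT s s')"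
proof -
  let ?J = "\<lambda>q s'. nvar s' v_rb = q * N \<and>
   (0 < q --> (\<exists>q0<q. nvar s' v_best = q0 * N \<and> rvar s' 13 = TT q0 \<and> (\<forall>q'<q. TT q0 \<le> TT q') \<and> (\<forall>q'<q0. TT q0 < TT q')))"
  let ?a = "Seq (NAssign v_rb (NConst 0)) (NAssign v_best (NConst 0))"
  let ?p = "For 28 (NVar v_L) SELECT_BODY"
  let ?u = "Seq (If (BAnd (NLess (NConst 0) (NVar 28)) (BNot (RLess (RVar 12) (RVar 13)))) Skip
    (Seq (RAssign 13 (RVar 12)) (NAssign v_best (NVar v_rb)))) (NAssign v_rb (NAdd (NVar v_rb) (NVar v_N)))"
  let ?T = "(m + 1) * ((N + 1) * (6 * proj_time l))"
  have "runs \<omega> SELECT s (4 + (L + 1) * ((?T + 20) + 9)) (?J L)"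
   unfolding SELECT_def
  proof (rule runs_Seq_wp)
   show "wp \<omega> ?a (\<lambda>s'. nvar s' v_rb = 0) s" by simp
   fix s1 assume h1: "nvar s1 v_rb = 0" and s1: "same ?a s s1"
   have st1: "params n d L l \<rho> N m R s1" by (rule params_same[OF s s1]) auto
   have "runs \<omega> ?p s1 ((L + 1) * ((?T + 20) + 9)) (\<lambda>s'. ?J L s' \<and> same ?p s1 s')"
   proof (rule runs_For[where J = ?J])
    show "nvar s1 v_L = L" using st1 by (simp add: params_def)
    fix q s' assume q: "q < L" and h: "same ?p s1 s'" "nvar s' 28 = q" "?J q s'"
    have st: "params n d L l \<rho> N m R s'" by (rule params_same[OF st1 h(1)]) auto
    have tt: "(\<Sum>t<m. test_term n d l \<rho> N R s' (nvar s' v_rb) t) = TT q"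
     using h(3) test_term_same[OF h(1)] test_term_same[OF s1] by (simp add: TT_def)
    show "runs \<omega> SELECT_BODY s' (?T + 20) (?J (Suc q))"
     unfolding SELECT_BODY_def
    proof (rule runs_Seq_same[OF runs_TEST[OF st \<rho> d]])
     fix s2 assume h2: "rvar s2 12 = (\<Sum>t<m. test_term n d l \<rho> N R s' (nvar s' v_rb) t) \<and> same TEST s' s2"
     note s2 = conjunct2[OF h2]
     have v2: "rvar s2 12 = TT q" "rvar s2 13 = rvar s' 13" "nvar s2 28 = q" "nvar s2 v_rb = q * N" "nvar s2 v_best = nvar s' v_best"
      using h2 h tt by (simp_all add: sameD[OF s2])
     have N2: "nvar s2 v_N = N" using st by (simp add: sameD[OF s2] params_def)
     have "wp \<omega> ?u (?J (Suc q)) s2"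
     proof (cases "0 < q \<and> \<not> TT q < rvar s' 13")
      case True
      then obtain q0 where q0: "q0 < q" "nvar s' v_best = q0 * N" "rvar s' 13 = TT q0" "\<forall>q'<q. TT q0 \<le> TT q'" "\<forall>q'<q0. TT q0 < TT q'"
       using h(3) by auto
      have "\<forall>q'<Suc q. TT q0 \<le> TT q'" using q0 True by (auto simp: less_Suc_eq)
      then show ?thesis using True q0 by (auto simp: v2 N2 intro!: exI[of _ q0])
     next
      case False
      have lt: "\<forall>q'<q. TT q < TT q'"
      proof (cases "q = 0")
       case False
       then obtain q0 where "\<forall>q'<q. TT q0 \<le> TT q'" "rvar s' 13 = TT q0" using h(3) by auto
       moreover have "TT q < rvar s' 13" using \<open>\<not> (0 < q \<and> \<not> TT q < rvar s' 13)\<close> False by simp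
       ultimately show ?thesis by force
      qed auto
      then have "\<forall>q'<Suc q. TT q \<le> TT q'" by (auto simp: less_Suc_eq intro: less_imp_le)
      then show ?thesis using False lt by (auto simp: v2 N2 intro!: exI[of _ q])
     qed
     then have "runs \<omega> ?u s2 (csize ?u) (?J (Suc q))" by (rule runs_wp)
     then show "runs \<omega> ?u s2 20 (?J (Suc q))" by (rule runs_mono) auto
    qed simp
   qed (use h1 in auto)
   then show "runs \<omega> ?p s1 ((L + 1) * ((?T + 20) + 9)) (?J L)"
    by (rule runs_mono) auto
  qed simp
  then show ?thesis
  proof (rule runs_mono[OF runs_same])
   have "33 \<le> (m + 1) * ((N + 1) * proj_time l)" by (simp add: algebra_simps)
   moreover have "(m + 1) * ((N + 1) * (7 * proj_time l)) = ?T + (m + 1) * ((N + 1) * proj_time l)"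
    by (simp add: algebra_simps)
   ultimately have "(L + 1) * (?T + 33) \<le> (L + 1) * ((m + 1) * ((N + 1) * (7 * proj_time l)))"
    by (intro mult_le_mono2) linarith
   moreover have "4 + (L + 1) * ((?T + 20) + 9) \<le> (L + 1) * (?T + 33)"
    unfolding distrib_left[of "L + 1"] by simp
   ultimately show "4 + (L + 1) * ((?T + 20) + 9) \<le> (L + 1) * ((m + 1) * ((N + 1) * (7 * proj_time l)))"
    by (rule order_trans[rotated])
  qed (use L in auto)
qed

section \<open>Projecting all points by the chosen candidate\<close>

definition FINAL_POINT :: com where
  "FINAL_POINT = Seq PROJ (For 25 (NVar v_rho) (RStore 9 (NAdd (NVar 36) (NVar 25)) (NVar 30) (RRead 7 (NVar v_l) (NVar 25))))"

definition FINAL_BODY :: com where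
  "FINAL_BODY = Seq (For 30 (NVar v_n) FINAL_POINT) (Seq (NAssign 31 (NAdd (NVar 31) (NConst 1))) (NAssign 36 (NAdd (NVar 36) (NVar v_rho))))"

text \<open>Variable 36 runs through the multiples of \<rho>, so that output a of block b becomes
  direction b \<rho> + a without a multiplication. Its last value is the number of
  directions.\<close>

definition FINAL :: com where
  "FINAL = Seq (Seq (NAssign 31 (NVar v_best)) (NAssign 36 (NConst 0))) (Seq (For 24 (NVar v_N) FINAL_BODY) (NAssign v_K (NVar 36)))"

lemma FINAL_POINT_sets [simp]: "wn FINAL_POINT = {20, 21, 22, 25}" "wr FINAL_POINT = {}" "wna FINAL_POINT = {}" "wra FINAL_POINT = {7, 9}" "sample_free FINAL_POINT"
  by (auto simp: FINAL_POINT_def)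

lemma FINAL_BODY_sets [simp]: "wn FINAL_BODY = {20, 21, 22, 25, 30, 31, 36}" "wr FINAL_BODY = {}" "wna FINAL_BODY = {}" "wra FINAL_BODY = {7, 9}" "sample_free FINAL_BODY"
  by (auto simp: FINAL_BODY_def)

lemma FINAL_sets [simp]: "wn FINAL = {15, 20, 21, 22, 24, 25, 30, 31, 36}" "wr FINAL = {}" "wna FINAL = {}" "wra FINAL = {7, 9}" "sample_free FINAL"
  by (auto simp: FINAL_def)

lemma runs_FINAL_POINT:
  assumes s: "params n d L l \<rho> N m R s" and \<rho>: "\<rho> \<le> 2 ^ l"
  shows "runs \<omega> FINAL_POINT s (2 * proj_time l)
   (\<lambda>s'. \<forall>k c. rarr s' 9 k c = (if c = nvar s 30 \<and> nvar s 36 \<le> k \<and> k < nvar s 36 + \<rho>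
    then proj l (rarr s 5 (nvar s 31)) (rarr s 0 (nvar s 30)) (k - nvar s 36) else rarr s 9 k c))"
proof -
  define P where "P = proj l (rarr s 5 (nvar s 31)) (rarr s 0 (nvar s 30))"
  define i where "i = nvar s 30"
  define b where "b = nvar s 36"
  have v: "nvar s v_l = l" "nvar s v_D = 2 ^ l" "nvar s v_half = 2 ^ l div 2" "nvar s v_rho = \<rho>"
   using s by (auto simp: params_def)
  let ?p = "For 25 (NVar v_rho) (RStore 9 (NAdd (NVar 36) (NVar 25)) (NVar 30) (RRead 7 (NVar v_l) (NVar 25)))"
  let ?J = "\<lambda>a s'. \<forall>k c. rarr s' 9 k c = (if c = i \<and> b \<le> k \<and> k < b + a then P (k - b) else rarr s 9 k c)"
  have "runs \<omega> FINAL_POINT s (proj_time l + (\<rho> + 1) * 30) (?J \<rho>)"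
   unfolding FINAL_POINT_def
  proof (rule runs_Seq_same[OF runs_PROJ[OF v(1-3)]])
   fix s1 assume h1: "(\<forall>a<2^l. rarr s1 7 l a = proj l (rarr s 5 (nvar s 31)) (rarr s 0 (nvar s 30)) a) \<and> same PROJ s s1"
   note s1 = conjunct2[OF h1]
   have v1: "nvar s1 v_l = l" "nvar s1 v_rho = \<rho>" "nvar s1 30 = i" "nvar s1 36 = b" "rarr s1 9 = rarr s 9"
    using v by (simp_all add: sameD[OF s1] i_def b_def)
   have "runs \<omega> ?p s1 ((\<rho> + 1) * 30) (\<lambda>s'. ?J \<rho> s' \<and> same ?p s1 s')"
   proof (rule runs_For_wp[where J = ?J])
    fix a s' assume a: "a < \<rho>" and h: "same ?p s1 s'" "nvar s' 25 = a" "?J a s'"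
    have "rarr s' 7 l a = P a" using h1 a \<rho> by (simp add: sameD[OF h(1)] P_def)
    then show "wp \<omega> (RStore 9 (NAdd (NVar 36) (NVar 25)) (NVar 30) (RRead 7 (NVar v_l) (NVar 25))) (?J (Suc a)) s'"
     using h by (auto simp: sameD[OF h(1)] v1 upd2_apply)
   qed (auto simp: v1)
   then show "runs \<omega> ?p s1 ((\<rho> + 1) * 30) (?J \<rho>)" by (rule runs_mono) auto
  qed simp
  then show ?thesis
  proof (rule runs_mono)
   have "(\<rho> + 1) * 30 \<le> proj_time l" using \<rho> by (simp add: algebra_simps)
   then show "proj_time l + (\<rho> + 1) * 30 \<le> 2 * proj_time l" by simp
  qed (simp add: P_def i_def b_def)
qed

lemma runs_FINAL:
  assumes s: "params n d L l \<rho> N m R s" and \<rho>: "\<rho> \<le> 2 ^ l" "0 < \<rho>"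
  shows "runs \<omega> FINAL s ((N + 1) * ((n + 1) * (3 * proj_time l)))
   (\<lambda>s'. (\<forall>k c. rarr s' 9 k c = (if c < n \<and> k < N * \<rho>
    then proj l (rarr s 5 (nvar s v_best + k div \<rho>)) (rarr s 0 c) (k mod \<rho>) else rarr s 9 k c)) \<and>
   nvar s' v_K = N * \<rho> \<and> same FINAL s s')"
proof -
  define P where "P b i = proj l (rarr s 5 (nvar s v_best + b)) (rarr s 0 i)" for b i
  let ?A = "\<lambda>b s'. nvar s' 31 = nvar s v_best + b \<and> nvar s' 36 = b * \<rho>"
  let ?B = "\<lambda>b s'. \<forall>k c. rarr s' 9 k c = (if c < n \<and> k < b * \<rho> then P (k div \<rho>) c (k mod \<rho>) else rarr s 9 k c)"
  let ?J = "\<lambda>b s'. ?A b s' \<and> ?B b s'"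
  let ?a = "Seq (NAssign 31 (NVar v_best)) (NAssign 36 (NConst 0))"
  let ?p = "For 24 (NVar v_N) FINAL_BODY"
  let ?q = "For 30 (NVar v_n) FINAL_POINT"
  let ?u = "Seq (NAssign 31 (NAdd (NVar 31) (NConst 1))) (NAssign 36 (NAdd (NVar 36) (NVar v_rho)))"
  let ?T = "(n + 1) * (2 * proj_time l + 9) + 8"
  have "runs \<omega> FINAL s (4 + ((N + 1) * (?T + 9) + 2)) (\<lambda>s'. ?B N s' \<and> nvar s' v_K = N * \<rho>)"
   unfolding FINAL_def
  proof (rule runs_Seq_wp)
   show "wp \<omega> ?a (?J 0) s" by simp
   fix s1 assume h1: "?J 0 s1" and s1: "same ?a s s1"
   have st1: "params n d L l \<rho> N m R s1" by (rule params_same[OF s s1]) auto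
   show "runs \<omega> (Seq ?p (NAssign v_K (NVar 36))) s1 ((N + 1) * (?T + 9) + 2) (\<lambda>s'. ?B N s' \<and> nvar s' v_K = N * \<rho>)"
   proof (rule runs_Seq_same)
    show "runs \<omega> ?p s1 ((N + 1) * (?T + 9)) (\<lambda>s'. ?J N s' \<and> same ?p s1 s')"
    proof (rule runs_For[where J = ?J])
     show "nvar s1 v_N = N" using st1 by (simp add: params_def)
     fix b s2 assume b: "b < N" and s2: "same ?p s1 s2" and h2: "?J b s2"
     have st2: "params n d L l \<rho> N m R s2" by (rule params_same[OF st1 s2]) auto
     have r2: "rarr s2 5 = rarr s 5" "rarr s2 0 = rarr s 0" by (simp_all add: sameD[OF s2] sameD[OF s1])
     let ?K = "\<lambda>i s'. \<forall>k c. rarr s' 9 k c = (if c < i \<and> b * \<rho> \<le> k \<and> k < b * \<rho> + \<rho> then P b c (k - b * \<rho>) else rarr s2 9 k c)"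
     show "runs \<omega> FINAL_BODY s2 ?T (?J (Suc b))"
      unfolding FINAL_BODY_def
     proof (rule runs_Seq_same)
      show "runs \<omega> ?q s2 ((n + 1) * (2 * proj_time l + 9)) (\<lambda>s'. ?K n s' \<and> same ?q s2 s')"
      proof (rule runs_For[where J = ?K])
       show "nvar s2 v_n = n" using st2 by (simp add: params_def)
       fix i s3 assume s3: "same ?q s2 s3" and i: "nvar s3 30 = i" and h3: "?K i s3"
       have st3: "params n d L l \<rho> N m R s3" by (rule params_same[OF st2 s3]) auto
       have v3: "nvar s3 36 = b * \<rho>" "proj l (rarr s3 5 (nvar s3 31)) (rarr s3 0 (nvar s3 30)) = P b i"
        using h2 i by (simp_all add: sameD[OF s3] r2 P_def)
       show "runs \<omega> FINAL_POINT s3 (2 * proj_time l) (?K (Suc i))"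
        using runs_FINAL_POINT[OF st3 \<rho>(1), of \<omega>] unfolding v3 unfolding i
       proof (rule runs_mono)
        fix s4 assume h4: "\<forall>k c. rarr s4 9 k c = (if c = i \<and> b * \<rho> \<le> k \<and> k < b * \<rho> + \<rho> then P b i (k - b * \<rho>) else rarr s3 9 k c)"
        show "?K (Suc i) s4" unfolding h4[rule_format] h3[rule_format] by (auto simp: less_Suc_eq)
       qed simp
      qed auto
      fix s5 assume h5: "?K n s5 \<and> same ?q s2 s5"
      note s5 = conjunct2[OF h5]
      have v5: "nvar s5 31 = nvar s v_best + b" "nvar s5 36 = b * \<rho>" "nvar s5 v_rho = \<rho>"
       using h2 st2 by (simp_all add: sameD[OF s5] params_def)
      have dm: "k div \<rho> = b" "k mod \<rho> = k - b * \<rho>" if "b * \<rho> \<le> k" "k < b * \<rho> + \<rho>" for k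
      proof -
       show "k div \<rho> = b" using that by (intro div_nat_eqI) (auto simp: algebra_simps)
       then show "k mod \<rho> = k - b * \<rho>" by (simp add: minus_div_mult_eq_mod[symmetric])
      qed
      have B5: "?B (Suc b) s5"
      proof (intro allI)
       fix k c
       have "rarr s5 9 k c = (if c < n \<and> b * \<rho> \<le> k \<and> k < b * \<rho> + \<rho> then P b c (k - b * \<rho>) else rarr s2 9 k c)"
        using h5 by blast
       also have "rarr s2 9 k c = (if c < n \<and> k < b * \<rho> then P (k div \<rho>) c (k mod \<rho>) else rarr s 9 k c)"
        using h2 by blast
       finally show "rarr s5 9 k c = (if c < n \<and> k < Suc b * \<rho> then P (k div \<rho>) c (k mod \<rho>) else rarr s 9 k c)"
        using dm[of k] by auto
      qed
      have "runs \<omega> ?u s5 (csize ?u) (?J (Suc b))"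
       by (rule runs_wp) (use B5 v5 in simp)
      then show "runs \<omega> ?u s5 8 (?J (Suc b))" by (rule runs_mono) auto
     qed simp
    qed (use h1 in auto)
    fix s6 assume h6: "?J N s6 \<and> same ?p s1 s6"
    have "runs \<omega> (NAssign v_K (NVar 36)) s6 (csize (NAssign v_K (NVar 36))) (\<lambda>s'. ?B N s' \<and> nvar s' v_K = N * \<rho>)"
     by (rule runs_wp) (use h6 in simp)
    then show "runs \<omega> (NAssign v_K (NVar 36)) s6 2 (\<lambda>s'. ?B N s' \<and> nvar s' v_K = N * \<rho>)"
     by (rule runs_mono) auto
   qed simp
  qed simp
  then show ?thesis
  proof (rule runs_mono[OF runs_same])
   have "(n + 1) * 40 \<le> (n + 1) * proj_time l" by (intro mult_le_mono2) (simp add: algebra_simps)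
   then have "?T + 15 \<le> (n + 1) * (3 * proj_time l)" by (simp add: algebra_simps)
   then have "(N + 1) * (?T + 15) \<le> (N + 1) * ((n + 1) * (3 * proj_time l))" by (rule mult_le_mono2)
   moreover have "4 + ((N + 1) * (?T + 9) + 2) \<le> (N + 1) * (?T + 15)"
    unfolding distrib_left[of "N + 1"] by simp
   ultimately show "4 + ((N + 1) * (?T + 9) + 2) \<le> (N + 1) * ((n + 1) * (3 * proj_time l))"
    by (rule order_trans[rotated])
  qed (auto simp: P_def)
qed

section \<open>Multiplication by a sum of one-dimensional distance matrices\<close>

lemma abs_sum_sorted:
  fixes q y :: "nat => real"
  assumes S: "sorted_block q S 0 M" and z: "z < M"
  shows "(\<Sum>j<M. \<bar>q (S z) - q j\<bar> * y j) =
   2 * (q (S z) * (\<Sum>z<z. y (S z)) - (\<Sum>z<z. q (S z) * y (S z))) + ((\<Sum>j<M. q j * y j) - q (S z) * (\<Sum>j<M. y j))"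
proof -
  have im: "S ` {..<M} = {..<M}" using S by (simp add: sorted_block_def atLeast0LessThan)
  then have inj: "inj_on S {..<M}" by (intro eq_card_imp_inj_on) auto
  have re: "(\<Sum>j<M. f j) = (\<Sum>u<M. f (S u))" for f :: "nat => real"
   using sum.reindex[OF inj, of f] by (simp add: im)
  have sp: "(\<Sum>u<M. f u) = (\<Sum>u<z. f u) + (\<Sum>u\<in>{z..<M}. f u)" for f :: "nat => real"
   using z by (metis atLeast0LessThan less_imp_le_nat sum.atLeastLessThan_concat zero_le)
  have le: "q (S u) \<le> q (S v)" if "u \<le> v" "v < M" for u v
   using S that unfolding sorted_block_def by (cases "u = v") auto
  \<comment> \<open>In sorted order every sign is known: the elements before z lie below the pivot,
    those from z on lie above it, and ties contribute 0 with either sign. Expressing the upper part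
    by totals leaves only prefix sums to be maintained.\<close>
  have "(\<Sum>j<M. \<bar>q (S z) - q j\<bar> * y j) =
    (\<Sum>u<z. \<bar>q (S z) - q (S u)\<bar> * y (S u)) + (\<Sum>u\<in>{z..<M}. \<bar>q (S z) - q (S u)\<bar> * y (S u))"
   by (subst re, subst sp) simp
  also have "(\<Sum>u<z. \<bar>q (S z) - q (S u)\<bar> * y (S u)) = (\<Sum>u<z. q (S z) * y (S u) - q (S u) * y (S u))"
   using le[of _ z] z by (intro sum.cong) (auto simp: left_diff_distrib abs_of_nonneg)
  also have "(\<Sum>u\<in>{z..<M}. \<bar>q (S z) - q (S u)\<bar> * y (S u)) = (\<Sum>u\<in>{z..<M}. q (S u) * y (S u) - q (S z) * y (S u))"
   using le[of z] by (intro sum.cong) (auto simp: left_diff_distrib abs_of_nonpos)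
  finally have 1: "(\<Sum>j<M. \<bar>q (S z) - q j\<bar> * y j) =
    q (S z) * (\<Sum>u<z. y (S u)) - (\<Sum>u<z. q (S u) * y (S u)) +
    ((\<Sum>u\<in>{z..<M}. q (S u) * y (S u)) - q (S z) * (\<Sum>u\<in>{z..<M}. y (S u)))"
   by (simp add: sum_subtractf sum_distrib_left)
  have 2: "(\<Sum>j<M. q j * y j) = (\<Sum>u<z. q (S u) * y (S u)) + (\<Sum>u\<in>{z..<M}. q (S u) * y (S u))"
   "(\<Sum>j<M. y j) = (\<Sum>u<z. y (S u)) + (\<Sum>u\<in>{z..<M}. y (S u))"
   by (subst re, subst sp, simp)+
  show ?thesis unfolding 1 2 by (simp add: algebra_simps)
qed

definition TOTALS_STEP :: com where
  "TOTALS_STEP = Seq (RAssign 20 (RAdd (RVar 20) (RRead 1 (NConst 0) (NVar 46))))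
   (RAssign 21 (RAdd (RVar 21) (RMul (RRead 9 (NVar 37) (NVar 46)) (RRead 1 (NConst 0) (NVar 46)))))"

text \<open>Variables 20 and 21 hold the total sums of y and of q y, and 22 and 23 the same sums
  over the elements already passed; 24 is the current coordinate. The answer is updated before the
  prefix sums, in accordance with the strict bound in \<open>abs_sum_sorted\<close>.\<close>

definition SWEEP_STEP :: com where
  "SWEEP_STEP = Seq (NAssign 48 (NRead 4 (NVar 37) (NVar 47))) (Seq (RAssign 24 (RRead 9 (NVar 37) (NVar 48)))
   (Seq (RStore 2 (NConst 0) (NVar 48) (RAdd (RRead 2 (NConst 0) (NVar 48)) (RMul (RVar 2)
    (RAdd (RMul (RConst 2) (RSub (RMul (RVar 24) (RVar 22)) (RVar 23))) (RSub (RVar 21) (RMul (RVar 24) (RVar 20)))))))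
   (Seq (RAssign 22 (RAdd (RVar 22) (RRead 1 (NConst 0) (NVar 48))))
    (RAssign 23 (RAdd (RVar 23) (RMul (RVar 24) (RRead 1 (NConst 0) (NVar 48))))))))"

definition APPLY_DIR :: com where
  "APPLY_DIR = Seq (Seq (RAssign 20 (RConst 0)) (RAssign 21 (RConst 0))) (Seq (For 46 (NVar v_PW) TOTALS_STEP)
   (Seq (Seq (RAssign 22 (RConst 0)) (RAssign 23 (RConst 0))) (For 47 (NVar v_PW) SWEEP_STEP)))"

definition APPLY :: com where
  "APPLY = Seq (For 45 (NVar v_n) (RStore 2 (NConst 0) (NVar 45) (RConst 0))) (For 37 (NVar v_K) APPLY_DIR)"

lemma TOTALS_STEP_sets [simp]: "wn TOTALS_STEP = {}" "wr TOTALS_STEP = {20, 21}" "wna TOTALS_STEP = {}" "wra TOTALS_STEP = {}" "sample_free TOTALS_STEP" "csize TOTALS_STEP \<le> 21"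
  by (auto simp: TOTALS_STEP_def)

lemma SWEEP_STEP_sets [simp]: "wn SWEEP_STEP = {48}" "wr SWEEP_STEP = {22, 23, 24}" "wna SWEEP_STEP = {}" "wra SWEEP_STEP = {2}" "sample_free SWEEP_STEP" "csize SWEEP_STEP \<le> 91"
  by (auto simp: SWEEP_STEP_def)

lemma APPLY_DIR_sets [simp]: "wn APPLY_DIR = {46, 47, 48}" "wr APPLY_DIR = {20, 21, 22, 23, 24}" "wna APPLY_DIR = {}" "wra APPLY_DIR = {2}" "sample_free APPLY_DIR"
  by (auto simp: APPLY_DIR_def)

lemma APPLY_sets [simp]: "wn APPLY = {37, 45, 46, 47, 48}" "wr APPLY = {20, 21, 22, 23, 24}" "wna APPLY = {}" "wra APPLY = {2}" "sample_free APPLY"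
  by (auto simp: APPLY_def)

lemma runs_APPLY_DIR:
  assumes M: "nvar s v_PW = M" and S: "sorted_block (rarr s 9 (nvar s 37)) (narr s 4 (nvar s 37)) 0 M"
  shows "runs \<omega> APPLY_DIR s ((M + 1) * 150)
   (\<lambda>s'. \<forall>i<M. rarr s' 2 0 i = rarr s 2 0 i + rvar s 2 * (\<Sum>j<M. \<bar>rarr s 9 (nvar s 37) i - rarr s 9 (nvar s 37) j\<bar> * rarr s 1 0 j))"
proof -
  define q where "q = rarr s 9 (nvar s 37)"
  define S' where "S' = narr s 4 (nvar s 37)"
  define y where "y = rarr s 1 0"
  define dir where "dir = nvar s 37"
  have S2: "sorted_block q S' 0 M" using S by (simp add: q_def S'_def)
  have im: "S' ` {..<M} = {..<M}" using S2 by (simp add: sorted_block_def atLeast0LessThan)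
  then have inj: "inj_on S' {..<M}" by (intro eq_card_imp_inj_on) auto
  let ?a = "Seq (RAssign 20 (RConst 0)) (RAssign 21 (RConst 0))"
  let ?b = "Seq (RAssign 22 (RConst 0)) (RAssign 23 (RConst 0))"
  let ?p = "For 46 (NVar v_PW) TOTALS_STEP"
  let ?r = "For 47 (NVar v_PW) SWEEP_STEP"
  let ?D = "\<lambda>i. rvar s 2 * (\<Sum>j<M. \<bar>q i - q j\<bar> * y j)"
  let ?Q = "\<lambda>s'. \<forall>i<M. rarr s' 2 0 i = rarr s 2 0 i + ?D i"
  have "runs \<omega> APPLY_DIR s (4 + ((M + 1) * 30 + (4 + (M + 1) * 100))) ?Q"
   unfolding APPLY_DIR_def
  proof (rule runs_Seq_wp)
   show "wp \<omega> ?a (\<lambda>s'. rvar s' 20 = 0 \<and> rvar s' 21 = 0) s" by simp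
   fix s1 assume h1: "rvar s1 20 = 0 \<and> rvar s1 21 = 0" and s1: "same ?a s s1"
   let ?J = "\<lambda>z s'. rvar s' 20 = (\<Sum>j<z. y j) \<and> rvar s' 21 = (\<Sum>j<z. q j * y j)"
   show "runs \<omega> (Seq ?p (Seq ?b ?r)) s1 ((M + 1) * 30 + (4 + (M + 1) * 100)) ?Q"
   proof (rule runs_Seq_same)
    show "runs \<omega> ?p s1 ((M + 1) * 30) (\<lambda>s'. ?J M s' \<and> same ?p s1 s')"
    proof (rule runs_For_wp[where J = ?J])
     fix z s' assume h: "same ?p s1 s'" "nvar s' 46 = z" "?J z s'"
     then show "wp \<omega> TOTALS_STEP (?J (Suc z)) s'"
      by (simp add: TOTALS_STEP_def sameD[OF h(1)] sameD[OF s1] y_def q_def)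
    qed (use h1 M TOTALS_STEP_sets(6) in \<open>auto simp: sameD[OF s1]\<close>)
    fix s2 assume h2: "?J M s2 \<and> same ?p s1 s2"
    note s2 = conjunct2[OF h2]
    show "runs \<omega> (Seq ?b ?r) s2 (4 + (M + 1) * 100) ?Q"
    proof (rule runs_Seq_wp)
     show "wp \<omega> ?b (\<lambda>s'. rvar s' 22 = 0 \<and> rvar s' 23 = 0) s2" by simp
     fix s3 assume h3: "rvar s3 22 = 0 \<and> rvar s3 23 = 0" and s3: "same ?b s2 s3"
     have v3: "rvar s3 20 = (\<Sum>j<M. y j)" "rvar s3 21 = (\<Sum>j<M. q j * y j)" "rvar s3 2 = rvar s 2"
      "rarr s3 9 dir = q" "rarr s3 1 0 = y" "narr s3 4 dir = S'" "nvar s3 37 = dir" "nvar s3 v_PW = M" "rarr s3 2 = rarr s 2"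
      using h2 M by (simp_all add: sameD[OF s3] sameD[OF s2] sameD[OF s1] q_def y_def S'_def dir_def)
     let ?K = "\<lambda>z s'. rvar s' 22 = (\<Sum>z<z. y (S' z)) \<and> rvar s' 23 = (\<Sum>z<z. q (S' z) * y (S' z)) \<and>
      (\<forall>i<M. rarr s' 2 0 i = rarr s 2 0 i + (if i \<in> S' ` {..<z} then ?D i else 0))"
     have "runs \<omega> ?r s3 ((M + 1) * 100) (\<lambda>s'. ?K M s' \<and> same ?r s3 s')"
     proof (rule runs_For_wp[where J = ?K])
      fix z s' assume z: "z < M" and h: "same ?r s3 s'" "nvar s' 47 = z" "?K z s'"
      have v': "rvar s' 20 = (\<Sum>j<M. y j)" "rvar s' 21 = (\<Sum>j<M. q j * y j)" "rvar s' 2 = rvar s 2"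
       "rarr s' 9 dir = q" "rarr s' 1 0 = y" "narr s' 4 dir = S'" "nvar s' 37 = dir"
       using v3 by (simp_all add: sameD[OF h(1)])
      \<comment> \<open>The order is injective, so each entry of the answer is changed in exactly
        one round.\<close>
      have new: "S' z \<notin> S' ` {..<z}" 
      proof
       assume "S' z \<in> S' ` {..<z}"
       then obtain w where w: "w < z" "S' z = S' w" by auto
       then show False using inj_onD[OF inj w(2)] z by auto
      qed
      have zM: "S' z < M" using im z by auto
      have old: "rarr s' 2 0 (S' z) = rarr s 2 0 (S' z)" using h(3) new zM by simp
      have D: "rvar s 2 * (2 * (q (S' z) * rvar s' 22 - rvar s' 23) + ((\<Sum>j<M. q j * y j) - q (S' z) * (\<Sum>j<M. y j))) = ?D (S' z)"
       using abs_sum_sorted[OF S2 z, of y] h(3) by simp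
      show "wp \<omega> SWEEP_STEP (?K (Suc z)) s'"
       using h(3) old D zM by (auto simp: SWEEP_STEP_def v'[unfolded One_nat_def] h(2) upd2_apply lessThan_Suc)
     qed (use v3 h3 SWEEP_STEP_sets(6) in auto)
     then show "runs \<omega> ?r s3 ((M + 1) * 100) ?Q"
      by (rule runs_mono) (auto simp: im)
    qed simp
   qed simp
  qed simp
  then show ?thesis
   by (rule runs_mono) (auto simp: q_def y_def)
qed

lemma runs_APPLY:
  assumes v: "nvar s v_PW = M" "nvar s v_n = n" "nvar s v_K = K" "n \<le> M"
   and S: "\<And>k. k < K ==> sorted_block (rarr s 9 k) (narr s 4 k) 0 M"
  shows "runs \<omega> APPLY s ((K + 1) * ((M + 1) * 200))
   (\<lambda>s'. \<forall>i<n. rarr s' 2 0 i = rvar s 2 * (\<Sum>k<K. \<Sum>j<M. \<bar>rarr s 9 k i - rarr s 9 k j\<bar> * rarr s 1 0 j))"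
proof -
  let ?p = "For 45 (NVar v_n) (RStore 2 (NConst 0) (NVar 45) (RConst 0))"
  let ?r = "For 37 (NVar v_K) APPLY_DIR"
  let ?J = "\<lambda>k s'. \<forall>i<n. rarr s' 2 0 i = rvar s 2 * (\<Sum>k<k. \<Sum>j<M. \<bar>rarr s 9 k i - rarr s 9 k j\<bar> * rarr s 1 0 j)"
  have "runs \<omega> APPLY s ((n + 1) * 20 + (K + 1) * ((M + 1) * 150 + 9)) (?J K)"
   unfolding APPLY_def
  proof (rule runs_Seq_same)
   show "runs \<omega> ?p s ((n + 1) * 20) (\<lambda>s'. (\<forall>i<n. rarr s' 2 0 i = 0) \<and> same ?p s s')"
    by (rule runs_For_wp) (auto simp: v upd2_apply less_Suc_eq)
   fix s1 assume h1: "(\<forall>i<n. rarr s1 2 0 i = 0) \<and> same ?p s s1"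
   note s1 = conjunct2[OF h1]
   have "runs \<omega> ?r s1 ((K + 1) * ((M + 1) * 150 + 9)) (\<lambda>s'. ?J K s' \<and> same ?r s1 s')"
   proof (rule runs_For[where J = ?J])
    fix k s' assume k: "k < K" and h: "same ?r s1 s'" "nvar s' 37 = k" "?J k s'"
    have v': "nvar s' v_PW = M" "rarr s' 9 = rarr s 9" "narr s' 4 = narr s 4" "rvar s' 2 = rvar s 2" "rarr s' 1 = rarr s 1"
     using v by (simp_all add: sameD[OF h(1)] sameD[OF s1])
    have "sorted_block (rarr s' 9 (nvar s' 37)) (narr s' 4 (nvar s' 37)) 0 M" using S[OF k] by (simp add: v' h(2))
    from runs_APPLY_DIR[OF v'(1) this, of \<omega>]
    show "runs \<omega> APPLY_DIR s' ((M + 1) * 150) (?J (Suc k))"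
     unfolding v' h(2) by (rule runs_mono) (use h(3) v(4) in \<open>auto simp: distrib_left\<close>)
   qed (use v h1 in \<open>auto simp: sameD[OF s1]\<close>)
   then show "runs \<omega> ?r s1 ((K + 1) * ((M + 1) * 150 + 9)) (?J K)" by (rule runs_mono) auto
  qed simp
  then show ?thesis
  proof (rule runs_mono)
   have "(n + 1) * 20 \<le> 1 * ((M + 1) * 20)" using v(4) by simp
   also have "... \<le> (K + 1) * ((M + 1) * 20)" by (rule mult_le_mono1) simp
   finally have "(n + 1) * 20 \<le> (K + 1) * ((M + 1) * 20)" .
   then have "(n + 1) * 20 + (K + 1) * ((M + 1) * 150 + 9) \<le> (K + 1) * ((M + 1) * 20 + ((M + 1) * 150 + 9))"
    unfolding distrib_left[of "K + 1"] by simp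
   also have "... \<le> (K + 1) * ((M + 1) * 200)" by (rule mult_le_mono2) simp
   finally show "(n + 1) * 20 + (K + 1) * ((M + 1) * 150 + 9) \<le> (K + 1) * ((M + 1) * 200)" .
  qed auto
qed

section \<open>The exact matrix\<close>

definition MATRIX :: com where
  "MATRIX = For 33 (NVar v_n) (For 34 (NVar v_n) (Seq DIST (RStore 10 (NVar 33) (NVar 34) (RVar 10))))"

definition DENSE :: com where
  "DENSE = For 45 (NVar v_n) (Seq (RAssign 20 (RConst 0)) (Seq
   (For 46 (NVar v_n) (RAssign 20 (RAdd (RVar 20) (RMul (RRead 10 (NVar 45) (NVar 46)) (RRead 1 (NConst 0) (NVar 46))))))
   (RStore 2 (NConst 0) (NVar 45) (RVar 20))))"

lemma MATRIX_sets [simp]: "wn MATRIX = {23, 33, 34}" "wr MATRIX = {10}" "wna MATRIX = {}" "wra MATRIX = {10}" "sample_free MATRIX"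
  by (auto simp: MATRIX_def)

lemma DENSE_sets [simp]: "wn DENSE = {45, 46}" "wr DENSE = {20}" "wna DENSE = {}" "wra DENSE = {2}" "sample_free DENSE"
  by (auto simp: DENSE_def)

lemma runs_MATRIX:
  assumes v: "nvar s v_n = n" "nvar s v_d = d"
  shows "runs \<omega> MATRIX s ((n + 1) * ((n + 1) * ((d + 1) * 100)))
   (\<lambda>s'. (\<forall>i<n. \<forall>j<n. rarr s' 10 i j = dst d (rarr s 0) i j) \<and> same MATRIX s s')"
proof -
  let ?st = "RStore 10 (NVar 33) (NVar 34) (RVar 10)"
  let ?q = "For 34 (NVar v_n) (Seq DIST ?st)"
  let ?p = "For 33 (NVar v_n) ?q"
  let ?J = "\<lambda>i s'. \<forall>i'<i. \<forall>j<n. rarr s' 10 i' j = dst d (rarr s 0) i' j"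
  have "runs \<omega> ?p s ((n + 1) * ((n + 1) * ((d + 1) * 50 + 4 + 9) + 9)) (\<lambda>s'. ?J n s' \<and> same ?p s s')"
  proof (rule runs_For[where J = ?J])
   fix i s1 assume i: "i < n" and s1: "same ?p s s1" and h1: "nvar s1 33 = i" "?J i s1"
   have v1: "nvar s1 v_n = n" "nvar s1 v_d = d" "rarr s1 0 = rarr s 0" using v by (simp_all add: sameD[OF s1])
   let ?K = "\<lambda>j s'. ?J i s' \<and> (\<forall>j'<j. rarr s' 10 i j' = dst d (rarr s 0) i j')"
   have "runs \<omega> ?q s1 ((n + 1) * ((d + 1) * 50 + 4 + 9)) (\<lambda>s'. ?K n s' \<and> same ?q s1 s')"
   proof (rule runs_For[where J = ?K])
    fix j s2 assume s2: "same ?q s1 s2" and h2: "nvar s2 34 = j" "?K j s2"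
    have v2: "nvar s2 v_d = d" "nvar s2 33 = i" "rarr s2 0 = rarr s 0" using v1 h1 by (simp_all add: sameD[OF s2])
    show "runs \<omega> (Seq DIST ?st) s2 ((d + 1) * 50 + 4) (?K (Suc j))"
    proof (rule runs_Seq_same[OF runs_DIST[OF v2(1)]])
     fix s3 assume h3: "rvar s3 10 = dst d (rarr s2 0) (nvar s2 33) (nvar s2 34) \<and> same DIST s2 s3"
     note s3 = conjunct2[OF h3]
     have v3: "rvar s3 10 = dst d (rarr s 0) i j" "nvar s3 33 = i" "nvar s3 34 = j" "rarr s3 10 = rarr s2 10"
      using h3 h2 v2 by (simp_all add: sameD[OF s3])
     have "runs \<omega> ?st s3 (csize ?st) (?K (Suc j))"
      by (rule runs_wp) (use h2 i in \<open>auto simp: v3 upd2_apply less_Suc_eq\<close>)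
     then show "runs \<omega> ?st s3 4 (?K (Suc j))" by (rule runs_mono) auto
    qed simp
   qed (use v1 h1 in auto)
   then show "runs \<omega> ?q s1 ((n + 1) * ((d + 1) * 50 + 4 + 9)) (?J (Suc i))"
    by (rule runs_mono) (auto simp: less_Suc_eq)
  qed (use v in auto)
  then show ?thesis
   unfolding MATRIX_def[symmetric]
  proof (rule runs_mono)
   have "(n + 1) * ((d + 1) * 50 + 4 + 9) + 9 \<le> (n + 1) * ((d + 1) * 50 + 22)" by simp
   also have "... \<le> (n + 1) * ((d + 1) * 100)" by (rule mult_le_mono2) simp
   finally show "(n + 1) * ((n + 1) * ((d + 1) * 50 + 4 + 9) + 9) \<le> (n + 1) * ((n + 1) * ((d + 1) * 100))"
    by (rule mult_le_mono2)
  qed auto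
qed

lemma runs_DENSE:
  assumes v: "nvar s v_n = n"
  shows "runs \<omega> DENSE s ((n + 1) * ((n + 1) * 60))
   (\<lambda>s'. \<forall>i<n. rarr s' 2 0 i = (\<Sum>j<n. rarr s 10 i j * rarr s 1 0 j))"
proof -
  let ?st = "RStore 2 (NConst 0) (NVar 45) (RVar 20)"
  let ?q = "For 46 (NVar v_n) (RAssign 20 (RAdd (RVar 20) (RMul (RRead 10 (NVar 45) (NVar 46)) (RRead 1 (NConst 0) (NVar 46)))))"
  let ?b = "Seq (RAssign 20 (RConst 0)) (Seq ?q ?st)"
  let ?p = "For 45 (NVar v_n) ?b"
  let ?J = "\<lambda>r s'. \<forall>i<r. rarr s' 2 0 i = (\<Sum>j<n. rarr s 10 i j * rarr s 1 0 j)"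
  have "runs \<omega> ?p s ((n + 1) * ((2 + ((n + 1) * 30 + 4)) + 9)) (\<lambda>s'. ?J n s' \<and> same ?p s s')"
  proof (rule runs_For[where J = ?J])
   fix i s1 assume i: "i < n" and s1: "same ?p s s1" and h1: "nvar s1 45 = i" "?J i s1"
   show "runs \<omega> ?b s1 (2 + ((n + 1) * 30 + 4)) (?J (Suc i))"
   proof (rule runs_Seq_wp)
    show "wp \<omega> (RAssign 20 (RConst 0)) (\<lambda>s'. rvar s' 20 = 0) s1" by simp
    fix s2 assume h2: "rvar s2 20 = 0" and s2: "same (RAssign 20 (RConst 0)) s1 s2"
    have v2: "nvar s2 v_n = n" "nvar s2 45 = i" "rarr s2 10 = rarr s 10" "rarr s2 1 = rarr s 1" "rarr s2 2 = rarr s1 2"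
     using v h1 by (simp_all add: sameD[OF s2] sameD[OF s1])
    let ?K = "\<lambda>j s'. rvar s' 20 = (\<Sum>j<j. rarr s 10 i j * rarr s 1 0 j)"
    show "runs \<omega> (Seq ?q ?st) s2 ((n + 1) * 30 + 4) (?J (Suc i))"
    proof (rule runs_Seq_same)
     show "runs \<omega> ?q s2 ((n + 1) * 30) (\<lambda>s'. ?K n s' \<and> same ?q s2 s')"
     proof (rule runs_For_wp[where J = ?K])
      fix j s' assume h: "same ?q s2 s'" "nvar s' 46 = j" "?K j s'"
      then show "wp \<omega> (RAssign 20 (RAdd (RVar 20) (RMul (RRead 10 (NVar 45) (NVar 46)) (RRead 1 (NConst 0) (NVar 46))))) (?K (Suc j)) s'"
       by (simp add: sameD[OF h(1)] v2[unfolded One_nat_def])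
     qed (use v2 h2 in auto)
     fix s3 assume h3: "?K n s3 \<and> same ?q s2 s3"
     note s3 = conjunct2[OF h3]
     have "runs \<omega> ?st s3 (csize ?st) (?J (Suc i))"
      by (rule runs_wp) (use h1 h3 in \<open>auto simp: v2 sameD[OF s3] upd2_apply less_Suc_eq\<close>)
     then show "runs \<omega> ?st s3 4 (?J (Suc i))" by (rule runs_mono) auto
    qed simp
   qed simp
  qed (use v in auto)
  then show ?thesis
   unfolding DENSE_def[symmetric]
  proof (rule runs_mono)
   show "(n + 1) * ((2 + ((n + 1) * 30 + 4)) + 9) \<le> (n + 1) * ((n + 1) * 60)"
    by (rule mult_le_mono2) simp
  qed auto
qed

section \<open>Preprocessing\<close>

text \<open>\<open>h\<close> keeps the previous power of two, which is half of the final one, or 0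
  if that is 1. The transform needs this value and the machine cannot halve.\<close>

definition DOUBLE :: "name => name => name => name => com" where
  "DOUBLE p e h t = Seq (Seq (NAssign p (NConst 1)) (Seq (NAssign e (NConst 0)) (NAssign h (NConst 0))))
   (While (NLess (NVar p) (NVar t)) (Seq (NAssign h (NVar p)) (Seq (NAssign p (NAdd (NVar p) (NVar p))) (NAssign e (NAdd (NVar e) (NConst 1))))))"

lemma DOUBLE_sets [simp]: "wn (DOUBLE p e h t) = {p, e, h}" "wr (DOUBLE p e h t) = {}" "wna (DOUBLE p e h t) = {}"
  "wra (DOUBLE p e h t) = {}" "sample_free (DOUBLE p e h t)"
  by (auto simp: DOUBLE_def)

lemma runs_DOUBLE:
  assumes d: "distinct [p, e, h, t]" and t: "nvar s t = n" and k: "n \<le> 2 ^ k" "\<And>i. i < k ==> 2 ^ i < n"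
  shows "runs \<omega> (DOUBLE p e h t) s ((k + 1) * 20)
   (\<lambda>s'. nvar s' p = 2 ^ k \<and> nvar s' e = k \<and> nvar s' h = 2 ^ k div 2)"
proof -
  let ?a = "Seq (NAssign p (NConst 1)) (Seq (NAssign e (NConst 0)) (NAssign h (NConst 0)))"
  let ?b = "NLess (NVar p) (NVar t)"
  let ?p = "Seq (NAssign h (NVar p)) (Seq (NAssign p (NAdd (NVar p) (NVar p))) (NAssign e (NAdd (NVar e) (NConst 1))))"
  let ?I = "\<lambda>i (s' :: state). i \<le> k \<and> nvar s' p = 2 ^ i \<and> nvar s' e = i \<and> nvar s' h = 2 ^ i div 2 \<and> nvar s' t = n"
  let ?W = "(\<Sum>i\<in>{0..<k}. 10 + 1 + bcost ?b) + 1 + bcost ?b"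
  have "runs \<omega> (DOUBLE p e h t) s (6 + ?W)
   (\<lambda>s'. nvar s' p = 2 ^ k \<and> nvar s' e = k \<and> nvar s' h = 2 ^ k div 2)"
   unfolding DOUBLE_def
  proof (rule runs_Seq_wp)
   show "wp \<omega> ?a (?I 0) s" using d t by simp
   fix s1 assume s1: "?I 0 s1"
   have "runs \<omega> (While ?b ?p) s1 ?W (\<lambda>s'. (\<exists>i. ?I i s') \<and> \<not> bval ?b s')"
   proof (rule runs_While)
    fix i s' assume I: "?I i s'" and b: "bval ?b s'"
    have "2 ^ i < n" using I b by simp
    then have "(2::nat) ^ i < 2 ^ k" using k(1) by (rule less_le_trans)
    then have ik: "i < k" by simp
    have "runs \<omega> ?p s' (csize ?p) (?I (Suc i))"
     by (rule runs_wp) (use I ik d in auto)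
    then show "i < k \<and> runs \<omega> ?p s' 10 (?I (Suc i))" using ik by (auto elim!: runs_mono)
   qed (use s1 in auto)
   then show "runs \<omega> (While ?b ?p) s1 ?W
    (\<lambda>s'. nvar s' p = 2 ^ k \<and> nvar s' e = k \<and> nvar s' h = 2 ^ k div 2)"
   proof (rule runs_mono)
    fix s' assume s': "(\<exists>i. ?I i s') \<and> \<not> bval ?b s'"
    then obtain i where i: "?I i s'" by blast
    have "\<not> i < k" using k(2)[of i] s' i by auto
    then have "i = k" using i by simp
    then show "nvar s' p = 2 ^ k \<and> nvar s' e = k \<and> nvar s' h = 2 ^ k div 2" using i by simp
   qed simp
  qed simp
  then show ?thesis by (rule runs_mono) auto
qed

section \<open>Sizes found by counting\<close>

definition blocks_cond :: bexp where
  "blocks_cond = BAnd (NLess (NVar v_rho) (NVar v_d)) (BAnd (BNot (RLess (RVar 1) (RAdd (ROfNat (NVar v_rho)) (RConst 1))))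
   (BNot (RLess (RMul (RVar 1) (ROfNat (NVar v_n)))
    (RMul (RMul (RAdd (ROfNat (NVar v_rho)) (RConst 1)) (RMul (ROfNat (NVar v_L)) (ROfNat (NVar v_L))))
     (RMul (RAdd (ROfNat (NVar v_rho)) (RConst 1)) (RMul (ROfNat (NVar v_L)) (ROfNat (NVar v_L))))))))"

definition ROWS :: com where
  "ROWS = Seq (NAssign v_rho (NConst 1)) (While blocks_cond (NAssign v_rho (NAdd (NVar v_rho) (NConst 1))))"

lemma ROWS_sets [simp]: "wn ROWS = {5}" "wr ROWS = {}" "wna ROWS = {}" "wra ROWS = {}" "sample_free ROWS"
  by (auto simp: ROWS_def)

text \<open>The first condition keeps N \<rho> <= 2 \<kappa> after rounding the number of blocks up;
  the second is the one that the tail bound for large deviations needs. More rows per block mean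
  fewer transforms, so the largest admissible \<rho> is sought. The program forms the products over
  the reals, where multiplication is available.\<close>

definition rows_ok :: "real => nat => nat => nat => bool" where
  "rows_ok \<kappa> n L \<rho> \<longleftrightarrow> real \<rho> \<le> \<kappa> \<and> (real \<rho> * (real L)\<^sup>2)\<^sup>2 \<le> \<kappa> * real n"

lemma rows_ok_mono: "rows_ok \<kappa> n L \<rho> ==> \<rho>' \<le> \<rho> ==> rows_ok \<kappa> n L \<rho>'"
  unfolding rows_ok_def
  by (meson of_nat_mono order_trans power_mono mult_right_mono zero_le_power2 mult_nonneg_nonneg of_nat_0_le_iff)

text \<open>By monotonicity of \<open>rows_ok\<close> the first failure already determines the
  largest admissible number.\<close>

lemma runs_ROWS:
  assumes v: "nvar s v_n = n" "nvar s v_d = d" "nvar s v_L = L" "rvar s 1 = \<kappa>"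
   and \<rho>: "0 < \<rho>" "\<rho> \<le> d" "rows_ok \<kappa> n L \<rho>" "\<rho> < d ==> \<not> rows_ok \<kappa> n L (\<rho> + 1)"
  shows "runs \<omega> ROWS s ((d + 1) * 60) (\<lambda>s'. nvar s' v_rho = \<rho>)"
proof -
  let ?p = "NAssign v_rho (NAdd (NVar v_rho) (NConst 1))"
  let ?I = "\<lambda>i (s' :: state). i + 1 \<le> \<rho> \<and> nvar s' v_rho = i + 1 \<and> nvar s' v_n = n \<and> nvar s' v_d = d \<and> nvar s' v_L = L \<and> rvar s' 1 = \<kappa>"
  let ?W = "(\<Sum>i\<in>{0..<\<rho> - 1}. 4 + 1 + bcost blocks_cond) + 1 + bcost blocks_cond"
  \<comment> \<open>After i rounds the counter stands at i + 1, and the test asks about the next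
    value i + 2.\<close>
  have c: "bval blocks_cond s' \<longleftrightarrow> i + 1 < d \<and> rows_ok \<kappa> n L (i + 2)" if "?I i s'" for i s'
   using that by (auto simp: blocks_cond_def rows_ok_def power2_eq_square not_less add.commute)
  have "runs \<omega> ROWS s (2 + ?W) (\<lambda>s'. nvar s' v_rho = \<rho>)"
   unfolding ROWS_def
  proof (rule runs_Seq_wp)
   show "wp \<omega> (NAssign v_rho (NConst 1)) (?I 0) s" using v \<rho>(1) by simp
   fix s1 assume s1: "?I 0 s1"
   have "runs \<omega> (While blocks_cond ?p) s1 ?W
    (\<lambda>s'. (\<exists>i. ?I i s') \<and> \<not> bval blocks_cond s')"
   proof (rule runs_While)
    fix i s' assume I: "?I i s'" and b: "bval blocks_cond s'"
    have "i + 1 \<noteq> \<rho>" using c[OF I] b \<rho>(4) by auto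
    then have i: "i + 2 \<le> \<rho>" using I by simp
    have "runs \<omega> ?p s' (csize ?p) (?I (Suc i))" by (rule runs_wp) (use I i in auto)
    then show "i < \<rho> - 1 \<and> runs \<omega> ?p s' 4 (?I (Suc i))" using i by (auto elim!: runs_mono)
   qed (use s1 in auto)
   then show "runs \<omega> (While blocks_cond ?p) s1 ?W (\<lambda>s'. nvar s' v_rho = \<rho>)"
   proof (rule runs_mono)
    fix s' assume s': "(\<exists>i. ?I i s') \<and> \<not> bval blocks_cond s'"
    then obtain i where i: "?I i s'" by blast
    have "\<not> i + 2 \<le> \<rho>"
    proof
     assume h: "i + 2 \<le> \<rho>"
     then have "rows_ok \<kappa> n L (i + 2)" using rows_ok_mono[OF \<rho>(3)] by blast
     then show False using c[OF i] s' h \<rho>(2) by simp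
    qed
    then show "nvar s' v_rho = \<rho>" using i by simp
   qed simp
  qed simp
  then show ?thesis
  proof (rule runs_mono)
   have "2 + ?W = 2 + ((\<rho> - 1) * (5 + bcost blocks_cond) + 1 + bcost blocks_cond)"
    by simp
   also have "... \<le> 2 + (d * (5 + bcost blocks_cond) + 1 + bcost blocks_cond)" using \<rho>(2) by (intro add_mono mult_le_mono) auto
   also have "... \<le> (d + 1) * 60" by (simp add: blocks_cond_def)
   finally show "2 + ?W \<le> (d + 1) * 60" .
  qed auto
qed

text \<open>The ceiling of \<kappa> / \<rho> by repeated addition, since a real number cannot be
  rounded to a natural number.\<close>

definition BLOCKS :: com where
  "BLOCKS = Seq (Seq (NAssign v_N (NConst 1)) (RAssign 3 (ROfNat (NVar v_rho))))
   (While (RLess (RVar 3) (RVar 1)) (Seq (NAssign v_N (NAdd (NVar v_N) (NConst 1))) (RAssign 3 (RAdd (RVar 3) (ROfNat (NVar v_rho))))))"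

lemma BLOCKS_sets [simp]: "wn BLOCKS = {6}" "wr BLOCKS = {3}" "wna BLOCKS = {}" "wra BLOCKS = {}" "sample_free BLOCKS"
  by (auto simp: BLOCKS_def)

lemma runs_BLOCKS:
  assumes v: "nvar s v_rho = \<rho>" "rvar s 1 = \<kappa>"
   and N: "0 < N" "\<kappa> \<le> real N * real \<rho>" "\<And>k. 0 < k ==> k < N ==> real k * real \<rho> < \<kappa>"
  shows "runs \<omega> BLOCKS s ((N + 1) * 20) (\<lambda>s'. nvar s' v_N = N)"
proof -
  let ?a = "Seq (NAssign v_N (NConst 1)) (RAssign 3 (ROfNat (NVar v_rho)))"
  let ?b = "RLess (RVar 3) (RVar 1)"
  let ?p = "Seq (NAssign v_N (NAdd (NVar v_N) (NConst 1))) (RAssign 3 (RAdd (RVar 3) (ROfNat (NVar v_rho))))"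
  let ?I = "\<lambda>i (s' :: state). i + 1 \<le> N \<and> nvar s' v_N = i + 1 \<and> rvar s' 3 = real (i + 1) * real \<rho> \<and> nvar s' v_rho = \<rho> \<and> rvar s' 1 = \<kappa>"
  let ?W = "(\<Sum>i\<in>{0..<N}. 10 + 1 + bcost ?b) + 1 + bcost ?b"
  have "runs \<omega> BLOCKS s (5 + ?W) (\<lambda>s'. nvar s' v_N = N)"
   unfolding BLOCKS_def
  proof (rule runs_Seq_wp)
   show "wp \<omega> ?a (?I 0) s" using v N(1) by simp
   fix s1 assume s1: "?I 0 s1"
   have "runs \<omega> (While ?b ?p) s1 ?W (\<lambda>s'. (\<exists>i. ?I i s') \<and> \<not> bval ?b s')"
   proof (rule runs_While)
    fix i s' assume I: "?I i s'" and b: "bval ?b s'"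
    have lt: "real (i + 1) * real \<rho> < \<kappa>" using I b by simp
    have "i + 1 \<noteq> N"
    proof
     assume h: "i + 1 = N"
     from lt show False unfolding h using N(2) by simp
    qed
    then have i: "i + 1 < N" using I by simp
    have "runs \<omega> ?p s' (csize ?p) (?I (Suc i))" by (rule runs_wp) (use I i in \<open>auto simp: algebra_simps\<close>)
    then show "i < N \<and> runs \<omega> ?p s' 10 (?I (Suc i))" using i by (auto elim!: runs_mono)
   qed (use s1 in auto)
   then show "runs \<omega> (While ?b ?p) s1 ?W (\<lambda>s'. nvar s' v_N = N)"
   proof (rule runs_mono)
    fix s' assume s': "(\<exists>i. ?I i s') \<and> \<not> bval ?b s'"
    then obtain i where i: "?I i s'" by blast
    have "\<not> i + 1 < N" using N(3)[of "i + 1"] s' i by auto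
    then show "nvar s' v_N = N" using i by simp
   qed simp
  qed simp
  then show ?thesis by (rule runs_mono) auto
qed

definition TESTS :: com where
  "TESTS = Seq (Seq (NAssign v_m (NConst 1)) (NAssign 16 (NVar v_L)))
   (While (NLess (NVar 16) (NVar v_n)) (Seq (NAssign v_m (NAdd (NVar v_m) (NConst 1))) (NAssign 16 (NAdd (NVar 16) (NVar v_L)))))"

lemma TESTS_sets [simp]: "wn TESTS = {7, 16}" "wr TESTS = {}" "wna TESTS = {}" "wra TESTS = {}" "sample_free TESTS"
  by (auto simp: TESTS_def)

lemma runs_TESTS:
  assumes v: "nvar s v_L = L" "nvar s v_n = n"
   and m: "0 < m" "n \<le> m * L" "\<And>k. k < m ==> k * L < n"
  shows "runs \<omega> TESTS s ((m + 1) * 20) (\<lambda>s'. nvar s' v_m = m)"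
proof -
  let ?a = "Seq (NAssign v_m (NConst 1)) (NAssign 16 (NVar v_L))"
  let ?b = "NLess (NVar 16) (NVar v_n)"
  let ?p = "Seq (NAssign v_m (NAdd (NVar v_m) (NConst 1))) (NAssign 16 (NAdd (NVar 16) (NVar v_L)))"
  let ?I = "\<lambda>i (s' :: state). i + 1 \<le> m \<and> nvar s' v_m = i + 1 \<and> nvar s' 16 = (i + 1) * L \<and> nvar s' v_L = L \<and> nvar s' v_n = n"
  let ?W = "(\<Sum>i\<in>{0..<m}. 8 + 1 + bcost ?b) + 1 + bcost ?b"
  have "runs \<omega> TESTS s (4 + ?W) (\<lambda>s'. nvar s' v_m = m)"
   unfolding TESTS_def
  proof (rule runs_Seq_wp)
   show "wp \<omega> ?a (?I 0) s" using v m(1) by simp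
   fix s1 assume s1: "?I 0 s1"
   have "runs \<omega> (While ?b ?p) s1 ?W (\<lambda>s'. (\<exists>i. ?I i s') \<and> \<not> bval ?b s')"
   proof (rule runs_While)
    fix i s' assume I: "?I i s'" and b: "bval ?b s'"
    have lt: "(i + 1) * L < n" using I b by simp
    have "i + 1 \<noteq> m"
    proof
     assume h: "i + 1 = m"
     from lt show False unfolding h using m(2) by simp
    qed
    then have i: "i + 1 < m" using I by simp
    have "runs \<omega> ?p s' (csize ?p) (?I (Suc i))" by (rule runs_wp) (use I i in \<open>auto simp: algebra_simps\<close>)
    then show "i < m \<and> runs \<omega> ?p s' 8 (?I (Suc i))" using i by (auto elim!: runs_mono)
   qed (use s1 in auto)
   then show "runs \<omega> (While ?b ?p) s1 ?W (\<lambda>s'. nvar s' v_m = m)"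
   proof (rule runs_mono)
    fix s' assume s': "(\<exists>i. ?I i s') \<and> \<not> bval ?b s'"
    then obtain i where i: "?I i s'" by blast
    have "\<not> i + 1 < m" using m(3)[of "i + 1"] s' i by auto
    then show "nvar s' v_m = m" using i by simp
   qed simp
  qed simp
  then show ?thesis by (rule runs_mono) auto
qed

section \<open>Weights of the points and sampling slots\<close>

definition mean :: "nat => (nat => nat => real) => nat => real" where
  "mean n X c = (\<Sum>i<n. X i c) / real n"

text \<open>The squared distance to the centroid. All weights take only O(n d) steps, and still they
  control the n^2 squared distances, by \<open>sum_dst_sq\<close> and
  \<open>dst_sq_le_weights\<close>.\<close>

definition weight :: "nat => nat => (nat => nat => real) => nat => real" where
  "weight n d X i = (\<Sum>c<d. (X i c - mean n X c)\<^sup>2)"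

definition MEAN_BODY :: com where
  "MEAN_BODY = Seq (RAssign 20 (RConst 0)) (Seq (For 23 (NVar v_n) (RAssign 20 (RAdd (RVar 20) (RRead 0 (NVar 23) (NVar 22)))))
   (RStore 4 (NConst 0) (NVar 22) (RDiv (RVar 20) (ROfNat (NVar v_n)))))"

definition WEIGHT_BODY :: com where
  "WEIGHT_BODY = Seq (RAssign 20 (RConst 0)) (Seq (For 22 (NVar v_d) (RAssign 20 (RAdd (RVar 20)
    (RMul (RSub (RRead 0 (NVar 23) (NVar 22)) (RRead 4 (NConst 0) (NVar 22))) (RSub (RRead 0 (NVar 23) (NVar 22)) (RRead 4 (NConst 0) (NVar 22)))))))
   (Seq (RStore 4 (NConst 1) (NVar 23) (RVar 20)) (RAssign 4 (RAdd (RVar 4) (RVar 20)))))"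

definition WEIGHTS :: com where
  "WEIGHTS = Seq (For 22 (NVar v_d) MEAN_BODY) (Seq (RAssign 4 (RConst 0)) (For 23 (NVar v_n) WEIGHT_BODY))"

lemma WEIGHTS_sets [simp]: "wn WEIGHTS = {22, 23}" "wr WEIGHTS = {4, 20}" "wna WEIGHTS = {}" "wra WEIGHTS = {4}" "sample_free WEIGHTS"
  by (auto simp: WEIGHTS_def MEAN_BODY_def WEIGHT_BODY_def)

lemma WEIGHTS_body_sets: "wn MEAN_BODY = {23}" "wr MEAN_BODY = {20}" "wna MEAN_BODY = {}" "wra MEAN_BODY = {4}" "sample_free MEAN_BODY"
  "wn WEIGHT_BODY = {22}" "wr WEIGHT_BODY = {4, 20}" "wna WEIGHT_BODY = {}" "wra WEIGHT_BODY = {4}" "sample_free WEIGHT_BODY"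
  by (auto simp: MEAN_BODY_def WEIGHT_BODY_def)

lemma runs_WEIGHTS:
  assumes v: "nvar s v_n = n" "nvar s v_d = d"
  shows "runs \<omega> WEIGHTS s ((n + 1) * ((d + 1) * 200))
   (\<lambda>s'. (\<forall>i<n. rarr s' 4 1 i = weight n d (rarr s 0) i) \<and> rvar s' 4 = (\<Sum>i<n. weight n d (rarr s 0) i))"
proof -
  note WEIGHTS_body_sets[simp]
  define X where "X = rarr s 0"
  let ?p = "For 22 (NVar v_d) MEAN_BODY"
  let ?J = "\<lambda>c (s' :: state). \<forall>c'<c. rarr s' 4 0 c' = mean n X c'"
  let ?q = "For 23 (NVar v_n) (RAssign 20 (RAdd (RVar 20) (RRead 0 (NVar 23) (NVar 22))))"
  let ?st = "RStore 4 (NConst 0) (NVar 22) (RDiv (RVar 20) (ROfNat (NVar v_n)))"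
  let ?r = "For 23 (NVar v_n) WEIGHT_BODY"
  let ?M = "\<lambda>i (s' :: state). (\<forall>i'<i. rarr s' 4 1 i' = weight n d X i') \<and> rvar s' 4 = (\<Sum>i'<i. weight n d X i') \<and> (\<forall>c'<d. rarr s' 4 0 c' = mean n X c')"
  let ?u = "For 22 (NVar v_d) (RAssign 20 (RAdd (RVar 20)
    (RMul (RSub (RRead 0 (NVar 23) (NVar 22)) (RRead 4 (NConst 0) (NVar 22))) (RSub (RRead 0 (NVar 23) (NVar 22)) (RRead 4 (NConst 0) (NVar 22))))))"
  let ?su = "Seq (RStore 4 (NConst 1) (NVar 23) (RVar 20)) (RAssign 4 (RAdd (RVar 4) (RVar 20)))"
  let ?T1 = "(d + 1) * ((2 + ((n + 1) * 20 + 10)) + 9)" and ?T2 = "(n + 1) * ((2 + ((d + 1) * 40 + 10)) + 9)"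
  have "runs \<omega> WEIGHTS s (?T1 + (2 + ?T2)) (?M n)"
   unfolding WEIGHTS_def
  proof (rule runs_Seq_same)
   show "runs \<omega> ?p s ?T1 (\<lambda>s'. ?J d s' \<and> same ?p s s')"
   proof (rule runs_For[where J = ?J])
    fix c s1 assume s1: "same ?p s s1" and h1: "nvar s1 22 = c" "?J c s1"
    show "runs \<omega> MEAN_BODY s1 (2 + ((n + 1) * 20 + 10)) (?J (Suc c))"
     unfolding MEAN_BODY_def
    proof (rule runs_Seq_wp)
     show "wp \<omega> (RAssign 20 (RConst 0)) (\<lambda>s'. rvar s' 20 = 0) s1" by simp
     fix s2 assume h2: "rvar s2 20 = 0" and s2: "same (RAssign 20 (RConst 0)) s1 s2"
     have v2: "nvar s2 v_n = n" "nvar s2 22 = c" "rarr s2 0 = X" "rarr s2 4 = rarr s1 4"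
      using v h1 by (simp_all add: sameD[OF s2] sameD[OF s1] X_def)
     show "runs \<omega> (Seq ?q ?st) s2 ((n + 1) * 20 + 10) (?J (Suc c))"
     proof (rule runs_Seq_same)
      show "runs \<omega> ?q s2 ((n + 1) * 20) (\<lambda>s'. rvar s' 20 = (\<Sum>i<n. X i c) \<and> same ?q s2 s')"
      proof (rule runs_For_wp[where J = "\<lambda>r s'. rvar s' 20 = (\<Sum>i<r. X i c)"])
       fix i s' assume h: "same ?q s2 s'" "nvar s' 23 = i" "rvar s' 20 = (\<Sum>i<i. X i c)"
       then show "wp \<omega> (RAssign 20 (RAdd (RVar 20) (RRead 0 (NVar 23) (NVar 22)))) (\<lambda>s'. rvar s' 20 = (\<Sum>i<Suc i. X i c)) s'"
        by (simp add: sameD[OF h(1)] v2)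
      qed (use v2 h2 in auto)
      fix s3 assume h3: "rvar s3 20 = (\<Sum>i<n. X i c) \<and> same ?q s2 s3"
      note s3 = conjunct2[OF h3]
      have "runs \<omega> ?st s3 (csize ?st) (?J (Suc c))"
       by (rule runs_wp) (use h1 h3 in \<open>auto simp: sameD[OF s3] v2 upd2_apply less_Suc_eq mean_def\<close>)
      then show "runs \<omega> ?st s3 10 (?J (Suc c))" by (rule runs_mono) auto
     qed simp
    qed simp
   qed (use v in auto)
   fix s4 assume h4: "?J d s4 \<and> same ?p s s4"
   note s4 = conjunct2[OF h4]
   show "runs \<omega> (Seq (RAssign 4 (RConst 0)) ?r) s4 (2 + ?T2) (?M n)"
   proof (rule runs_Seq_wp)
    show "wp \<omega> (RAssign 4 (RConst 0)) (?M 0) s4" using h4 by simp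
    fix s5 assume h5: "?M 0 s5" and s5: "same (RAssign 4 (RConst 0)) s4 s5"
    have "runs \<omega> ?r s5 ?T2 (\<lambda>s'. ?M n s' \<and> same ?r s5 s')"
    proof (rule runs_For[where J = ?M])
     show "nvar s5 v_n = n" using v by (simp add: sameD[OF s5] sameD[OF s4])
     fix i s6 assume s6: "same ?r s5 s6" and h6: "nvar s6 23 = i" "?M i s6"
     show "runs \<omega> WEIGHT_BODY s6 (2 + ((d + 1) * 40 + 10)) (?M (Suc i))"
      unfolding WEIGHT_BODY_def
     proof (rule runs_Seq_wp)
      show "wp \<omega> (RAssign 20 (RConst 0)) (\<lambda>s'. rvar s' 20 = 0) s6" by simp
      fix s7 assume h7: "rvar s7 20 = 0" and s7: "same (RAssign 20 (RConst 0)) s6 s7"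
      have v7: "nvar s7 v_d = d" "nvar s7 23 = i" "rarr s7 0 = X" "rarr s7 4 = rarr s6 4" "rvar s7 4 = rvar s6 4"
       using v h6 by (simp_all add: sameD[OF s7] sameD[OF s6] sameD[OF s5] sameD[OF s4] X_def)
      let ?K = "\<lambda>r (s' :: state). rvar s' 20 = (\<Sum>c<r. (X i c - mean n X c)\<^sup>2)"
      show "runs \<omega> (Seq ?u ?su) s7 ((d + 1) * 40 + 10) (?M (Suc i))"
      proof (rule runs_Seq_same)
       show "runs \<omega> ?u s7 ((d + 1) * 40) (\<lambda>s'. ?K d s' \<and> same ?u s7 s')"
       proof (rule runs_For_wp[where J = ?K])
        fix c s' assume c: "c < d" and h: "same ?u s7 s'" "nvar s' 22 = c" "?K c s'"
        have "rarr s' 4 0 c = mean n X c" using h6 c by (simp add: sameD[OF h(1)] v7)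
        then show "wp \<omega> (RAssign 20 (RAdd (RVar 20)
         (RMul (RSub (RRead 0 (NVar 23) (NVar 22)) (RRead 4 (NConst 0) (NVar 22))) (RSub (RRead 0 (NVar 23) (NVar 22)) (RRead 4 (NConst 0) (NVar 22)))))) (?K (Suc c)) s'"
         using h by (simp add: sameD[OF h(1)] v7 power2_eq_square)
       qed (use v7 h7 in auto)
       fix s8 assume h8: "?K d s8 \<and> same ?u s7 s8"
       note s8 = conjunct2[OF h8]
       have "runs \<omega> ?su s8 (csize ?su) (?M (Suc i))"
        by (rule runs_wp) (use h6 h8 in \<open>auto simp: sameD[OF s8] v7 upd2_apply less_Suc_eq weight_def\<close>)
       then show "runs \<omega> ?su s8 10 (?M (Suc i))" by (rule runs_mono) auto
      qed simp
     qed simp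
    qed (use h5 in auto)
    then show "runs \<omega> ?r s5 ?T2 (?M n)" by (rule runs_mono) auto
   qed simp
  qed simp
  then show ?thesis
   by (rule runs_mono) (auto simp: X_def algebra_simps)
qed

definition SLOT_PUSH :: com where
  "SLOT_PUSH = Seq (NStore 0 (NConst 0) (NVar v_R) (NVar 23)) (Seq (NAssign v_R (NAdd (NVar v_R) (NConst 1))) (NAssign 24 (NAdd (NVar 24) (NConst 1))))"

text \<open>Compares the slots opened so far with n times the share of the point in the total
  weight. The comparison is cross-multiplied, so a total weight of 0 leaves each point with the one
  slot that it receives unconditionally.\<close>

definition slot_cond :: bexp where
  "slot_cond = RLess (RMul (ROfNat (NVar 24)) (RVar 4)) (RMul (ROfNat (NVar v_n)) (RRead 4 (NConst 1) (NVar 23)))"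

definition SLOT_BODY :: com where
  "SLOT_BODY = Seq (Seq (NAssign 24 (NConst 0)) SLOT_PUSH) (Seq (While slot_cond SLOT_PUSH) (NStore 1 (NConst 0) (NVar 23) (NVar 24)))"

definition SLOTS :: com where
  "SLOTS = Seq (NAssign v_R (NConst 0)) (For 23 (NVar v_n) SLOT_BODY)"

lemma SLOTS_sets [simp]: "wn SLOTS = {14, 23, 24}" "wr SLOTS = {}" "wna SLOTS = {0, 1}" "wra SLOTS = {}" "sample_free SLOTS"
  by (auto simp: SLOTS_def SLOT_PUSH_def SLOT_BODY_def)

lemma SLOT_BODY_sets: "wn SLOT_BODY = {14, 24}" "wr SLOT_BODY = {}" "wna SLOT_BODY = {0, 1}" "wra SLOT_BODY = {}" "sample_free SLOT_BODY"
  by (auto simp: SLOT_PUSH_def SLOT_BODY_def)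

text \<open>The inner loop has a different length for every point; only the sum of the lengths is
  bounded by 2 n. Hence the loop rule with summed times.\<close>

lemma runs_SLOTS:
  fixes r own :: "nat => nat"
  assumes v: "nvar s v_n = n" "rvar s 4 = S"
   and r: "\<And>i. i < n ==> 0 < r i" "\<And>i. i < n ==> real n * rarr s 4 1 i \<le> real (r i) * S"
    "\<And>i k. i < n ==> 0 < k ==> k < r i ==> real k * S < real n * rarr s 4 1 i"
   and own: "\<And>i k. i < n ==> k < r i ==> own ((\<Sum>i'<i. r i') + k) = i"
  shows "runs \<omega> SLOTS s ((\<Sum>i<n. r i) * 30 + (n + 1) * 60)
   (\<lambda>s'. nvar s' v_R = (\<Sum>i<n. r i) \<and> (\<forall>u<\<Sum>i<n. r i. narr s' 0 0 u = own u) \<and> (\<forall>i<n. narr s' 1 0 i = r i))"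
proof -
  note SLOT_BODY_sets[simp]
  define W where "W = rarr s 4 1"
  define off where "off i = (\<Sum>i'<i. r i')" for i
  let ?J = "\<lambda>i (s' :: state). nvar s' v_R = off i \<and> (\<forall>u<off i. narr s' 0 0 u = own u) \<and> (\<forall>i'<i. narr s' 1 0 i' = r i')"
  let ?p = "For 23 (NVar v_n) SLOT_BODY"
  have "runs \<omega> SLOTS s (2 + ((\<Sum>i<n. r i * 30 + 40) + (n + 1) * 9)) (?J n)"
   unfolding SLOTS_def
  proof (rule runs_Seq_wp)
   show "wp \<omega> (NAssign v_R (NConst 0)) (?J 0) s" by (simp add: off_def)
   fix s1 assume h1: "?J 0 s1" and s1: "same (NAssign v_R (NConst 0)) s s1"
   have "runs \<omega> ?p s1 ((\<Sum>i<n. r i * 30 + 40) + (n + 1) * 9) (\<lambda>s'. ?J n s' \<and> same ?p s1 s')"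
   proof (rule runs_For_sum[where J = ?J])
    show "nvar s1 v_n = n" using v by (simp add: sameD[OF s1])
    fix i s2 assume i: "i < n" and s2: "same ?p s1 s2" and h2: "nvar s2 23 = i" "?J i s2"
    have v2: "nvar s2 v_n = n" "rvar s2 4 = S" "rarr s2 4 1 = W" using v by (simp_all add: sameD[OF s2] sameD[OF s1] W_def)
    let ?I = "\<lambda>k (s' :: state). k + 1 \<le> r i \<and> nvar s' 24 = k + 1 \<and> nvar s' v_R = off i + (k + 1) \<and> nvar s' 23 = i \<and> nvar s' v_n = n \<and> rvar s' 4 = S \<and>
     rarr s' 4 1 = W \<and> (\<forall>u<off i + (k + 1). narr s' 0 0 u = own u) \<and> (\<forall>i'<i. narr s' 1 0 i' = r i')"
    let ?a = "Seq (NAssign 24 (NConst 0)) SLOT_PUSH"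
    let ?st = "NStore 1 (NConst 0) (NVar 23) (NVar 24)"
    have o: "own (off i + k) = i" if "k < r i" for k using own[OF i that] by (simp add: off_def)
    show "runs \<omega> SLOT_BODY s2 (r i * 30 + 40) (?J (Suc i))"
     unfolding SLOT_BODY_def
    proof (rule runs_Seq_wp)
     have "Suc 0 \<le> r i" using r(1)[OF i] by simp
     then show "wp \<omega> ?a (?I 0) s2"
      using h2 v2 o[of 0] r(1)[OF i] by (auto simp: SLOT_PUSH_def upd2_apply less_Suc_eq)
     fix s3 assume h3: "?I 0 s3"
     show "runs \<omega> (Seq (While slot_cond SLOT_PUSH) ?st) s3 (((\<Sum>k\<in>{0..<r i}. 15 + 1 + bcost slot_cond) + 1 + bcost slot_cond) + 4) (?J (Suc i))"
     proof (rule runs_Seq)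
      show "runs \<omega> (While slot_cond SLOT_PUSH) s3 ((\<Sum>k\<in>{0..<r i}. 15 + 1 + bcost slot_cond) + 1 + bcost slot_cond) (\<lambda>s'. (\<exists>k. ?I k s') \<and> \<not> bval slot_cond s')"
      proof (rule runs_While)
       fix k s' assume I: "?I k s'" and b: "bval slot_cond s'"
       have lt: "real (k + 1) * S < real n * W i" using I b by (simp add: slot_cond_def)
       have "k + 1 \<noteq> r i"
       proof
        assume h: "k + 1 = r i"
        from lt show False unfolding h using r(2)[OF i] by (simp add: W_def)
       qed
       then have k: "k + 1 < r i" using I by simp
       have "runs \<omega> SLOT_PUSH s' (csize SLOT_PUSH) (?I (Suc k))"
        by (rule runs_wp) (use I k o[OF k] in \<open>auto simp: SLOT_PUSH_def upd2_apply less_Suc_eq\<close>)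
       then show "k < r i \<and> runs \<omega> SLOT_PUSH s' 15 (?I (Suc k))" using k by (auto elim!: runs_mono simp: SLOT_PUSH_def)
      qed (use h3 in auto)
      fix s4 assume h4: "(\<exists>k. ?I k s4) \<and> \<not> bval slot_cond s4"
      then obtain k where k: "?I k s4" by blast
      have "\<not> k + 1 < r i" using r(3)[OF i, of "k + 1"] h4 k by (auto simp: slot_cond_def W_def)
      then have kr: "k + 1 = r i" using k by simp
      have "runs \<omega> ?st s4 (csize ?st) (?J (Suc i))"
       by (rule runs_wp) (use k[unfolded kr] in \<open>auto simp: upd2_apply less_Suc_eq off_def\<close>)
      then show "runs \<omega> ?st s4 4 (?J (Suc i))" by (rule runs_mono) auto
     qed
    next
     show "csize ?a + (((\<Sum>k\<in>{0..<r i}. 15 + 1 + bcost slot_cond) + 1 + bcost slot_cond) + 4) \<le> r i * 30 + 40"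
      by (simp add: slot_cond_def SLOT_PUSH_def)
    qed
   qed (use h1 in auto)
   then show "runs \<omega> ?p s1 ((\<Sum>i<n. r i * 30 + 40) + (n + 1) * 9) (?J n)" by (rule runs_mono) auto
  qed simp
  then show ?thesis
   by (rule runs_mono) (auto simp: off_def sum.distrib sum_distrib_right[symmetric])
qed

section \<open>Drawing the random numbers\<close>

definition BITS :: "name => com" where
  "BITS w = Seq (NAssign 25 (NConst 0)) (For 22 (NVar w) (Seq (Gauss 20) (If (RLess (RVar 20) (RConst 0))
   (NAssign 25 (NAdd (NAdd (NVar 25) (NVar 25)) (NConst 1))) (NAssign 25 (NAdd (NVar 25) (NVar 25))))))"

lemma BITS_sets [simp]: "wn (BITS w) = {22, 25}" "wr (BITS w) = {20}" "wna (BITS w) = {}" "wra (BITS w) = {}"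
  by (auto simp: BITS_def)

lemma runs_BITS:
  assumes w: "nvar s w = k" "w \<notin> {22, 25}" and p: "pos s = p0"
  shows "runs \<omega> (BITS w) s ((k + 1) * 40)
   (\<lambda>s'. nvar s' 25 = bits k (after p0 (\<lambda>q. snd (\<omega> q))) \<and> pos s' = p0 + k)"
proof -
  let ?q = "Seq (Gauss 20) (If (RLess (RVar 20) (RConst 0))
   (NAssign 25 (NAdd (NAdd (NVar 25) (NVar 25)) (NConst 1))) (NAssign 25 (NAdd (NVar 25) (NVar 25))))"
  let ?J = "\<lambda>i (s' :: state). nvar s' 25 = bits i (after p0 (\<lambda>q. snd (\<omega> q))) \<and> pos s' = p0 + i"
  have "runs \<omega> (BITS w) s (2 + (k + 1) * 30) (?J k)"
   unfolding BITS_def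
  proof (rule runs_Seq_wp)
   show "wp \<omega> (NAssign 25 (NConst 0)) (?J 0) s" using p by simp
   fix s1 assume h1: "?J 0 s1" and s1: "same (NAssign 25 (NConst 0)) s s1"
   have "runs \<omega> (For 22 (NVar w) ?q) s1 ((k + 1) * 30) (\<lambda>s'. ?J k s' \<and> same (For 22 (NVar w) ?q) s1 s')"
   proof (rule runs_For_wp[where J = ?J])
    show "nvar s1 w = k" using w by (simp add: sameD[OF s1])
   qed (use h1 w in \<open>auto simp: after_apply\<close>)
   then show "runs \<omega> (For 22 (NVar w) ?q) s1 ((k + 1) * 30) (?J k)" by (rule runs_mono) auto
  qed simp
  then show ?thesis by (rule runs_mono) auto
qed

definition DRAW_ROW :: com where
  "DRAW_ROW = For 22 (NVar 17) (Seq (Gauss 20) (RStore 5 (NVar 31) (NVar 22) (RVar 20)))"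

definition DRAW_ROWS :: com where
  "DRAW_ROWS = Seq (Seq (NAssign 17 (NAdd (NVar v_D) (NVar v_D))) (NAssign 18 (NConst 0)))
   (Seq (For 24 (NVar v_L) (NAssign 18 (NAdd (NVar 18) (NVar v_N)))) (For 31 (NVar 18) DRAW_ROW))"

lemma DRAW_ROW_sets [simp]: "wn DRAW_ROW = {22}" "wr DRAW_ROW = {20}" "wna DRAW_ROW = {}" "wra DRAW_ROW = {5}"
  by (auto simp: DRAW_ROW_def)

lemma DRAW_ROWS_sets [simp]: "wn DRAW_ROWS = {17, 18, 22, 24, 31}" "wr DRAW_ROWS = {20}" "wna DRAW_ROWS = {}" "wra DRAW_ROWS = {5}"
  by (auto simp: DRAW_ROWS_def)

text \<open>Row r receives the r-th group of 2 D consecutive numbers of the tape, so rows of the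
  array are the blocks addressed by \<open>after\<close> in the analysis.\<close>

lemma runs_DRAW_ROWS:
  assumes v: "nvar s v_L = L" "nvar s v_N = N" "nvar s v_D = D" "pos s = 0"
  shows "runs \<omega> DRAW_ROWS s ((L * N + L + 2) * ((D + 1) * 60))
   (\<lambda>s'. (\<forall>r<L * N. \<forall>c<2 * D. rarr s' 5 r c = snd (\<omega> (r * (2 * D) + c))) \<and> pos s' = L * N * (2 * D))"
proof -
  let ?a = "Seq (NAssign 17 (NAdd (NVar v_D) (NVar v_D))) (NAssign 18 (NConst 0))"
  let ?p = "For 24 (NVar v_L) (NAssign 18 (NAdd (NVar 18) (NVar v_N)))"
  let ?q = "For 31 (NVar 18) DRAW_ROW"
  let ?J = "\<lambda>r (s' :: state). pos s' = r * (2 * D) \<and> (\<forall>r'<r. \<forall>c<2 * D. rarr s' 5 r' c = snd (\<omega> (r' * (2 * D) + c)))"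
  have "runs \<omega> DRAW_ROWS s (6 + ((L + 1) * 20 + (L * N + 1) * ((2 * D + 1) * 20 + 9))) (?J (L * N))"
   unfolding DRAW_ROWS_def
  proof (rule runs_Seq_wp)
   show "wp \<omega> ?a (\<lambda>s'. nvar s' 17 = 2 * D \<and> nvar s' 18 = 0 \<and> pos s' = 0) s" using v by simp
   fix s1 assume h1: "nvar s1 17 = 2 * D \<and> nvar s1 18 = 0 \<and> pos s1 = 0" and s1: "same ?a s s1"
   show "runs \<omega> (Seq ?p ?q) s1 ((L + 1) * 20 + (L * N + 1) * ((2 * D + 1) * 20 + 9)) (?J (L * N))"
   proof (rule runs_Seq_same)
    show "runs \<omega> ?p s1 ((L + 1) * 20) (\<lambda>s'. nvar s' 18 = L * N \<and> same ?p s1 s')"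
    proof (rule runs_For_wp[where J = "\<lambda>i s'. nvar s' 18 = i * N"])
     fix i s' assume h: "same ?p s1 s'" and "nvar s' 18 = i * N"
     then show "wp \<omega> (NAssign 18 (NAdd (NVar 18) (NVar v_N))) (\<lambda>s'. nvar s' 18 = Suc i * N) s'"
      using v by (simp add: sameD[OF h] sameD[OF s1])
    qed (use v h1 in \<open>auto simp: sameD[OF s1]\<close>)
    fix s2 assume h2: "nvar s2 18 = L * N \<and> same ?p s1 s2"
    note s2 = conjunct2[OF h2]
    have v2: "nvar s2 17 = 2 * D" "pos s2 = 0" using h1 by (simp_all add: sameD[OF s2])
    have "runs \<omega> ?q s2 ((L * N + 1) * ((2 * D + 1) * 20 + 9)) (\<lambda>s'. ?J (L * N) s' \<and> same ?q s2 s')"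
    proof (rule runs_For[where J = ?J])
     fix r s3 assume s3: "same ?q s2 s3" and h3: "nvar s3 31 = r" "?J r s3"
     let ?b = "Seq (Gauss 20) (RStore 5 (NVar 31) (NVar 22) (RVar 20))"
     let ?K = "\<lambda>c (s' :: state). pos s' = r * (2 * D) + c \<and> (\<forall>r'<r. \<forall>c<2 * D. rarr s' 5 r' c = snd (\<omega> (r' * (2 * D) + c))) \<and>
      (\<forall>c'<c. rarr s' 5 r c' = snd (\<omega> (r * (2 * D) + c')))"
     have "runs \<omega> DRAW_ROW s3 ((2 * D + 1) * 20) (\<lambda>s'. ?K (2 * D) s' \<and> same DRAW_ROW s3 s')"
      unfolding DRAW_ROW_def
     proof (rule runs_For_wp[where J = ?K])
      show "nvar s3 17 = 2 * D" using v2 by (simp add: sameD[OF s3])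
      fix c s' assume h: "same (For 22 (NVar 17) ?b) s3 s'" "nvar s' 22 = c" "?K c s'"
      have "nvar s' 31 = r" using h3 by (simp add: sameD[OF h(1)])
      then show "wp \<omega> ?b (?K (Suc c)) s'"
       using h by (auto simp: upd2_apply less_Suc_eq)
     qed (use h3 in auto)
     then show "runs \<omega> DRAW_ROW s3 ((2 * D + 1) * 20) (?J (Suc r))"
      by (rule runs_mono) (auto simp: less_Suc_eq)
    qed (use v2 h2 in auto)
    then show "runs \<omega> ?q s2 ((L * N + 1) * ((2 * D + 1) * 20 + 9)) (?J (L * N))" by (rule runs_mono) auto
   qed simp
  qed simp
  then show ?thesis
   by (rule runs_mono) (auto simp: algebra_simps)
qed

text \<open>Variable 19 holds L + 1, enough bits for the at most 2 n slots; L bits suffice for the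
  partner.\<close>

definition DRAW_PAIR :: com where
  "DRAW_PAIR = Seq (BITS 19) (Seq (NStore 2 (NVar 27) (NConst 0) (NVar 25)) (Seq (BITS v_L) (NStore 2 (NVar 27) (NConst 1) (NVar 25))))"

definition DRAW_PAIRS :: com where
  "DRAW_PAIRS = Seq (NAssign 19 (NAdd (NVar v_L) (NConst 1))) (For 27 (NVar v_m) DRAW_PAIR)"

lemma DRAW_PAIR_sets [simp]: "wn DRAW_PAIR = {22, 25}" "wr DRAW_PAIR = {20}" "wna DRAW_PAIR = {2}" "wra DRAW_PAIR = {}"
  by (auto simp: DRAW_PAIR_def)

lemma DRAW_PAIRS_sets [simp]: "wn DRAW_PAIRS = {19, 22, 25, 27}" "wr DRAW_PAIRS = {20}" "wna DRAW_PAIRS = {2}" "wra DRAW_PAIRS = {}"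
  by (auto simp: DRAW_PAIRS_def)

lemma runs_DRAW_PAIRS:
  fixes \<omega> :: tape
  assumes v: "nvar s v_L = L" "nvar s v_m = m" "pos s = p0"
  defines "g \<equiv> after p0 (\<lambda>q. snd (\<omega> q))"
  shows "runs \<omega> DRAW_PAIRS s ((m + 1) * ((L + 2) * 100))
   (\<lambda>s'. \<forall>t<m. narr s' 2 t 0 = bits (L + 1) (after (t * (L + 1 + L)) g) \<and> narr s' 2 t 1 = bits L (after (L + 1) (after (t * (L + 1 + L)) g)))"
proof -
  let ?u = "\<lambda>t. bits (L + 1) (after (t * (L + 1 + L)) g)" and ?v = "\<lambda>t. bits L (after (L + 1) (after (t * (L + 1 + L)) g))"
  let ?p = "For 27 (NVar v_m) DRAW_PAIR"
  let ?J = "\<lambda>t (s' :: state). pos s' = p0 + t * (L + 1 + L) \<and> (\<forall>t'<t. narr s' 2 t' 0 = ?u t' \<and> narr s' 2 t' 1 = ?v t')"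
  let ?s0 = "NStore 2 (NVar 27) (NConst 0) (NVar 25)" and ?s1 = "NStore 2 (NVar 27) (NConst 1) (NVar 25)"
  let ?T = "(L + 1 + 1) * 40 + (4 + ((L + 1) * 40 + 4))"
  have "runs \<omega> DRAW_PAIRS s (4 + (m + 1) * (?T + 9)) (?J m)"
   unfolding DRAW_PAIRS_def
  proof (rule runs_Seq_wp)
   let ?a = "NAssign 19 (NAdd (NVar v_L) (NConst 1))"
   show "wp \<omega> ?a (\<lambda>s'. nvar s' 19 = L + 1 \<and> ?J 0 s') s" using v by simp
   fix s1 assume h1: "nvar s1 19 = L + 1 \<and> ?J 0 s1" and s1: "same ?a s s1"
   have "runs \<omega> ?p s1 ((m + 1) * (?T + 9)) (\<lambda>s'. ?J m s' \<and> same ?p s1 s')"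
   proof (rule runs_For[where J = ?J])
    show "nvar s1 v_m = m" using v by (simp add: sameD[OF s1])
    fix t s2 assume s2: "same ?p s1 s2" and h2: "nvar s2 27 = t" "?J t s2"
    have v2: "nvar s2 19 = L + 1" "nvar s2 v_L = L" using h1 v by (simp_all add: sameD[OF s2] sameD[OF s1])
    show "runs \<omega> DRAW_PAIR s2 ?T (?J (Suc t))"
     unfolding DRAW_PAIR_def
    proof (rule runs_Seq_same[OF runs_BITS])
     show "nvar s2 19 = L + 1" by (rule v2)
     show "pos s2 = p0 + t * (L + 1 + L)" using h2 by simp
     fix s3 assume h3: "(nvar s3 25 = bits (L + 1) (after (p0 + t * (L + 1 + L)) (\<lambda>q. snd (\<omega> q))) \<and>
      pos s3 = p0 + t * (L + 1 + L) + (L + 1))" and s3: "same (BITS 19) s2 s3"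
     have e3: "nvar s3 25 = ?u t" using h3 by (simp add: g_def after_def add_ac)
     show "runs \<omega> (Seq ?s0 (Seq (BITS v_L) ?s1)) s3 (4 + ((L + 1) * 40 + 4)) (?J (Suc t))"
     proof (rule runs_Seq_wp)
      let ?Q = "\<lambda>(s' :: state). pos s' = p0 + t * (L + 1 + L) + (L + 1) \<and> narr s' 2 t 0 = ?u t \<and> (\<forall>t'<t. narr s' 2 t' 0 = ?u t' \<and> narr s' 2 t' 1 = ?v t')"
      show "wp \<omega> ?s0 ?Q s3" using h3 h2 e3 by (simp add: sameD[OF s3] upd2_apply)
      fix s4 assume h4: "?Q s4" and s4: "same ?s0 s3 s4"
      show "runs \<omega> (Seq (BITS v_L) ?s1) s4 ((L + 1) * 40 + 4) (?J (Suc t))"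
      proof (rule runs_Seq_same[OF runs_BITS])
       show "nvar s4 v_L = L" using v2 by (simp add: sameD[OF s4] sameD[OF s3])
       show "pos s4 = p0 + t * (L + 1 + L) + (L + 1)" using h4 by simp
       fix s5 assume h5: "nvar s5 25 = bits L (after (p0 + t * (L + 1 + L) + (L + 1)) (\<lambda>q. snd (\<omega> q))) \<and>
        pos s5 = p0 + t * (L + 1 + L) + (L + 1) + L" and s5: "same (BITS v_L) s4 s5"
       have e5: "nvar s5 25 = ?v t" using h5 by (simp add: g_def after_def add_ac)
       have v5: "nvar s5 27 = t" "narr s5 2 = narr s4 2" using h2 by (simp_all add: sameD[OF s5] sameD[OF s4] sameD[OF s3])
       have "runs \<omega> ?s1 s5 (csize ?s1) (?J (Suc t))"
        by (rule runs_wp) (use h4 h5 e5 v5 in \<open>auto simp: upd2_apply less_Suc_eq\<close>)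
       then show "runs \<omega> ?s1 s5 4 (?J (Suc t))" by (rule runs_mono) auto
      qed auto
     qed simp
    qed auto
   qed (use h1 in auto)
   then show "runs \<omega> ?p s1 ((m + 1) * (?T + 9)) (?J m)" by (rule runs_mono) auto
  qed simp
  then show ?thesis
   by (rule runs_mono) (auto simp: algebra_simps)
qed

section \<open>Prepared states and the selected candidate\<close>

definition sketch :: "nat => nat => nat => nat => nat => nat => nat => (nat => nat) => (nat => nat) =>
   (nat => nat => real) => (nat => real) => state => bool" where
  "sketch n d L l \<rho> N m own r X g s \<longleftrightarrow> params n d L l \<rho> N m (\<Sum>i<n. r i) s \<and> rarr s 0 = X \<and>
   (\<forall>q<L * N. \<forall>c<2 * 2 ^ l. rarr s 5 q c = g (q * (2 * 2 ^ l) + c)) \<and>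
   (\<forall>t<m. narr s 2 t 0 = bits (L + 1) (after (t * (L + 1 + L)) (after (L * (N * (2 * 2 ^ l))) g)) \<and>
    narr s 2 t 1 = bits L (after (L + 1) (after (t * (L + 1 + L)) (after (L * (N * (2 * 2 ^ l))) g)))) \<and>
   (\<forall>u<\<Sum>i<n. r i. narr s 0 0 u = own u) \<and> (\<forall>i<n. narr s 1 0 i = r i) \<and>
   rvar s 2 = sqrt (pi / 2) / (sqrt (2 ^ l) * (real N * real \<rho>))"

text \<open>The numbers of candidate q begin at q times the size of a candidate. The bits of the
  test pairs begin behind all \<open>L\<close> candidates and are shared by them, as
  \<open>selection\<close> assumes.\<close>

definition test_sum :: "nat => nat => nat => nat => nat => nat => nat => (nat => nat) => (nat => nat) =>
   (nat => nat => real) => (nat => real) => nat => real" where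
  "test_sum n d L l \<rho> N m own r X g q = sample_sum (L + 1) L m
   (\<lambda>u v. test_value l \<rho> N d X n (\<Sum>i<n. r i) own r u v (after (q * (N * (2 * 2 ^ l))) g)) (after (L * (N * (2 * 2 ^ l))) g)"

text \<open>Taking the least minimiser makes the result a definite and measurable function of the
  random numbers, which is also the one that the program computes.\<close>

definition choice :: "nat => nat => nat => nat => nat => nat => nat => (nat => nat) => (nat => nat) =>
   (nat => nat => real) => (nat => real) => nat" where
  "choice n d L l \<rho> N m own r X g = (LEAST q. q < L \<and>
   (\<forall>q'<L. test_sum n d L l \<rho> N m own r X g q \<le> test_sum n d L l \<rho> N m own r X g q'))"

text \<open>The program numbers the blocks consecutively across candidates, the analysis shifts
  first by candidates and then by blocks; the two offsets agree.\<close>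

lemma sketch_row:
  assumes "sketch n d L l \<rho> N m own r X g s" "q < L" "b < N" "a < 2 ^ l"
  shows "proj l (rarr s 5 (q * N + b)) x a = proj l (after (b * (2 * 2 ^ l)) (after (q * (N * (2 * 2 ^ l))) g)) x a"
proof (rule proj_cong[OF assms(4)])
  fix c :: nat assume c: "c < 2 * 2 ^ l"
  have "q * N + b < Suc q * N" using assms(3) by simp
  also have "... \<le> L * N" using assms(2) by (intro mult_le_mono1) simp
  finally have "rarr s 5 (q * N + b) c = g ((q * N + b) * (2 * 2 ^ l) + c)"
   using assms(1) c unfolding sketch_def by blast
  also have "(q * N + b) * (2 * 2 ^ l) + c = q * (N * (2 * 2 ^ l)) + (b * (2 * 2 ^ l) + c)" by (simp add: algebra_simps)
  finally show "rarr s 5 (q * N + b) c = after (b * (2 * 2 ^ l)) (after (q * (N * (2 * 2 ^ l))) g) c"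
   by (simp add: after_apply add.assoc)
qed

lemma sketch_est:
  assumes s: "sketch n d L l \<rho> N m own r X g s" and q: "q < L" and \<rho>: "\<rho> \<le> 2 ^ l"
  shows "rvar s 2 * abs_sum l \<rho> N s (q * N) i j = est l \<rho> N X (after (q * (N * (2 * 2 ^ l))) g) i j"
proof -
  have "rarr s 0 = X" "rvar s 2 = sqrt (pi / 2) / (sqrt (2 ^ l) * (real N * real \<rho>))" using s by (auto simp: sketch_def)
  moreover have "abs_sum l \<rho> N s (q * N) i j = (\<Sum>b<N. \<Sum>a<\<rho>. \<bar>proj l (after (b * (2 * 2 ^ l)) (after (q * (N * (2 * 2 ^ l))) g)) (rarr s 0 i) a -
   proj l (after (b * (2 * 2 ^ l)) (after (q * (N * (2 * 2 ^ l))) g)) (rarr s 0 j) a\<bar>)"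
   unfolding abs_sum_def
  proof (intro sum.cong refl)
   fix b a assume "b \<in> {..<N}" "a \<in> {..<\<rho>}"
   then have b: "b < N" and a: "a < 2 ^ l" using \<rho> by auto
   show "\<bar>proj l (rarr s 5 (q * N + b)) (rarr s 0 i) a - proj l (rarr s 5 (q * N + b)) (rarr s 0 j) a\<bar> =
    \<bar>proj l (after (b * (2 * 2 ^ l)) (after (q * (N * (2 * 2 ^ l))) g)) (rarr s 0 i) a -
    proj l (after (b * (2 * 2 ^ l)) (after (q * (N * (2 * 2 ^ l))) g)) (rarr s 0 j) a\<bar>"
    by (simp only: sketch_row[OF s q b a])
  qed
  ultimately show ?thesis by (simp add: est_def)
qed

text \<open>Both sides differ only in where indices and counts are read from. The owner array is
  known below the number of slots only, and exactly these entries pass the guard.\<close>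

lemma sketch_test:
  assumes s: "sketch n d L l \<rho> N m own r X g s" and q: "q < L" and \<rho>: "\<rho> \<le> 2 ^ l"
   and own: "\<And>u. u < (\<Sum>i<n. r i) ==> own u < n"
  shows "(\<Sum>t<m. test_term n d l \<rho> N (\<Sum>i<n. r i) s (q * N) t) = test_sum n d L l \<rho> N m own r X g q"
  unfolding test_sum_def sample_sum_def
proof (intro sum.cong refl)
  fix t assume "t \<in> {..<m}"
  then have t: "t < m" by simp
  let ?h = "after (q * (N * (2 * 2 ^ l))) g" and ?g = "after (t * (L + 1 + L)) (after (L * (N * (2 * 2 ^ l))) g)"
  let ?u = "bits (L + 1) ?g" and ?v = "bits L (after (L + 1) ?g)"
  have uv: "narr s 2 t 0 = ?u" "narr s 2 t 1 = ?v" using s t by (auto simp: sketch_def)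
  have o: "narr s 0 0 ?u = own ?u \<and> narr s 1 0 (own ?u) = r (own ?u)" if "?u < (\<Sum>i<n. r i)"
   using s that own[OF that] by (auto simp: sketch_def)
  have v: "narr s 1 0 ?v = r ?v" if "?v < n" using s that by (auto simp: sketch_def)
  have "rarr s 0 = X" using s by (simp add: sketch_def)
  then show "test_term n d l \<rho> N (\<Sum>i<n. r i) s (q * N) t =
    sample (L + 1) L (\<lambda>u v. test_value l \<rho> N d X n (\<Sum>i<n. r i) own r u v ?h) ?g"
   unfolding sample_def test_term_def test_value_def sketch_est[OF s q \<rho>] uv using o v by auto
qed

definition solved :: "nat => nat => nat => nat => nat => (nat => nat => real) => (nat => real) => state => bool" where
  "solved n L l \<rho> N X h s \<longleftrightarrow> nvar s v_n = n \<and> nvar s v_PW = 2 ^ L \<and> nvar s v_K = N * \<rho> \<and>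
   (\<forall>k<N * \<rho>. \<forall>c<n. rarr s 9 k c = proj l (after ((k div \<rho>) * (2 * 2 ^ l)) h) (X c) (k mod \<rho>)) \<and>
   (\<forall>k<N * \<rho>. sorted_block (rarr s 9 k) (narr s 4 k) 0 (2 ^ L)) \<and>
   rvar s 2 = sqrt (pi / 2) / (sqrt (2 ^ l) * (real N * real \<rho>))"

text \<open>Free of sampling commands, so it may be run in preprocessing or be postponed to the
  query, whichever budget can pay for it.\<close>

definition COMPUTE :: com where
  "COMPUTE = Seq SELECT (Seq FINAL (For 37 (NVar v_K) SORT))"

lemma COMPUTE_sets [simp]: "wn COMPUTE \<inter> {8} = {}" "wra COMPUTE \<inter> {0, 1, 2} = {}" "sample_free COMPUTE"
  by (auto simp: COMPUTE_def)

abbreviation compute_time :: "nat => nat => nat => nat => nat => nat => nat" where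
  "compute_time n L l \<rho> N m \<equiv> (L + 1) * ((m + 1) * ((N + 1) * (7 * proj_time l))) + ((N + 1) * ((n + 1) * (3 * proj_time l)) +
   (N * \<rho> + 1) * ((L + 1) * ((2 ^ L + 1) * 200) + 9))"

lemma runs_COMPUTE:
  assumes s: "sketch n d L l \<rho> N m own r X g s" and \<rho>: "0 < \<rho>" "\<rho> \<le> 2 ^ l" and d: "d \<le> 2 ^ l" and L: "0 < L"
   and own: "\<And>u. u < (\<Sum>i<n. r i) ==> own u < n"
  shows "runs \<omega> COMPUTE s (compute_time n L l \<rho> N m)
   (solved n L l \<rho> N X (after (choice n d L l \<rho> N m own r X g * (N * (2 * 2 ^ l))) g))"
  unfolding COMPUTE_def
proof (rule runs_Seq_same)
  have ps: "params n d L l \<rho> N m (\<Sum>i<n. r i) s" using s by (simp add: sketch_def)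
  let ?T = "test_sum n d L l \<rho> N m own r X g"
  let ?TT = "\<lambda>q. \<Sum>t<m. test_term n d l \<rho> N (\<Sum>i<n. r i) s (q * N) t"
  show "runs \<omega> SELECT s ((L + 1) * ((m + 1) * ((N + 1) * (7 * proj_time l))))
   (\<lambda>s'. (\<exists>q<L. nvar s' v_best = q * N \<and> (\<forall>q'<L. ?TT q \<le> ?TT q') \<and> (\<forall>q'<q. ?TT q < ?TT q')) \<and> same SELECT s s')"
   by (rule runs_SELECT[OF ps \<rho>(2) d L])
  fix s1 assume h1: "(\<exists>q<L. nvar s1 v_best = q * N \<and> (\<forall>q'<L. ?TT q \<le> ?TT q') \<and> (\<forall>q'<q. ?TT q < ?TT q')) \<and> same SELECT s s1"
  note s1 = conjunct2[OF h1]
  obtain q where q: "q < L" "nvar s1 v_best = q * N" "\<forall>q'<L. ?TT q \<le> ?TT q'" "\<forall>q'<q. ?TT q < ?TT q'"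
   using conjunct1[OF h1] by blast
  have link: "?TT q' = ?T q'" if "q' < L" for q' using sketch_test[OF s that \<rho>(2) own] .
  have le: "?T q \<le> ?T q'" if "q' < L" for q' using q(3) that link q(1) by auto
  have "?T q < ?T q'" if "q' < q" for q' using q(4) that link q(1) by auto
  then have "choice n d L l \<rho> N m own r X g = q"
   unfolding choice_def using le q(1) by (intro Least_equality) (auto simp: not_less[symmetric])
  note c = this
  let ?h = "after (q * (N * (2 * 2 ^ l))) g"
  have p1: "params n d L l \<rho> N m (\<Sum>i<n. r i) s1" by (rule params_same[OF ps s1]) auto
  have r1: "rarr s1 5 = rarr s 5" "rarr s1 0 = X" "rvar s1 2 = sqrt (pi / 2) / (sqrt (2 ^ l) * (real N * real \<rho>))"
   using s by (simp_all add: sameD[OF s1] sketch_def)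
  show "runs \<omega> (Seq FINAL (For 37 (NVar v_K) SORT)) s1
   ((N + 1) * ((n + 1) * (3 * proj_time l)) + (N * \<rho> + 1) * ((L + 1) * ((2 ^ L + 1) * 200) + 9))
   (solved n L l \<rho> N X (after (choice n d L l \<rho> N m own r X g * (N * (2 * 2 ^ l))) g))"
   unfolding c
  proof (rule runs_Seq_same[OF runs_FINAL[OF p1 \<rho>(2,1)]])
   fix s2 assume h2: "(\<forall>k c. rarr s2 9 k c = (if c < n \<and> k < N * \<rho>
    then proj l (rarr s1 5 (nvar s1 v_best + k div \<rho>)) (rarr s1 0 c) (k mod \<rho>) else rarr s1 9 k c)) \<and>
   nvar s2 v_K = N * \<rho> \<and> same FINAL s1 s2"
   note s2 = conjunct2[OF conjunct2[OF h2]]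
   have Q2: "rarr s2 9 k c = proj l (after ((k div \<rho>) * (2 * 2 ^ l)) ?h) (X c) (k mod \<rho>)" if "k < N * \<rho>" "c < n" for k c
   proof -
    have "k div \<rho> < N" using that(1) by (simp add: less_mult_imp_div_less)
    moreover have "k mod \<rho> < 2 ^ l" using mod_less_divisor[OF \<rho>(1), of k] \<rho>(2) by (rule less_le_trans)
    ultimately have "proj l (rarr s 5 (q * N + k div \<rho>)) (X c) (k mod \<rho>) = proj l (after ((k div \<rho>) * (2 * 2 ^ l)) ?h) (X c) (k mod \<rho>)"
     by (intro sketch_row[OF s q(1)])
    then show ?thesis using h2 that by (simp add: r1 q(2))
   qed
   have p2: "params n d L l \<rho> N m (\<Sum>i<n. r i) s2" by (rule params_same[OF p1 s2]) auto
   let ?p = "For 37 (NVar v_K) SORT"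
   let ?J = "\<lambda>k (s' :: state). \<forall>k'<k. sorted_block (rarr s2 9 k') (narr s' 4 k') 0 (2 ^ L)"
   have "runs \<omega> ?p s2 ((N * \<rho> + 1) * ((L + 1) * ((2 ^ L + 1) * 200) + 9)) (\<lambda>s'. ?J (N * \<rho>) s' \<and> same ?p s2 s')"
   proof (rule runs_For[where J = ?J])
    show "nvar s2 v_K = N * \<rho>" using h2 by blast
    fix k s3 assume s3: "same ?p s2 s3" and h3: "nvar s3 37 = k" "?J k s3"
    have p3: "params n d L l \<rho> N m (\<Sum>i<n. r i) s3" by (rule params_same[OF p2 s3]) auto
    have v3: "nvar s3 v_L = L" "nvar s3 v_PW = 2 ^ L" using p3 by (auto simp: params_def)
    have q3: "rarr s3 9 = rarr s2 9" by (simp add: sameD[OF s3])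
    show "runs \<omega> SORT s3 ((L + 1) * ((2 ^ L + 1) * 200)) (?J (Suc k))"
     by (rule runs_mono[OF runs_SORT[OF v3]]) (use h3 in \<open>auto simp: q3 less_Suc_eq\<close>)
   qed auto
   then show "runs \<omega> ?p s2 ((N * \<rho> + 1) * ((L + 1) * ((2 ^ L + 1) * 200) + 9)) (solved n L l \<rho> N X ?h)"
   proof (rule runs_mono)
    fix s4 assume h4: "?J (N * \<rho>) s4 \<and> same ?p s2 s4"
    note s4 = conjunct2[OF h4]
    have v4: "nvar s4 v_n = n" "nvar s4 v_PW = 2 ^ L" "nvar s4 v_K = N * \<rho>" "rarr s4 9 = rarr s2 9"
      "rvar s4 2 = sqrt (pi / 2) / (sqrt (2 ^ l) * (real N * real \<rho>))"
     using p2 h2 r1 by (simp_all add: sameD[OF s4] sameD[OF s2] params_def)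
    show "solved n L l \<rho> N X ?h s4"
     unfolding solved_def v4 using Q2 h4 by auto
   qed simp
  qed simp
qed simp

lemma sum_div_mod:
  fixes f :: "nat => nat => 'a::comm_monoid_add"
  assumes "0 < \<rho>"
  shows "(\<Sum>k<N * \<rho>. f (k div \<rho>) (k mod \<rho>)) = (\<Sum>b<N. \<Sum>a<\<rho>. f b a)"
proof -
  have "(\<Sum>k<N * \<rho>. f (k div \<rho>) (k mod \<rho>)) = (\<Sum>b<N. \<Sum>k=b * \<rho>..<b * \<rho> + \<rho>. f (k div \<rho>) (k mod \<rho>))"
   by (rule sum.nat_group[symmetric])
  also have "... = (\<Sum>b<N. \<Sum>a<\<rho>. f b a)"
  proof (rule sum.cong[OF refl])
   fix b
   have "(\<Sum>k=b * \<rho>..<b * \<rho> + \<rho>. f (k div \<rho>) (k mod \<rho>)) = (\<Sum>a=0..<\<rho>. f ((a + b * \<rho>) div \<rho>) ((a + b * \<rho>) mod \<rho>))"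
    using sum.shift_bounds_nat_ivl[of "\<lambda>k. f (k div \<rho>) (k mod \<rho>)" 0 "b * \<rho>" \<rho>] by (simp add: add.commute)
   also have "... = (\<Sum>a<\<rho>. f b a)"
    using assms by (intro sum.cong) auto
   finally show "(\<Sum>k=b * \<rho>..<b * \<rho> + \<rho>. f (k div \<rho>) (k mod \<rho>)) = (\<Sum>a<\<rho>. f b a)" .
  qed
  finally show ?thesis .
qed

abbreviation apply_time :: "nat => nat => nat => nat" where
  "apply_time L \<rho> N \<equiv> (N * \<rho> + 1) * ((2 ^ L + 1) * 200)"

lemma runs_APPLY_est:
  assumes s: "solved n L l \<rho> N X h s" and n: "n \<le> 2 ^ L" and \<rho>: "0 < \<rho>" and y: "\<And>j. n \<le> j ==> rarr s 1 0 j = 0"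
  shows "runs \<omega> APPLY s (apply_time L \<rho> N) (\<lambda>s'. \<forall>i<n. rarr s' 2 0 i = (\<Sum>j<n. est l \<rho> N X h i j * rarr s 1 0 j))"
proof -
  have v: "nvar s v_PW = 2 ^ L" "nvar s v_n = n" "nvar s v_K = N * \<rho>" using s by (auto simp: solved_def)
  have S: "sorted_block (rarr s 9 k) (narr s 4 k) 0 (2 ^ L)" if "k < N * \<rho>" for k using s that by (auto simp: solved_def)
  show ?thesis
  proof (rule runs_mono[OF runs_APPLY[OF v n S]])
   fix s' assume s': "\<forall>i<n. rarr s' 2 0 i = rvar s 2 * (\<Sum>k<N * \<rho>. \<Sum>j<2 ^ L. \<bar>rarr s 9 k i - rarr s 9 k j\<bar> * rarr s 1 0 j)"
   show "\<forall>i<n. rarr s' 2 0 i = (\<Sum>j<n. est l \<rho> N X h i j * rarr s 1 0 j)"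
   proof (intro allI impI)
    fix i assume i: "i < n"
    let ?P = "\<lambda>b i a. proj l (after (b * (2 * 2 ^ l)) h) (X i) a"
    have "(\<Sum>k<N * \<rho>. \<Sum>j<2 ^ L. \<bar>rarr s 9 k i - rarr s 9 k j\<bar> * rarr s 1 0 j) =
     (\<Sum>k<N * \<rho>. \<Sum>j<n. \<bar>?P (k div \<rho>) i (k mod \<rho>) - ?P (k div \<rho>) j (k mod \<rho>)\<bar> * rarr s 1 0 j)"
    proof (rule sum.cong[OF refl])
     fix k assume "k \<in> {..<N * \<rho>}"
     then have Q: "rarr s 9 k c = ?P (k div \<rho>) c (k mod \<rho>)" if "c < n" for c using s that by (auto simp: solved_def)
     have "(\<Sum>j<2 ^ L. \<bar>rarr s 9 k i - rarr s 9 k j\<bar> * rarr s 1 0 j) = (\<Sum>j<n. \<bar>rarr s 9 k i - rarr s 9 k j\<bar> * rarr s 1 0 j)"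
      using n y by (intro sum.mono_neutral_right) auto
     also have "... = (\<Sum>j<n. \<bar>?P (k div \<rho>) i (k mod \<rho>) - ?P (k div \<rho>) j (k mod \<rho>)\<bar> * rarr s 1 0 j)"
      using Q i by (intro sum.cong) auto
     finally show "(\<Sum>j<2 ^ L. \<bar>rarr s 9 k i - rarr s 9 k j\<bar> * rarr s 1 0 j) =
      (\<Sum>j<n. \<bar>?P (k div \<rho>) i (k mod \<rho>) - ?P (k div \<rho>) j (k mod \<rho>)\<bar> * rarr s 1 0 j)" .
    qed
    also have "... = (\<Sum>j<n. \<Sum>k<N * \<rho>. \<bar>?P (k div \<rho>) i (k mod \<rho>) - ?P (k div \<rho>) j (k mod \<rho>)\<bar> * rarr s 1 0 j)"
     by (rule sum.swap)
    also have "... = (\<Sum>j<n. (\<Sum>b<N. \<Sum>a<\<rho>. \<bar>?P b i a - ?P b j a\<bar>) * rarr s 1 0 j)"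
     by (simp add: sum_distrib_right[symmetric] sum_div_mod[OF \<rho>, where f = "\<lambda>b a. \<bar>?P b i a - ?P b _ a\<bar>"])
    finally have "rarr s' 2 0 i = rvar s 2 * (\<Sum>j<n. (\<Sum>b<N. \<Sum>a<\<rho>. \<bar>?P b i a - ?P b j a\<bar>) * rarr s 1 0 j)"
     using s' i by simp
    moreover have "rvar s 2 = sqrt (pi / 2) / (sqrt (2 ^ l) * (real N * real \<rho>))" using s by (simp add: solved_def)
    ultimately show "rarr s' 2 0 i = (\<Sum>j<n. est l \<rho> N X h i j * rarr s 1 0 j)"
     by (simp only: est_def mult.assoc sum_distrib_left[symmetric])
   qed
  qed simp_all
qed

section \<open>Assembly of the two programs\<close>

definition SCALE :: com where
  "SCALE = RAssign 2 (RDiv (RSqrt (RDiv RPi (RConst 2))) (RMul (RSqrt (ROfNat (NVar v_D))) (RMul (ROfNat (NVar v_N)) (ROfNat (NVar v_rho)))))"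

definition SKETCH :: com where
  "SKETCH = Seq ROWS (Seq BLOCKS (Seq TESTS (Seq WEIGHTS (Seq SLOTS (Seq DRAW_ROWS (Seq DRAW_PAIRS SCALE))))))"

lemma SCALE_sets [simp]: "wn SCALE = {}" "wr SCALE = {2}" "wna SCALE = {}" "wra SCALE = {}" "sample_free SCALE"
  by (auto simp: SCALE_def)

lemma SKETCH_sets [simp]: "wn SKETCH \<inter> {8} = {}" "wra SKETCH \<inter> {0, 1, 2} = {}"
  by (auto simp: SKETCH_def)

abbreviation sketch_time :: "nat => nat => nat => nat => nat => nat => nat => nat" where
  "sketch_time n d L l N m R \<equiv> (d + 1) * 60 + ((N + 1) * 20 + ((m + 1) * 20 + ((n + 1) * ((d + 1) * 200) + (R * 30 + (n + 1) * 60 +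
   ((L * N + L + 2) * ((2 ^ l + 1) * 60) + ((m + 1) * ((L + 2) * 100) + 20))))))"

lemma runs_SKETCH:
  fixes \<omega> :: tape
  assumes v: "nvar s v_n = n" "nvar s v_d = d" "nvar s v_L = L" "nvar s v_PW = 2 ^ L" "nvar s v_l = l" "nvar s v_D = 2 ^ l"
    "nvar s v_half = 2 ^ l div 2" "rvar s 1 = \<kappa>" "rarr s 0 = X" "pos s = 0"
   and \<rho>: "0 < \<rho>" "\<rho> \<le> d" "rows_ok \<kappa> n L \<rho>" "\<rho> < d ==> \<not> rows_ok \<kappa> n L (\<rho> + 1)"
   and N: "0 < N" "\<kappa> \<le> real N * real \<rho>" "\<And>k. 0 < k ==> k < N ==> real k * real \<rho> < \<kappa>"
   and m: "0 < m" "n \<le> m * L" "\<And>k. k < m ==> k * L < n"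
   and r: "\<And>i. i < n ==> 0 < r i" "\<And>i. i < n ==> real n * weight n d X i \<le> real (r i) * (\<Sum>i<n. weight n d X i)"
    "\<And>i k. i < n ==> 0 < k ==> k < r i ==> real k * (\<Sum>i<n. weight n d X i) < real n * weight n d X i"
   and own: "\<And>i k. i < n ==> k < r i ==> own ((\<Sum>i'<i. r i') + k) = i"
  shows "runs \<omega> SKETCH s (sketch_time n d L l N m (\<Sum>i<n. r i)) (sketch n d L l \<rho> N m own r X (\<lambda>q. snd (\<omega> q)))"
proof -
  let ?R = "\<Sum>i<n. r i"
  let ?Q = "sketch n d L l \<rho> N m own r X (\<lambda>q. snd (\<omega> q))"
  let ?p1 = "Seq DRAW_PAIRS SCALE"
  let ?p2 = "Seq DRAW_ROWS ?p1"
  let ?p3 = "Seq SLOTS ?p2"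
  let ?p4 = "Seq WEIGHTS ?p3"
  let ?p5 = "Seq TESTS ?p4"
  let ?p6 = "Seq BLOCKS ?p5"
  let ?t1 = "(m + 1) * ((L + 2) * 100) + 20"
  let ?t2 = "(L * N + L + 2) * ((2 ^ l + 1) * 60) + ?t1"
  let ?t3 = "?R * 30 + (n + 1) * 60 + ?t2"
  let ?t4 = "(n + 1) * ((d + 1) * 200) + ?t3"
  let ?t5 = "(m + 1) * 20 + ?t4"
  let ?t6 = "(N + 1) * 20 + ?t5"
  let ?core = "\<lambda>s'. nvar s' v_n = n \<and> nvar s' v_d = d \<and> nvar s' v_L = L \<and> nvar s' v_PW = 2 ^ L \<and> nvar s' v_l = l \<and> nvar s' v_D = 2 ^ l \<and>
    nvar s' v_half = 2 ^ l div 2 \<and> rarr s' 0 = X"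
  have core: "?core s'" if "?core s0" "same p s0 s'" "wn p \<inter> {0, 1, 2, 3, 4, 9, 10} = {}" "wra p \<inter> {0} = {}" for p s0 s'
   using that by (auto simp: same_def)
  have c: "?core s" using v by simp
  show ?thesis
   unfolding SKETCH_def
  proof (rule runs_Seq_same[OF runs_ROWS[OF v(1,2,3,8) \<rho>]])
   fix s1 assume h1: "nvar s1 v_rho = \<rho>" and s1: "same ROWS s s1"
   have c1: "?core s1" by (rule core[OF c s1]) auto
   have v1: "rvar s1 1 = \<kappa>" "pos s1 = 0" using v by (simp_all add: sameD[OF s1])
   show "runs \<omega> ?p6 s1
    ?t6 ?Q"
   proof (rule runs_Seq_same[OF runs_BLOCKS[OF h1 v1(1) N]])
    fix s2 assume h2: "nvar s2 v_N = N" and s2: "same BLOCKS s1 s2"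
    have c2: "?core s2" by (rule core[OF c1 s2]) auto
    have v2: "nvar s2 v_rho = \<rho>" "pos s2 = 0" using h1 v1 by (simp_all add: sameD[OF s2])
    show "runs \<omega> ?p5 s2
     ?t5 ?Q"
    proof (rule runs_Seq_same[OF runs_TESTS[OF _ _ m]])
     show "nvar s2 v_L = L" "nvar s2 v_n = n" using c2 by auto
     fix s3 assume h3: "nvar s3 v_m = m" and s3: "same TESTS s2 s3"
     have c3: "?core s3" by (rule core[OF c2 s3]) auto
     have v3: "nvar s3 v_rho = \<rho>" "nvar s3 v_N = N" "pos s3 = 0" using v2 h2 by (simp_all add: sameD[OF s3])
     show "runs \<omega> ?p4 s3
      ?t4 ?Q"
     proof (rule runs_Seq_same[OF runs_WEIGHTS])
      show "nvar s3 v_n = n" "nvar s3 v_d = d" using c3 by auto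
      fix s4 assume h4: "(\<forall>i<n. rarr s4 4 1 i = weight n d (rarr s3 0) i) \<and> rvar s4 4 = (\<Sum>i<n. weight n d (rarr s3 0) i)"
       and s4: "same WEIGHTS s3 s4"
      have c4: "?core s4" by (rule core[OF c3 s4]) auto
      have v4: "nvar s4 v_rho = \<rho>" "nvar s4 v_N = N" "nvar s4 v_m = m" "pos s4 = 0" using v3 h3 by (simp_all add: sameD[OF s4])
      have W4: "rarr s4 4 1 i = weight n d X i" if "i < n" for i using h4 that c3 by auto
      have S4: "rvar s4 4 = (\<Sum>i<n. weight n d X i)" using h4 c3 by auto
      show "runs \<omega> ?p3 s4
       ?t3
       ?Q"
      proof (rule runs_Seq_same[OF runs_SLOTS[where r = r and own = own]])
       show "nvar s4 v_n = n" using c4 by auto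
       show "rvar s4 4 = (\<Sum>i<n. weight n d X i)" by (rule S4)
       fix s5 assume h5: "nvar s5 v_R = ?R \<and> (\<forall>u<?R. narr s5 0 0 u = own u) \<and> (\<forall>i<n. narr s5 1 0 i = r i)" and s5: "same SLOTS s4 s5"
       have c5: "?core s5" by (rule core[OF c4 s5]) auto
       have v5: "nvar s5 v_rho = \<rho>" "nvar s5 v_N = N" "nvar s5 v_m = m" "pos s5 = 0" using v4 by (simp_all add: sameD[OF s5])
       show "runs \<omega> ?p2 s5
        ?t2 ?Q"
       proof (rule runs_Seq_same[OF runs_DRAW_ROWS[OF _ v5(2) _ v5(4)]])
        show "nvar s5 v_L = L" "nvar s5 v_D = 2 ^ l" using c5 by auto
        fix s6 assume h6: "(\<forall>r<L * N. \<forall>c<2 * 2 ^ l. rarr s6 5 r c = snd (\<omega> (r * (2 * 2 ^ l) + c))) \<and> pos s6 = L * N * (2 * 2 ^ l)"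
         and s6: "same DRAW_ROWS s5 s6"
        have c6: "?core s6" by (rule core[OF c5 s6]) auto
        have v6: "nvar s6 v_rho = \<rho>" "nvar s6 v_N = N" "nvar s6 v_m = m" using v5 by (simp_all add: sameD[OF s6])
        have h6': "nvar s6 v_R = ?R \<and> (\<forall>u<?R. narr s6 0 0 u = own u) \<and> (\<forall>i<n. narr s6 1 0 i = r i)"
         using h5 same_narr[OF s6, of 0] same_narr[OF s6, of 1] by (simp add: sameD[OF s6])
        have p6: "pos s6 = L * (N * (2 * 2 ^ l))" using h6 by (simp only: mult.assoc)
        show "runs \<omega> ?p1 s6 ?t1 ?Q"
        proof (rule runs_Seq_same[OF runs_DRAW_PAIRS[OF _ v6(3) p6]])
         show "nvar s6 v_L = L" using c6 by auto
         fix s7 assume h7: "\<forall>t<m. narr s7 2 t 0 = bits (L + 1) (after (t * (L + 1 + L)) (after (L * (N * (2 * 2 ^ l))) (\<lambda>q. snd (\<omega> q)))) \<and>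
           narr s7 2 t 1 = bits L (after (L + 1) (after (t * (L + 1 + L)) (after (L * (N * (2 * 2 ^ l))) (\<lambda>q. snd (\<omega> q)))))"
          and s7: "same DRAW_PAIRS s6 s7"
         have c7: "?core s7" by (rule core[OF c6 s7]) auto
         have v7: "nvar s7 v_rho = \<rho>" "nvar s7 v_N = N" "nvar s7 v_m = m" "rarr s7 5 = rarr s6 5" using v6 by (simp_all add: sameD[OF s7])
         have h7': "nvar s7 v_R = ?R \<and> (\<forall>u<?R. narr s7 0 0 u = own u) \<and> (\<forall>i<n. narr s7 1 0 i = r i)"
          using h6' same_narr[OF s7, of 0] same_narr[OF s7, of 1] by (simp add: sameD[OF s7])
         have "wp \<omega> SCALE ?Q s7"
          using h7 h7' h6 c7 v7 by (simp add: SCALE_def sketch_def params_def del: One_nat_def)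
         from runs_wp[OF this] show "runs \<omega> SCALE s7 20 ?Q"
          by (rule runs_mono) (auto simp: SCALE_def)
        qed simp_all
       qed simp_all
      qed (use W4 r own in auto)
     qed simp_all
    qed simp_all
   qed simp_all
  qed simp_all
qed

lemma runs_If_True: "bval b s ==> runs \<omega> p s T Q ==> 1 + bcost b + T \<le> T' ==> runs \<omega> (If b p q) s T' Q"
  by (rule runs_mono[OF runs_If[of b s \<omega> p T Q q]]) auto

lemma runs_If_False: "\<not> bval b s ==> runs \<omega> q s T Q ==> 1 + bcost b + T \<le> T' ==> runs \<omega> (If b p q) s T' Q"
  by (rule runs_mono[OF runs_If[of b s \<omega> p T Q q]]) auto

definition points :: "nat => nat => (nat => real vec) => nat => nat => real" where
  "points n d x = (\<lambda>i j. if i < n \<and> j < d then vec_index (x i) j else 0)"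

definition INIT :: "nat => com" where
  "INIT K = Seq (DOUBLE v_PW v_L 16 v_n) (Seq (DOUBLE v_D v_l v_half v_d) (RAssign 1 (RDiv (ROfNat (NConst K)) (RMul (RVar 0) (RVar 0)))))"

text \<open>A disjunction in De Morgan form, since tests have only negation and conjunction. For n
  <= d the n^2 d steps for the exact matrix fit into n d^2, and with n <= \<kappa> L the dense
  product fits into the query time; \<open>n0\<close> takes care of small n.\<close>

definition exact_cond :: "nat => bexp" where
  "exact_cond n0 = BNot (BAnd (BNot (NLess (NVar v_n) (NConst n0))) (BNot (BAnd (BNot (NLess (NVar v_d) (NVar v_n)))
   (BNot (RLess (RMul (RVar 1) (ROfNat (NVar v_L))) (ROfNat (NVar v_n)))))))"

text \<open>With n d <= \<kappa> L even a computation of all distances, about n^2 d steps, fits into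
  the query time n L \<kappa>.\<close>

definition late_cond :: bexp where
  "late_cond = BNot (RLess (RMul (RVar 1) (ROfNat (NVar v_L))) (RMul (ROfNat (NVar v_n)) (ROfNat (NVar v_d))))"

abbreviation (input) BRANCH :: "nat => com" where
  "BRANCH n0 \<equiv> If (exact_cond n0) (Seq MATRIX (NAssign v_mode (NConst 0)))
   (If late_cond (NAssign v_mode (NConst 1))
    (Seq SKETCH (If (NLess (NVar v_rho) (NVar v_d)) (Seq COMPUTE (NAssign v_mode (NConst 2))) (NAssign v_mode (NConst 3)))))"

definition PREP :: "nat => nat => com" where
  "PREP K n0 = Seq (INIT K) (BRANCH n0)"

text \<open>The mode records what preprocessing has left behind: 0 the exact matrix, 1 only the
  points, 2 sorted projections, 3 random numbers and test pairs without projections.\<close>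

definition QUERY :: com where
  "QUERY = If (NLess (NVar v_mode) (NConst 1)) DENSE (If (NLess (NVar v_mode) (NConst 2)) (Seq MATRIX DENSE)
   (If (NLess (NVar v_mode) (NConst 3)) APPLY (Seq COMPUTE APPLY)))"

lemma INIT_sets [simp]: "wra (INIT K) = {}" "sample_free (INIT K)"
  by (auto simp: INIT_def)

lemma sample_free_QUERY: "sample_free QUERY"
  by (simp add: QUERY_def)

abbreviation init_time :: "nat => nat => nat" where
  "init_time L l \<equiv> (L + 1) * 20 + ((l + 1) * 20 + 10)"

definition initialised :: "nat => nat => nat => nat => real => (nat => nat => real) => state => bool" where
  "initialised n d L l \<kappa> X s \<longleftrightarrow> nvar s v_n = n \<and> nvar s v_d = d \<and> nvar s v_L = L \<and> nvar s v_PW = 2 ^ L \<and> nvar s v_l = l \<and> nvar s v_D = 2 ^ l \<and>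
    nvar s v_half = 2 ^ l div 2 \<and> rvar s 1 = \<kappa> \<and> rarr s 0 = X \<and> rarr s 1 = (\<lambda>_ _. 0) \<and> pos s = 0"

lemma runs_INIT:
  assumes L: "n \<le> 2 ^ L" "\<And>i. i < L ==> 2 ^ i < n" and l: "d \<le> 2 ^ l" "\<And>i. i < l ==> 2 ^ i < d"
  shows "runs \<omega> (INIT K) (input n d \<epsilon> x) (init_time L l) (initialised n d L l (real K / \<epsilon>\<^sup>2) (points n d x))"
proof -
  let ?s = "input n d \<epsilon> x"
  have i: "nvar ?s v_n = n" "nvar ?s v_d = d" "rvar ?s 0 = \<epsilon>" "rarr ?s 0 = points n d x" "pos ?s = 0"
   by (simp_all add: input_def points_def fun_eq_iff)
  have i1: "rarr ?s 1 = (\<lambda>_ _. 0)" by (simp add: input_def)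
  show ?thesis
   unfolding INIT_def
  proof (rule runs_Seq_same)
   show "runs \<omega> (DOUBLE v_PW v_L 16 v_n) ?s ((L + 1) * 20) (\<lambda>s'. nvar s' v_PW = 2 ^ L \<and> nvar s' v_L = L \<and> nvar s' 16 = 2 ^ L div 2)"
    by (rule runs_DOUBLE[OF _ i(1) L]) auto
   fix s1 assume h1: "nvar s1 v_PW = 2 ^ L \<and> nvar s1 v_L = L \<and> nvar s1 16 = 2 ^ L div 2" and s1: "same (DOUBLE v_PW v_L 16 v_n) ?s s1"
   have v1: "nvar s1 v_d = d" "nvar s1 v_n = n" "rvar s1 0 = \<epsilon>" "rarr s1 0 = points n d x" "pos s1 = 0" using i by (simp_all add: sameD[OF s1])
   have w1: "rarr s1 1 = (\<lambda>_ _. 0)" using same_rarr[OF s1, of 1] i1 by simp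
   let ?r = "RAssign 1 (RDiv (ROfNat (NConst K)) (RMul (RVar 0) (RVar 0)))"
   show "runs \<omega> (Seq (DOUBLE v_D v_l v_half v_d) ?r) s1 ((l + 1) * 20 + 10) (initialised n d L l (real K / \<epsilon>\<^sup>2) (points n d x))"
   proof (rule runs_Seq_same)
    show "runs \<omega> (DOUBLE v_D v_l v_half v_d) s1 ((l + 1) * 20) (\<lambda>s'. nvar s' v_D = 2 ^ l \<and> nvar s' v_l = l \<and> nvar s' v_half = 2 ^ l div 2)"
     by (rule runs_DOUBLE[OF _ v1(1) l]) auto
    fix s2 assume h2: "nvar s2 v_D = 2 ^ l \<and> nvar s2 v_l = l \<and> nvar s2 v_half = 2 ^ l div 2" and s2: "same (DOUBLE v_D v_l v_half v_d) s1 s2"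
    have v2: "nvar s2 v_d = d" "nvar s2 v_n = n" "nvar s2 v_L = L" "nvar s2 v_PW = 2 ^ L" "rvar s2 0 = \<epsilon>" "rarr s2 0 = points n d x" "pos s2 = 0"
     using v1 h1 by (simp_all add: sameD[OF s2])
    have w2: "rarr s2 1 = (\<lambda>_ _. 0)" using same_rarr[OF s2, of 1] w1 by simp
    have "wp \<omega> ?r (initialised n d L l (real K / \<epsilon>\<^sup>2) (points n d x)) s2"
     using h2 v1 v2 w2 by (simp add: initialised_def power2_eq_square)
    from runs_wp[OF this] show "runs \<omega> ?r s2 10 (initialised n d L l (real K / \<epsilon>\<^sup>2) (points n d x))"
     by (rule runs_mono) auto
   qed simp
  qed simp
qed

section \<open>From program runs to implicit matrices\<close>

lemma load_query_simps: "nvar (load_query n y s) = nvar s" "rvar (load_query n y s) = rvar s" "narr (load_query n y s) = narr s"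
  "a \<noteq> 1 ==> rarr (load_query n y s) a = rarr s a" "pos (load_query n y s) = pos s"
  "rarr (load_query n y s) 1 0 j = (if j < n then y $ j else rarr s 1 0 j)"
  by (auto simp: load_query_def)

text \<open>The hypothesis on the query speaks about the loaded array row instead of a vector, so
  that the program lemmas never mention vectors or matrices.\<close>

lemma implementsI:
  assumes p: "runs \<omega> prep s0 T P" and T: "real T \<le> U" "real T' \<le> U'"
   and q: "\<And>s y. P s ==> y \<in> carrier_vec n ==>
    runs \<omega> query (load_query n y s) T' (\<lambda>s'. \<forall>i<n. rarr s' 2 0 i = (\<Sum>j<n. b i j * rarr (load_query n y s) 1 0 j))"
  shows "implements prep query \<omega> n s0 U U' (mat n n (\<lambda>(i, j). b i j))"
proof -
  obtain t s where ts: "exec \<omega> prep s0 t s" "t \<le> T" "P s" using p by (auto simp: runs_def)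
  have "\<exists>t' s'. exec \<omega> query (load_query n y s) t' s' \<and> real t' \<le> U' \<and> answer n s' = mat n n (\<lambda>(i, j). b i j) *\<^sub>v y"
   if y: "y \<in> carrier_vec n" for y
  proof -
   obtain t' s' where 1: "exec \<omega> query (load_query n y s) t' s'" "t' \<le> T'"
    "\<forall>i<n. rarr s' 2 0 i = (\<Sum>j<n. b i j * rarr (load_query n y s) 1 0 j)"
    using q[OF ts(3) y] by (auto simp: runs_def)
   have "answer n s' = mat n n (\<lambda>(i, j). b i j) *\<^sub>v y"
   proof (rule eq_vecI)
    fix i assume "i < dim_vec (mat n n (\<lambda>(i, j). b i j) *\<^sub>v y)"
    then have i: "i < n" by simp
    have "(mat n n (\<lambda>(i, j). b i j) *\<^sub>v y) $ i = (\<Sum>j<n. b i j * y $ j)"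
     using i y by (simp add: scalar_prod_def atLeast0LessThan)
    also have "... = (\<Sum>j<n. b i j * rarr (load_query n y s) 1 0 j)"
     by (intro sum.cong) (auto simp: load_query_simps(6)[unfolded One_nat_def])
    finally show "answer n s' $ i = (mat n n (\<lambda>(i, j). b i j) *\<^sub>v y) $ i"
     using 1(3) i by (simp add: answer_def)
   qed (simp add: answer_def)
   then show ?thesis using 1 T(2) of_nat_mono[OF 1(2), where 'a = real] by force
  qed
  then show ?thesis
   unfolding implements_def using ts T(1) of_nat_mono[OF ts(2), where 'a = real] by force
qed

abbreviation matrix_time :: "nat => nat => nat" where
  "matrix_time n d \<equiv> (n + 1) * ((n + 1) * ((d + 1) * 100))"

abbreviation dense_time :: "nat => nat" where
  "dense_time n \<equiv> (n + 1) * ((n + 1) * 60)"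

lemma implements_early:
  assumes L: "n \<le> 2 ^ L" "\<And>i. i < L ==> 2 ^ i < n" and l: "d \<le> 2 ^ l" "\<And>i. i < l ==> 2 ^ i < d"
   and b: "n < n0 \<or> (n \<le> d \<and> real n \<le> real K / \<epsilon>\<^sup>2 * real L)"
   and T: "real (init_time L l + (100 + matrix_time n d)) \<le> U" "real (10 + dense_time n) \<le> U'"
  shows "implements (PREP K n0) QUERY \<omega> n (input n d \<epsilon> x) U U' (mat n n (\<lambda>(i, j). dst d (points n d x) i j))"
proof (rule implementsI[OF _ T])
  let ?P = "\<lambda>s :: state. nvar s v_n = n \<and> nvar s v_mode = 0 \<and> (\<forall>i<n. \<forall>j<n. rarr s 10 i j = dst d (points n d x) i j)"
  show "runs \<omega> (PREP K n0) (input n d \<epsilon> x) (init_time L l + (100 + matrix_time n d)) ?P"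
   unfolding PREP_def
  proof (rule runs_Seq_same[OF runs_INIT[OF L l]])
   fix s1 assume h1: "initialised n d L l (real K / \<epsilon>\<^sup>2) (points n d x) s1"
   show "runs \<omega> (BRANCH n0) s1 (100 + matrix_time n d) ?P"
   proof (rule runs_If_True)
    show "bval (exact_cond n0) s1" using h1 b by (auto simp: exact_cond_def initialised_def)
    show "runs \<omega> (Seq MATRIX (NAssign v_mode (NConst 0))) s1 (matrix_time n d + 2) ?P"
    proof (rule runs_Seq_same[OF runs_MATRIX])
     show "nvar s1 v_n = n" "nvar s1 v_d = d" using h1 by (auto simp: initialised_def)
     fix s2 assume h2: "(\<forall>i<n. \<forall>j<n. rarr s2 10 i j = dst d (rarr s1 0) i j) \<and> same MATRIX s1 s2" and s2: "same MATRIX s1 s2"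
     have "nvar s2 v_n = n" "rarr s1 0 = points n d x" using h1 by (auto simp: sameD[OF s2] initialised_def)
     then have "wp \<omega> (NAssign v_mode (NConst 0)) ?P s2" using h2 by simp
     from runs_wp[OF this] show "runs \<omega> (NAssign v_mode (NConst 0)) s2 2 ?P" by (rule runs_mono) auto
    qed simp
   qed (simp add: exact_cond_def)
  qed simp_all
  fix s and y :: "real vec" assume P: "?P s" and y: "y \<in> carrier_vec n"
  let ?s = "load_query n y s"
  have v: "nvar ?s v_n = n" using P by (simp add: load_query_simps)
  have e: "rarr ?s 10 i j = dst d (points n d x) i j" if "i < n" "j < n" for i j using P that by (simp add: load_query_simps)
  show "runs \<omega> QUERY ?s (10 + dense_time n) (\<lambda>s'. \<forall>i<n. rarr s' 2 0 i = (\<Sum>j<n. dst d (points n d x) i j * rarr ?s 1 0 j))"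
   unfolding QUERY_def
  proof (rule runs_If_True[OF _ runs_mono[OF runs_DENSE[OF v] order_refl]])
   fix s' assume "\<forall>i<n. rarr s' 2 0 i = (\<Sum>j<n. rarr ?s 10 i j * rarr ?s 1 0 j)"
   then show "\<forall>i<n. rarr s' 2 0 i = (\<Sum>j<n. dst d (points n d x) i j * rarr ?s 1 0 j)" using e by simp
  qed (use P in \<open>auto simp: load_query_simps\<close>)
qed

lemma implements_late:
  assumes L: "n \<le> 2 ^ L" "\<And>i. i < L ==> 2 ^ i < n" and l: "d \<le> 2 ^ l" "\<And>i. i < l ==> 2 ^ i < d"
   and b: "n0 \<le> n" "n \<le> d ==> real K / \<epsilon>\<^sup>2 * real L < real n" "real n * real d \<le> real K / \<epsilon>\<^sup>2 * real L"
   and T: "real (init_time L l + 100) \<le> U" "real (20 + (matrix_time n d + dense_time n)) \<le> U'"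
  shows "implements (PREP K n0) QUERY \<omega> n (input n d \<epsilon> x) U U' (mat n n (\<lambda>(i, j). dst d (points n d x) i j))"
proof (rule implementsI[OF _ T])
  let ?P = "\<lambda>s :: state. nvar s v_n = n \<and> nvar s v_d = d \<and> nvar s v_mode = 1 \<and> rarr s 0 = points n d x"
  show "runs \<omega> (PREP K n0) (input n d \<epsilon> x) (init_time L l + 100) ?P"
   unfolding PREP_def
  proof (rule runs_Seq_same[OF runs_INIT[OF L l]])
   fix s1 assume h1: "initialised n d L l (real K / \<epsilon>\<^sup>2) (points n d x) s1"
   show "runs \<omega> (BRANCH n0) s1 100 ?P"
   proof (rule runs_If_False)
    show "\<not> bval (exact_cond n0) s1"
     using h1 b by (cases "n \<le> d") (auto simp: exact_cond_def initialised_def)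
    show "runs \<omega> (If late_cond (NAssign v_mode (NConst 1))
     (Seq SKETCH (If (NLess (NVar v_rho) (NVar v_d)) (Seq COMPUTE (NAssign v_mode (NConst 2))) (NAssign v_mode (NConst 3))))) s1 50 ?P"
    proof (rule runs_If_True)
     show "bval late_cond s1" using h1 b by (auto simp: late_cond_def initialised_def)
     show "runs \<omega> (NAssign v_mode (NConst 1)) s1 (csize (NAssign v_mode (NConst 1))) ?P"
      by (rule runs_wp) (use h1 in \<open>simp add: initialised_def\<close>)
    qed (simp add: late_cond_def)
   qed (simp add: exact_cond_def)
  qed simp_all
  fix s and y :: "real vec" assume P: "?P s" and y: "y \<in> carrier_vec n"
  let ?s = "load_query n y s"
  have v: "nvar ?s v_n = n" "nvar ?s v_d = d" "rarr ?s 0 = points n d x" using P by (simp_all add: load_query_simps)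
  show "runs \<omega> QUERY ?s (20 + (matrix_time n d + dense_time n)) (\<lambda>s'. \<forall>i<n. rarr s' 2 0 i = (\<Sum>j<n. dst d (points n d x) i j * rarr ?s 1 0 j))"
   unfolding QUERY_def
  proof (rule runs_If_False)
   show "runs \<omega> (If (NLess (NVar v_mode) (NConst 2)) (Seq MATRIX DENSE) (If (NLess (NVar v_mode) (NConst 3)) APPLY (Seq COMPUTE APPLY))) ?s
    (10 + (matrix_time n d + dense_time n)) (\<lambda>s'. \<forall>i<n. rarr s' 2 0 i = (\<Sum>j<n. dst d (points n d x) i j * rarr ?s 1 0 j))"
   proof (rule runs_If_True)
    show "runs \<omega> (Seq MATRIX DENSE) ?s (matrix_time n d + dense_time n) (\<lambda>s'. \<forall>i<n. rarr s' 2 0 i = (\<Sum>j<n. dst d (points n d x) i j * rarr ?s 1 0 j))"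
    proof (rule runs_Seq_same[OF runs_MATRIX[OF v(1,2)]])
     fix s1 assume h1: "(\<forall>i<n. \<forall>j<n. rarr s1 10 i j = dst d (rarr ?s 0) i j) \<and> same MATRIX ?s s1" and s1: "same MATRIX ?s s1"
     have v1: "nvar s1 v_n = n" using v by (simp add: sameD[OF s1])
     have y1: "rarr s1 1 = rarr ?s 1" by (rule same_rarr[OF s1]) simp
     show "runs \<omega> DENSE s1 (dense_time n) (\<lambda>s'. \<forall>i<n. rarr s' 2 0 i = (\<Sum>j<n. dst d (points n d x) i j * rarr ?s 1 0 j))"
      by (rule runs_mono[OF runs_DENSE[OF v1]]) (use h1 y1 v(3) in auto)
    qed simp
   qed (use P in \<open>auto simp: load_query_simps\<close>)
  qed (use P in \<open>auto simp: load_query_simps\<close>)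
qed

lemma sketch_load: "sketch n d L l \<rho> N m own r X g s ==> sketch n d L l \<rho> N m own r X g (load_query k y s)"
  by (simp add: sketch_def params_def load_query_simps)

lemma solved_load: "solved n L l \<rho> N X h s ==> solved n L l \<rho> N X h (load_query k y s)"
  by (simp add: solved_def load_query_simps)

lemma implements_sketch:
  fixes \<omega> :: tape and K L :: nat and \<epsilon> :: real and x :: "nat => real vec" and r :: "nat => nat"
  assumes L: "n \<le> 2 ^ L" "\<And>i. i < L ==> 2 ^ i < n" "0 < L" and l: "d \<le> 2 ^ l" "\<And>i. i < l ==> 2 ^ i < d"
   and b: "n0 \<le> n" "n \<le> d ==> real K / \<epsilon>\<^sup>2 * real L < real n" "real K / \<epsilon>\<^sup>2 * real L < real n * real d"
   and \<rho>: "0 < \<rho>" "\<rho> \<le> d" "rows_ok (real K / \<epsilon>\<^sup>2) n L \<rho>" "\<rho> < d ==> \<not> rows_ok (real K / \<epsilon>\<^sup>2) n L (\<rho> + 1)"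
   and N: "0 < N" "real K / \<epsilon>\<^sup>2 \<le> real N * real \<rho>" "\<And>k. 0 < k ==> k < N ==> real k * real \<rho> < real K / \<epsilon>\<^sup>2"
   and m: "0 < m" "n \<le> m * L" "\<And>k. k < m ==> k * L < n"
   and r: "\<And>i. i < n ==> 0 < r i"
    "\<And>i. i < n ==> real n * weight n d (points n d x) i \<le> real (r i) * (\<Sum>i<n. weight n d (points n d x) i)"
    "\<And>i k. i < n ==> 0 < k ==> k < r i ==> real k * (\<Sum>i<n. weight n d (points n d x) i) < real n * weight n d (points n d x) i"
   and own: "\<And>i k. i < n ==> k < r i ==> own ((\<Sum>i'<i. r i') + k) = i" "\<And>u. u < (\<Sum>i<n. r i) ==> own u < n"
   and T: "real (init_time L l + (200 + (sketch_time n d L l N m (\<Sum>i<n. r i) + (if \<rho> < d then compute_time n L l \<rho> N m else 0)))) \<le> U"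
    "real (30 + (apply_time L \<rho> N + (if \<rho> < d then 0 else compute_time n L l \<rho> N m))) \<le> U'"
  defines "g \<equiv> \<lambda>q. snd (\<omega> q)"
  shows "implements (PREP K n0) QUERY \<omega> n (input n d \<epsilon> x) U U'
   (mat n n (\<lambda>(i, j). est l \<rho> N (points n d x) (after (choice n d L l \<rho> N m own r (points n d x) g * (N * (2 * 2 ^ l))) g) i j))"
proof (rule implementsI[OF _ T])
  let ?X = "points n d x" and ?\<kappa> = "real K / \<epsilon>\<^sup>2" and ?R = "\<Sum>i<n. r i"
  let ?h = "after (choice n d L l \<rho> N m own r ?X g * (N * (2 * 2 ^ l))) g"
  let ?C = "compute_time n L l \<rho> N m"
  \<comment> \<open>The query array is recorded as zero because the sweep runs over 2^L entries,
    while loading a query sets only the first n of them.\<close>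
  let ?P = "\<lambda>s. rarr s 1 = (\<lambda>_ _. 0) \<and> (if \<rho> < d then nvar s v_mode = 2 \<and> solved n L l \<rho> N ?X ?h s
   else nvar s v_mode = 3 \<and> sketch n d L l \<rho> N m own r ?X g s)"
  have \<rho>l: "\<rho> \<le> 2 ^ l" using \<rho>(2) l(1) by simp
  let ?fin = "If (NLess (NVar v_rho) (NVar v_d)) (Seq COMPUTE (NAssign v_mode (NConst 2))) (NAssign v_mode (NConst 3))"
  let ?T2 = "if \<rho> < d then ?C else 0"
  have fin: "runs \<omega> ?fin s2 (10 + ?T2) ?P" if h2: "sketch n d L l \<rho> N m own r ?X g s2" "rarr s2 1 = (\<lambda>_ _. 0)" for s2
  proof (cases "\<rho> < d")
   case True
   have "runs \<omega> (Seq COMPUTE (NAssign v_mode (NConst 2))) s2 (?C + 2) ?P"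
   proof (rule runs_Seq_same[OF runs_COMPUTE[OF h2(1) \<rho>(1) \<rho>l l(1) L(3) own(2)]])
    fix s3 assume h3: "solved n L l \<rho> N ?X ?h s3" and s3: "same COMPUTE s2 s3"
    have "rarr s3 1 = (\<lambda>_ _. 0)" using same_rarr[OF s3, of 1] h2(2) COMPUTE_sets(2) by auto
    then have "wp \<omega> (NAssign v_mode (NConst 2)) ?P s3" using h3 True by (simp add: solved_def)
    from runs_wp[OF this] show "runs \<omega> (NAssign v_mode (NConst 2)) s3 2 ?P" by (rule runs_mono) auto
   qed simp_all
   then show ?thesis
    by (rule runs_If_True[rotated]) (use True h2 in \<open>auto simp: sketch_def params_def\<close>)
  next
   case False
   have "wp \<omega> (NAssign v_mode (NConst 3)) ?P s2" using h2 False by (simp add: sketch_def params_def)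
   from runs_wp[OF this] show ?thesis
    by (rule runs_If_False[rotated]) (use False h2 in \<open>auto simp: sketch_def params_def\<close>)
  qed
  show "runs \<omega> (PREP K n0) (input n d \<epsilon> x) (init_time L l + (200 + (sketch_time n d L l N m ?R + ?T2))) ?P"
   unfolding PREP_def
  proof (rule runs_Seq_same[OF runs_INIT[OF L(1,2) l]])
   fix s1 assume h1: "initialised n d L l ?\<kappa> ?X s1"
   show "runs \<omega> (If (exact_cond n0) (Seq MATRIX (NAssign v_mode (NConst 0)))
    (If late_cond (NAssign v_mode (NConst 1)) (Seq SKETCH ?fin))) s1 (200 + (sketch_time n d L l N m ?R + ?T2)) ?P"
   proof (rule runs_If_False)
    show "\<not> bval (exact_cond n0) s1"
     using h1 b by (cases "n \<le> d") (auto simp: exact_cond_def initialised_def)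
    show "runs \<omega> (If late_cond (NAssign v_mode (NConst 1)) (Seq SKETCH ?fin)) s1 (100 + (sketch_time n d L l N m ?R + ?T2)) ?P"
    proof (rule runs_If_False)
     show "\<not> bval late_cond s1" using h1 b by (auto simp: late_cond_def initialised_def)
     show "runs \<omega> (Seq SKETCH ?fin) s1 (sketch_time n d L l N m ?R + (10 + ?T2)) ?P"
     proof (rule runs_Seq_same)
      show "runs \<omega> SKETCH s1 (sketch_time n d L l N m ?R) (sketch n d L l \<rho> N m own r ?X g)"
       unfolding g_def
       by (rule runs_SKETCH[where \<kappa> = ?\<kappa>]) (use h1 \<rho> N m r own in \<open>auto simp: initialised_def\<close>)
      fix s2 assume h2: "sketch n d L l \<rho> N m own r ?X g s2" and s2: "same SKETCH s1 s2"
      have "rarr s2 1 = rarr s1 1" using same_rarr[OF s2, of 1] SKETCH_sets(2) by auto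
      then have "rarr s2 1 = (\<lambda>_ _. 0)" using h1 by (simp add: initialised_def)
      with h2 show "runs \<omega> ?fin s2 (10 + ?T2) ?P" by (rule fin)
     qed (rule order_refl)
    qed (simp add: late_cond_def)
   qed (simp add: exact_cond_def)
  qed simp_all
  fix s and y :: "real vec" assume P: "?P s" and y: "y \<in> carrier_vec n"
  let ?s = "load_query n y s"
  let ?Q = "\<lambda>s'. \<forall>i<n. rarr s' 2 0 i = (\<Sum>j<n. est l \<rho> N ?X ?h i j * rarr ?s 1 0 j)"
  have z: "rarr ?s 1 0 j = 0" if "n \<le> j" for j using P that by (simp add: load_query_simps(6)[unfolded One_nat_def])
  show "runs \<omega> QUERY ?s (30 + (apply_time L \<rho> N + (if \<rho> < d then 0 else ?C))) ?Q"
   unfolding QUERY_def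
  proof (rule runs_If_False)
   show "\<not> bval (NLess (NVar v_mode) (NConst 1)) ?s" using P by (auto simp: load_query_simps split: if_splits)
   show "runs \<omega> (If (NLess (NVar v_mode) (NConst 2)) (Seq MATRIX DENSE) (If (NLess (NVar v_mode) (NConst 3)) APPLY (Seq COMPUTE APPLY))) ?s
    (20 + (apply_time L \<rho> N + (if \<rho> < d then 0 else ?C))) ?Q"
   proof (rule runs_If_False)
    show "\<not> bval (NLess (NVar v_mode) (NConst 2)) ?s" using P by (auto simp: load_query_simps split: if_splits)
    show "runs \<omega> (If (NLess (NVar v_mode) (NConst 3)) APPLY (Seq COMPUTE APPLY)) ?s (10 + (apply_time L \<rho> N + (if \<rho> < d then 0 else ?C))) ?Q"
    proof (cases "\<rho> < d")
     case True
     have "solved n L l \<rho> N ?X ?h ?s" using P True by (auto intro: solved_load)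
     from runs_APPLY_est[OF this L(1) \<rho>(1) z]
     have "runs \<omega> APPLY ?s (apply_time L \<rho> N) ?Q" .
     then show ?thesis
      by (rule runs_If_True[rotated]) (use P True in \<open>auto simp: load_query_simps\<close>)
    next
     case False
     have sk: "sketch n d L l \<rho> N m own r ?X g ?s" using P False by (auto intro: sketch_load)
     have "runs \<omega> (Seq COMPUTE APPLY) ?s (?C + apply_time L \<rho> N) ?Q"
     proof (rule runs_Seq_same[OF runs_COMPUTE[OF sk \<rho>(1) \<rho>l l(1) L(3) own(2)]])
      fix s3 assume h3: "solved n L l \<rho> N ?X ?h s3" and s3: "same COMPUTE ?s s3"
      have e: "rarr s3 1 = rarr ?s 1" using same_rarr[OF s3, of 1] COMPUTE_sets(2) by auto
      have z3: "rarr s3 1 0 j = 0" if "n \<le> j" for j unfolding e using z[OF that] .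
      show "runs \<omega> APPLY s3 (apply_time L \<rho> N) ?Q"
       using runs_APPLY_est[OF h3 L(1) \<rho>(1) z3, of \<omega>] unfolding e .
     qed simp_all
     then show ?thesis
      by (rule runs_If_False[rotated]) (use P False in \<open>auto simp: load_query_simps\<close>)
    qed
   qed simp
  qed simp
qed

section \<open>Correctness of the estimate\<close>

text \<open>Centring at the mean makes the mixed terms vanish.\<close>

lemma sum_sq_diff:
  fixes a :: "nat => real"
  assumes n: "0 < n"
  defines "\<mu> \<equiv> (\<Sum>i<n. a i) / real n"
  shows "(\<Sum>i<n. \<Sum>j<n. (a i - a j)\<^sup>2) = 2 * real n * (\<Sum>i<n. (a i - \<mu>)\<^sup>2)"
proof -
  define b where "b i = a i - \<mu>" for i
  have b0: "(\<Sum>i<n. b i) = 0" using n by (simp add: b_def sum_subtractf \<mu>_def)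
  have "(\<Sum>i<n. \<Sum>j<n. (a i - a j)\<^sup>2) = (\<Sum>i<n. \<Sum>j<n. (b i)\<^sup>2 - 2 * b i * b j + (b j)\<^sup>2)"
   by (intro sum.cong refl) (simp add: b_def power2_eq_square algebra_simps)
  also have "... = 2 * real n * (\<Sum>i<n. (b i)\<^sup>2)"
   by (simp add: sum.distrib sum_subtractf sum_distrib_left[symmetric] b0)
  finally show ?thesis by (simp add: b_def)
qed

lemma dst_sq: "(dst d X i j)\<^sup>2 = (\<Sum>c<d. (X i c - X j c)\<^sup>2)"
  by (simp add: dst_def sum_nonneg)

lemma weight_nonneg: "0 \<le> weight n d X i"
  by (simp add: weight_def sum_nonneg)

lemma sum_dst_sq:
  assumes "0 < n"
  shows "(\<Sum>i<n. \<Sum>j<n. (dst d X i j)\<^sup>2) = 2 * real n * (\<Sum>i<n. weight n d X i)"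
proof -
  have "(\<Sum>i<n. \<Sum>j<n. (dst d X i j)\<^sup>2) = (\<Sum>i<n. \<Sum>c<d. \<Sum>j<n. (X i c - X j c)\<^sup>2)"
   unfolding dst_sq by (intro sum.cong refl sum.swap)
  also have "... = (\<Sum>c<d. \<Sum>i<n. \<Sum>j<n. (X i c - X j c)\<^sup>2)" by (rule sum.swap)
  also have "... = (\<Sum>c<d. 2 * real n * (\<Sum>i<n. (X i c - mean n X c)\<^sup>2))"
   unfolding mean_def by (rule sum.cong[OF refl]) (rule sum_sq_diff[OF assms])
  also have "... = 2 * real n * (\<Sum>i<n. weight n d X i)"
   unfolding weight_def sum_distrib_left[symmetric] by (subst sum.swap) simp
  finally show ?thesis .
qed

text \<open>Coordinatewise the parallelogram law: with the centroid coordinate t, the right side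
  exceeds the left by (u + v - 2 t)^2.\<close>

lemma dst_sq_le_weights: "(dst d X i j)\<^sup>2 \<le> 2 * (weight n d X i + weight n d X j)"
proof -
  have "(u - v)\<^sup>2 \<le> 2 * ((u - t)\<^sup>2 + (v - t)\<^sup>2)" for u v t :: real
  proof -
   have "2 * ((u - t)\<^sup>2 + (v - t)\<^sup>2) - (u - v)\<^sup>2 = (u + v - 2 * t)\<^sup>2" by (simp add: power2_eq_square algebra_simps)
   then show ?thesis using zero_le_power2[of "u + v - 2 * t"] by linarith
  qed
  then have "(\<Sum>c<d. (X i c - X j c)\<^sup>2) \<le> (\<Sum>c<d. 2 * ((X i c - mean n X c)\<^sup>2 + (X j c - mean n X c)\<^sup>2))"
   by (intro sum_mono)
  also have "... = 2 * (weight n d X i + weight n d X j)"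
   by (simp add: weight_def sum.distrib sum_distrib_left)
  finally show ?thesis by (simp add: dst_sq)
qed

section \<open>Slots proportional to the weights\<close>

definition reps :: "nat => nat => (nat => nat => real) => nat => nat" where
  "reps n d X i = max 1 (nat \<lceil>real n * weight n d X i / (\<Sum>i<n. weight n d X i)\<rceil>)"

lemma reps_pos: "0 < reps n d X i"
  by (simp add: reps_def)

context
  fixes n d :: nat and X :: "nat => nat => real" and S :: real
  defines "S \<equiv> \<Sum>i<n. weight n d X i"
begin

lemma sum_weight_nonneg: "0 \<le> S"
  unfolding S_def by (intro sum_nonneg weight_nonneg)

lemma weight_zero: "S = 0 ==> i < n ==> weight n d X i = 0"
  unfolding S_def using weight_nonneg by (subst (asm) sum_nonneg_eq_0_iff) auto

text \<open>If the total weight is 0, all weights are 0, and division by zero gives every point a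
  single slot; otherwise this is the rounding up.\<close>

lemma reps_ge:
  assumes "i < n"
  shows "real n * weight n d X i \<le> real (reps n d X i) * S"
proof (cases "S = 0")
  case False
  have "real n * weight n d X i / S \<le> real (reps n d X i)" unfolding reps_def S_def[symmetric] by linarith
  then show ?thesis using sum_weight_nonneg False by (simp add: pos_divide_le_eq)
qed (use weight_zero[OF _ assms] in simp)

lemma reps_least:
  assumes "0 < k" "k < reps n d X i"
  shows "real k * S < real n * weight n d X i"
proof -
  have lt: "real k < real n * weight n d X i / S" using assms unfolding reps_def S_def[symmetric] by linarith
  then have "S \<noteq> 0" using assms(1) by (intro notI) simp
  then show ?thesis using lt sum_weight_nonneg by (simp add: pos_less_divide_eq)
qed

text \<open>The exact shares add up to at most n, and rounding up, including the minimum 1, adds at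
  most 1 per point.\<close>

lemma sum_reps: "(\<Sum>i<n. reps n d X i) \<le> 2 * n"
proof -
  have "real (reps n d X i) \<le> 1 + real n * weight n d X i / S" for i
  proof -
   have "0 \<le> real n * weight n d X i / S" using weight_nonneg sum_weight_nonneg by simp
   then show ?thesis unfolding reps_def S_def[symmetric] by linarith
  qed
  then have "(\<Sum>i<n. real (reps n d X i)) \<le> (\<Sum>i<n. 1 + real n * weight n d X i / S)" by (intro sum_mono)
  also have "... = real n + real n * S / S"
   by (simp add: sum.distrib sum_divide_distrib[symmetric] sum_distrib_left[symmetric] S_def)
  also have "... \<le> real (2 * n)" by simp
  finally show ?thesis by (simp only: of_nat_sum[symmetric] of_nat_le_iff)
qed

end

definition owner :: "(nat => nat) => nat => nat" where
  "owner r u = (LEAST i. u < (\<Sum>i'<Suc i. r i'))"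

lemma owner_slot:
  assumes "k < r i"
  shows "owner r ((\<Sum>i'<i. r i') + k) = i"
  unfolding owner_def
proof (rule Least_equality)
  fix y assume y: "(\<Sum>i'<i. r i') + k < (\<Sum>i'<Suc y. r i')"
  show "i \<le> y"
  proof (rule ccontr)
   assume "\<not> i \<le> y"
   then have "(\<Sum>i'<Suc y. r i') \<le> (\<Sum>i'<i. r i')" by (intro sum_mono2) auto
   then show False using y by simp
  qed
qed (use assms in simp)

lemma slot_cases:
  fixes r :: "nat => nat"
  shows "u < (\<Sum>i<n. r i) ==> \<exists>i<n. \<exists>k<r i. u = (\<Sum>i'<i. r i') + k"
proof (induction n)
  case (Suc n)
  show ?case
  proof (cases "u < (\<Sum>i<n. r i)")
   case True
   then show ?thesis using Suc.IH less_Suc_eq by blast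
  next
   case False
   then have "u - (\<Sum>i<n. r i) < r n" "u = (\<Sum>i<n. r i) + (u - (\<Sum>i<n. r i))" using Suc.prems by auto
   then show ?thesis by blast
  qed
qed simp

lemma owner_less: "u < (\<Sum>i<n. r i) ==> owner r u < n"
  using slot_cases[of u r n] owner_slot by auto

lemma card_owner:
  assumes "i < n"
  shows "card {u \<in> {..<\<Sum>i<n. r i}. owner r u = i} = r i"
proof -
  let ?o = "\<Sum>i'<i. r i'"
  have "?o + r i = (\<Sum>i'<Suc i. r i')" by simp
  also have "... \<le> (\<Sum>i<n. r i)" using assms by (intro sum_mono2) auto
  finally have le: "?o + r i \<le> (\<Sum>i<n. r i)" .
  have "{u \<in> {..<\<Sum>i<n. r i}. owner r u = i} = (\<lambda>k. ?o + k) ` {..<r i}"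
  proof (intro equalityI subsetI)
   fix u assume "u \<in> {u \<in> {..<\<Sum>i<n. r i}. owner r u = i}"
   then have u: "u < (\<Sum>i<n. r i)" "owner r u = i" by auto
   obtain i' k where "k < r i'" "u = (\<Sum>i''<i'. r i'') + k" using slot_cases[OF u(1)] by blast
   then show "u \<in> (\<lambda>k. ?o + k) ` {..<r i}" using owner_slot[of k r i'] u(2) by auto
  next
   fix u assume "u \<in> (\<lambda>k. ?o + k) ` {..<r i}"
   then obtain k where "k < r i" "u = ?o + k" by auto
   then show "u \<in> {u \<in> {..<\<Sum>i<n. r i}. owner r u = i}" using owner_slot[of k r i] le by auto
  qed
  then show ?thesis by (simp add: card_image)
qed

section \<open>Success probability on tapes\<close>

lemma measure_tapes:
  assumes "G \<in> sets gseq"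
  shows "measure tapes {\<omega> \<in> space tapes. (\<lambda>q. snd (\<omega> q)) \<in> G} = measure gseq G"
proof -
  have "measure gseq G = measure (distr tapes gseq (\<lambda>\<omega> q. snd (\<omega> q))) G" by (simp only: distr_tapes)
  also have "... = measure tapes ((\<lambda>\<omega> q. snd (\<omega> q)) -` G \<inter> space tapes)"
   by (rule measure_distr[OF measurable_tape_gaussians assms])
  also have "(\<lambda>\<omega> q. snd (\<omega> q)) -` G \<inter> space tapes = {\<omega> \<in> space tapes. (\<lambda>q. snd (\<omega> q)) \<in> G}" by auto
  finally show ?thesis by simp
qed

lemma measure_space_tapes: "measure tapes (space tapes) = 1"
  using measure_tapes[of UNIV] sets.top[of gseq] gs.P.prob_space by simp

lemma measurable_test_sum [measurable]: "(\<lambda>g. test_sum n d L l \<rho> N m own r X g q) \<in> borel_measurable gseq"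
proof -
  have t: "test_value l \<rho> N d X n R own r u v \<in> borel_measurable gseq" for R u v
   unfolding test_value_def by (cases "u < R \<and> v < n") simp_all
  show ?thesis
   unfolding test_sum_def
   by (intro measurable_sample_sum measurable_compose[OF measurable_after t] measurable_after)
qed

lemma measurable_choice: "choice n d L l \<rho> N m own r X \<in> measurable gseq (count_space UNIV)"
proof -
  let ?T = "test_sum n d L l \<rho> N m own r X"
  have *: "Measurable.pred gseq (\<lambda>g. q < L \<and> (\<forall>q'<L. ?T g q \<le> ?T g q'))" for q
  proof -
   have le: "{g \<in> space gseq. ?T g q \<le> ?T g q'} \<in> sets gseq" for q'
    by (intro borel_measurable_le measurable_test_sum)
   have "{g \<in> space gseq. \<forall>q'\<in>{..<L}. ?T g q \<le> ?T g q'} \<in> sets gseq"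
    by (rule sets.sets_Collect_finite_All[OF le]) simp
   then show ?thesis by (cases "q < L") (simp_all add: pred_def Ball_def)
  qed
  show ?thesis unfolding choice_def[abs_def] by (rule measurable_Least) (rule *)
qed

lemma choice_argmin:
  assumes "0 < L"
  shows "choice n d L l \<rho> N m own r X g < L"
   "q' < L ==> test_sum n d L l \<rho> N m own r X g (choice n d L l \<rho> N m own r X g) \<le> test_sum n d L l \<rho> N m own r X g q'"
proof -
  let ?T = "test_sum n d L l \<rho> N m own r X g"
  define q where "q = arg_min_on ?T {..<L}"
  have "finite {..<L}" "{..<L} \<noteq> {}" using assms by auto
  note arg_min_if_finite[OF this, of ?T, folded q_def]
  then have q: "q < L \<and> (\<forall>q'<L. ?T q \<le> ?T q')" by (metis lessThan_iff not_le)
  have *: "choice n d L l \<rho> N m own r X g < L \<and> (\<forall>q'<L. ?T (choice n d L l \<rho> N m own r X g) \<le> ?T q')"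
   unfolding choice_def by (rule LeastI[of "\<lambda>q. q < L \<and> (\<forall>q'<L. ?T q \<le> ?T q')", OF q])
  show "choice n d L l \<rho> N m own r X g < L" using * by (rule conjunct1)
  show "?T (choice n d L l \<rho> N m own r X g) \<le> ?T q'" if "q' < L" using conjunct2[OF *] that by (elim allE impE)
qed

text \<open>Supplies the sampling distribution: the sum F of squared distances is 2 n times the
  total weight, so a squared distance is at most twice the sum of two weights, hence at most F/n^2
  times the slots of both points. The bound for the Gaussian sequence is then transferred to
  tapes.\<close>

lemma sketch_probability:
  fixes l \<rho> N d n m L c :: nat and X :: "nat => nat => real" and \<epsilon> K :: real
  assumes \<rho>: "0 < \<rho>" "\<rho> \<le> 2 ^ l" and N: "0 < N" and d: "d \<le> 2 ^ l"
   and X0: "\<And>i c. i < n ==> d \<le> c ==> X i c = 0"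
   and \<epsilon>: "0 < \<epsilon>" and n: "2 \<le> n"
   and sizes: "2 ^ L \<le> 2 * n" "n \<le> 2 ^ L" "0 < L" "L \<le> n"
   and m: "n \<le> m * L" and N\<rho>: "K / \<epsilon>\<^sup>2 \<le> N * \<rho>"
   and \<rho>1: "(real \<rho> * real L ^ 2)\<^sup>2 \<le> K / \<epsilon>\<^sup>2 * n" and \<rho>2: "real \<rho> * real L ^ 6 \<le> (real n)\<^sup>2"
   and K: "1536 * 2 ^ (c + 2) \<le> K" "4 * (64 * (c + 3)) * (c + 5)\<^sup>2 \<le> K" "4 * (c + 5) * mgf_const * (64 * (c + 3)) \<le> K"
  defines "r \<equiv> reps n d X"
  defines "h \<equiv> \<lambda>g. after (choice n d L l \<rho> N m (owner r) r X g * (N * (2 * 2 ^ l))) g"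
  shows "measure tapes {\<omega> \<in> space tapes.
   (\<Sum>i<n. \<Sum>j<n. (dst d X i j - est l \<rho> N X (h (\<lambda>q. snd (\<omega> q))) i j)\<^sup>2) \<le> \<epsilon>\<^sup>2 * (\<Sum>i<n. \<Sum>j<n. (dst d X i j)\<^sup>2)} \<ge> 1 - 1 / real n ^ c"
proof -
  define F where "F = (\<Sum>i<n. \<Sum>j<n. (dst d X i j)\<^sup>2)"
  define W where "W q g = (\<Sum>i<n. \<Sum>j<n. (dst d X i j - est l \<rho> N X (after (q * (N * (2 * 2 ^ l))) g) i j)\<^sup>2)" for q g
  let ?q = "choice n d L l \<rho> N m (owner r) r X"
  have W [measurable]: "W q \<in> borel_measurable gseq" for q
  proof -
   have "(\<lambda>g. est l \<rho> N X (after (q * (N * (2 * 2 ^ l))) g) i j) \<in> borel_measurable gseq" for i j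
    by (rule measurable_compose[OF measurable_after measurable_est])
   then show ?thesis unfolding W_def by (intro borel_measurable_sum borel_measurable_power borel_measurable_diff) auto
  qed
  have "(\<lambda>g. W (?q g) g) \<in> borel_measurable gseq"
   by (rule measurable_compose_countable[where g = ?q and f = W, OF W measurable_choice])
  then have "{g \<in> space gseq. W (?q g) g \<le> \<epsilon>\<^sup>2 * F} \<in> sets gseq"
   by (intro borel_measurable_le borel_measurable_const)
  then have G: "{g. W (?q g) g \<le> \<epsilon>\<^sup>2 * F} \<in> sets gseq" by simp
  have n0: "0 < n" using n by simp
  let ?S = "\<Sum>i<n. weight n d X i"
  have FS: "F = 2 * real n * ?S" unfolding F_def by (rule sum_dst_sq[OF n0])
  have bad: "measure gseq (space gseq - {g. W (?q g) g \<le> \<epsilon>\<^sup>2 * F}) \<le> 1 / real n ^ c"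
  \<comment> \<open>If all points coincide, every estimate is exact and the bad event is empty; the
    selection argument divides by F and needs the other case.\<close>
  proof (cases "F = 0")
   case True
   have z: "dst d X i j = 0" if "i < n" "j < n" for i j
    using True that unfolding F_def by (simp add: sum_nonneg_eq_0_iff sum_nonneg)
   have "est l \<rho> N X g i j = 0" if ij: "i < n" "j < n" for g i j
   proof -
    have "est l \<rho> N X g i j - dst d X i j = dst d X i j * group_error l \<rho> N (\<lambda>c. X i c - X j c) g"
     by (rule est_error[OF \<rho> N d _ ij]) (rule X0)
    then show ?thesis using z[OF ij] by simp
   qed
   then have "W q g = 0" for q g
    unfolding W_def using z by (intro sum.neutral ballI) simp
   then show ?thesis using True by simp
  next
   case False
   have "0 \<le> F" unfolding F_def by (intro sum_nonneg) simp
   then have Fpos: "0 < F" using False by simp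
   let ?T = "\<lambda>q g. sample_sum (L + 1) L m (\<lambda>u v. test_value l \<rho> N d X n (\<Sum>i<n. r i) (owner r) r u v (after (q * (N * (2 * 2 ^ l))) g))
     (after (L * (N * (2 * 2 ^ l))) g)"
   let ?B = "{g. \<exists>q<L. (\<forall>q'<L. ?T q g \<le> ?T q' g) \<and> \<epsilon>\<^sup>2 * F < W q g}"
   have TT: "?T q g = test_sum n d L l \<rho> N m (owner r) r X g q" for q g by (simp add: test_sum_def)
   have dr: "(dst d X i j)\<^sup>2 \<le> F / (real n)\<^sup>2 * (real (r i) + real (r j))" if ij: "i < n" "j < n" for i j
   proof -
    have "(dst d X i j)\<^sup>2 * real n \<le> 2 * (weight n d X i + weight n d X j) * real n"
     by (intro mult_right_mono dst_sq_le_weights) simp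
    also have "... = 2 * (real n * weight n d X i + real n * weight n d X j)" by (simp add: algebra_simps)
    also have "... \<le> 2 * (real (r i) * ?S + real (r j) * ?S)"
     unfolding r_def by (intro mult_left_mono add_mono reps_ge ij) simp
    finally show ?thesis using n0 by (simp add: FS field_simps power2_eq_square)
   qed
   have R: "(\<Sum>i<n. r i) \<le> 2 ^ (L + 1)" using sum_reps[of n d X] sizes(2) by (simp add: r_def)
   have "(2::real) ^ (L + 1 + L) \<le> 8 * (real n)\<^sup>2"
   proof -
    have "real (2 ^ L) \<le> real (2 * n)" using sizes(1) by (rule of_nat_mono)
    then have "(2::real) ^ L \<le> 2 * real n" by simp
    then have "2 * ((2::real) ^ L * 2 ^ L) \<le> 2 * ((2 * real n) * (2 * real n))" by (intro mult_left_mono mult_mono) auto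
    then show ?thesis by (simp add: power_add power2_eq_square)
   qed
   note size = R sizes(2) this sizes(2,3,4)
   have "emeasure gseq ?B \<le> ennreal (1 / real n ^ c)"
    unfolding W_def
   proof (rule good_group_probability[OF \<rho> N d X0 \<epsilon> n _ _ _ F_def Fpos dr size m N\<rho> \<rho>1 \<rho>2 K])
    show "owner r u < n" if "u < (\<Sum>i<n. r i)" for u using owner_less[OF that] .
    show "card {u \<in> {..<\<Sum>i<n. r i}. owner r u = i} = r i" if "i < n" for i using card_owner[OF that] .
    show "0 < r i" for i by (simp add: r_def reps_pos)
   qed
   moreover have B: "?B \<in> sets gseq" unfolding TT by (rule sets_argmin[OF measurable_test_sum W])
   moreover have "space gseq - {g. W (?q g) g \<le> \<epsilon>\<^sup>2 * F} \<subseteq> ?B"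
    unfolding TT
   proof
    fix g assume "g \<in> space gseq - {g. W (?q g) g \<le> \<epsilon>\<^sup>2 * F}"
    then have "\<epsilon>\<^sup>2 * F < W (?q g) g" by simp
    then show "g \<in> {g. \<exists>q<L. (\<forall>q'<L. test_sum n d L l \<rho> N m (owner r) r X g q \<le> test_sum n d L l \<rho> N m (owner r) r X g q') \<and> \<epsilon>\<^sup>2 * F < W q g}"
     by (intro CollectI exI[of _ "?q g"] conjI allI impI choice_argmin[OF sizes(3)])
   qed
   ultimately have "emeasure gseq (space gseq - {g. W (?q g) g \<le> \<epsilon>\<^sup>2 * F}) \<le> ennreal (1 / real n ^ c)"
    using emeasure_mono[of _ ?B gseq] by (meson order_trans)
   then show ?thesis by (simp add: gs.P.emeasure_eq_measure)
  qed
  have "measure gseq {g. W (?q g) g \<le> \<epsilon>\<^sup>2 * F} = 1 - measure gseq (space gseq - {g. W (?q g) g \<le> \<epsilon>\<^sup>2 * F})"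
   using gs.P.prob_compl[OF G] by simp
  then have "1 - 1 / real n ^ c \<le> measure gseq {g. W (?q g) g \<le> \<epsilon>\<^sup>2 * F}" using bad by simp
  also have "... = measure tapes {\<omega> \<in> space tapes. (\<lambda>q. snd (\<omega> q)) \<in> {g. W (?q g) g \<le> \<epsilon>\<^sup>2 * F}}"
   by (rule measure_tapes[OF G, symmetric])
  finally show ?thesis by (simp add: W_def F_def h_def)
qed

section \<open>Frobenius norms as sums over pairs\<close>

lemma norm2_points:
  assumes "\<And>i. i < n ==> x i \<in> carrier_vec d" "i < n" "j < n"
  shows "norm2 (x i - x j) = dst d (points n d x) i j"
proof -
  have "dim_vec (x i) = d" "dim_vec (x j) = d" using assms by auto
  then show ?thesis using assms(2,3) by (simp add: norm2_def dst_def points_def)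
qed

lemma frobenius_le_iff:
  assumes x: "\<And>i. i < n ==> x i \<in> carrier_vec d" and \<epsilon>: "0 < \<epsilon>"
  shows "frobenius_norm (distance_matrix n x - mat n n (\<lambda>(i, j). f i j)) \<le> \<epsilon> * frobenius_norm (distance_matrix n x) \<longleftrightarrow>
   (\<Sum>i<n. \<Sum>j<n. (dst d (points n d x) i j - f i j)\<^sup>2) \<le> \<epsilon>\<^sup>2 * (\<Sum>i<n. \<Sum>j<n. (dst d (points n d x) i j)\<^sup>2)"
proof -
  have e: "(\<Sum>i<n. \<Sum>j<n. (norm2 (x i - x j) - f i j)\<^sup>2) = (\<Sum>i<n. \<Sum>j<n. (dst d (points n d x) i j - f i j)\<^sup>2)" for f
  proof (intro sum.cong refl)
   fix i j assume "i \<in> {..<n}" "j \<in> {..<n}"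
   then have "norm2 (x i - x j) = dst d (points n d x) i j" by (intro norm2_points x) auto
   then show "(norm2 (x i - x j) - f i j)\<^sup>2 = (dst d (points n d x) i j - f i j)\<^sup>2" by simp
  qed
  have "frobenius_norm (distance_matrix n x - mat n n (\<lambda>(i, j). f i j)) = sqrt (\<Sum>i<n. \<Sum>j<n. (dst d (points n d x) i j - f i j)\<^sup>2)"
   using e[of f] by (simp add: frobenius_norm_def distance_matrix_def)
  moreover have "\<epsilon> * frobenius_norm (distance_matrix n x) = sqrt (\<epsilon>\<^sup>2 * (\<Sum>i<n. \<Sum>j<n. (dst d (points n d x) i j)\<^sup>2))"
   using \<epsilon> e[of "\<lambda>_ _. 0"] by (simp add: frobenius_norm_def distance_matrix_def real_sqrt_mult)
  ultimately show ?thesis by simp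
qed

section \<open>Time bounds\<close>

text \<open>The number of rounds of the doubling loop; \<open>less_log_ceil\<close> provides the
  second hypothesis of \<open>runs_DOUBLE\<close>.\<close>

definition log_ceil :: "nat => nat" where
  "log_ceil n = (LEAST k. n \<le> 2 ^ k)"

lemma le_power_log_ceil: "n \<le> 2 ^ log_ceil n"
  unfolding log_ceil_def by (rule LeastI[of _ n]) (simp add: less_imp_le[OF less_exp])

lemma less_log_ceil: "i < log_ceil n ==> 2 ^ i < n"
  unfolding log_ceil_def using not_less_Least by force

lemma power_log_ceil_le:
  assumes "0 < n"
  shows "2 ^ log_ceil n \<le> 2 * n"
proof (cases "log_ceil n")
  case (Suc k)
  then show ?thesis using less_log_ceil[of k n] by simp
qed (use assms in simp)

lemma log_ceil_le:
  assumes "0 < n"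
  shows "log_ceil n \<le> n"
proof (cases "log_ceil n")
  case (Suc k)
  have "k < 2 ^ k" by (rule less_exp)
  also have "2 ^ k < n" using less_log_ceil[of k n] Suc by simp
  finally show ?thesis using Suc by simp
qed simp

lemma log_ceil_pos: "2 \<le> n ==> 0 < log_ceil n"
  using le_power_log_ceil[of n] by (cases "log_ceil n") auto

lemma log_ceil_mono: "m \<le> n ==> log_ceil m \<le> log_ceil n"
  using less_log_ceil[of "log_ceil n" m] le_power_log_ceil[of n] by (meson not_le order_trans leD)

text \<open>Since ln 2 >= 2/3, the exponent before the last doubling is at most 3/2 ln n. The last
  doubling adds 1, which n >= 2 bounds by 3/2 ln n again.\<close>

lemma log_ceil_le_ln:
  assumes n: "2 \<le> n"
  shows "real (log_ceil n) \<le> 3 * ln (real n)"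
proof -
  obtain k where k: "log_ceil n = Suc k" using log_ceil_pos[OF n] gr0_conv_Suc by blast
  have "ln (2 ^ k) \<le> ln (real n)"
   using less_log_ceil[of k n] k of_nat_mono[of "2 ^ k" n, where 'a = real] n by simp
  then have 1: "real k * ln 2 \<le> ln (real n)" by (simp add: ln_realpow)
  have 2: "ln 2 \<le> ln (real n)" using n by simp
  have "real k * (2 / 3) \<le> real k * ln 2" using ln2_ge_two_thirds by (intro mult_left_mono) auto
  then have "real k * (2 / 3) + 2 / 3 \<le> 2 * ln (real n)" using 1 2 ln2_ge_two_thirds by linarith
  then show ?thesis by (simp add: k)
qed

text \<open>The sixth power is dictated by the second condition on \<rho> in
  \<open>good_group_probability\<close>; the choice of \<rho> and the time bounds get by with the
  fourth and fifth.\<close>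

lemma log_ceil_power_le: "\<exists>n0. \<forall>n\<ge>n0. real (log_ceil n) ^ 6 \<le> real n"
proof -
  have "\<forall>\<^sub>F k :: nat in at_top. 2 * real k ^ 6 \<le> 2 powr real k" by real_asymp
  then obtain k0 where k0: "\<And>k. k0 \<le> k ==> 2 * real k ^ 6 \<le> 2 powr real k"
   by (auto simp: eventually_at_top_linorder)
  show ?thesis
  proof (intro exI[of _ "2 ^ k0"] allI impI)
   fix n :: nat assume n: "2 ^ k0 \<le> n"
   have "(2::nat) ^ k0 \<le> 2 ^ log_ceil n" using n le_power_log_ceil[of n] by (rule order_trans)
   then have "k0 \<le> log_ceil n" by simp
   then have "2 * real (log_ceil n) ^ 6 \<le> 2 ^ log_ceil n" using k0[of "log_ceil n"] by (simp add: powr_realpow)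
   also have "(2::real) ^ log_ceil n = real (2 ^ log_ceil n)" by simp
   also have "... \<le> real (2 * n)"
    using n by (intro of_nat_mono power_log_ceil_le) (simp add: less_le_trans[of 0 "2 ^ k0"])
   finally show "real (log_ceil n) ^ 6 \<le> real n" by simp
  qed
qed

text \<open>Equality holds at l = 3. From there on (l + 2)^3 <= 2 (l + 1)^3, which fails for smaller
  l, so those values are checked directly.\<close>

lemma cube_le_power: "(l + 1) ^ 3 \<le> 8 * (2::nat) ^ l"
proof (induction l)
  case (Suc l)
  show ?case
  proof (cases "l < 3")
   case True
   then have "l = 0 \<or> l = 1 \<or> l = 2" by auto
   then show ?thesis by (auto simp: eval_nat_numeral)
  next
   case False
   then obtain k where k: "l = k + 3" using le_Suc_ex[of 3 l] by (auto simp: add.commute)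
   have "(Suc l + 1) ^ 3 \<le> 2 * (l + 1) ^ 3" unfolding k by (simp add: power3_eq_cube algebra_simps)
   also have "... \<le> 8 * 2 ^ Suc l" using Suc by simp
   finally show ?thesis .
  qed
qed simp

section \<open>Existence of the numbers of blocks, tests and rows\<close>

lemma blocks_exist:
  assumes "0 < \<rho>" "real \<rho> \<le> \<kappa>"
  obtains N where "0 < N" "\<kappa> \<le> real N * real \<rho>" "\<And>k. 0 < k ==> k < N ==> real k * real \<rho> < \<kappa>" "real N * real \<rho> \<le> 2 * \<kappa>"
proof
  let ?N = "nat \<lceil>\<kappa> / real \<rho>\<rceil>"
  have p: "0 < real \<rho>" "0 < \<kappa>" using assms by auto
  then have q: "0 < \<kappa> / real \<rho>" by simp
  show "0 < ?N" using q by linarith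
  have "\<kappa> / real \<rho> \<le> real ?N" by linarith
  then show "\<kappa> \<le> real ?N * real \<rho>" by (simp only: pos_divide_le_eq[OF p(1)])
  show "real k * real \<rho> < \<kappa>" if "0 < k" "k < ?N" for k
  proof -
   have "real k < \<kappa> / real \<rho>" using that by linarith
   then show ?thesis using p by (simp add: pos_less_divide_eq)
  qed
  have "real ?N \<le> \<kappa> / real \<rho> + 1" using q by linarith
  then have "real ?N * real \<rho> \<le> (\<kappa> / real \<rho> + 1) * real \<rho>" using p by (intro mult_right_mono) auto
  also have "... = \<kappa> + real \<rho>" using p by (simp add: distrib_right)
  finally show "real ?N * real \<rho> \<le> 2 * \<kappa>" using assms(2) by simp
qed

lemma tests_exist:
  fixes L n :: nat
  assumes "0 < L" "L \<le> n"
  obtains m where "0 < m" "n \<le> m * L" "\<And>k. k < m ==> k * L < n" "m * L \<le> 2 * n"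
proof
  let ?m = "LEAST m. n \<le> m * L"
  have "n \<le> n * L" using assms by simp
  then show le: "n \<le> ?m * L" by (rule LeastI)
  show pos: "0 < ?m" using le assms by (cases ?m) auto
  show lt: "k * L < n" if "k < ?m" for k using not_less_Least[OF that] by simp
  have "(?m - 1) * L < n" using pos by (intro lt) simp
  then show "?m * L \<le> 2 * n" using assms(2) by (cases ?m) auto
qed

text \<open>\<rho> = 1 is admissible because L^4 <= n; the largest admissible value up to d is then
  taken.\<close>

lemma rows_exist:
  assumes "1 \<le> \<kappa>" "0 < d" "real L ^ 4 \<le> real n"
  obtains \<rho> where "0 < \<rho>" "\<rho> \<le> d" "rows_ok \<kappa> n L \<rho>" "\<rho> < d ==> \<not> rows_ok \<kappa> n L (\<rho> + 1)"
proof -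
  let ?S = "{\<rho>. 0 < \<rho> \<and> \<rho> \<le> d \<and> rows_ok \<kappa> n L \<rho>}"
  have fin: "finite ?S" by (rule finite_subset[of _ "{..d}"]) auto
  have "1 * real n \<le> \<kappa> * real n" using assms(1) by (intro mult_right_mono) auto
  then have "real L ^ 4 \<le> \<kappa> * real n" using assms(3) by linarith
  then have "1 \<in> ?S" using assms by (simp add: rows_ok_def power_mult[symmetric] del: power_mult)
  then have M: "Max ?S \<in> ?S" using Max_in[OF fin] by blast
  have "\<not> rows_ok \<kappa> n L (Max ?S + 1)" if "Max ?S < d"
  proof
   assume "rows_ok \<kappa> n L (Max ?S + 1)"
   then have "Max ?S + 1 \<in> ?S" using that by simp
   from Max_ge[OF fin this] show False by simp
  qed
  then show ?thesis using M that by blast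
qed

section \<open>Bounds for the step counts\<close>

lemma compute_time_le:
  fixes n d L l \<rho> N m :: nat
  assumes pos: "0 < n" "0 < d" "0 < L" "0 < \<rho>" "0 < N" "0 < m"
   and m: "m * L \<le> 2 * n" and l: "2 ^ l \<le> 2 * d" and L: "2 ^ L \<le> 2 * n"
  shows "compute_time n L l \<rho> N m \<le> 75000 * (n * (N * ((l + 1) * d))) + 2500 * (n * (L * (N * \<rho>)))"
proof -
  have pt: "proj_time l \<le> 600 * ((l + 1) * d)"
  proof -
   have "(l + 1) * (2 ^ l + 1) \<le> (l + 1) * (3 * d)" using l pos by (intro mult_le_mono2) linarith
   then show ?thesis by simp
  qed
  have "(L + 1) * (m + 1) \<le> (2 * L) * (2 * m)" using pos by (intro mult_le_mono) auto
  \<comment> \<open>All candidates together are tested on about m L <= 2 n pairs, so selecting costs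
    no more than a constant times projecting all points once.\<close>
  then have Lm: "(L + 1) * (m + 1) \<le> 8 * n" using m by (simp add: mult.commute)
  have N: "N + 1 \<le> 2 * N" and n: "n + 1 \<le> 2 * n" using pos by auto
  have "(L + 1) * ((m + 1) * ((N + 1) * (7 * proj_time l))) = ((L + 1) * (m + 1)) * ((N + 1) * (7 * proj_time l))" by (simp only: mult.assoc)
  also have "... \<le> (8 * n) * ((2 * N) * (7 * (600 * ((l + 1) * d))))"
   by (intro mult_le_mono Lm N pt order_refl)
  also have "... = 67200 * (n * (N * ((l + 1) * d)))" by ((simp only: mult_ac), simp?)
  finally have A: "(L + 1) * ((m + 1) * ((N + 1) * (7 * proj_time l))) \<le> 67200 * (n * (N * ((l + 1) * d)))" .
  have "(N + 1) * ((n + 1) * (3 * proj_time l)) \<le> (2 * N) * ((2 * n) * (3 * (600 * ((l + 1) * d))))"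
   by (intro mult_le_mono n N pt order_refl)
  also have "... = 7200 * (n * (N * ((l + 1) * d)))" by ((simp only: mult_ac), simp?)
  finally have B: "(N + 1) * ((n + 1) * (3 * proj_time l)) \<le> 7200 * (n * (N * ((l + 1) * d)))" .
  have "(L + 1) * ((2 ^ L + 1) * 200) \<le> (2 * L) * ((3 * n) * 200)" using pos L by (intro mult_le_mono) linarith+
  moreover have "9 \<le> 9 * (L * n)" using pos by simp
  moreover have "(2 * L) * ((3 * n) * 200) = 1200 * (L * n)" by simp
  moreover have "x + 9 \<le> 1209 * z" if "x \<le> y" "y = 1200 * z" "9 \<le> 9 * z" for x y z :: nat using that by linarith
  ultimately have "(L + 1) * ((2 ^ L + 1) * 200) + 9 \<le> 1209 * (L * n)" by blast
  then have "(N * \<rho> + 1) * ((L + 1) * ((2 ^ L + 1) * 200) + 9) \<le> (2 * (N * \<rho>)) * (1209 * (L * n))"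
   using pos by (intro mult_le_mono) auto
  also have "... = 2418 * (n * (L * (N * \<rho>)))" by ((simp only: mult_ac), simp?)
  finally have "(N * \<rho> + 1) * ((L + 1) * ((2 ^ L + 1) * 200) + 9) \<le> 2418 * (n * (L * (N * \<rho>)))" .
  then show ?thesis using A B by linarith
qed

lemma sketch_time_le:
  fixes n d L l N m R :: nat
  assumes pos: "0 < n" "0 < d" "0 < L" "0 < N" "0 < m" and m: "m * L \<le> 2 * n" and l: "2 ^ l \<le> 2 * d" and R: "R \<le> 2 * n"
  shows "sketch_time n d L l N m R \<le> 2400 * (n * d) + 760 * (L * (N * d))"
proof -
  have nd: "n \<le> n * d" "d \<le> n * d" "1 \<le> n * d" using pos by auto
  have LN: "N \<le> L * (N * d)" using pos by (simp add: mult.assoc[symmetric] mult.commute[of L N])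
  have "m * 1 \<le> m * L" using pos by (intro mult_le_mono2) simp
  then have m2: "m \<le> 2 * n" using m by linarith
  have 1: "(n + 1) * ((d + 1) * 200) \<le> (2 * n) * ((2 * d) * 200)" using pos by (intro mult_le_mono) auto
  have "L * 1 \<le> L * N" "1 * 1 \<le> L * N" using pos by (intro mult_le_mono; simp)+
  then have "L + 2 \<le> 3 * (L * N)" by linarith
  then have "(L * N + L + 2) * ((2 ^ l + 1) * 60) \<le> (4 * (L * N)) * ((3 * d) * 60)" using l pos by (intro mult_le_mono) linarith+
  then have 2: "(L * N + L + 2) * ((2 ^ l + 1) * 60) \<le> 720 * (L * (N * d))" by (simp add: mult_ac)
  have "(m + 1) * ((L + 2) * 100) \<le> (2 * m) * ((3 * L) * 100)" using pos by (intro mult_le_mono) auto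
  then have 3: "(m + 1) * ((L + 2) * 100) \<le> 1200 * n" using m by simp
  have 1: "(n + 1) * ((d + 1) * 200) \<le> 800 * (n * d)" using 1 by simp
  have "(d + 1) * 60 + ((N + 1) * 20 + ((m + 1) * 20 + (x1 + (R * 30 + (n + 1) * 60 + (x2 + (x3 + 20)))))) \<le> 2400 * a + 760 * b"
   if "n \<le> a" "d \<le> a" "1 \<le> a" "N \<le> b" "m \<le> 2 * n" "x1 \<le> 800 * a" "x2 \<le> 720 * b" "x3 \<le> 1200 * n" "R \<le> 2 * n" for x1 x2 x3 a b
  proof -
   have "(d + 1) * 60 \<le> 120 * a" using that(2,3) unfolding distrib_right by linarith
   moreover have "(N + 1) * 20 \<le> 20 * b + 20 * a" using that(3,4) unfolding distrib_right by linarith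
   moreover have "(m + 1) * 20 \<le> 60 * a" using that(1,3,5) unfolding distrib_right by linarith
   moreover have "R * 30 + (n + 1) * 60 \<le> 180 * a" using that(1,3,9) unfolding distrib_right by linarith
   moreover have "x3 + 20 \<le> 1220 * a" using that(1,3,8) unfolding distrib_right by linarith
   moreover have "y1 + (y2 + (y3 + (x1 + (y4 + (x2 + y5))))) \<le> 2400 * a + 760 * b"
    if "y1 \<le> 120 * a" "y2 \<le> 20 * b + 20 * a" "y3 \<le> 60 * a" "y4 \<le> 180 * a" "y5 \<le> 1220 * a" for y1 y2 y3 y4 y5
    using that \<open>x1 \<le> 800 * a\<close> \<open>x2 \<le> 720 * b\<close> by linarith
   ultimately show ?thesis by blast
  qed
  from this[OF nd LN m2 1 2 3 R] show ?thesis .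
qed

context
  fixes n d L l \<rho> N m :: nat and \<kappa> :: real
  assumes pos: "2 \<le> n" "0 < d" "0 < \<rho>" "\<rho> \<le> d" "0 < N" "0 < m" and L: "L = log_ceil n" and l: "l = log_ceil d"
   and m: "m * L \<le> 2 * n" and N: "real N * real \<rho> \<le> 2 * \<kappa>" and \<kappa>: "1 \<le> \<kappa>"
   and mid: "\<kappa> * real L < real n * real d" and L6: "real L ^ 6 \<le> real n"
begin

private lemma L1: "0 < L" "1 \<le> real L"
proof -
  show "0 < L" using log_ceil_pos[OF pos(1)] L by simp
  then show "1 \<le> real L" by simp
qed

private lemma sizes: "2 ^ l \<le> 2 * d" "2 ^ L \<le> 2 * n"
  using power_log_ceil_le[of d] power_log_ceil_le[of n] pos L l by auto

private lemma compute_real: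
  "real (compute_time n L l \<rho> N m) \<le> 75000 * (real n * real d * (real N * (real l + 1))) + 5000 * (real n * (real L * \<kappa>))"
proof -
  have "compute_time n L l \<rho> N m \<le> 75000 * (n * (N * ((l + 1) * d))) + 2500 * (n * (L * (N * \<rho>)))"
   by (rule compute_time_le) (use pos L1 m sizes in auto)
  from of_nat_mono[OF this, where 'a = real]
  have "real (compute_time n L l \<rho> N m) \<le> 75000 * (real n * (real N * ((real l + 1) * real d))) + 2500 * (real n * (real L * (real N * real \<rho>)))"
   by (simp only: of_nat_add of_nat_mult of_nat_numeral of_nat_1)
  also have "2500 * (real n * (real L * (real N * real \<rho>))) \<le> 2500 * (real n * (real L * (2 * \<kappa>)))"
   using N by (intro mult_left_mono) auto
  finally show ?thesis by (simp add: mult_ac)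
qed

text \<open>The transform costs log d per coordinate, while the query budget offers log n. Combining
  d^2 <= \<kappa> n with \<kappa> L < n d gives d < n^2, so the two logarithms agree up to a factor
  2.\<close>

lemma query_compute_bound:
  assumes eq: "\<rho> = d" and ok: "rows_ok \<kappa> n L d"
  shows "real (compute_time n L l \<rho> N m) \<le> 500000 * (real n * (real L * \<kappa>))"
proof -
  have n: "0 < real n" and d: "0 < real d" using pos by auto
  have "(real d * (real L)\<^sup>2)\<^sup>2 \<le> \<kappa> * real n" using ok by (simp add: rows_ok_def)
  moreover have "(real d)\<^sup>2 \<le> (real d * (real L)\<^sup>2)\<^sup>2"
   using L1 d mult_left_mono[OF power_mono[of 1 "real L" 2], of "real d"] by (intro power_mono) auto
  ultimately have "(real d)\<^sup>2 \<le> \<kappa> * real n" by linarith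
  also have "... \<le> \<kappa> * real L * real n" using L1 \<kappa> n by simp
  also have "... < real n * real d * real n" using mid n by (rule mult_strict_right_mono)
  finally have "real d * real d < (real n * real n) * real d" by (simp add: power2_eq_square mult_ac)
  then have "real d < real n * real n" using d by simp
  then have "d < n * n" by (simp only: of_nat_mult[symmetric] of_nat_less_iff)
  also have "... \<le> 2 ^ L * 2 ^ L" using le_power_log_ceil[of n] L by (intro mult_le_mono) auto
  also have "... = 2 ^ (2 * L)" by (simp add: power_add mult_2)
  finally have "\<not> 2 * L < l" using less_log_ceil[of "2 * L" d] l by auto
  then have "real l \<le> 2 * real L" by linarith
  then have "real l + 1 \<le> 3 * real L" using L1 by linarith
  from mult_mono[OF N[unfolded eq] this]
  have "(real N * real d) * (real l + 1) \<le> (2 * \<kappa>) * (3 * real L)" using \<kappa> by simp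
  then have "real n * ((real N * real d) * (real l + 1)) \<le> real n * ((2 * \<kappa>) * (3 * real L))" using n by (intro mult_left_mono) auto
  then have "real n * real d * (real N * (real l + 1)) \<le> 6 * (real n * (real L * \<kappa>))" by (simp add: mult_ac)
  moreover have "0 \<le> real n * (real L * \<kappa>)" using \<kappa> by simp
  ultimately show ?thesis using compute_real by linarith
qed

text \<open>The transforms fit into n d^2 once N (l + 1) = O(d). As \<rho> is maximal, one condition
  fails for \<rho> + 1. If \<rho> + 1 exceeds \<kappa>, there are at most four blocks, and sorting
  the directions uses the term n d log n of the budget. Otherwise (\<rho> + 1)^2 L^4 > \<kappa> n,
  which bounds \<kappa> in terms of d and also the number of blocks.\<close>

lemma prep_compute_bound:
  assumes lt: "\<rho> < d" and max: "\<not> rows_ok \<kappa> n L (\<rho> + 1)" and nd: "n \<le> d ==> \<kappa> * real L < real n"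
  shows "real (compute_time n L l \<rho> N m) \<le> 5000000 * (real n * (real d)\<^sup>2 + real n * real d * real L)"
proof -
  have n: "0 < real n" and d: "1 \<le> real d" using pos by auto
  define t where "t = real \<rho> + 1"
  have t: "t \<le> real d" "t \<le> 2 * real \<rho>" "0 < t" using lt pos by (auto simp: t_def)
  have key: "real N * (real l + 1) \<le> 64 * real d \<and> real n * (real L * \<kappa>) \<le> 2 * (real n * (real d)\<^sup>2) + 2 * (real n * real d * real L)"
  proof (cases "\<kappa> < t")
   case True
   have "real N * real \<rho> < 4 * real \<rho>" using N True t by linarith
   then have "real N \<le> 4" using pos by simp
   moreover have "real l + 1 \<le> 2 * real d" using log_ceil_le[of d] pos l by simp
   ultimately have "real N * (real l + 1) \<le> 4 * (2 * real d)" by (intro mult_mono) auto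
   moreover have "real n * (real L * \<kappa>) \<le> real n * (real L * real d)" using True t by (intro mult_left_mono) auto
   moreover have "real n * (real L * real d) = real n * real d * real L" by (simp add: mult_ac)
   moreover have "0 \<le> real n * (real d)\<^sup>2" "0 \<le> real n * real d * real L" by auto
   ultimately have "real N * (real l + 1) \<le> 64 * real d" "real n * (real L * \<kappa>) \<le> 2 * (real n * (real d)\<^sup>2) + 2 * (real n * real d * real L)"
    using d by linarith+
   then show ?thesis ..
  next
   case False
   have big: "\<kappa> * real n < (t * (real L)\<^sup>2)\<^sup>2" using max False by (simp add: rows_ok_def t_def add.commute)
   have L4: "(real L)\<^sup>2 * (real L)\<^sup>2 = real L ^ 4" by (simp add: power_add[symmetric])
   have L5: "real L ^ 5 \<le> real n" using L6 power_increasing[of 5 6 "real L"] L1 by linarith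
   have "(t * (real L)\<^sup>2)\<^sup>2 \<le> (real d * (real L)\<^sup>2)\<^sup>2" using t by (intro power_mono mult_right_mono) auto
   moreover have "(real d * (real L)\<^sup>2)\<^sup>2 = (real d)\<^sup>2 * real L ^ 4" by (simp add: power_mult_distrib power_mult[symmetric])
   ultimately have knd: "\<kappa> * real n < (real d)\<^sup>2 * real L ^ 4" using big by linarith
   have "real L * (\<kappa> * real n) \<le> real L * ((real d)\<^sup>2 * real L ^ 4)" using knd by (intro mult_left_mono) auto
   also have "... = (real d)\<^sup>2 * real L ^ 5" by (simp add: eval_nat_numeral mult_ac)
   also have "... \<le> (real d)\<^sup>2 * real n" using L5 by (intro mult_left_mono) auto
   finally have third: "real n * (real L * \<kappa>) \<le> real n * (real d)\<^sup>2" by (simp add: mult_ac)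
   have "real N * t \<le> real N * (2 * real \<rho>)" using t by (intro mult_left_mono) auto
   then have "real N * t \<le> 4 * \<kappa>" using N by linarith
   then have "(real N * t)\<^sup>2 \<le> (4 * \<kappa>)\<^sup>2" using t by (intro power_mono) auto
   then have Nt: "(real N * t)\<^sup>2 * real L ^ 4 \<le> (4 * \<kappa>)\<^sup>2 * real L ^ 4" by (intro mult_right_mono) auto
   have "(real N)\<^sup>2 * (\<kappa> * real n) \<le> (real N)\<^sup>2 * (t * (real L)\<^sup>2)\<^sup>2" using big by (intro mult_left_mono) auto
   also have "... = (real N * t)\<^sup>2 * real L ^ 4" unfolding L4[symmetric] by (simp add: power2_eq_square mult_ac)
   also have "... \<le> \<kappa> * (16 * \<kappa> * real L ^ 4)" using Nt by (simp add: power2_eq_square mult_ac)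
   finally have "\<kappa> * ((real N)\<^sup>2 * real n) \<le> \<kappa> * (16 * \<kappa> * real L ^ 4)" by (simp add: mult_ac)
   then have N2: "(real N)\<^sup>2 * real n \<le> 16 * \<kappa> * real L ^ 4" using \<kappa> by simp
   have "real N * (real l + 1) \<le> 64 * real d"
   \<comment> \<open>For d < n the bound on N n carries the factor L^4, and together with log d it
     stays below L^5 <= n up to a constant. For n <= d the exact regime is excluded, so \<kappa> L <
     n; this gives N <= 4 L^2, and the cube of log d is below a multiple of d.\<close>
   proof (cases "n \<le> d")
    case False
    then have "l \<le> L" using log_ceil_mono[of d n] L l by simp
    then have lL: "real l + 1 \<le> 2 * real L" using L1 by linarith
    have "(real N * real n)\<^sup>2 = ((real N)\<^sup>2 * real n) * real n" by (simp add: power2_eq_square mult_ac)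
    also have "... \<le> (16 * \<kappa> * real L ^ 4) * real n" using N2 by (intro mult_right_mono) auto
    also have "... = 16 * real L ^ 4 * (\<kappa> * real n)" by (simp add: mult_ac)
    also have "... \<le> 16 * real L ^ 4 * ((real d)\<^sup>2 * real L ^ 4)" using knd by (intro mult_left_mono) auto
    also have "... = (4 * real d * real L ^ 4)\<^sup>2" by (simp add: power2_eq_square mult_ac)
    finally have "real N * real n \<le> 4 * real d * real L ^ 4" by (rule power2_le_imp_le) simp
    from mult_mono[OF this lL]
    have "(real N * real n) * (real l + 1) \<le> (4 * real d * real L ^ 4) * (2 * real L)" by simp
    also have "... = 8 * real d * real L ^ 5" by (simp add: eval_nat_numeral mult_ac)
    also have "... \<le> 8 * real d * real n" using L5 by (intro mult_left_mono) auto
    finally have "(real N * (real l + 1)) * real n \<le> (8 * real d) * real n" by (simp add: mult_ac)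
    then have "real N * (real l + 1) \<le> 8 * real d" using n by simp
    then show ?thesis using d by linarith
   next
    case True
    have lL: "L \<le> l" using log_ceil_mono[OF True] L l by simp
    have "((real N)\<^sup>2 * real L) * real n = ((real N)\<^sup>2 * real n) * real L" by (simp add: mult_ac)
    also have "... \<le> (16 * \<kappa> * real L ^ 4) * real L" using N2 by (intro mult_right_mono) auto
    also have "... = (16 * real L ^ 4) * (\<kappa> * real L)" by (simp add: mult_ac)
    also have "... \<le> (16 * real L ^ 4) * real n" using nd[OF True] by (intro mult_left_mono) auto
    finally have "(real N)\<^sup>2 * real L \<le> 16 * real L ^ 4" using n by simp
    moreover have "(real N)\<^sup>2 * 1 \<le> (real N)\<^sup>2 * real L" using L1 by (intro mult_left_mono) auto
    moreover have "16 * real L ^ 4 = (4 * (real L)\<^sup>2)\<^sup>2" by (simp add: power_mult[symmetric] power_mult_distrib)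
    ultimately have "(real N)\<^sup>2 \<le> (4 * (real L)\<^sup>2)\<^sup>2" by linarith
    then have "real N \<le> 4 * (real L)\<^sup>2" by (rule power2_le_imp_le) simp
    also have "... \<le> 4 * (real l + 1)\<^sup>2" using lL by (intro mult_left_mono power_mono) auto
    finally have "real N * (real l + 1) \<le> 4 * (real l + 1)\<^sup>2 * (real l + 1)" by (rule mult_right_mono) simp
    also have "... = 4 * real ((l + 1) ^ 3)" by (simp only: of_nat_power of_nat_mult of_nat_add of_nat_1 power3_eq_cube power2_eq_square mult.assoc)
    also have "... \<le> 4 * real (8 * (2 * d))"
    proof -
     have "(l + 1) ^ 3 \<le> 8 * (2 * d)" using cube_le_power[of l] mult_le_mono2[OF sizes(1), of 8] by (rule order_trans)
     then show ?thesis by (intro mult_left_mono of_nat_mono) auto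
    qed
    finally show ?thesis by simp
   qed
   moreover have "0 \<le> real n * (real d)\<^sup>2" "0 \<le> real n * real d * real L" by auto
   ultimately show ?thesis using third by linarith
  qed
  have "real n * real d * (real N * (real l + 1)) \<le> real n * real d * (64 * real d)" using key by (intro mult_left_mono) auto
  then have 1: "real n * real d * (real N * (real l + 1)) \<le> 64 * (real n * (real d)\<^sup>2)" by (simp add: power2_eq_square mult_ac)
  have nn: "0 \<le> real n * (real d)\<^sup>2" "0 \<le> real n * real d * real L" by auto
  have "z \<le> 5000000 * (a + b)" if "z \<le> 75000 * x + 5000 * y" "x \<le> 64 * a" "y \<le> 2 * a + 2 * b" "0 \<le> a" "0 \<le> b"
   for x y z a b :: real
   using that unfolding distrib_left by linarith
  from this[OF compute_real 1 conjunct2[OF key] nn] show ?thesis .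
qed

text \<open>The random numbers of all candidates dominate, of order L N d. The late regime being
  excluded, \<kappa> L < n d brings them below a multiple of n d^2.\<close>

lemma sketch_bound:
  assumes R: "R \<le> 2 * n"
  shows "real (sketch_time n d L l N m R) \<le> 4000 * (real n * (real d)\<^sup>2)"
proof -
  have "sketch_time n d L l N m R \<le> 2400 * (n * d) + 760 * (L * (N * d))"
   by (rule sketch_time_le) (use pos L1 m sizes R in auto)
  from of_nat_mono[OF this, where 'a = real]
  have 1: "real (sketch_time n d L l N m R) \<le> 2400 * (real n * real d) + 760 * (real L * (real N * real d))"
   by (simp only: of_nat_add of_nat_mult of_nat_numeral of_nat_1)
  have d: "1 \<le> real d" using pos by simp
  have "real N * 1 \<le> real N * real \<rho>" using pos by (intro mult_left_mono) auto
  then have "real N \<le> 2 * \<kappa>" using N by linarith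
  then have "real N * (real L * real d) \<le> (2 * \<kappa>) * (real L * real d)" by (intro mult_right_mono) auto
  also have "... = 2 * (\<kappa> * real L) * real d" by (simp add: mult_ac)
  also have "... \<le> 2 * (real n * real d) * real d" using mid by (intro mult_right_mono mult_left_mono) auto
  finally have 2: "real L * (real N * real d) \<le> 2 * (real n * (real d)\<^sup>2)" by (simp add: power2_eq_square mult_ac)
  have "real n * real d * 1 \<le> real n * real d * real d" using d by (intro mult_left_mono) auto
  then have "real n * real d \<le> real n * (real d)\<^sup>2" by (simp add: power2_eq_square mult_ac)
  then show ?thesis using 1 2 by linarith
qed

text \<open>The sweeps alone need only O(n \<kappa>) steps. The factor L of the query budget is
  spent by a postponed \<open>COMPUTE\<close> and in the exact regimes.\<close>

lemma apply_bound: "real (apply_time L \<rho> N) \<le> 2400 * (real n * (real L * \<kappa>))"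
proof -
  have "2 ^ L + 1 \<le> 3 * n" using sizes(2) pos by linarith
  then have "(N * \<rho> + 1) * ((2 ^ L + 1) * 200) \<le> (2 * (N * \<rho>)) * ((3 * n) * 200)" using pos by (intro mult_le_mono) auto
  then have "apply_time L \<rho> N \<le> 1200 * (n * (N * \<rho>))" by (simp add: mult_ac)
  from of_nat_mono[OF this, where 'a = real]
  have "real (apply_time L \<rho> N) \<le> 1200 * (real n * (real N * real \<rho>))"
   by (simp only: of_nat_mult of_nat_numeral)
  also have "... \<le> 1200 * (real n * (2 * \<kappa>))" using N by (intro mult_left_mono) auto
  also have "... = 2400 * (real n * (1 * \<kappa>))" by simp
  also have "... \<le> 2400 * (real n * (real L * \<kappa>))" using L1 \<kappa> by (intro mult_left_mono mult_right_mono) auto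
  finally show ?thesis .
qed

end

lemma init_bound:
  assumes "2 \<le> n" "0 < d"
  shows "real (init_time (log_ceil n) (log_ceil d) + 200) \<le> 300 * (real n * (real d)\<^sup>2 + real n * real d * real (log_ceil n))"
proof -
  have d: "1 \<le> real d" and n: "1 \<le> real n" using assms by auto
  have L: "1 \<le> real (log_ceil n)" using log_ceil_pos[OF assms(1)] by simp
  have l: "real (log_ceil d) \<le> real d" using log_ceil_le[OF assms(2)] by simp
  have "1 * 1 \<le> real n * real d" using n d by (intro mult_mono) auto
  then have nd: "1 \<le> real n * real d" by simp
  have "1 * real (log_ceil n) \<le> real n * real d * real (log_ceil n)" using nd by (intro mult_right_mono) auto
  moreover have "1 * real d \<le> real n * real d * real d" using nd by (intro mult_right_mono) auto
  moreover have "real (init_time (log_ceil n) (log_ceil d) + 200) \<le> 270 * real (log_ceil n) + 20 * real d"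
   using L l by simp
  moreover have "real n * (real d)\<^sup>2 = real n * real d * real d" by (simp add: power2_eq_square)
  moreover have "t \<le> 300 * (a + b)" if t: "t \<le> 270 * u + 20 * v" and b: "1 * u \<le> b" and a: "1 * v \<le> a" and u: "1 \<le> u" and v: "1 \<le> v" for t a b u v :: real
  proof -
   have "270 * u \<le> 300 * b" "20 * v \<le> 300 * a" using a b u v by auto
   then show ?thesis using t by (simp add: distrib_left)
  qed
  ultimately show ?thesis using L d by metis
qed

lemma matrix_bound:
  assumes "0 < n" "0 < d"
  shows "real (matrix_time n d) \<le> 800 * (real n * real n * real d)" "real (dense_time n) \<le> 240 * (real n * real n)"
proof -
  have "matrix_time n d \<le> (2 * n) * ((2 * n) * ((2 * d) * 100))" using assms by (intro mult_le_mono) auto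
  also have "... = 800 * (n * n * d)" by simp
  finally show "real (matrix_time n d) \<le> 800 * (real n * real n * real d)"
   by (simp only: of_nat_mult[symmetric] of_nat_numeral[symmetric, where 'a = real] of_nat_le_iff)
  have "dense_time n \<le> (2 * n) * ((2 * n) * 60)" using assms by (intro mult_le_mono) auto
  also have "... = 240 * (n * n)" by simp
  finally show "real (dense_time n) \<le> 240 * (real n * real n)"
   by (simp only: of_nat_mult[symmetric] of_nat_numeral[symmetric, where 'a = real] of_nat_le_iff)
qed

lemma exact_event:
  assumes x: "\<And>i. i < n ==> x i \<in> carrier_vec d" and \<epsilon>: "0 < \<epsilon>"
  shows "1 - 1 / real n ^ c \<le> measure tapes {\<omega> \<in> space tapes.
   frobenius_norm (distance_matrix n x - mat n n (\<lambda>(i, j). dst d (points n d x) i j)) \<le> \<epsilon> * frobenius_norm (distance_matrix n x)}"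
proof -
  have "frobenius_norm (distance_matrix n x - mat n n (\<lambda>(i, j). dst d (points n d x) i j)) \<le> \<epsilon> * frobenius_norm (distance_matrix n x)"
   by (subst frobenius_le_iff[of n x d]) (use x \<epsilon> in \<open>auto intro!: mult_nonneg_nonneg sum_nonneg\<close>)
  then have "{\<omega> \<in> space tapes. frobenius_norm (distance_matrix n x - mat n n (\<lambda>(i, j). dst d (points n d x) i j)) \<le> \<epsilon> * frobenius_norm (distance_matrix n x)}
   = space tapes" by auto
  then show ?thesis by (simp add: measure_space_tapes)
qed

section \<open>The regimes and the common constant\<close>

context
  fixes n d K n0 c :: nat and \<epsilon> :: real and x :: "nat => real vec" and C :: real
  assumes n: "2 \<le> n" and d: "1 \<le> d" and \<epsilon>: "0 < \<epsilon>" "\<epsilon> < 1" and x: "\<And>i. i < n ==> x i \<in> carrier_vec d"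
   and K: "1536 * 2 ^ (c + 2) \<le> real K" "4 * (64 * (c + 3)) * (c + 5)\<^sup>2 \<le> real K" "4 * (c + 5) * mgf_const * (64 * (c + 3)) \<le> real K"
   and n0: "\<And>n. n0 \<le> n ==> real (log_ceil n) ^ 6 \<le> real n"
   and C: "C = (6000000 + 800 * real n0) * 3 * real K"
begin

private definition "L = log_ceil n"
private definition "l = log_ceil d"
private definition "\<kappa> = real K / \<epsilon>\<^sup>2"
private definition "A = real n * (real d)\<^sup>2 + real n * real d * real L"
private definition "Q = real n * (real L * \<kappa>)"

private lemma reals: "2 \<le> real n" "1 \<le> real d" "1 \<le> real L" "1 \<le> real K" "1 \<le> \<kappa>"
proof -
  show "2 \<le> real n" "1 \<le> real d" using n d by auto
  show "1 \<le> real L" using log_ceil_pos[OF n] by (simp add: L_def)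
  have "(1::real) \<le> 2 ^ (c + 2)" by (rule one_le_power) simp
  then show K1: "1 \<le> real K" using K(1) by linarith
  have "\<epsilon>\<^sup>2 \<le> 1" using \<epsilon> by (simp add: power_le_one)
  then have "\<epsilon>\<^sup>2 \<le> real K" using K1 by linarith
  then show "1 \<le> \<kappa>" using \<epsilon> by (simp add: \<kappa>_def)
qed

private lemma A_ge: "real n * (real d)\<^sup>2 \<le> A" "1 \<le> A" "0 \<le> A"
proof -
  show 1: "real n * (real d)\<^sup>2 \<le> A" by (simp add: A_def)
  have "1 * 1 \<le> real n * (real d)\<^sup>2" using reals by (intro mult_mono) auto
  then show "1 \<le> A" "0 \<le> A" using 1 by auto
qed

private lemma Q_ge: "1 \<le> Q" "0 \<le> Q"
proof -
  have "1 * (1 * 1) \<le> Q" unfolding Q_def using reals by (intro mult_mono) auto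
  then show "1 \<le> Q" "0 \<le> Q" by auto
qed

private abbreviation (input) "budget \<equiv> C * (real n * (real d)\<^sup>2 + real n * real d * ln (real n))"
private abbreviation (input) "budget' \<equiv> C * (real n * ln (real n) / \<epsilon>\<^sup>2)"
private abbreviation (input) "exact \<equiv> mat n n (\<lambda>(i, j). dst d (points n d x) i j)"

text \<open>In C the factor 3 converts L into ln n, and K turns 1/\<epsilon>^2 into \<kappa> in the
  query budget; in the preprocessing budget K >= 1 is merely a slack.\<close>

private lemma budgets:
  "(6000000 + 800 * real n0) * A \<le> budget"
  "(6000000 + 800 * real n0) * Q \<le> budget'"
proof -
  have Lln: "real L \<le> 3 * ln (real n)" using log_ceil_le_ln[OF n] by (simp add: L_def)
  have ln0: "0 \<le> ln (real n)" using n by simp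
  have "real n * real d * real L \<le> real n * real d * (3 * ln (real n))" using Lln by (intro mult_left_mono) auto
  moreover have "real n * real d * (3 * ln (real n)) = 3 * (real n * real d * ln (real n))" by simp
  moreover have "0 \<le> real n * (real d)\<^sup>2" by simp
  ultimately have "A \<le> 3 * (real n * (real d)\<^sup>2 + real n * real d * ln (real n))" unfolding A_def distrib_left by linarith
  also have "... = 1 * (3 * (real n * (real d)\<^sup>2 + real n * real d * ln (real n)))" by simp
  also have "... \<le> real K * (3 * (real n * (real d)\<^sup>2 + real n * real d * ln (real n)))" using reals ln0 by (intro mult_right_mono) auto
  finally have "(6000000 + 800 * real n0) * A \<le> (6000000 + 800 * real n0) * (real K * (3 * (real n * (real d)\<^sup>2 + real n * real d * ln (real n))))"
   by (rule mult_left_mono) simp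
  also have "... = budget" by (simp only: C mult_ac)
  finally show "(6000000 + 800 * real n0) * A \<le> budget" .
  have "Q \<le> real n * ((3 * ln (real n)) * \<kappa>)" unfolding Q_def using Lln reals by (intro mult_left_mono mult_right_mono) auto
  then have "(6000000 + 800 * real n0) * Q \<le> (6000000 + 800 * real n0) * (real n * ((3 * ln (real n)) * \<kappa>))"
   by (rule mult_left_mono) simp
  also have "... = budget'" by (simp add: C \<kappa>_def mult_ac)
  finally show "(6000000 + 800 * real n0) * Q \<le> budget'" .
qed

private definition "I = real (init_time L l + 200)"
private definition "M = real (matrix_time n d)"
private definition "E = real (dense_time n)"

private lemma times: "I \<le> 300 * A" "M \<le> 800 * (real n * real n * real d)" "E \<le> 240 * (real n * real n)"
proof -
  have d0: "0 < d" and n1: "0 < n" using n d by auto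
  show "I \<le> 300 * A" unfolding I_def A_def L_def l_def by (rule init_bound[OF n d0])
  show "M \<le> 800 * (real n * real n * real d)" "E \<le> 240 * (real n * real n)"
   unfolding M_def E_def by (rule matrix_bound[OF n1 d0])+
qed

private lemma absorb: "z \<le> 6000000 * a ==> 0 \<le> a ==> z \<le> (6000000 + 800 * real n0) * a"
  by (rule order_trans[of _ "6000000 * a"]) (auto intro: mult_right_mono)

private lemma pow: "n \<le> 2 ^ L" "\<And>i. i < L ==> 2 ^ i < n" "d \<le> 2 ^ l" "\<And>i. i < l ==> 2 ^ i < d"
  by (auto simp: L_def l_def le_power_log_ceil less_log_ceil)

private abbreviation "result B \<equiv> (\<forall>\<omega>\<in>space tapes. B \<omega> \<in> carrier_mat n n \<and>
   implements (PREP K n0) QUERY \<omega> n (input n d \<epsilon> x)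
    budget budget' (B \<omega>)) \<and>
  measure tapes {\<omega> \<in> space tapes. frobenius_norm (distance_matrix n x - B \<omega>) \<le> \<epsilon> * frobenius_norm (distance_matrix n x)}
   \<ge> 1 - 1 / real n ^ c"

text \<open>For n < n0 one factor n of the exact computation is replaced by the constant n0, which
  accounts for the summand 800 n0 in C. For n <= d the budgets cover the costs with an absolute
  constant.\<close>

private lemma early:
  assumes b: "n < n0 \<or> (n \<le> d \<and> real n \<le> \<kappa> * real L)"
  shows "\<exists>B. result B"
proof -
  have "real n * real n * real d \<le> (1 + real n0) * A \<and> real n * real n \<le> (1 + real n0) * Q"
   using b
  proof
   assume "n < n0"
   then have nn0: "real n \<le> real n0" by simp
   have "real n * (real n * real d) \<le> real n0 * (real n * (real d)\<^sup>2)"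
    using nn0 reals by (intro mult_mono) (auto simp: power2_eq_square)
   also have "... \<le> real n0 * A" using A_ge by (intro mult_left_mono) auto
   also have "... \<le> (1 + real n0) * A" using A_ge by (intro mult_right_mono) auto
   finally have 1: "real n * real n * real d \<le> (1 + real n0) * A" by (simp add: mult_ac)
   have "1 * 1 \<le> real L * \<kappa>" using reals by (intro mult_mono) auto
   then have "real n * 1 \<le> Q" unfolding Q_def by (intro mult_left_mono) auto
   then have "real n * real n \<le> real n0 * Q" using nn0 by (intro mult_mono) auto
   also have "... \<le> (1 + real n0) * Q" using Q_ge by (intro mult_right_mono) auto
   finally show ?thesis using 1 by simp
  next
   assume h: "n \<le> d \<and> real n \<le> \<kappa> * real L"
   then have "real n * (real n * real d) \<le> real n * (real d * real d)" by (intro mult_left_mono mult_right_mono) auto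
   then have "real n * real n * real d \<le> 1 * A" using A_ge by (simp add: power2_eq_square mult_ac)
   also have "... \<le> (1 + real n0) * A" using A_ge by (intro mult_right_mono) auto
   finally have 1: "real n * real n * real d \<le> (1 + real n0) * A" .
   have "real n * real n \<le> real n * (\<kappa> * real L)" using h by (intro mult_left_mono) auto
   then have "real n * real n \<le> 1 * Q" by (simp only: Q_def mult_ac mult_1)
   also have "... \<le> (1 + real n0) * Q" using Q_ge by (intro mult_right_mono) auto
   finally show ?thesis using 1 by simp
  qed
  then have nnd: "real n * real n * real d \<le> A + real n0 * A" and nn: "real n * real n \<le> Q + real n0 * Q"
   by (auto simp: distrib_right)
  have z: "0 \<le> real n0 * A" "0 \<le> real n0 * Q" using A_ge Q_ge by auto
  have "I + M \<le> 6000000 * A + 800 * (real n0 * A)" using times nnd A_ge z by linarith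
  then have "I + M \<le> (6000000 + 800 * real n0) * A" by (simp only: distrib_right mult.assoc)
  moreover have "real (init_time L l + (100 + matrix_time n d)) \<le> I + M"
   unfolding I_def M_def of_nat_add[symmetric] by (rule of_nat_mono) simp
  ultimately have T: "real (init_time L l + (100 + matrix_time n d)) \<le> budget"
   using budgets(1) by linarith
  have "10 + E \<le> 6000000 * Q + 800 * (real n0 * Q)" using times nn Q_ge z by linarith
  then have "10 + E \<le> (6000000 + 800 * real n0) * Q" by (simp only: distrib_right mult.assoc)
  then have "10 + E \<le> budget'" using budgets(2) by (rule order_trans)
  then have T': "real (10 + dense_time n) \<le> budget'"
   by (simp only: E_def of_nat_add of_nat_numeral)
  have "implements (PREP K n0) QUERY \<omega> n (input n d \<epsilon> x) budget
   budget' exact" for \<omega>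
   by (rule implements_early[OF pow b[unfolded \<kappa>_def] T T'])
  then show ?thesis
   using exact_event[OF x \<epsilon>(1)] by (intro exI[of _ "\<lambda>_. exact"]) simp
qed

private lemma late:
  assumes b: "n0 \<le> n" "n \<le> d ==> \<kappa> * real L < real n" "real n * real d \<le> \<kappa> * real L"
  shows "\<exists>B. result B"
proof -
  have "real n * (real n * real d) \<le> real n * (\<kappa> * real L)" using b(3) by (rule mult_left_mono) simp
  then have nnd: "real n * real n * real d \<le> Q" by (simp add: Q_def mult_ac)
  have "real n * real n * 1 \<le> real n * real n * real d" using reals by (intro mult_left_mono) auto
  then have nn: "real n * real n \<le> Q" using nnd by simp
  have "I \<le> (6000000 + 800 * real n0) * A" by (rule absorb) (use times A_ge in linarith)+
  moreover have "real (init_time L l + 100) \<le> I" unfolding I_def by (rule of_nat_mono) simp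
  ultimately have T: "real (init_time L l + 100) \<le> budget"
   using budgets(1) by linarith
  have "20 + (M + E) \<le> (6000000 + 800 * real n0) * Q" by (rule absorb) (use times nn nnd Q_ge in linarith)+
  then have "20 + (M + E) \<le> budget'" using budgets(2) by (rule order_trans)
  then have T': "real (20 + (matrix_time n d + dense_time n)) \<le> budget'"
   by (simp only: M_def E_def of_nat_add of_nat_numeral)
  have "implements (PREP K n0) QUERY \<omega> n (input n d \<epsilon> x) budget
   budget' exact" for \<omega>
   by (rule implements_late[OF pow b[unfolded \<kappa>_def] T T'])
  then show ?thesis
   using exact_event[OF x \<epsilon>(1)] by (intro exI[of _ "\<lambda>_. exact"]) simp
qed

private lemma sketched:
  assumes b: "n0 \<le> n" "n \<le> d ==> \<kappa> * real L < real n" "\<kappa> * real L < real n * real d"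
  shows "\<exists>B. result B"
proof -
  have L6: "real L ^ 6 \<le> real n" using n0[OF b(1)] by (simp add: L_def)
  have "real L ^ 4 \<le> real L ^ 6" using reals by (intro power_increasing) auto
  then have L4: "real L ^ 4 \<le> real n" using L6 by linarith
  have L1: "0 < L" using log_ceil_pos[OF n] by (simp add: L_def)
  have Ln: "L \<le> n" using log_ceil_le[of n] n by (simp add: L_def)
  have d0: "0 < d" using d by simp
  obtain \<rho> where \<rho>: "0 < \<rho>" "\<rho> \<le> d" "rows_ok \<kappa> n L \<rho>" "\<rho> < d ==> \<not> rows_ok \<kappa> n L (\<rho> + 1)"
   using rows_exist[OF reals(5) d0 L4] by blast
  have \<rho>\<kappa>: "real \<rho> \<le> \<kappa>" using \<rho>(3) by (simp add: rows_ok_def)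
  obtain N where N: "0 < N" "\<kappa> \<le> real N * real \<rho>" "\<And>k. 0 < k ==> k < N ==> real k * real \<rho> < \<kappa>" "real N * real \<rho> \<le> 2 * \<kappa>"
   using blocks_exist[OF \<rho>(1) \<rho>\<kappa>] by blast
  obtain m where m: "0 < m" "n \<le> m * L" "\<And>k. k < m ==> k * L < n" "m * L \<le> 2 * n"
   using tests_exist[OF L1 Ln] by blast
  define r where "r = reps n d (points n d x)"
  define g :: "tape => nat => real" where "g \<omega> = (\<lambda>q. snd (\<omega> q))" for \<omega>
  \<comment> \<open>Defined for every tape, whether or not its candidate is accurate: the program
    computes this product in any case.\<close>
  define B where "B \<omega> = mat n n (\<lambda>(i, j). est l \<rho> N (points n d x)
   (after (choice n d L l \<rho> N m (owner r) r (points n d x) (g \<omega>) * (N * (2 * 2 ^ l))) (g \<omega>)) i j)" for \<omega>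
  note bounds = n d0 \<rho>(1,2) N(1) m(1) L_def l_def m(4) N(4) reals(5) b(3) L6
  have R: "(\<Sum>i<n. r i) \<le> 2 * n" unfolding r_def by (rule sum_reps)
  have sk: "real (sketch_time n d L l N m (\<Sum>i<n. r i)) \<le> 4000 * A"
   using sketch_bound[OF bounds R] A_ge by linarith
  have prep: "real (if \<rho> < d then compute_time n L l \<rho> N m else 0) \<le> 5000000 * A"
  proof (cases "\<rho> < d")
   case True
   then have "real (compute_time n L l \<rho> N m) \<le> 5000000 * A"
    unfolding A_def by (intro prep_compute_bound[OF bounds True] \<rho>(4) b(2))
   then show ?thesis using True by (simp only: if_True)
  qed (use A_ge in simp)
  have query: "real (if \<rho> < d then 0 else compute_time n L l \<rho> N m) \<le> 500000 * Q"
  proof (cases "\<rho> < d")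
   case False
   then have e: "\<rho> = d" using \<rho>(2) by simp
   have "real (compute_time n L l \<rho> N m) \<le> 500000 * Q"
    unfolding Q_def by (rule query_compute_bound[OF bounds e]) (use \<rho>(3) e in simp)
   then show ?thesis using False by (simp only: if_False)
  qed (use Q_ge in simp)
  have ap: "real (apply_time L \<rho> N) \<le> 2400 * Q" unfolding Q_def by (rule apply_bound[OF bounds])
  have T: "real (init_time L l + (200 + (sketch_time n d L l N m (\<Sum>i<n. r i) + (if \<rho> < d then compute_time n L l \<rho> N m else 0))))
   \<le> budget"
  proof -
   have "I + (real (sketch_time n d L l N m (\<Sum>i<n. r i)) + real (if \<rho> < d then compute_time n L l \<rho> N m else 0))
    \<le> 300 * A + (4000 * A + 5000000 * A)" by (intro add_mono times(1) sk prep)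
   also have "... \<le> (6000000 + 800 * real n0) * A" by (rule absorb) (use A_ge in linarith)+
   finally have "I + (real (sketch_time n d L l N m (\<Sum>i<n. r i)) + real (if \<rho> < d then compute_time n L l \<rho> N m else 0))
    \<le> budget" using budgets(1) by (rule order_trans)
   then show ?thesis by (simp only: I_def of_nat_add[symmetric] add.assoc)
  qed
  have T': "real (30 + (apply_time L \<rho> N + (if \<rho> < d then 0 else compute_time n L l \<rho> N m))) \<le> budget'"
  proof -
   have "30 + (real (apply_time L \<rho> N) + real (if \<rho> < d then 0 else compute_time n L l \<rho> N m)) \<le> 30 * Q + (2400 * Q + 500000 * Q)"
    using Q_ge by (intro add_mono ap query) simp
   also have "... \<le> (6000000 + 800 * real n0) * Q" by (rule absorb) (use Q_ge in linarith)+
   finally have "30 + (real (apply_time L \<rho> N) + real (if \<rho> < d then 0 else compute_time n L l \<rho> N m)) \<le> budget'"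
    using budgets(2) by (rule order_trans)
   then show ?thesis by (simp only: of_nat_add of_nat_numeral)
  qed
  have imp: "implements (PREP K n0) QUERY \<omega> n (input n d \<epsilon> x) budget
   budget' (B \<omega>)" for \<omega>
   unfolding B_def g_def
  proof (rule implements_sketch[OF pow(1,2) L1 pow(3,4) b[unfolded \<kappa>_def] \<rho>[unfolded \<kappa>_def] N(1-3)[unfolded \<kappa>_def] m(1-3) _ _ _ _ _ T T'])
   show "0 < r i" for i by (simp add: r_def reps_pos)
   show "real n * weight n d (points n d x) i \<le> real (r i) * (\<Sum>i<n. weight n d (points n d x) i)" if "i < n" for i
    unfolding r_def by (rule reps_ge[OF that])
   show "real k * (\<Sum>i<n. weight n d (points n d x) i) < real n * weight n d (points n d x) i" if "0 < k" "k < r i" for i k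
    using that unfolding r_def by (rule reps_least)
   show "owner r ((\<Sum>i'<i. r i') + k) = i" if "k < r i" for i k using that by (rule owner_slot)
   show "owner r u < n" if "u < (\<Sum>i<n. r i)" for u using that by (rule owner_less)
  qed
  \<comment> \<open>For n <= d the exclusion of the exact regime gives \<rho> <= \<kappa> <=
    \<kappa> L < n. Together with L^6 <= n this yields the second condition on \<rho>.\<close>
  have "real \<rho> \<le> real n"
  proof (cases "n \<le> d")
   case True
   have "\<kappa> * 1 \<le> \<kappa> * real L" using reals by (intro mult_left_mono) auto
   then show ?thesis using b(2)[OF True] \<rho>\<kappa> by linarith
  qed (use \<rho>(2) in simp)
  then have "real \<rho> * real L ^ 6 \<le> real n * real n" using L6 by (intro mult_mono) auto
  then have \<rho>2: "real \<rho> * real L ^ 6 \<le> (real n)\<^sup>2" by (simp add: power2_eq_square)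
  have \<rho>1: "(real \<rho> * real L ^ 2)\<^sup>2 \<le> real K / \<epsilon>\<^sup>2 * real n" using \<rho>(3) by (simp add: rows_ok_def \<kappa>_def)
  have N\<rho>: "real K / \<epsilon>\<^sup>2 \<le> real (N * \<rho>)" using N(2) by (simp add: \<kappa>_def)
  have \<rho>l: "\<rho> \<le> 2 ^ l" using \<rho>(2) pow(3) by simp
  have pL: "2 ^ L \<le> 2 * n" unfolding L_def using n by (intro power_log_ceil_le) simp
  have X0: "points n d x i c = 0" if "d \<le> c" for i c using that by (simp add: points_def)
  have "1 - 1 / real n ^ c \<le> measure tapes {\<omega> \<in> space tapes.
   (\<Sum>i<n. \<Sum>j<n. (dst d (points n d x) i j - est l \<rho> N (points n d x)
    (after (choice n d L l \<rho> N m (owner r) r (points n d x) (g \<omega>) * (N * (2 * 2 ^ l))) (g \<omega>)) i j)\<^sup>2)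
    \<le> \<epsilon>\<^sup>2 * (\<Sum>i<n. \<Sum>j<n. (dst d (points n d x) i j)\<^sup>2)}"
   unfolding r_def g_def
   by (rule sketch_probability[OF \<rho>(1) \<rho>l N(1) pow(3) _ \<epsilon>(1) n pL pow(1) L1 Ln m(2) N\<rho> \<rho>1 \<rho>2 K])
    (rule X0)
  moreover have "frobenius_norm (distance_matrix n x - B \<omega>) \<le> \<epsilon> * frobenius_norm (distance_matrix n x) \<longleftrightarrow>
   (\<Sum>i<n. \<Sum>j<n. (dst d (points n d x) i j - est l \<rho> N (points n d x)
    (after (choice n d L l \<rho> N m (owner r) r (points n d x) (g \<omega>) * (N * (2 * 2 ^ l))) (g \<omega>)) i j)\<^sup>2)
    \<le> \<epsilon>\<^sup>2 * (\<Sum>i<n. \<Sum>j<n. (dst d (points n d x) i j)\<^sup>2)" for \<omega>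
   unfolding B_def by (rule frobenius_le_iff) (use x \<epsilon> in auto)
  ultimately have "1 - 1 / real n ^ c \<le> measure tapes {\<omega> \<in> space tapes.
   frobenius_norm (distance_matrix n x - B \<omega>) \<le> \<epsilon> * frobenius_norm (distance_matrix n x)}"
   by (simp only:)
  then show ?thesis using imp by (intro exI[of _ B]) (simp add: B_def)
qed

lemma algorithm_result: "\<exists>B. result B"
proof (cases "n < n0 \<or> (n \<le> d \<and> real n \<le> \<kappa> * real L)")
  case True
  then show ?thesis by (rule early)
next
  case False
  then have b: "n0 \<le> n" "n \<le> d ==> \<kappa> * real L < real n" by auto
  show ?thesis
   using late[OF b] sketched[OF b] by (cases "real n * real d \<le> \<kappa> * real L") auto
qed

end

theorem theorem23:
  fixes c :: nat
  shows "\<exists>(prep :: com) (query :: com) (C :: real). sample_free query \<and>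
    (\<forall>(n :: nat) (d :: nat) (\<epsilon> :: real) (x :: nat \<Rightarrow> real vec).
       2 \<le> n \<and> 1 \<le> d \<and> 0 < \<epsilon> \<and> \<epsilon> < 1 \<and> (\<forall>i<n. x i \<in> carrier_vec d) \<longrightarrow>
       (\<exists>B :: tape \<Rightarrow> real mat.
          (\<forall>\<omega>\<in>space tapes. B \<omega> \<in> carrier_mat n n \<and>
             implements prep query \<omega> n (input n d \<epsilon> x)
               (C * (real n * (real d)\<^sup>2 + real n * real d * ln (real n)))
               (C * (real n * ln (real n) / \<epsilon>\<^sup>2))
               (B \<omega>)) \<and>
          measure tapes {\<omega> \<in> space tapes.
             frobenius_norm (distance_matrix n x - B \<omega>)
               \<le> \<epsilon> * frobenius_norm (distance_matrix n x)}
            \<ge> 1 - 1 / real n ^ c))"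
proof -
  obtain n0 where n0: "\<And>n. n0 \<le> n \<Longrightarrow> real (log_ceil n) ^ 6 \<le> real n" using log_ceil_power_le by blast
  \<comment> \<open>The three lower bounds are those of \<open>good_group_probability\<close> and
    depend on \<open>c\<close> alone. A natural number is taken because \<open>K\<close> becomes a
    constant of the program.\<close>
  have "\<exists>K :: nat. k1 \<le> real K \<and> k2 \<le> real K \<and> k3 \<le> real K" for k1 k2 k3
    using real_arch_simple[of "max k1 (max k2 k3)"] by auto
  then obtain K :: nat where K: "1536 * 2 ^ (c + 2) \<le> real K" "4 * (64 * (c + 3)) * (c + 5)\<^sup>2 \<le> real K"
    "4 * (c + 5) * mgf_const * (64 * (c + 3)) \<le> real K" by blast
  show ?thesis
  proof (rule exI[of _ "PREP K n0"], rule exI[of _ QUERY], rule exI[of _ "(6000000 + 800 * real n0) * 3 * real K"], intro conjI allI impI)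
    show "sample_free QUERY" by (rule sample_free_QUERY)
    fix n d :: nat and \<epsilon> :: real and x :: "nat \<Rightarrow> real vec"
    assume "2 \<le> n \<and> 1 \<le> d \<and> 0 < \<epsilon> \<and> \<epsilon> < 1 \<and> (\<forall>i<n. x i \<in> carrier_vec d)"
    then have h: "2 \<le> n" "1 \<le> d" "0 < \<epsilon>" "\<epsilon> < 1" "\<And>i. i < n \<Longrightarrow> x i \<in> carrier_vec d" by auto
    show "\<exists>B :: tape \<Rightarrow> real mat.
          (\<forall>\<omega>\<in>space tapes. B \<omega> \<in> carrier_mat n n \<and>
             implements (PREP K n0) QUERY \<omega> n (input n d \<epsilon> x)
               ((6000000 + 800 * real n0) * 3 * real K * (real n * (real d)\<^sup>2 + real n * real d * ln (real n)))
               ((6000000 + 800 * real n0) * 3 * real K * (real n * ln (real n) / \<epsilon>\<^sup>2))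
               (B \<omega>)) \<and>
          measure tapes {\<omega> \<in> space tapes.
             frobenius_norm (distance_matrix n x - B \<omega>)
               \<le> \<epsilon> * frobenius_norm (distance_matrix n x)}
            \<ge> 1 - 1 / real n ^ c"
      by (rule algorithm_result[OF h K n0 refl])
  qed
qed

end
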